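(* Let $K$ be a field and let $x+H \in K[x]^n$ be a Keller map, where $x=(x_1,\ldots,x_n)$, $H$ is quadratic homogeneous and $\operatorname{rk}\mathcal{J}H \le 3$. Then $x+H$ (up to a square part if $\operatorname{char} K = 2$) is linearly conjugate to one of the following automorphisms: (1) a triangular automorphism; (2) $(x_1+x_2x_5+u_1,\; x_2+x_1x_4-x_3x_5+u_2,\; x_3+x_2x_4+u_3,\; x_4,\ldots,x_n)$, where $u_1,u_2,u_3\in K[x_4,x_5,\ldots,x_n]$; (3) $(x_1+x_2x_6,\; x_2+x_1x_5-x_3x_6+a x_4x_5-b x_4x_6+u_2,\; x_3+x_2x_5,\; x_4+x_5x_6,\; x_5,\ldots,x_n)$ with $\operatorname{char} K=2$, where $a,b\in K$ and $u_2\in K[x_4,x_7,x_8,\ldots,x_n]$. In particular, $x+H$ is a tame automorphism (up to a square part if $\operatorname{char} K=2$).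
   Context: $K$ is a field of arbitrary characteristic and $K[x]=K[x_1,\ldots,x_n]$. A polynomial map $H\in K[x]^n$ is quadratic homogeneous if each component is zero or homogeneous of degree $2$. $\mathcal{J}F=(\partial F_i/\partial x_j)$ is the Jacobian matrix, with rank taken over $K(x)$. $F\in K[x]^n$ is a Keller map if $\det\mathcal{J}F\in K^*$. Maps $F$ and $G$ in $K[x]^n$ are linearly conjugate if $G=T^{-1}F(Tx)$ for some $T\in\operatorname{GL}_n(K)$. A map $x+H$ is triangular if $H_n\in K$ and $H_i\in K[x_{i+1},\ldots,x_n]$ for $1\le i\le n-1$. An elementary automorphism is one of the form $(x_1,\ldots,x_{i-1},x_i+a,x_{i+1},\ldots,x_n)$ with $a\in K[x]$ not containing $x_i$; a polynomial automorphism is tame if it is a finite composition of elementary ones and affine ones (those of degree $1$). "Up to a square part if $\operatorname{char} K=2$" means: when $\operatorname{char} K=2$, the assertion is about the map obtained from $x+H$ by deleting from the components of $H$ all terms in $x_1^2,\ldots,x_n^2$, i.e. by replacing $H$ by its square-free part (in characteristic $2$, maps whose components are $K$-linear combinations of $x_1^2,\ldots,x_n^2$ are preserved under linear conjugation); when $\operatorname{char} K\neq 2$ the assertion is about $x+H$ itself.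
   Formalization: If char K = 2, "up to a square part" means that some map differing from x+H only by K-combinations of x_1²,…,x_n² is conjugate to (1)–(3) and tame; literally deleting squares from H fails, e.g. H=(q,q,q), q=x_1x_2+x_1x_3+x_2x_3. *)

theory Defs
  imports
    "HOL-Library.Poly_Mapping"
    "HOL-Computational_Algebra.Fraction_Field"
    "Jordan_Normal_Form.DL_Rank"
begin

text \<open>
  Polynomials are finitely supported functions on exponent vectors. Variables and vector
  components are numbered from 0, as in the matrix library: \<open>Var i\<close> is the
  variable usually written $x_{i+1}$, and $K[x_1,\ldots,x_n]$ consists of the polynomials
  with variables in \<open>{..<n}\<close>.
\<close>

type_synonym 'a mpoly = "(nat \<Rightarrow>\<^sub>0 nat) \<Rightarrow>\<^sub>0 'a"

definition Var :: "nat \<Rightarrow> 'a::field mpoly"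
  where "Var i = Poly_Mapping.single (Poly_Mapping.single i 1) 1"

definition Const :: "'a::field \<Rightarrow> 'a mpoly"
  where "Const c = Poly_Mapping.single 0 c"

definition vars :: "'a::field mpoly \<Rightarrow> nat set"
  where "vars p = (\<Union>m\<in>Poly_Mapping.keys p. Poly_Mapping.keys m)"

definition monom_degree :: "(nat \<Rightarrow>\<^sub>0 nat) \<Rightarrow> nat"
  where "monom_degree m = (\<Sum>i\<in>Poly_Mapping.keys m. Poly_Mapping.lookup m i)"

definition subst :: "(nat \<Rightarrow> 'a mpoly) \<Rightarrow> 'a::field mpoly \<Rightarrow> 'a mpoly"
  where "subst f p = (\<Sum>m\<in>Poly_Mapping.keys p.
    Const (Poly_Mapping.lookup p m) * (\<Prod>i\<in>Poly_Mapping.keys m. f i ^ Poly_Mapping.lookup m i))"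

text \<open>If \<open>i\<close> does not occur in \<open>m\<close>, then \<open>m - single i 1 = m\<close> (subtraction truncates), but
  the coefficient is zero.\<close>

definition partial_deriv :: "nat \<Rightarrow> 'a::field mpoly \<Rightarrow> 'a mpoly"
  where "partial_deriv i p = (\<Sum>m\<in>Poly_Mapping.keys p.
    Poly_Mapping.single (m - Poly_Mapping.single i 1)
      (of_nat (Poly_Mapping.lookup m i) * Poly_Mapping.lookup p m))"

definition polynomial_map :: "nat \<Rightarrow> 'a::field mpoly vec \<Rightarrow> bool"
  where "polynomial_map n F \<longleftrightarrow> F \<in> carrier_vec n \<and> (\<forall>i<n. vars (F $ i) \<subseteq> {..<n})"

definition id_map :: "nat \<Rightarrow> 'a::field mpoly vec"
  where "id_map n = vec n Var"

text \<open>\<open>compose F G\<close> is $F(G(x))$.\<close>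

definition compose :: "'a::field mpoly vec \<Rightarrow> 'a mpoly vec \<Rightarrow> 'a mpoly vec"
  where "compose F G = map_vec (subst (\<lambda>i. G $ i)) F"

definition quadratic_homogeneous :: "nat \<Rightarrow> 'a::field mpoly vec \<Rightarrow> bool"
  where "quadratic_homogeneous n H \<longleftrightarrow> polynomial_map n H \<and>
    (\<forall>i<n. \<forall>m\<in>Poly_Mapping.keys (H $ i). monom_degree m = 2)"

definition jacobian :: "nat \<Rightarrow> 'a::field mpoly vec \<Rightarrow> 'a mpoly mat"
  where "jacobian n F = mat n n (\<lambda>(i, j). partial_deriv j (F $ i))"

text \<open>The rank is taken over the fraction field of the polynomial ring in countably many
  variables. This is an extension field of $K(x_1,\ldots,x_n)$, which does not affect the rank
  of matrices over the latter.\<close>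

definition jacobian_rank :: "nat \<Rightarrow> 'a::field mpoly vec \<Rightarrow> nat"
  where "jacobian_rank n F = vec_space.rank n (map_mat (\<lambda>p. Fract p 1) (jacobian n F))"

definition keller_map :: "nat \<Rightarrow> 'a::field mpoly vec \<Rightarrow> bool"
  where "keller_map n F \<longleftrightarrow> polynomial_map n F \<and> (\<exists>c. c \<noteq> 0 \<and> det (jacobian n F) = Const c)"

definition linearly_conjugate :: "nat \<Rightarrow> 'a::field mpoly vec \<Rightarrow> 'a mpoly vec \<Rightarrow> bool"
  where "linearly_conjugate n F G \<longleftrightarrow>
    (\<exists>T\<in>carrier_mat n n. \<exists>T'\<in>carrier_mat n n. T * T' = 1\<^sub>m n \<and> T' * T = 1\<^sub>m n \<and>
      G = map_mat Const T' *\<^sub>v compose F (map_mat Const T *\<^sub>v id_map n))"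

definition polynomial_automorphism :: "nat \<Rightarrow> 'a::field mpoly vec \<Rightarrow> bool"
  where "polynomial_automorphism n F \<longleftrightarrow> polynomial_map n F \<and>
    (\<exists>G. polynomial_map n G \<and> compose F G = id_map n \<and> compose G F = id_map n)"

definition elementary_automorphism :: "nat \<Rightarrow> 'a::field mpoly vec \<Rightarrow> bool"
  where "elementary_automorphism n E \<longleftrightarrow>
    (\<exists>i<n. \<exists>a. vars a \<subseteq> {..<n} - {i} \<and>
      E = vec n (\<lambda>j. if j = i then Var i + a else Var j))"

text \<open>No component of an automorphism is constant, so the bound on the degree forces degree 1.\<close>

definition affine_automorphism :: "nat \<Rightarrow> 'a::field mpoly vec \<Rightarrow> bool"
  where "affine_automorphism n E \<longleftrightarrow> polynomial_automorphism n E \<and>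
    (\<forall>i<n. \<forall>m\<in>Poly_Mapping.keys (E $ i). monom_degree m \<le> 1)"

definition tame_automorphism :: "nat \<Rightarrow> 'a::field mpoly vec \<Rightarrow> bool"
  where "tame_automorphism n F \<longleftrightarrow> polynomial_automorphism n F \<and>
    (\<exists>Es. (\<forall>E\<in>set Es. elementary_automorphism n E \<or> affine_automorphism n E) \<and>
      F = foldr compose Es (id_map n))"

definition triangular :: "nat \<Rightarrow> 'a::field mpoly vec \<Rightarrow> bool"
  where "triangular n F \<longleftrightarrow>
    (\<exists>H\<in>carrier_vec n. F = id_map n + H \<and> (\<forall>i<n. vars (H $ i) \<subseteq> {i<..<n}))"

text \<open>Deletes the terms in $x_1^2,\ldots,x_n^2$.\<close>

definition square_free_part :: "nat \<Rightarrow> 'a::field mpoly vec \<Rightarrow> 'a mpoly vec"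
  where "square_free_part n F = map_vec (\<lambda>p. p - (\<Sum>i<n.
    Poly_Mapping.single (Poly_Mapping.single i 2)
      (Poly_Mapping.lookup p (Poly_Mapping.single i 2)))) F"

text \<open>
  In characteristic 2, the maps whose components are linear combinations of
  $x_1^2,\ldots,x_n^2$ are stable under linear conjugation, so ``up to a square part'' is a
  conjugation-invariant equivalence. The map \<open>square_free_part\<close> itself does not commute with
  linear conjugation: a square-free map may be conjugate to an automorphism only after
  adding squares, as for $x + (q,q,q)$ with $q = x_1x_2 + x_1x_3 + x_2x_3$, which is Keller but
  sends both $0$ and $(1,1,1)$ to $0$, whereas $q + x_2^2 = (x_1+x_2)(x_2+x_3)$ gives a
  linearly triangularizable map.
\<close>

definition eq_up_to_square_part :: "nat \<Rightarrow> 'a::field mpoly vec \<Rightarrow> 'a mpoly vec \<Rightarrow> bool"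
  where "eq_up_to_square_part n F G \<longleftrightarrow>
    (if CHAR('a) = 2 then square_free_part n F = square_free_part n G else F = G)"

text \<open>The explicit maps below use the customary numbering from 1: \<open>X k\<close> is $x_k$, and
  \<open>poly_in I\<close> is the ring $K[x_k : k \in I]$.\<close>

definition X :: "nat \<Rightarrow> 'a::field mpoly"
  where "X k = Var (k - 1)"

definition poly_in :: "nat set \<Rightarrow> 'a::field mpoly set"
  where "poly_in I = {p. vars p \<subseteq> (\<lambda>k. k - 1) ` I}"

definition normal_form_2 :: "nat \<Rightarrow> 'a::field mpoly vec \<Rightarrow> bool"
  where "normal_form_2 n G \<longleftrightarrow> n \<ge> 5 \<and>
    (\<exists>u1\<in>poly_in {4..n}. \<exists>u2\<in>poly_in {4..n}. \<exists>u3\<in>poly_in {4..n}.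
      G = vec_of_list
        ([X 1 + X 2 * X 5 + u1,
          X 2 + X 1 * X 4 - X 3 * X 5 + u2,
          X 3 + X 2 * X 4 + u3] @ map X [4..<Suc n]))"

definition normal_form_3 :: "nat \<Rightarrow> 'a::field mpoly vec \<Rightarrow> bool"
  where "normal_form_3 n G \<longleftrightarrow> n \<ge> 6 \<and> CHAR('a) = 2 \<and>
    (\<exists>a b. \<exists>u2\<in>poly_in ({4} \<union> {7..n}).
      G = vec_of_list
        ([X 1 + X 2 * X 6,
          X 2 + X 1 * X 5 - X 3 * X 6 + Const a * X 4 * X 5 - Const b * X 4 * X 6 + u2,
          X 3 + X 2 * X 5,
          X 4 + X 5 * X 6] @ map X [5..<Suc n]))"

end

theory Submission
  imports Defs "HOL-Library.Function_Algebras"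
begin

text \<open>
  The polarization of $H$ is a commutative product $x \cdot y$ on $K^n$ with
  $\mathcal{J}H(x)\,y = x \cdot y$. Since $\det(1 + s\,\mathcal{J}H(x))$ is constant in $s$, every
  multiplication is nilpotent, and by assumption it has rank at most 3. The descending series
  $V_0 = K^n$, $V_{i+1} = K^n \cdot V_i$ becomes stationary at a perfect subspace $W = K^n \cdot W$.
  Moving along lines $a + tz$ through a vector $a$ whose multiplication has maximal rank shows,
  first over an infinite field and then over $K$ by extension of scalars, that $\dim W \le 3$.
  If $W = 0$, a basis adapted to the series makes the map triangular. Otherwise $\dim W = 3$, and
  the linearization of $x^3 W = 0$ puts the action of $K^n$ on $W$ into the shape seen in the
  normal form (2), given by two linear forms $s$ and $t$. For $c_4$ and $c_5$ dual to $t$ and $s$, the rank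
  condition puts all products into $W$, except possibly $c_4 \cdot c_5$ in characteristic 2, which leads
  to the normal form (3). The structure constants in the new basis recover the map, up to squares in
  characteristic 2.
\<close>

section \<open>Linear independence of lists\<close>

text \<open>Separate nilpotency of the multiplications gives no common flag: the matrices with rows
  (0, s, 0), (t, 0, -s), (0, t, 0) are all nilpotent, yet have no common kernel vector. So W cannot
  be shown to vanish, only to be small, and the bound on its dimension is the bulk of the work. Two
  devices carry it. First, independence survives a generic perturbation, so the rank bound at a + t
  z for generic t constrains the kernel and the range R of a multiplication a of maximal rank. In
  particular all products with ker a lie in R, so the product modulo R is a vector-valued form on V
  / ker a, of dimension at most 3, and the cases are separated by the rank of this form. Second, no
  multiplication has a nonzero eigenvalue, and many coefficients are killed by exhibiting an
  eigenvector. The characteristics differ in the position of a. In characteristic 2, a lies in its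
  own kernel and the form is alternating on three vectors c1, c2, c3. Otherwise a can be chosen with
  a a nonzero, so that a itself accounts for one of the three dimensions and drops out of the form
  modulo R.\<close>

lemma all_lists_Suc: "(\<forall>cs. length cs = Suc n \<longrightarrow> P cs) \<longleftrightarrow> (\<forall>c cs. length cs = n \<longrightarrow> P (c # cs))"
  by (auto simp: length_Suc_conv)

locale vec_sp = vector_space scale
  for scale :: "'a::field \<Rightarrow> 'b::ab_group_add \<Rightarrow> 'b" (infixr "*s" 75)
begin

fun lincomb_list :: "'a list \<Rightarrow> 'b list \<Rightarrow> 'b" where
  "lincomb_list (c # cs) (v # vs) = c *s v + lincomb_list cs vs"
| "lincomb_list _ _ = 0"

text \<open>Lists instead of sets: a repeated vector makes a list dependent, so
  \<open>li (map (mul x) ys)\<close> really bounds the rank of \<open>mul x\<close> from below,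
  whereas the set of images could shrink.\<close>

definition li :: "'b list \<Rightarrow> bool" where
  "li vs \<longleftrightarrow> (\<forall>cs. length cs = length vs \<longrightarrow> lincomb_list cs vs = 0 \<longrightarrow> set cs \<subseteq> {0})"

lemma span_set_iff: "x \<in> span (set vs) \<longleftrightarrow> (\<exists>cs. length cs = length vs \<and> x = lincomb_list cs vs)"
proof (induction vs arbitrary: x)
  case (Cons v vs)
  show ?case
  proof
    assume "x \<in> span (set (v # vs))"
    then obtain k where "x - k *s v \<in> span (set vs)" by (auto simp: span_breakdown_eq)
    with Cons obtain cs where "length cs = length vs" "x - k *s v = lincomb_list cs vs" by auto
    then have "length (k # cs) = length (v # vs) \<and> x = lincomb_list (k # cs) (v # vs)"
      by (auto simp: algebra_simps)
    then show "\<exists>cs. length cs = length (v # vs) \<and> x = lincomb_list cs (v # vs)" by blast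
  next
    assume "\<exists>cs. length cs = length (v # vs) \<and> x = lincomb_list cs (v # vs)"
    then obtain cs' where cs': "length cs' = Suc (length vs)" "x = lincomb_list cs' (v # vs)" by auto
    then obtain k cs where "cs' = k # cs" "length cs = length vs" by (auto simp: length_Suc_conv)
    with cs' have "length cs = length vs" "x = k *s v + lincomb_list cs vs" by auto
    then have "length cs = length vs" "x - k *s v = lincomb_list cs vs" by auto
    with Cons have "x - k *s v \<in> span (set vs)" by auto
    then show "x \<in> span (set (v # vs))" by (auto simp: span_breakdown_eq)
  qed
qed simp

lemma span2: "x \<in> span {u, v} \<longleftrightarrow> (\<exists>a b. x = a *s u + b *s v)"
  by (simp add: span_breakdown_eq diff_diff_eq)

lemma span3: "x \<in> span {u, v, w} \<longleftrightarrow> (\<exists>a b c. x = a *s u + b *s v + c *s w)"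
  by (simp add: span_breakdown_eq diff_diff_eq add.assoc)

lemma span4: "x \<in> span {u, v, w, y} \<longleftrightarrow> (\<exists>a b c d. x = a *s u + b *s v + c *s w + d *s y)"
  by (simp add: span_breakdown_eq diff_diff_eq add.assoc)

lemma span1: "x \<in> span {u} \<longleftrightarrow> (\<exists>a. x = a *s u)"
  by (auto simp: span_singleton)

lemma li_Nil [simp]: "li []"
  by (simp add: li_def)

lemma lincomb_list_scale: "lincomb_list (map ((*) k) cs) vs = k *s lincomb_list cs vs"
  by (induction cs vs rule: lincomb_list.induct) (auto simp: algebra_simps)

lemma li_Cons: "li (v # vs) \<longleftrightarrow> v \<notin> span (set vs) \<and> li vs"
proof (intro iffI conjI)
  assume L: "li (v # vs)"
  show "v \<notin> span (set vs)"
  proof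
    assume "v \<in> span (set vs)"
    then obtain cs where "length cs = length vs" "v = lincomb_list cs vs" by (auto simp: span_set_iff)
    then have "lincomb_list (-1 # cs) (v # vs) = 0" "length (-1 # cs) = length (v # vs)" by auto
    with L have "set (-1 # cs) \<subseteq> {0}" unfolding li_def by blast
    then show False by simp
  qed
  show "li vs"
    unfolding li_def
  proof (intro allI impI)
    fix cs assume "length cs = length vs" "lincomb_list cs vs = 0"
    then have "lincomb_list (0 # cs) (v # vs) = 0" "length (0 # cs) = length (v # vs)" by auto
    with L have "set (0 # cs) \<subseteq> {0}" unfolding li_def by blast
    then show "set cs \<subseteq> {0}" by simp
  qed
next
  assume A: "v \<notin> span (set vs) \<and> li vs"
  show "li (v # vs)"
    unfolding li_def
  proof (intro allI impI)
    fix cs' assume *: "length cs' = length (v # vs)" "lincomb_list cs' (v # vs) = 0"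
    then obtain c cs where cs': "cs' = c # cs" "length cs = length vs" by (auto simp: length_Suc_conv)
    with * have eq: "c *s v + lincomb_list cs vs = 0" by simp
    have "c = 0"
    proof (rule ccontr)
      assume "c \<noteq> 0"
      then have "v = (- inverse c) *s lincomb_list cs vs"
        using eq by (metis add_eq_0_iff scale_minus_left scale_minus_right scale_one scale_scale left_inverse minus_minus)
      then have "v \<in> span (set vs)"
        using cs'(2) by (auto simp: span_set_iff simp flip: lincomb_list_scale
            intro!: exI[of _ "map ((*) (- inverse c)) cs"])
      with A show False by simp
    qed
    with eq cs' A show "set cs' \<subseteq> {0}" by (auto simp: li_def)
  qed
qed

lemma li_independent: "li vs \<Longrightarrow> independent (set vs) \<and> distinct vs"
  by (induction vs) (auto simp: li_Cons independent_insertI span_base independent_empty)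

lemma li_length_le: 
  assumes "li vs" "set vs \<subseteq> span (set us)" shows "length vs \<le> length us"
proof -
  from independent_span_bound[OF _ _ assms(2)] li_independent[OF assms(1)]
  have "card (set vs) \<le> card (set us)" by auto
  also have "\<dots> \<le> length us" by (rule card_length)
  finally show ?thesis using li_independent[OF assms(1)] by (simp add: distinct_card)
qed

lemma li_span_full: 
  assumes "li vs" "set vs \<subseteq> span (set us)" "length us \<le> length vs"
  shows "span (set us) \<subseteq> span (set vs)"
proof
  fix x assume x: "x \<in> span (set us)"
  show "x \<in> span (set vs)"
  proof (rule ccontr)
    assume "x \<notin> span (set vs)"
    then have "li (x # vs)" using assms by (simp add: li_Cons)
    from li_length_le[OF this, of us] x assms show False by simp
  qed
qed

lemma li1: "li [u] \<longleftrightarrow> u \<noteq> 0"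
  by (simp add: li_Cons)

lemma li2: "li [u, v] \<longleftrightarrow> (\<forall>a b. a *s u + b *s v = 0 \<longrightarrow> a = 0 \<and> b = 0)"
  unfolding li_def by (simp add: all_lists_Suc)

lemma li3: "li [u, v, w] \<longleftrightarrow> (\<forall>a b c. a *s u + b *s v + c *s w = 0 \<longrightarrow> a = 0 \<and> b = 0 \<and> c = 0)"
  unfolding li_def by (simp add: all_lists_Suc add.assoc)

lemma li4: "li [u, v, w, y] \<longleftrightarrow> (\<forall>a b c d. a *s u + b *s v + c *s w + d *s y = 0 \<longrightarrow>
    a = 0 \<and> b = 0 \<and> c = 0 \<and> d = 0)"
  unfolding li_def by (simp add: all_lists_Suc add.assoc)

lemma li5: "li [u, v, w, y, z] \<longleftrightarrow> (\<forall>a b c d e. a *s u + b *s v + c *s w + d *s y + e *s z = 0 \<longrightarrow>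
    a = 0 \<and> b = 0 \<and> c = 0 \<and> d = 0 \<and> e = 0)"
  unfolding li_def by (simp add: all_lists_Suc add.assoc)

lemma lincomb_list_sum: "length cs = length vs \<Longrightarrow> lincomb_list cs vs = (\<Sum>j<length vs. (cs ! j) *s (vs ! j))"
proof (induction cs vs rule: lincomb_list.induct)
  case (1 c cs v vs)
  then show ?case by (simp add: sum.lessThan_Suc_shift del: sum.lessThan_Suc)
qed auto

text \<open>In coordinates dual to \<open>us\<close> the family becomes a square matrix with entries
  linear in t. Its determinant is 1 at t = 0, hence a nonzero polynomial, and every t with a
  dependent list is one of its finitely many roots.\<close>

lemma finite_dependent_parameters:
  assumes "li us" "length ws = length us"
  shows "finite {t. \<not> li (map2 (\<lambda>u w. u + t *s w) us ws)}"
proof -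
  interpret vp: vector_space_pair scale "(*) :: 'a \<Rightarrow> 'a \<Rightarrow> 'a"
    by unfold_locales (auto simp: algebra_simps)
  let ?m = "length us"
  note ind = li_independent[OF assms(1)]
  define f where "f i = vp.construct (set us) (\<lambda>v. if v = us ! i then 1 else 0)" for i
  have f: "Vector_Spaces.linear scale (*) (f i)" for i
    unfolding f_def using ind by (intro vp.linear_construct) auto
  have f_us: "f i (us ! j) = (if i = j then 1 else 0)" if "i < ?m" "j < ?m" for i j
    unfolding f_def using ind that by (subst vp.construct_basis) (auto simp: nth_eq_iff_index_eq)
  have f_sum: "f i (\<Sum>j<?m. c j *s v j) = (\<Sum>j<?m. c j * f i (v j))" for i c v
    using f[of i] by (simp add: vp.linear_sum vp.linear_scale)
  define G where "G = mat ?m ?m (\<lambda>(i, j). [:f i (us ! j), f i (ws ! j):])"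
  define D where "D = Determinant.det G"
  have D: "poly D t = Determinant.det (mat ?m ?m (\<lambda>(i, j). f i (us ! j + t *s ws ! j)))" for t
  proof -
    interpret h: comm_ring_hom "\<lambda>p. poly p t" by unfold_locales auto
    have "poly D t = Determinant.det (map_mat (\<lambda>p. poly p t) G)"
      unfolding D_def by (rule h.hom_det[symmetric])
    also have "map_mat (\<lambda>p. poly p t) G = mat ?m ?m (\<lambda>(i, j). f i (us ! j + t *s ws ! j))"
      unfolding G_def using f by (auto simp: vp.linear_add vp.linear_scale intro!: eq_matI)
    finally show ?thesis .
  qed
  have "mat ?m ?m (\<lambda>(i, j). f i (us ! j + 0 *s ws ! j)) = 1\<^sub>m ?m"
    by (auto simp: f_us intro!: eq_matI)
  then have "poly D 0 = 1" by (simp add: D)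
  then have "D \<noteq> 0" by auto
  then have "finite {t. poly D t = 0}" by (rule poly_roots_finite)
  moreover have "poly D t = 0" if nli: "\<not> li (map2 (\<lambda>u w. u + t *s w) us ws)" for t
  proof -
    let ?vs = "map2 (\<lambda>u w. u + t *s w) us ws"
    have len: "length ?vs = ?m" using assms by simp
    from nli obtain cs where cs: "length cs = ?m" "lincomb_list cs ?vs = 0" "\<not> set cs \<subseteq> {0}"
      unfolding li_def len by auto
    from cs(3) obtain k where k: "k < ?m" "cs ! k \<noteq> 0" using cs(1)
      by (metis in_set_conv_nth insertI1 subsetI)
    let ?v = "vec ?m (\<lambda>j. cs ! j)"
    have "(\<Sum>j<?m. cs ! j *s (us ! j + t *s ws ! j)) = 0"
      using cs(2) lincomb_list_sum[of cs ?vs] cs(1) assms by simp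
    then have z: "(\<Sum>j<?m. cs ! j * f i (us ! j + t *s ws ! j)) = 0" for i
      using f_sum[of i "\<lambda>j. cs ! j" "\<lambda>j. us ! j + t *s ws ! j"] f[of i] by (simp add: vp.linear_0)
    let ?A = "mat ?m ?m (\<lambda>(i, j). f i (us ! j + t *s ws ! j))"
    have "?A *\<^sub>v ?v = 0\<^sub>v ?m"
      using z by (auto simp: scalar_prod_def atLeast0LessThan mult.commute intro!: eq_vecI)
    moreover have "?v \<noteq> 0\<^sub>v ?m" using k by (metis index_vec index_zero_vec(1))
    ultimately have "Determinant.det ?A = 0"
      by (subst det_0_iff_vec_prod_zero_field[of _ ?m]) (auto intro!: exI[of _ ?v])
    then show ?thesis by (simp add: D)
  qed
  ultimately show ?thesis by (auto elim: rev_finite_subset)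
qed

end

section \<open>Commutative nilpotent algebras\<close>

text \<open>The underlying space is a whole type and need not have finite dimension. Dimension
  bounds are expressed by spans of short lists, usually modulo a subspace.\<close>

locale comm_alg = vec_sp scale
  for scale :: "'a::field \<Rightarrow> 'b::ab_group_add \<Rightarrow> 'b" (infixr "*s" 75) +
  fixes mul :: "'b \<Rightarrow> 'b \<Rightarrow> 'b" (infixl "\<diamondop>" 80)
  assumes mul_commute: "x \<diamondop> y = y \<diamondop> x"
    and mul_add_left: "(x + x') \<diamondop> y = x \<diamondop> y + x' \<diamondop> y"
    and mul_scale_left: "(c *s x) \<diamondop> y = c *s (x \<diamondop> y)"
begin

lemma mul_add_right: "x \<diamondop> (y + y') = x \<diamondop> y + x \<diamondop> y'"
  using mul_add_left[of y y' x] by (simp only: mul_commute[of x])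

lemma mul_scale_right: "x \<diamondop> (c *s y) = c *s (x \<diamondop> y)"
  using mul_scale_left[of c y x] by (simp only: mul_commute[of x])

lemma mul_zero_left [simp]: "0 \<diamondop> y = 0"
  using mul_scale_left[of 0 0 y] by simp

lemma mul_zero_right [simp]: "x \<diamondop> 0 = 0"
  using mul_scale_right[of x 0 0] by simp

lemma mul_minus_left: "(- x) \<diamondop> y = - (x \<diamondop> y)"
  using mul_scale_left[of "-1" x y] by simp

lemma mul_minus_right: "x \<diamondop> (- y) = - (x \<diamondop> y)"
  using mul_scale_right[of x "-1" y] by simp

lemma mul_diff_left: "(x - x') \<diamondop> y = x \<diamondop> y - x' \<diamondop> y"
  using mul_add_left[of x "- x'" y] by (simp add: mul_minus_left)

lemma mul_diff_right: "x \<diamondop> (y - y') = x \<diamondop> y - x \<diamondop> y'"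
  using mul_add_right[of x y "- y'"] by (simp add: mul_minus_right)

lemmas mul_simps = mul_add_left mul_add_right mul_scale_left mul_scale_right
  mul_minus_left mul_minus_right mul_diff_left mul_diff_right

definition products :: "'b set \<Rightarrow> 'b set" where
  "products W = span {x \<diamondop> w | x w. w \<in> W}"

definition perfect :: "'b set \<Rightarrow> bool" where
  "perfect W \<longleftrightarrow> subspace W \<and> products W = W"

definition submod :: "'b set \<Rightarrow> bool" where
  "submod U \<longleftrightarrow> subspace U \<and> (\<forall>x. \<forall>u\<in>U. x \<diamondop> u \<in> U)"

lemma subspace_products: "subspace (products W)"
  by (simp add: products_def)

lemma mul_in_products: "w \<in> W \<Longrightarrow> x \<diamondop> w \<in> products W"
  unfolding products_def by (auto intro: span_base)

lemma products_least:
  assumes "\<And>x w. w \<in> W \<Longrightarrow> x \<diamondop> w \<in> S" "subspace S" shows "products W \<subseteq> S"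
  unfolding products_def using assms by (intro span_minimal) auto

lemma products_mono: "W \<subseteq> W' \<Longrightarrow> products W \<subseteq> products W'"
  unfolding products_def by (intro span_mono) auto

lemma perfect_subspace: "perfect W \<Longrightarrow> subspace W"
  by (simp add: perfect_def)

lemma perfect_mul: "perfect W \<Longrightarrow> w \<in> W \<Longrightarrow> x \<diamondop> w \<in> W"
  using mul_in_products unfolding perfect_def by blast

lemma perfect_subset:
  assumes "perfect W" "\<And>x w. w \<in> W \<Longrightarrow> x \<diamondop> w \<in> S" "subspace S" shows "W \<subseteq> S"
  using products_least[of W S] assms unfolding perfect_def by auto

lemma mul_mem_span:
  assumes "y \<in> span S" "\<And>s. s \<in> S \<Longrightarrow> x \<diamondop> s \<in> T" "subspace T"
  shows "x \<diamondop> y \<in> T"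
  using assms(1)
proof (induction rule: span_induct_alt)
  case base
  then show ?case using assms by (simp add: subspace_0)
next
  case (step c v z)
  then show ?case using assms by (simp add: mul_simps subspace_add subspace_scale)
qed

end

locale nilp_alg = comm_alg scale mul
  for scale :: "'a::field \<Rightarrow> 'b::ab_group_add \<Rightarrow> 'b" (infixr "*s" 75)
    and mul :: "'b \<Rightarrow> 'b \<Rightarrow> 'b" (infixl "\<diamondop>" 80) +
  assumes rank_le_3: "length ys = 4 \<Longrightarrow> \<not> li (map (mul x) ys)"
    and nilp: "\<exists>N. ((mul x) ^^ N) y = 0"
begin

text \<open>The N-th power of x maps y to c^N y, which nilpotency makes zero. Many configurations
  below are excluded by producing such an eigenvector.\<close>

lemma mul_eigen: 
  assumes "x \<diamondop> y = c *s y" shows "c = 0 \<or> y = 0"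
proof -
  have "((mul x) ^^ N) y = c ^ N *s y" for N
    by (induction N) (simp_all add: assms mul_simps mult.commute)
  with nilp[of x y] obtain N where "c ^ N *s y = 0" by metis
  then show ?thesis by (auto split: if_splits)
qed

lemma no_rank_4: "li [x \<diamondop> y1, x \<diamondop> y2, x \<diamondop> y3, x \<diamondop> y4] \<Longrightarrow> False"
  using rank_le_3[of "[y1, y2, y3, y4]" x] by simp

text \<open>If the fourth power of x did not kill y, moving y along its orbit would give
  \<open>y'\<close> with fifth image zero and fourth image nonzero. Its first four images are then
  independent vectors in the range of x, against rank at most 3.\<close>

lemma nilp4: "x \<diamondop> (x \<diamondop> (x \<diamondop> (x \<diamondop> y))) = 0"
proof (rule ccontr)
  let ?T = "mul x"
  assume "x \<diamondop> (x \<diamondop> (x \<diamondop> (x \<diamondop> y))) \<noteq> 0"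
  then have nz: "(?T ^^ 4) y \<noteq> 0" by (simp add: eval_nat_numeral)
  define N where "N = (LEAST N. (?T ^^ N) y = 0)"
  have N: "(?T ^^ N) y = 0" unfolding N_def using nilp[of x y] by (rule LeastI_ex)
  have less: "(?T ^^ k) y \<noteq> 0" if "k < N" for k
    using not_less_Least[of k "\<lambda>N. (?T ^^ N) y = 0"] that unfolding N_def by auto
  have z: "(?T ^^ k) y = 0" if "k \<ge> N" for k
    using that by (induction k rule: dec_induct) (auto simp: N)
  have "N > 4" using z nz by (meson not_le)
  define y' where "y' = (?T ^^ (N - 5)) y"
  have y': "(?T ^^ k) y' = (?T ^^ (N - 5 + k)) y" for k
    unfolding y'_def by (metis add.commute comp_apply funpow_add)
  have 5: "(?T ^^ 5) y' = 0" and 4: "(?T ^^ 4) y' \<noteq> 0"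
    unfolding y' using \<open>N > 4\<close> by (auto intro!: z less)
  have 5: "x \<diamondop> (x \<diamondop> (x \<diamondop> (x \<diamondop> (x \<diamondop> y')))) = 0" and 4: "x \<diamondop> (x \<diamondop> (x \<diamondop> (x \<diamondop> y'))) \<noteq> 0"
    using 5 4 by (auto simp: eval_nat_numeral)
  have "li [x \<diamondop> y', x \<diamondop> (x \<diamondop> y'), x \<diamondop> (x \<diamondop> (x \<diamondop> y')), x \<diamondop> (x \<diamondop> (x \<diamondop> (x \<diamondop> y')))]"
    unfolding li4
  proof (intro allI impI)
    fix a b c d
    assume *: "a *s x \<diamondop> y' + b *s x \<diamondop> (x \<diamondop> y') + c *s x \<diamondop> (x \<diamondop> (x \<diamondop> y')) + d *s x \<diamondop> (x \<diamondop> (x \<diamondop> (x \<diamondop> y'))) = 0"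
    from arg_cong[OF *, of "\<lambda>v. x \<diamondop> (x \<diamondop> (x \<diamondop> v))"] have a: "a = 0" using 4 5 by (simp add: mul_simps)
    from arg_cong[OF *, of "\<lambda>v. x \<diamondop> (x \<diamondop> v)"] have b: "b = 0" using 4 5 a by (simp add: mul_simps)
    from arg_cong[OF *, of "\<lambda>v. x \<diamondop> v"] have c: "c = 0" using 4 5 a b by (simp add: mul_simps)
    with * a b c 4 show "a = 0 \<and> b = 0 \<and> c = 0 \<and> d = 0" by simp
  qed
  then show False by (rule no_rank_4)
qed

lemma li3_powers:
  assumes "x \<diamondop> (x \<diamondop> y) \<noteq> 0" shows "li [y, x \<diamondop> y, x \<diamondop> (x \<diamondop> y)]"
  unfolding li3
proof (intro allI impI)
  fix a b c assume *: "a *s y + b *s x \<diamondop> y + c *s x \<diamondop> (x \<diamondop> y) = 0"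
  have a: "a = 0"
  proof (cases "x \<diamondop> (x \<diamondop> (x \<diamondop> y)) = 0")
    case True
    with arg_cong[OF *, of "\<lambda>v. x \<diamondop> (x \<diamondop> v)"] assms show ?thesis by (simp add: mul_simps)
  next
    case False
    with arg_cong[OF *, of "\<lambda>v. x \<diamondop> (x \<diamondop> (x \<diamondop> v))"] assms show ?thesis by (simp add: mul_simps nilp4)
  qed
  have b: "b = 0"
  proof (cases "x \<diamondop> (x \<diamondop> (x \<diamondop> y)) = 0")
    case True
    with arg_cong[OF *, of "\<lambda>v. x \<diamondop> v"] assms a show ?thesis by (simp add: mul_simps)
  next
    case False
    with arg_cong[OF *, of "\<lambda>v. x \<diamondop> (x \<diamondop> v)"] assms a show ?thesis by (simp add: mul_simps nilp4)
  qed
  from * a b assms show "a = 0 \<and> b = 0 \<and> c = 0" by simp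
qed

lemma li4_powers:
  assumes "x \<diamondop> (x \<diamondop> (x \<diamondop> y)) \<noteq> 0" shows "li [y, x \<diamondop> y, x \<diamondop> (x \<diamondop> y), x \<diamondop> (x \<diamondop> (x \<diamondop> y))]"
  unfolding li4
proof (intro allI impI)
  fix a b c d assume *: "a *s y + b *s x \<diamondop> y + c *s x \<diamondop> (x \<diamondop> y) + d *s x \<diamondop> (x \<diamondop> (x \<diamondop> y)) = 0"
  from arg_cong[OF *, of "\<lambda>v. x \<diamondop> (x \<diamondop> (x \<diamondop> v))"] have a: "a = 0" using assms by (simp add: mul_simps nilp4)
  from arg_cong[OF *, of "\<lambda>v. x \<diamondop> (x \<diamondop> v)"] have b: "b = 0" using assms a by (simp add: mul_simps nilp4)
  from arg_cong[OF *, of "\<lambda>v. x \<diamondop> v"] have c: "c = 0" using assms a b by (simp add: mul_simps nilp4)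
  with * a b c assms show "a = 0 \<and> b = 0 \<and> c = 0 \<and> d = 0" by simp
qed

text \<open>Otherwise y and its first three images would be four independent vectors in a space of
  dimension 3.\<close>

lemma cube_zero_of_dim3:
  assumes "\<And>y. y \<in> Y \<Longrightarrow> x \<diamondop> y \<in> Y" "Y \<subseteq> span {u, v, w}" "y \<in> Y"
  shows "x \<diamondop> (x \<diamondop> (x \<diamondop> y)) = 0"
proof (rule ccontr)
  assume "x \<diamondop> (x \<diamondop> (x \<diamondop> y)) \<noteq> 0"
  from li_length_le[OF li4_powers[OF this], of "[u, v, w]"] assms show False by auto
qed

end

text \<open>Over an infinite field, polynomial identities in a parameter can be read off coefficientwise.\<close>

locale inf_nilp_alg = nilp_alg scale mul
  for scale :: "'a::field \<Rightarrow> 'b::ab_group_add \<Rightarrow> 'b" (infixr "*s" 75)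
    and mul :: "'b \<Rightarrow> 'b \<Rightarrow> 'b" (infixl "\<diamondop>" 80) +
  assumes infinite_field: "infinite (UNIV :: 'a set)"
begin

lemma generic_parameter:
  assumes "finite A" shows "\<exists>t::'a. t \<notin> A"
  using ex_new_if_finite[OF infinite_field assms] .

lemma li_perturb:
  assumes "li us" "length ws = length us" "finite A"
  shows "\<exists>t. t \<notin> A \<and> li (map2 (\<lambda>u w. u + t *s w) us ws)"
proof -
  have "finite (A \<union> {t. \<not> li (map2 (\<lambda>u w. u + t *s w) us ws)})"
    using finite_dependent_parameters[OF assms(1,2)] assms(3) by simp
  from generic_parameter[OF this] show ?thesis by blast
qed

text \<open>A linear functional turns the identity into a polynomial in t with infinitely many
  roots, and functionals separate vectors.\<close>

lemma quartic_coeffs_zero: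
  assumes "\<And>t. v0 + t *s v1 + (t^2) *s v2 + (t^3) *s v3 + (t^4) *s v4 = 0"
  shows "v0 = 0 \<and> v1 = 0 \<and> v2 = 0 \<and> v3 = 0 \<and> v4 = 0"
proof -
  interpret vp: vector_space_pair scale "(*) :: 'a \<Rightarrow> 'a \<Rightarrow> 'a"
    by unfold_locales (auto simp: algebra_simps)
  have *: "f v0 = 0 \<and> f v1 = 0 \<and> f v2 = 0 \<and> f v3 = 0 \<and> f v4 = 0" if f: "Vector_Spaces.linear scale (*) f" for f
  proof -
    let ?p = "[:f v0, f v1, f v2, f v3, f v4:]"
    have "poly ?p t = 0" for t
    proof -
      have "poly ?p t = f (v0 + t *s v1 + (t^2) *s v2 + (t^3) *s v3 + (t^4) *s v4)"
        using f by (simp add: vp.linear_add vp.linear_scale power2_eq_square power3_eq_cube power4_eq_xxxx algebra_simps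
            del: vp.vs2.scale_scale)
      also have "\<dots> = 0" using assms f by (simp add: vp.linear_0)
      finally show ?thesis .
    qed
    then have "infinite {t. poly ?p t = 0}" using infinite_field by simp
    then have "?p = 0" using poly_roots_finite by blast
    then show ?thesis by simp
  qed
  have "v = 0" if "\<And>f. Vector_Spaces.linear scale (*) f \<Longrightarrow> f v = (0::'a)" for v
  proof (rule ccontr)
    assume "v \<noteq> 0"
    then have "independent {v}" by simp
    from vp.linear_independent_extend[OF this, of "\<lambda>_. 1"]
    obtain g where g: "Vector_Spaces.linear scale (*) g" "g v = 1" by auto
    from that[OF g(1)] g(2) show False by simp
  qed
  with * show ?thesis by blast
qed

lemma cubic_coeffs_zero:
  assumes "\<And>t. v0 + t *s v1 + (t^2) *s v2 + (t^3) *s v3 = 0"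
  shows "v0 = 0 \<and> v1 = 0 \<and> v2 = 0 \<and> v3 = 0"
  using quartic_coeffs_zero[of v0 v1 v2 v3 0] assms by simp

text \<open>The coefficient of t in the cube of x + t y applied to w. Reading it off needs
  infinitely many t, but no division, so the characteristic does not matter.\<close>

lemma polarized_cube:
  assumes "\<And>x. x \<diamondop> (x \<diamondop> (x \<diamondop> w)) = 0"
  shows "x \<diamondop> (x \<diamondop> (y \<diamondop> w)) + x \<diamondop> (y \<diamondop> (x \<diamondop> w)) + y \<diamondop> (x \<diamondop> (x \<diamondop> w)) = 0"
proof -
  have "x \<diamondop> (x \<diamondop> (x \<diamondop> w))
      + t *s (x \<diamondop> (x \<diamondop> (y \<diamondop> w)) + x \<diamondop> (y \<diamondop> (x \<diamondop> w)) + y \<diamondop> (x \<diamondop> (x \<diamondop> w)))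
      + t\<^sup>2 *s (x \<diamondop> (y \<diamondop> (y \<diamondop> w)) + y \<diamondop> (x \<diamondop> (y \<diamondop> w)) + y \<diamondop> (y \<diamondop> (x \<diamondop> w)))
      + t ^ 3 *s (y \<diamondop> (y \<diamondop> (y \<diamondop> w))) = 0" for t
    using assms[of "x + t *s y"]
    by (simp add: mul_simps scale_right_distrib power2_eq_square power3_eq_cube add_ac mult_ac)
  from cubic_coeffs_zero[OF this] show ?thesis by blast
qed

lemma polarized_nilp4:
  "x \<diamondop> (x \<diamondop> (x \<diamondop> (y \<diamondop> w))) + x \<diamondop> (x \<diamondop> (y \<diamondop> (x \<diamondop> w))) + x \<diamondop> (y \<diamondop> (x \<diamondop> (x \<diamondop> w)))
   + y \<diamondop> (x \<diamondop> (x \<diamondop> (x \<diamondop> w))) = 0"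
proof -
  define c2 c3 where "c2 = (\<Sum>z\<leftarrow>[(x,x,y,y),(x,y,x,y),(x,y,y,x),(y,x,x,y),(y,x,y,x),(y,y,x,x)].
      (case z of (p,q,r,s) \<Rightarrow> p \<diamondop> (q \<diamondop> (r \<diamondop> (s \<diamondop> w)))))"
    and "c3 = (\<Sum>z\<leftarrow>[(x,y,y,y),(y,x,y,y),(y,y,x,y),(y,y,y,x)].
      (case z of (p,q,r,s) \<Rightarrow> p \<diamondop> (q \<diamondop> (r \<diamondop> (s \<diamondop> w)))))"
  have "x \<diamondop> (x \<diamondop> (x \<diamondop> (x \<diamondop> w)))
      + t *s (x \<diamondop> (x \<diamondop> (x \<diamondop> (y \<diamondop> w))) + x \<diamondop> (x \<diamondop> (y \<diamondop> (x \<diamondop> w)))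
          + x \<diamondop> (y \<diamondop> (x \<diamondop> (x \<diamondop> w))) + y \<diamondop> (x \<diamondop> (x \<diamondop> (x \<diamondop> w))))
      + t\<^sup>2 *s c2 + t ^ 3 *s c3 + t ^ 4 *s (y \<diamondop> (y \<diamondop> (y \<diamondop> (y \<diamondop> w)))) = 0" for t
    using nilp4[of "x + t *s y" w] unfolding c2_def c3_def
    by (simp add: mul_simps scale_right_distrib power2_eq_square power3_eq_cube power4_eq_xxxx add_ac mult_ac)
  from quartic_coeffs_zero[OF this] show ?thesis by blast
qed

end

section \<open>Projections, spanning lists and dual functionals\<close>

context vec_sp
begin

text \<open>The quotient by S, realized inside the same type: \<open>\<pi>\<close> is idempotent
  with kernel S, and \<open>\<pi> x\<close> is the chosen representative of the coset of x.\<close>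

lemma ex_projection:
  assumes "subspace S"
  obtains \<pi> where "Vector_Spaces.linear scale scale \<pi>" "\<And>x. \<pi> x = 0 \<longleftrightarrow> x \<in> S" "\<And>x. x - \<pi> x \<in> S"
proof -
  interpret vp: vector_space_pair scale scale by unfold_locales
  obtain B where B: "B \<subseteq> S" "independent B" "S \<subseteq> span B"
    using maximal_independent_subset[of S] by blast
  have spB: "span B = S" using B assms by (metis span_subspace)
  let ?E = "extend_basis B"
  define \<pi> where "\<pi> = vp.construct ?E (\<lambda>b. if b \<in> B then 0 else b)"
  have E: "independent ?E" "B \<subseteq> ?E" "span ?E = UNIV"
    using B(2) by (auto simp: independent_extend_basis extend_basis_superset)
  have l: "Vector_Spaces.linear scale scale \<pi>" unfolding \<pi>_def using E by (intro vp.linear_construct)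
  have b: "\<pi> b = (if b \<in> B then 0 else b)" if "b \<in> ?E" for b
    unfolding \<pi>_def using E that by (simp add: vp.construct_basis)
  have diff: "x - \<pi> x \<in> S" for x
  proof -
    have "x \<in> span ?E" using E by simp
    then show ?thesis
    proof (induction rule: span_induct_alt)
      case base
      then show ?case using l assms by (simp add: vp.linear_0 subspace_0)
    next
      case (step c v z)
      have "v - \<pi> v \<in> S" using b[OF step(1)] B assms by (auto simp: subspace_0)
      then have "c *s (v - \<pi> v) + (z - \<pi> z) \<in> S"
        using step(2) assms by (simp add: subspace_add subspace_scale)
      moreover have "c *s v + z - \<pi> (c *s v + z) = c *s (v - \<pi> v) + (z - \<pi> z)"
        using l by (simp add: vp.linear_add vp.linear_scale algebra_simps)
      ultimately show ?case by metis
    qed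
  qed
  have "\<pi> x = 0" if "x \<in> S" for x
  proof -
    have x: "x \<in> span B" using that spB by simp
    have "\<pi> y = 0" if "y \<in> B" for y using b[of y] E(2) that by auto
    then show ?thesis using vp.linear_eq_0_on_span[OF l _ x] by blast
  qed
  moreover have "x \<in> S" if "\<pi> x = 0" for x using diff[of x] that by simp
  ultimately show ?thesis using that[OF l _ diff] by blast
qed

text \<open>An independent list in W of maximal length spans W; it is padded with zeros to exactly k
  entries, so that it can be destructed into k named vectors.\<close>

lemma ex_spanning_list:
  assumes "\<And>vs. li vs \<Longrightarrow> set vs \<subseteq> W \<Longrightarrow> length vs \<le> k"
  obtains ys where "length ys = k" "W \<subseteq> span (set ys)"
proof -
  define P where "P m \<longleftrightarrow> (\<exists>vs. li vs \<and> set vs \<subseteq> W \<and> length vs = m)" for m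
  have P0: "P 0" unfolding P_def by (intro exI[of _ "[]"]) simp
  have bd: "m \<le> k" if "P m" for m using that assms unfolding P_def by blast
  define m where "m = Greatest P"
  have m: "P m" "\<And>m'. P m' \<Longrightarrow> m' \<le> m"
    unfolding m_def using GreatestI_nat[of P, OF P0 bd] Greatest_le_nat[of P, OF _ bd] by blast+
  from m(1) obtain vs where vs: "li vs" "set vs \<subseteq> W" "length vs = m" unfolding P_def by blast
  have "W \<subseteq> span (set vs)"
  proof
    fix x assume x: "x \<in> W"
    show "x \<in> span (set vs)"
    proof (rule ccontr)
      assume "x \<notin> span (set vs)"
      then have "P (Suc m)" unfolding P_def using vs x by (intro exI[of _ "x # vs"]) (simp add: li_Cons)
      from m(2)[OF this] show False by simp
    qed
  qed
  moreover have "m \<le> k" using assms[OF vs(1,2)] vs(3) by simp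
  ultimately show ?thesis
    using vs(3) by (intro that[of "vs @ replicate (k - m) 0"]) (auto intro: span_mono[THEN subsetD, rotated])
qed

lemma linear_functional3:
  assumes "li [p1, p2, p3]"
  obtains f1 f2 f3 where "Vector_Spaces.linear scale (*) f1" "Vector_Spaces.linear scale (*) f2"
    "Vector_Spaces.linear scale (*) f3"
    "\<And>a b c. f1 (a *s p1 + b *s p2 + c *s p3) = a" "\<And>a b c. f2 (a *s p1 + b *s p2 + c *s p3) = b"
    "\<And>a b c. f3 (a *s p1 + b *s p2 + c *s p3) = c"
proof -
  interpret vp: vector_space_pair scale "(*) :: 'a \<Rightarrow> 'a \<Rightarrow> 'a"
    by unfold_locales (auto simp: algebra_simps)
  from li_independent[OF assms] have ind: "independent {p1, p2, p3}" and d: "distinct [p1, p2, p3]" by auto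
  have "\<exists>g. Vector_Spaces.linear scale (*) g \<and> g p1 = u1 \<and> g p2 = u2 \<and> g p3 = u3" for u1 u2 u3
    using vp.linear_independent_extend[OF ind, of "\<lambda>x. if x = p1 then u1 else if x = p2 then u2 else u3"] d
    by auto
  then obtain f1 f2 f3 where f: "Vector_Spaces.linear scale (*) f1 \<and> f1 p1 = 1 \<and> f1 p2 = 0 \<and> f1 p3 = 0"
    "Vector_Spaces.linear scale (*) f2 \<and> f2 p1 = 0 \<and> f2 p2 = 1 \<and> f2 p3 = 0"
    "Vector_Spaces.linear scale (*) f3 \<and> f3 p1 = 0 \<and> f3 p2 = 0 \<and> f3 p3 = 1" by meson
  then show ?thesis by (intro that[of f1 f2 f3]) (auto simp: vp.linear_add vp.linear_scale)
qed

end

section \<open>Perfect subspaces of dimension at most 3\<close>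

context comm_alg
begin

text \<open>The shape of a three-dimensional module on which all of \<open>V\<close> acts by nilpotent maps
  without a common flag.\<close>

definition frame3 :: "'b set \<Rightarrow> 'b \<Rightarrow> 'b \<Rightarrow> 'b \<Rightarrow> ('b \<Rightarrow> 'a) \<Rightarrow> ('b \<Rightarrow> 'a) \<Rightarrow> bool" where
  "frame3 W p1 p2 p3 s t \<longleftrightarrow> li [p1, p2, p3] \<and> W = span {p1, p2, p3} \<and>
     Vector_Spaces.linear scale (*) s \<and> Vector_Spaces.linear scale (*) t \<and>
     (\<forall>y. y \<diamondop> p1 = t y *s p2 \<and> y \<diamondop> p2 = s y *s p1 + t y *s p3 \<and> y \<diamondop> p3 = - (s y *s p2)) \<and>
     (\<forall>w\<in>W. s w = 0 \<and> t w = 0)"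

text \<open>Polarizing x(x w) = 0 makes any two multiplications anticommute on W. If b moved a w off
  its line, w, b w, a w and b(a w) would be four independent vectors in dimension 3. So a w is an
  eigenvector of b, the factor is 0 because b squares to zero, and perfectness turns vanishing
  double products into W = 0.\<close>

lemma perfect_dim3_square:
  assumes W: "perfect W" "W \<subseteq> span {y1, y2, y3}"
    and sq: "\<And>x w. w \<in> W \<Longrightarrow> x \<diamondop> (x \<diamondop> w) = 0"
  shows "W = {0}"
proof -
  have anti: "a \<diamondop> (b \<diamondop> w) = - (b \<diamondop> (a \<diamondop> w))" if "w \<in> W" for a b w
    using sq[OF that, of "a + b"] sq[OF that, of a] sq[OF that, of b]
    by (simp add: mul_simps add_eq_0_iff)
  have kill: "b \<diamondop> (a \<diamondop> w) = 0" if w: "w \<in> W" for a b w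
  proof (cases "a \<diamondop> w = 0")
    case False
    let ?q = "a \<diamondop> w"
    have bq: "b \<diamondop> ?q \<in> span {?q}"
    proof (rule ccontr)
      assume *: "b \<diamondop> ?q \<notin> span {?q}"
      \<comment> \<open>The sign makes a send \<open>?w2\<close> to b(a w), just as it sends w to a
        w.\<close>
      let ?w2 = "- (b \<diamondop> w)"
      have w2: "?w2 \<in> W" using W w by (intro subspace_neg perfect_mul) (auto simp: perfect_def)
      have q2: "a \<diamondop> ?w2 = b \<diamondop> ?q" using anti[OF w, of a b] by (simp add: mul_simps)
      have q2': "a \<diamondop> (b \<diamondop> w) = - (b \<diamondop> ?q)" by (rule anti[OF w])
      have aa: "a \<diamondop> (b \<diamondop> ?q) = 0" using sq[OF w2, of a] q2 by simp
      have l2: "li [b \<diamondop> ?q, ?q]" using * False by (simp add: li_Cons)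
      have "li [w, ?w2, ?q, b \<diamondop> ?q]"
        unfolding li4
      proof (intro allI impI)
        fix k l m n assume e: "k *s w + l *s ?w2 + m *s ?q + n *s b \<diamondop> ?q = 0"
        from arg_cong[OF e, of "mul a"] have "k *s ?q + l *s (b \<diamondop> ?q) = 0"
          using aa sq[OF w, of a] by (simp add: mul_simps q2')
        then have "l = 0 \<and> k = 0" using l2[unfolded li2] by (simp add: add.commute)
        moreover from this e have "n *s (b \<diamondop> ?q) + m *s ?q = 0" by (simp add: add.commute)
        then have "n = 0 \<and> m = 0" using l2[unfolded li2] by blast
        ultimately show "k = 0 \<and> l = 0 \<and> m = 0 \<and> n = 0" by simp
      qed
      moreover have "set [w, ?w2, ?q, b \<diamondop> ?q] \<subseteq> W" using w w2 W by (auto simp: perfect_mul)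
      ultimately have "length [w, ?w2, ?q, b \<diamondop> ?q] \<le> length [y1, y2, y3]"
        using W(2) by (intro li_length_le) auto
      then show False by simp
    qed
    then obtain l where l: "b \<diamondop> ?q = l *s ?q" by (auto simp: span_singleton)
    have "b \<diamondop> (b \<diamondop> ?q) = 0" using W w by (intro sq) (simp add: perfect_mul)
    then show ?thesis using l by (auto simp: mul_simps)
  qed simp
  have "b \<diamondop> w = 0" if "w \<in> W" for b w
  proof -
    have "w \<in> span {x \<diamondop> w | x w. w \<in> W}" using W that unfolding perfect_def products_def by auto
    then have "b \<diamondop> w \<in> {0}" by (rule mul_mem_span) (auto simp: kill)
    then show ?thesis by simp
  qed
  then have "W \<subseteq> {0}" using perfect_subset[OF W(1), of "{0}"] by auto
  then show ?thesis using W(1) by (auto simp: perfect_def subspace_0)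
qed

text \<open>One element a with a(a w) nonzero and one element c that moves p1 = a(a w) off its line
  generate the frame. The relation \<open>star\<close> for the pairs (a, y) and (c, y) then fixes
  the matrix of an arbitrary y up to its diagonal, and nilpotency kills the diagonal.\<close>

lemma frame3_of_perfect:
  assumes W: "perfect W" "W \<subseteq> span {y1, y2, y3}" "W \<noteq> {0}"
    and cube: "\<And>x w. w \<in> W \<Longrightarrow> x \<diamondop> (x \<diamondop> (x \<diamondop> w)) = 0"
    and star: "\<And>x y w. w \<in> W \<Longrightarrow> x \<diamondop> (x \<diamondop> (y \<diamondop> w)) + x \<diamondop> (y \<diamondop> (x \<diamondop> w)) + y \<diamondop> (x \<diamondop> (x \<diamondop> w)) = 0"
  shows "\<exists>p1 p2 p3 s t c4 c5. frame3 W p1 p2 p3 s t \<and> s c4 = 0 \<and> t c4 = 1 \<and> s c5 = 1 \<and> t c5 = 0"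
proof -
  have sW: "subspace W" using W by (simp add: perfect_def)
  note mW = perfect_mul[OF W(1)]
  from perfect_dim3_square[OF W(1,2)] W(3) obtain a w where aw: "w \<in> W" "a \<diamondop> (a \<diamondop> w) \<noteq> 0" by blast
  define p1 p2' where "p1 = a \<diamondop> (a \<diamondop> w)" and "p2' = a \<diamondop> w"
  have in1: "p1 \<in> W" "p2' \<in> W" using aw mW by (auto simp: p1_def p2'_def)
  have a1: "a \<diamondop> p1 = 0" "a \<diamondop> p2' = p1" "a \<diamondop> w = p2'" "p1 \<noteq> 0"
    using cube[OF aw(1), of a] aw by (auto simp: p1_def p2'_def)
  have li': "li [p1, p2', w]" unfolding li3
  proof (intro allI impI)
    fix k l m assume e: "k *s p1 + l *s p2' + m *s w = 0"
    from arg_cong[OF e, of "\<lambda>v. a \<diamondop> (a \<diamondop> v)"] a1 have "m = 0" by (simp add: mul_simps)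
    with arg_cong[OF e, of "mul a"] a1 have "l = 0" by (simp add: mul_simps)
    with e \<open>m = 0\<close> a1 show "k = 0 \<and> l = 0 \<and> m = 0" by simp
  qed
  have full: "W \<subseteq> span {q1, q2, q3}" if "li [q1, q2, q3]" "{q1, q2, q3} \<subseteq> W" for q1 q2 q3
    using li_span_full[OF that(1), of "[y1, y2, y3]"] that(2) W(2) by auto
  have W': "W \<subseteq> span {p1, p2', w}" using full[OF li'] in1 aw by auto
  have rep: "\<exists>m1 m2 m3. v = m1 *s p1 + m2 *s p2' + m3 *s w" if "v \<in> W" for v
    using W' that unfolding span3[symmetric] by blast
  \<comment> \<open>If p1 were an eigenvector of all multiplications, they would all kill it; then
    \<open>star\<close> for a and y, together with nilpotency of y, would force all products with W
    into the plane of p1 and \<open>p2'\<close>, which is smaller than the perfect space W.\<close>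
  have "\<exists>c. c \<diamondop> p1 \<notin> span {p1}"
  proof (rule ccontr)
    assume "\<not> ?thesis"
    then have *: "y \<diamondop> p1 \<in> span {p1}" for y by blast
    have "y \<diamondop> p1 = 0 \<and> y \<diamondop> p2' \<in> span {p1, p2'} \<and> y \<diamondop> w \<in> span {p1, p2'}" for y
    proof -
      from * obtain m11 where y1: "y \<diamondop> p1 = m11 *s p1" by (auto simp: span_singleton)
      have "m11 = 0" using cube[OF in1(1), of y] a1 by (simp add: y1 mul_simps)
      with y1 have y1: "y \<diamondop> p1 = 0" by simp
      from rep[OF mW[OF in1(2)]] obtain m12 m22 m32 where y2: "y \<diamondop> p2' = m12 *s p1 + m22 *s p2' + m32 *s w"
        by blast
      from rep[OF mW[OF aw(1)]] obtain m13 m23 m33 where y3: "y \<diamondop> w = m13 *s p1 + m23 *s p2' + m33 *s w"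
        by blast
      have "(m22 + m33) *s p1 + m32 *s p2' + 0 *s w = 0"
        using star[OF aw(1), of a y] by (simp add: y1 y2 y3 a1 mul_simps algebra_simps flip: p1_def)
      then have z: "m32 = 0" "m22 + m33 = 0" using li' unfolding li3 by blast+
      have "y \<diamondop> (y \<diamondop> (y \<diamondop> p2')) = (m22 * m22 * m12) *s p1 + (m22 * m22 * m22) *s p2' + 0 *s w"
        by (simp add: y1 y2 z mul_simps algebra_simps)
      then have "m22 * m22 * m22 = 0" using cube[OF in1(2), of y] li' unfolding li3 by metis
      then have "m22 = 0" by simp
      then have "m33 = 0" using z by simp
      show ?thesis using y1 by (auto simp: y2 y3 z \<open>m22 = 0\<close> \<open>m33 = 0\<close> span2
            intro: exI[of _ m12] exI[of _ m13] exI[of _ m23] exI[of _ 0])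
    qed
    note ** = this
    have "y \<diamondop> v \<in> span {p1, p2'}" if "v \<in> W" for y v
      by (rule mul_mem_span[of v "{p1, p2', w}"]) (use ** that W' span_zero in auto)
    then have "W \<subseteq> span {p1, p2'}" using perfect_subset[OF W(1)] by blast
    then have "set [p1, p2', w] \<subseteq> span (set [p1, p2'])" using aw in1 by auto
    from li_length_le[OF li' this] show False by simp
  qed
  then obtain c0 where c0: "c0 \<diamondop> p1 \<notin> span {p1}" by blast
  from rep[OF mW[OF in1(1)]] obtain n1 n2 n3 where n: "c0 \<diamondop> p1 = n1 *s p1 + n2 *s p2' + n3 *s w"
        by blast
  \<comment> \<open>In \<open>star\<close> for a, c0 and w, the first two summands lie in the span
    of p1 and \<open>p2'\<close>, so n3 is the whole coefficient of w.\<close>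
  have n3: "n3 = 0"
  proof -
    from rep[OF mW[OF in1(2)]] obtain m12 m22 m32 where y2: "c0 \<diamondop> p2' = m12 *s p1 + m22 *s p2' + m32 *s w"
        by blast
    from rep[OF mW[OF aw(1)]] obtain m13 m23 m33 where y3: "c0 \<diamondop> w = m13 *s p1 + m23 *s p2' + m33 *s w"
        by blast
    have "(m22 + m33 + n1) *s p1 + (m32 + n2) *s p2' + n3 *s w = 0"
      using star[OF aw(1), of a c0] by (simp add: n y2 y3 a1 mul_simps algebra_simps flip: p1_def)
    then show ?thesis using li' unfolding li3 by blast
  qed
  have n2: "n2 \<noteq> 0" using c0 n n3 by (auto simp: span_singleton)
  \<comment> \<open>After this scaling p2 = c p1 agrees with \<open>p2'\<close> modulo p1, so that a
    p2 = p1.\<close>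
  define c where "c = inverse n2 *s c0"
  define p2 p3 where "p2 = c \<diamondop> p1" and "p3 = c \<diamondop> p2"
  have p2: "p2 = (inverse n2 * n1) *s p1 + p2'"
    unfolding p2_def c_def using n n2 n3 by (simp add: mul_simps algebra_simps)
  have in2: "p2 \<in> W" "p3 \<in> W" using in1 mW by (auto simp: p2_def p3_def)
  have c1: "c \<diamondop> p1 = p2" "c \<diamondop> p2 = p3" "c \<diamondop> p3 = 0"
    using cube[OF in1(1), of c] by (auto simp: p2_def p3_def)
  have a2: "a \<diamondop> p2 = p1" unfolding p2 by (simp add: mul_simps a1)
  have a3: "a \<diamondop> p3 = - p2"
    using star[OF in1(1), of c a] by (simp add: c1 a1 a2 add_eq_0_iff)
  have lip: "li [p1, p2, p3]" unfolding li3
  proof (intro allI impI)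
    fix k l m assume e: "k *s p1 + l *s p2 + m *s p3 = 0"
    from arg_cong[OF e, of "\<lambda>v. a \<diamondop> (a \<diamondop> v)"] a1 a2 a3 have "m = 0" by (simp add: mul_simps)
    with arg_cong[OF e, of "mul a"] a1 a2 have "l = 0" by (simp add: mul_simps)
    with e \<open>m = 0\<close> a1 show "k = 0 \<and> l = 0 \<and> m = 0" by simp
  qed
  have Wp: "W = span {p1, p2, p3}"
    using full[OF lip] in1 in2 sW by (simp add: span_minimal subset_antisym)
  interpret vp: vector_space_pair scale "(*) :: 'a \<Rightarrow> 'a \<Rightarrow> 'a"
    by unfold_locales (auto simp: algebra_simps)
  obtain f1 f2 f3 where
    f: "Vector_Spaces.linear scale (*) f1" "Vector_Spaces.linear scale (*) f2"
    "Vector_Spaces.linear scale (*) f3"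
    "\<And>a b c. f1 (a *s p1 + b *s p2 + c *s p3) = a" "\<And>a b c. f2 (a *s p1 + b *s p2 + c *s p3) = b"
    "\<And>a b c. f3 (a *s p1 + b *s p2 + c *s p3) = c"
    by (rule linear_functional3[OF lip]) blast
  define s t where "s y = f1 (y \<diamondop> p2)" and "t y = f2 (y \<diamondop> p1)" for y
  have lin: "Vector_Spaces.linear scale (*) s" "Vector_Spaces.linear scale (*) t"
    unfolding s_def t_def Vector_Spaces.linear_iff
    by (simp_all add: mul_simps vp.linear_add[OF f(1)] vp.linear_scale[OF f(1)] vp.linear_add[OF f(2)]
        vp.linear_scale[OF f(2)] vector_space_axioms vp.vs2.vector_space_axioms del: vp.vs2.scale_scale)
  have act: "y \<diamondop> p1 = t y *s p2 \<and> y \<diamondop> p2 = s y *s p1 + t y *s p3 \<and> y \<diamondop> p3 = - (s y *s p2)" for y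
  proof -
    obtain m11 m21 m31 where y1: "y \<diamondop> p1 = m11 *s p1 + m21 *s p2 + m31 *s p3"
      using mW[OF in1(1), of y] unfolding Wp span3 by blast
    obtain m12 m22 m32 where y2: "y \<diamondop> p2 = m12 *s p1 + m22 *s p2 + m32 *s p3"
      using mW[OF in2(1), of y] unfolding Wp span3 by blast
    obtain m13 m23 m33 where y3: "y \<diamondop> p3 = m13 *s p1 + m23 *s p2 + m33 *s p3"
      using mW[OF in2(2), of y] unfolding Wp span3 by blast
    have "(- (m11 + m22 + m33)) *s p1 + (m32 - m21) *s p2 + (- m31) *s p3 = 0"
      using star[OF in2(2), of a y] by (simp add: y1 y2 y3 a1 a2 a3 mul_simps algebra_simps)
    then have z1: "m31 = 0" "m32 = m21" using lip unfolding li3 by fastforce+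
    have "m13 *s p1 + (m12 + m23) *s p2 + (m11 + m22 + m33) *s p3 = 0"
      using star[OF in1(1), of c y] by (simp add: y1 y2 y3 c1 mul_simps algebra_simps)
    then have z2: "m13 = 0" "m23 = - m12" using lip unfolding li3 by (blast, metis add_eq_0_iff)
    \<comment> \<open>Subtracting the matrices of a and c with the off-diagonal entries of y leaves
      a diagonal action, which must be nilpotent.\<close>
    let ?y = "y - m12 *s a - m21 *s c"
    have d: "?y \<diamondop> p1 = m11 *s p1" "?y \<diamondop> p2 = m22 *s p2" "?y \<diamondop> p3 = m33 *s p3"
      by (simp_all add: y1 y2 y3 z1 z2 a1 a2 a3 c1 mul_simps)
    have nz: "p1 \<noteq> 0" "p2 \<noteq> 0" "p3 \<noteq> 0"
      using lip li_independent[OF lip] dependent_zero by auto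
    have "m11 = 0" "m22 = 0" "m33 = 0"
      using cube[OF in1(1), of ?y] cube[OF in2(1), of ?y] cube[OF in2(2), of ?y] nz
      by (simp_all add: d mul_scale_right)
    then have y: "y \<diamondop> p1 = m21 *s p2" "y \<diamondop> p2 = m12 *s p1 + m21 *s p3" "y \<diamondop> p3 = - (m12 *s p2)"
      by (simp_all add: y1 y2 y3 z1 z2)
    have "s y = m12" "t y = m21"
      using f(4)[of m12 0 m21] f(5)[of 0 m21 0] by (simp_all add: s_def t_def y)
    with y show ?thesis by simp
  qed
  \<comment> \<open>The products of two vectors of the frame, computed by the action of either
    factor, must agree; this forces s and t to vanish on W.\<close>
  have "t p2 = 0 \<and> s p1 = 0 \<and> t p1 = 0"
  proof -
    have "s p1 *s p1 + (- t p2) *s p2 + t p1 *s p3 = 0"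
      using act[of p1] act[of p2] mul_commute[of p1 p2] by simp
    then show ?thesis using lip unfolding li3 by (metis neg_equal_0_iff_equal)
  qed
  moreover have "t p3 = 0"
  proof -
    have "t p3 *s p2 = - (s p1 *s p2)" using act[of p1] act[of p3] mul_commute[of p1 p3] by simp
    with calculation show ?thesis using li_independent[OF lip] dependent_zero[of "{p1, p2, p3}"] by auto
  qed
  moreover have "s p3 = 0 \<and> s p2 = 0"
  proof -
    have "s p3 *s p1 + t p3 *s p3 = - (s p2 *s p2)"
      using act[of p2] act[of p3] mul_commute[of p2 p3] by simp
    then have "s p3 *s p1 + s p2 *s p2 + t p3 *s p3 = 0"
      by (metis add.commute add.left_commute add.right_inverse)
    then show ?thesis using lip unfolding li3 by blast
  qed
  ultimately have van: "\<forall>w\<in>W. s w = 0 \<and> t w = 0"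
    unfolding Wp using lin by (auto simp: span3 vp.linear_add vp.linear_scale)
  have "frame3 W p1 p2 p3 s t"
    unfolding frame3_def using lip Wp lin act van by blast
  \<comment> \<open>The elements c and a become the \<open>c4\<close> and \<open>c5\<close> of the
    statement.\<close>
  moreover have "s c = 0" "t c = 1" "s a = 1" "t a = 0"
    using f(4)[of 0 0 1] f(5)[of 0 1 0] f(4)[of 1 0 0] f(5)[of 0 0 0] by (simp_all add: s_def t_def c1 a1 a2)
  ultimately show ?thesis by blast
qed

end

context vec_sp
begin

lemma lincomb_list_linear:
  assumes "Vector_Spaces.linear scale scale f"
  shows "f (lincomb_list cs vs) = lincomb_list cs (map f vs)"
proof -
  interpret f: Vector_Spaces.linear scale scale f by (rule assms)
  show ?thesis
    by (induction cs vs rule: lincomb_list.induct) (simp_all add: f.add f.scale f.zero)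
qed

lemma li_of_linear_image:
  assumes "Vector_Spaces.linear scale scale f" "li (map f vs)" shows "li vs"
proof -
  interpret f: Vector_Spaces.linear scale scale f by (rule assms(1))
  show ?thesis
  unfolding li_def
  proof (intro allI impI)
    fix cs assume *: "length cs = length vs" "lincomb_list cs vs = 0"
    then have "lincomb_list cs (map f vs) = 0"
      using lincomb_list_linear[OF assms(1), of cs vs] f.zero by simp
    with * assms(2) show "set cs \<subseteq> {0}" unfolding li_def by simp
  qed
qed

lemma span_scale_iff: "c \<noteq> 0 \<Longrightarrow> c *s v \<in> span S \<longleftrightarrow> v \<in> span S"
  using span_scale[of "c *s v" S "inverse c"] span_scale[of v S c] by auto

lemma li_scale_Cons: "c \<noteq> 0 \<Longrightarrow> li (c *s v # vs) \<longleftrightarrow> li (v # vs)"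
  by (simp add: li_Cons span_scale_iff)

end

context comm_alg
begin

lemma subspace_range_mul: "subspace (range (mul a))"
  unfolding subspace_def
proof (intro conjI ballI allI)
  show "0 \<in> range (mul a)" by (rule range_eqI[of _ _ 0]) simp
next
  fix x y assume "x \<in> range (mul a)" "y \<in> range (mul a)"
  then obtain u v where "x = a \<diamondop> u" "y = a \<diamondop> v" by blast
  then show "x + y \<in> range (mul a)" by (intro range_eqI[of _ _ "u + v"]) (simp add: mul_simps)
next
  fix c x assume "x \<in> range (mul a)"
  then obtain u where "x = a \<diamondop> u" by blast
  then show "c *s x \<in> range (mul a)" by (intro range_eqI[of _ _ "c *s u"]) (simp add: mul_simps)
qed

lemma subspace_kernel_mul: "subspace {k. a \<diamondop> k = 0}"
  by (auto simp: subspace_def mul_simps)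

lemma subspace_annihilator: "subspace {u. \<forall>x. x \<diamondop> u = 0}"
  by (auto simp: subspace_def mul_simps)

lemma submod_annihilator: "submod {u. \<forall>x. x \<diamondop> u = 0}"
  by (auto simp: submod_def subspace_annihilator)

lemma perfect_annihilated: "perfect W \<Longrightarrow> W \<subseteq> {u. \<forall>x. x \<diamondop> u = 0} \<Longrightarrow> W \<subseteq> {0}"
  by (rule perfect_subset) auto

end

section \<open>Quotients by invariant subspaces\<close>

context inf_nilp_alg
begin

text \<open>Followed by \<open>\<pi>\<close>, the product becomes that of the quotient algebra on
  representatives. Rank and nilpotency pass to it because \<open>\<pi>\<close> is linear, commutes
  with the multiplications modulo Y, and independence of images under \<open>\<pi>\<close> implies
  independence before \<open>\<pi>\<close>.\<close>

lemma quotient: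
  assumes Y: "submod Y"
  obtains \<pi> where "Vector_Spaces.linear scale scale \<pi>" "\<And>x. \<pi> x = 0 \<longleftrightarrow> x \<in> Y" "\<And>x. x - \<pi> x \<in> Y"
    "inf_nilp_alg scale (\<lambda>x y. \<pi> (x \<diamondop> y))"
    "\<And>x y. \<pi> (x \<diamondop> \<pi> y) = \<pi> (x \<diamondop> y)" "\<And>x y. \<pi> (\<pi> x \<diamondop> y) = \<pi> (x \<diamondop> y)"
proof -
  interpret vp: vector_space_pair scale scale by unfold_locales
  from Y have sX: "subspace Y" and mX: "\<And>x u. u \<in> Y \<Longrightarrow> x \<diamondop> u \<in> Y" by (auto simp: submod_def)
  obtain \<pi> where \<pi>: "Vector_Spaces.linear scale scale \<pi>" "\<And>x. \<pi> x = 0 \<longleftrightarrow> x \<in> Y" "\<And>x. x - \<pi> x \<in> Y"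
    by (rule ex_projection[OF sX]) blast
  note lin = vp.linear_add[OF \<pi>(1)] vp.linear_scale[OF \<pi>(1)] vp.linear_diff[OF \<pi>(1)] vp.linear_0[OF \<pi>(1)]
  have r: "\<pi> (x \<diamondop> \<pi> y) = \<pi> (x \<diamondop> y)" for x y
  proof -
    have "x \<diamondop> (y - \<pi> y) \<in> Y" by (rule mX[OF \<pi>(3)])
    then have "\<pi> (x \<diamondop> (y - \<pi> y)) = 0" by (simp add: \<pi>(2))
    then show ?thesis by (simp add: mul_simps lin)
  qed
  have l: "\<pi> (\<pi> x \<diamondop> y) = \<pi> (x \<diamondop> y)" for x y
    using r[of y x] by (simp add: mul_commute[of y])
  let ?m = "\<lambda>x y. \<pi> (x \<diamondop> y)"
  have pow: "((?m x) ^^ N) (\<pi> y) = \<pi> (((mul x) ^^ N) y)" for x y N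
    by (induction N) (simp_all add: r)
  have "inf_nilp_alg scale ?m"
  proof unfold_locales
    show "\<pi> (x \<diamondop> y) = \<pi> (y \<diamondop> x)" for x y by (simp add: mul_commute)
    show "\<pi> ((x + x') \<diamondop> y) = \<pi> (x \<diamondop> y) + \<pi> (x' \<diamondop> y)" for x x' y by (simp add: mul_simps lin)
    show "\<pi> ((c *s x) \<diamondop> y) = c *s \<pi> (x \<diamondop> y)" for c x y by (simp add: mul_simps lin)
    show "\<not> li (map (?m x) ys)" if "length ys = 4" for x ys
      using rank_le_3[OF that, of x] li_of_linear_image[OF \<pi>(1), of "map (mul x) ys"]
      by (auto simp: comp_def)
    show "\<exists>N. ((?m x) ^^ N) y = 0" for x y
    proof -
      from nilp[of x "x \<diamondop> y"] obtain N where "((mul x) ^^ N) (x \<diamondop> y) = 0" by blast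
      then have "((?m x) ^^ Suc N) y = 0" by (simp only: funpow_Suc_right comp_def pow lin)
      then show ?thesis by blast
    qed
    show "infinite (UNIV :: 'a set)" by (rule infinite_field)
  qed
  from that[OF \<pi> this r l] show ?thesis .
qed

text \<open>If the image of W modulo Y were nonzero, it would carry a \<open>frame3\<close>. Its
  forms s and t vanish on the image of W and are independent, so c4 and c5 complete p1, p2, p3 to
  five independent vectors in a quotient of dimension at most 4.\<close>

lemma perfect_subset_submod:
  assumes Y: "submod Y" and W: "perfect W" "W \<subseteq> span (Y \<union> {y1, y2, y3})"
    and V: "UNIV \<subseteq> span (Y \<union> {v1, v2, v3, v4})"
  shows "W \<subseteq> Y"
proof -
  interpret vp: vector_space_pair scale scale by unfold_locales
  interpret vf: vector_space_pair scale "(*) :: 'a \<Rightarrow> 'a \<Rightarrow> 'a"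
    by unfold_locales (auto simp: algebra_simps)
  obtain \<pi> where \<pi>: "Vector_Spaces.linear scale scale \<pi>" "\<And>x. \<pi> x = 0 \<longleftrightarrow> x \<in> Y" "\<And>x. x - \<pi> x \<in> Y"
    and q: "inf_nilp_alg scale (\<lambda>x y. \<pi> (x \<diamondop> y))"
    and r: "\<And>x y. \<pi> (x \<diamondop> \<pi> y) = \<pi> (x \<diamondop> y)" and l: "\<And>x y. \<pi> (\<pi> x \<diamondop> y) = \<pi> (x \<diamondop> y)"
    by (rule quotient[OF Y]) blast
  interpret q: inf_nilp_alg scale "\<lambda>x y. \<pi> (x \<diamondop> y)" by (rule q)
  note lin = vp.linear_add[OF \<pi>(1)] vp.linear_scale[OF \<pi>(1)] vp.linear_diff[OF \<pi>(1)] vp.linear_0[OF \<pi>(1)]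
  have img: "\<pi> ` S \<subseteq> span (\<pi> ` T)" if "S \<subseteq> span (Y \<union> T)" for S T
  proof -
    have "\<pi> ` S \<subseteq> \<pi> ` span (Y \<union> T)" using that by blast
    also have "\<dots> = span (\<pi> ` (Y \<union> T))" by (rule vp.linear_span_image[OF \<pi>(1), symmetric])
    also have "\<dots> \<subseteq> span (\<pi> ` T)"
    proof (rule span_minimal)
      show "\<pi> ` (Y \<union> T) \<subseteq> span (\<pi> ` T)" by (auto simp: \<pi>(2)[THEN iffD2] span_base span_zero)
    qed simp
    finally show ?thesis .
  qed
  let ?W = "\<pi> ` W"
  have sW: "subspace ?W" using W(1) by (intro vp.linear_subspace_image[OF \<pi>(1)]) (simp add: perfect_def)
  have "q.products ?W = span (\<pi> ` {x \<diamondop> w | x w. w \<in> W})"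
  proof -
    have "{\<pi> (x \<diamondop> w) | x w. w \<in> ?W} = {\<pi> (x \<diamondop> \<pi> w) | x w. w \<in> W}" by blast
    also have "\<dots> = {\<pi> (x \<diamondop> w) | x w. w \<in> W}" by (simp only: r)
    also have "\<dots> = \<pi> ` {x \<diamondop> w | x w. w \<in> W}" by blast
    finally show ?thesis unfolding q.products_def by simp
  qed
  also have "\<dots> = \<pi> ` products W" unfolding products_def by (rule vp.linear_span_image[OF \<pi>(1)])
  finally have pW: "q.perfect ?W" using W(1) sW by (simp add: q.perfect_def perfect_def)
  have dim3: "?W \<subseteq> span {\<pi> y1, \<pi> y2, \<pi> y3}" using img[OF W(2)] by simp
  have dim4: "range \<pi> \<subseteq> span (set [\<pi> v1, \<pi> v2, \<pi> v3, \<pi> v4])" using img[OF V] by simp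
  show ?thesis
  proof (rule ccontr)
    assume "\<not> W \<subseteq> Y"
    then have nz: "?W \<noteq> {0}" using \<pi>(2) by (metis image_eqI singletonD subsetI)
    have cube: "\<pi> (x \<diamondop> \<pi> (x \<diamondop> \<pi> (x \<diamondop> w))) = 0" if "w \<in> ?W" for x w
      by (rule q.cube_zero_of_dim3[OF _ dim3 that]) (rule q.perfect_mul[OF pW])
    from q.frame3_of_perfect[OF pW dim3 nz cube q.polarized_cube[OF cube]]
    obtain p1 p2 p3 s t c4 c5 where f: "q.frame3 ?W p1 p2 p3 s t" "s c4 = 0" "t c4 = 1" "s c5 = 1" "t c5 = 0"
      by blast
    then have li: "li [p1, p2, p3]" and lst: "Vector_Spaces.linear scale (*) s" "Vector_Spaces.linear scale (*) t"
      and act: "\<And>y. \<pi> (y \<diamondop> p2) = s y *s p1 + t y *s p3"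
      and van: "\<And>w. w \<in> ?W \<Longrightarrow> s w = 0 \<and> t w = 0" and Wp: "?W = span {p1, p2, p3}"
      unfolding q.frame3_def by blast+
    have st\<pi>: "s (\<pi> c) = s c \<and> t (\<pi> c) = t c" for c
    proof -
      have "(s (\<pi> c) - s c) *s p1 + 0 *s p2 + (t (\<pi> c) - t c) *s p3 = 0"
        using act[of "\<pi> c"] act[of c] l[of c p2] by (simp add: algebra_simps)
      then show ?thesis using li unfolding li3 by fastforce
    qed
    have st_lin: "s (a *s x + y) = a * s x + s y" "t (a *s x + y) = a * t x + t y" for a x y
      using lst by (simp_all add: vf.linear_add vf.linear_scale)
    have pW': "p1 \<in> ?W" "p2 \<in> ?W" "p3 \<in> ?W" unfolding Wp by (auto simp: span_base)
    have "li [p1, p2, p3, \<pi> c4, \<pi> c5]"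
      unfolding li5
    proof (intro allI impI)
      fix a b c d e assume *: "a *s p1 + b *s p2 + c *s p3 + d *s \<pi> c4 + e *s \<pi> c5 = 0"
      then have *: "a *s p1 + (b *s p2 + (c *s p3 + (d *s \<pi> c4 + (e *s \<pi> c5 + 0)))) = 0" by (simp add: add.assoc)
      have z: "s 0 = 0" "t 0 = 0" using lst by (simp_all add: vf.linear_0)
      have "d = 0" "e = 0"
        using arg_cong[OF *, of s] arg_cong[OF *, of t] van[OF pW'(1)] van[OF pW'(2)] van[OF pW'(3)] f(2-) st\<pi>
        by (simp_all only: st_lin z) simp_all
      with * li show "a = 0 \<and> b = 0 \<and> c = 0 \<and> d = 0 \<and> e = 0" unfolding li3 by (simp add: add.assoc)
    qed
    moreover have "set [p1, p2, p3, \<pi> c4, \<pi> c5] \<subseteq> span (set [\<pi> v1, \<pi> v2, \<pi> v3, \<pi> v4])"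
      using dim4 pW' by auto
    ultimately have "length [p1, p2, p3, \<pi> c4, \<pi> c5] \<le> length [\<pi> v1, \<pi> v2, \<pi> v3, \<pi> v4]" by (rule li_length_le)
    then show False by simp
  qed
qed

lemma perfect_codim3:
  assumes "submod Y" "perfect W" "UNIV \<subseteq> span (Y \<union> {v1, v2, v3})"
  shows "W \<subseteq> Y"
proof -
  have "W \<subseteq> span (Y \<union> {v1, v2, v3})" using assms(3) by blast
  from perfect_subset_submod[OF assms(1,2) this, of v1 v2 v3 v3] assms(3) show ?thesis by simp
qed

text \<open>A vector outside W + Y shows that W is proper modulo Y, hence of dimension at most 3
  there, as \<open>perfect_subset_submod\<close> demands.\<close>

lemma perfect_codim4:
  assumes Y: "submod Y" and W: "perfect W" and V: "UNIV \<subseteq> span (Y \<union> {v1, v2, v3, v4})"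
    and ne: "span (W \<union> Y) \<noteq> UNIV"
  shows "W \<subseteq> Y"
proof -
  interpret vp: vector_space_pair scale scale by unfold_locales
  have sX: "subspace Y" using Y by (simp add: submod_def)
  obtain \<pi> where \<pi>: "Vector_Spaces.linear scale scale \<pi>" "\<And>x. \<pi> x = 0 \<longleftrightarrow> x \<in> Y" "\<And>x. x - \<pi> x \<in> Y"
    by (rule ex_projection[OF sX]) blast
  note lin = vp.linear_add[OF \<pi>(1)] vp.linear_scale[OF \<pi>(1)] vp.linear_diff[OF \<pi>(1)] vp.linear_0[OF \<pi>(1)]
  obtain v0 where v0: "v0 \<notin> span (W \<union> Y)" using ne by blast
  have sW: "subspace (\<pi> ` W)" using W by (intro vp.linear_subspace_image[OF \<pi>(1)]) (simp add: perfect_def)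
  have "\<pi> v0 \<notin> \<pi> ` W"
  proof
    assume "\<pi> v0 \<in> \<pi> ` W"
    then obtain w where w: "w \<in> W" "\<pi> v0 = \<pi> w" by blast
    then have "v0 - w \<in> Y" by (simp add: lin flip: \<pi>(2))
    then have "(v0 - w) + w \<in> span (W \<union> Y)" using w by (intro span_add) (auto intro: span_base)
    then show False using v0 by simp
  qed
  have "length vs \<le> 3" if "li vs" "set vs \<subseteq> \<pi> ` W" for vs
  proof -
    have "\<pi> v0 \<notin> span (set vs)" using span_minimal[OF that(2) sW] \<open>\<pi> v0 \<notin> \<pi> ` W\<close> by blast
    then have "li (\<pi> v0 # vs)" using that by (simp add: li_Cons)
    moreover have "\<pi> x \<in> span (set [\<pi> v1, \<pi> v2, \<pi> v3, \<pi> v4])" for x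
    proof -
      have "\<pi> x \<in> \<pi> ` span (Y \<union> {v1, v2, v3, v4})" using V by blast
      also have "\<dots> = span (\<pi> ` (Y \<union> {v1, v2, v3, v4}))" by (rule vp.linear_span_image[OF \<pi>(1), symmetric])
      also have "\<dots> \<subseteq> span (set [\<pi> v1, \<pi> v2, \<pi> v3, \<pi> v4])"
        by (rule span_minimal) (auto simp: \<pi>(2)[THEN iffD2] span_base span_zero)
      finally show ?thesis .
    qed
    then have "set (\<pi> v0 # vs) \<subseteq> span (set [\<pi> v1, \<pi> v2, \<pi> v3, \<pi> v4])" using that(2) by auto
    ultimately have "length (\<pi> v0 # vs) \<le> length [\<pi> v1, \<pi> v2, \<pi> v3, \<pi> v4]" by (rule li_length_le)
    then show ?thesis by simp
  qed
  then obtain ys where ys: "length ys = 3" "\<pi> ` W \<subseteq> span (set ys)" by (rule ex_spanning_list)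
  then obtain y1 y2 y3 where y: "ys = [y1, y2, y3]" by (auto simp: length_Suc_conv eval_nat_numeral)
  have "W \<subseteq> span (Y \<union> {y1, y2, y3})"
  proof
    fix w assume "w \<in> W"
    then have "\<pi> w \<in> span {y1, y2, y3}" using ys y by auto
    then have "(w - \<pi> w) + \<pi> w \<in> span (Y \<union> {y1, y2, y3})"
      using \<pi>(3)[of w] by (intro span_add) (auto intro: span_base span_mono[THEN subsetD, rotated])
    then show "w \<in> span (Y \<union> {y1, y2, y3})" by simp
  qed
  from perfect_subset_submod[OF Y W this V] show ?thesis .
qed

text \<open>Let v be the sum of \<kappa>^i x^i e for i up to 3 and u v = p e, where p is a cubic
  polynomial in \<kappa> whose coefficients are the four factors in question. If p were not the zero
  polynomial, a generic \<kappa> would make v an eigenvector of x plus a multiple of u, with the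
  nonzero eigenvalue 1 / \<kappa>.\<close>

lemma rank_one_orbit:
  assumes u: "\<And>v. u \<diamondop> v \<in> span {e}"
  shows "u \<diamondop> e = 0" "u \<diamondop> (x \<diamondop> e) = 0" "u \<diamondop> (x \<diamondop> (x \<diamondop> e)) = 0" "u \<diamondop> (x \<diamondop> (x \<diamondop> (x \<diamondop> e))) = 0"
proof -
  obtain \<theta> where \<theta>: "u \<diamondop> v = \<theta> v *s e" for v using u unfolding span1 by metis
  define t0 t1 t2 t3 where "t0 = \<theta> e" and "t1 = \<theta> (x \<diamondop> e)" and "t2 = \<theta> (x \<diamondop> (x \<diamondop> e))"
    and "t3 = \<theta> (x \<diamondop> (x \<diamondop> (x \<diamondop> e)))"
  have ev: "u \<diamondop> e = t0 *s e" "u \<diamondop> (x \<diamondop> e) = t1 *s e" "u \<diamondop> (x \<diamondop> (x \<diamondop> e)) = t2 *s e"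
    "u \<diamondop> (x \<diamondop> (x \<diamondop> (x \<diamondop> e))) = t3 *s e"
    by (simp_all add: \<theta> t0_def t1_def t2_def t3_def)
  have "e = 0 \<or> [:t0, t1, t2, t3:] = 0"
  proof (rule ccontr)
    assume A: "\<not> ?thesis"
    then have "finite (insert 0 {\<kappa>. poly [:t0, t1, t2, t3:] \<kappa> = 0})" using poly_roots_finite by blast
    from generic_parameter[OF this] obtain \<kappa> where \<kappa>: "\<kappa> \<noteq> 0" "poly [:t0, t1, t2, t3:] \<kappa> \<noteq> 0" by auto
    define p where "p = poly [:t0, t1, t2, t3:] \<kappa>"
    \<comment> \<open>The resolvent of x at e: since the fourth power of x is zero, v minus \<kappa>
      times x v is e.\<close>
    define v where "v = e + \<kappa> *s (x \<diamondop> e) + \<kappa>\<^sup>2 *s (x \<diamondop> (x \<diamondop> e)) + \<kappa>^3 *s (x \<diamondop> (x \<diamondop> (x \<diamondop> e)))"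
    have uv: "u \<diamondop> v = p *s e"
      by (simp add: v_def p_def ev mul_simps algebra_simps power2_eq_square power3_eq_cube)
    have xv: "x \<diamondop> v = inverse \<kappa> *s (v - e)"
    proof -
      have "inverse \<kappa> * \<kappa>\<^sup>2 = \<kappa>" "inverse \<kappa> * \<kappa> ^ 3 = \<kappa>\<^sup>2"
        using \<kappa>(1) by (simp_all add: power2_eq_square power3_eq_cube)
      then show ?thesis using \<kappa>(1) by (simp add: v_def mul_simps nilp4 scale_right_distrib)
    qed
    have p0: "p \<noteq> 0" using \<kappa>(2) unfolding p_def .
    then have "(x + (inverse \<kappa> * inverse p) *s u) \<diamondop> v = inverse \<kappa> *s v"
      by (simp add: mul_simps uv xv scale_right_diff_distrib)
    from mul_eigen[OF this] \<kappa>(1) have "v = 0" by simp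
    then show False using uv A p0 by simp
  qed
  with ev show "u \<diamondop> e = 0" "u \<diamondop> (x \<diamondop> e) = 0" "u \<diamondop> (x \<diamondop> (x \<diamondop> e)) = 0" "u \<diamondop> (x \<diamondop> (x \<diamondop> (x \<diamondop> e))) = 0"
    by auto
qed

text \<open>In z + t x the image of k is a nonzero multiple of e for all t but - l / m, while for
  generic t the other three images stay independent of e. That multiplication would have rank
  4.\<close>

lemma rank_violation:
  assumes li: "li [e, z \<diamondop> y1, z \<diamondop> y2, z \<diamondop> y3]" and zk: "z \<diamondop> k = l *s e" and xk: "x \<diamondop> k = m *s e" "m \<noteq> 0"
  shows False
proof -
  from li_perturb[OF li, of "[0, x \<diamondop> y1, x \<diamondop> y2, x \<diamondop> y3]" "{- l / m}"]
  obtain t where t: "t \<noteq> - l / m"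
    "li [e, (z + t *s x) \<diamondop> y1, (z + t *s x) \<diamondop> y2, (z + t *s x) \<diamondop> y3]" by (auto simp: mul_simps)
  have "l + t * m \<noteq> 0" using t(1) xk(2) by (auto simp: field_simps add_eq_0_iff)
  moreover have "(z + t *s x) \<diamondop> k = (l + t * m) *s e" by (simp add: mul_simps zk xk algebra_simps)
  ultimately have "li [(z + t *s x) \<diamondop> k, (z + t *s x) \<diamondop> y1, (z + t *s x) \<diamondop> y2, (z + t *s x) \<diamondop> y3]"
    using t(2) by (simp add: li_scale_Cons)
  then show False by (rule no_rank_4)
qed

section \<open>Multiplications of maximal rank and the chain conditions\<close>

definition max_rank :: "'b \<Rightarrow> 'b list \<Rightarrow> bool" where
  "max_rank a cs \<longleftrightarrow> li (map (mul a) cs) \<and> (\<forall>x ys. length ys = Suc (length cs) \<longrightarrow> \<not> li (map (mul x) ys))"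

lemma ex_max_rank: "\<exists>a cs. max_rank a cs"
proof -
  define P where "P m \<longleftrightarrow> (\<exists>a cs. length cs = m \<and> li (map (mul a) cs))" for m
  have P0: "P 0" by (auto simp: P_def)
  have bd: "m \<le> 3" if m: "P m" for m
  proof (rule ccontr)
    assume "\<not> m \<le> 3"
    from m obtain a cs where cs: "length cs = m" "li (map (mul a) cs)" unfolding P_def by blast
    have "li (drop (m - 4) (map (mul a) cs))" 
    proof -
      have "li (xs @ ys) \<Longrightarrow> li ys" for xs ys by (induction xs) (auto simp: li_Cons)
      then show ?thesis using cs(2) by (metis append_take_drop_id)
    qed
    with rank_le_3[of "drop (m - 4) cs" a] cs(1) \<open>\<not> m \<le> 3\<close> show False by (simp add: drop_map)
  qed
  define m where "m = Greatest P"
  have m: "P m" "\<And>m'. P m' \<Longrightarrow> m' \<le> m"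
    unfolding m_def using GreatestI_nat[of P, OF P0 bd] Greatest_le_nat[of P, OF _ bd] by blast+
  from m(1) obtain a cs where cs: "length cs = m" "li (map (mul a) cs)" unfolding P_def by blast
  have "\<not> li (map (mul x) ys)" if "length ys = Suc m" for x ys
    using m(2)[of "Suc m"] that unfolding P_def by auto
  with cs show ?thesis unfolding max_rank_def by blast
qed

lemma max_rank_length: "max_rank a cs \<Longrightarrow> length cs \<le> 3"
proof (rule ccontr)
  assume "max_rank a cs" and n: "\<not> length cs \<le> 3"
  then have l: "li (map (mul a) cs)" unfolding max_rank_def by blast
  have "li (xs @ ys) \<Longrightarrow> li ys" for xs ys by (induction xs) (auto simp: li_Cons)
  then have "li (drop (length cs - 4) (map (mul a) cs))" using l by (metis append_take_drop_id)
  with rank_le_3[of "drop (length cs - 4) cs" a] n show False by (simp add: drop_map)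
qed

lemma max_rank_range: 
  assumes "max_rank a cs" shows "range (mul a) = span (set (map (mul a) cs))"
proof
  show "range (mul a) \<subseteq> span (set (map (mul a) cs))"
  proof (clarify, rule ccontr)
    fix v assume "a \<diamondop> v \<notin> span (set (map (mul a) cs))"
    then have "li (map (mul a) (v # cs))" using assms by (simp add: li_Cons max_rank_def)
    with assms show False unfolding max_rank_def by (metis length_Cons)
  qed
  show "span (set (map (mul a) cs)) \<subseteq> range (mul a)"
    by (rule span_minimal) (auto simp: subspace_range_mul)
qed

lemma max_rank_transfer:
  assumes "max_rank a cs" "li (map (mul b) ds)" "length ds = length cs" shows "max_rank b ds"
  using assms unfolding max_rank_def by simp

text \<open>The range of multiplication is upper semicontinuous at points of maximal rank; this yields
  the conditions \<open>chain1\<close> to \<open>chain4\<close>, obtained from formal kernel vectors of \<open>a + t z\<close>.\<close>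

lemma max_rank_closed:
  assumes "max_rank a cs" "\<And>t. t \<noteq> 0 \<Longrightarrow> \<exists>v. (a + t *s z) \<diamondop> v = y"
  shows "y \<in> range (mul a)"
proof (rule ccontr)
  assume "y \<notin> range (mul a)"
  then have "li (y # map (mul a) cs)"
    using assms(1) by (simp add: li_Cons max_rank_range max_rank_def)
  from li_perturb[OF this, of "0 # map (mul z) cs" "{0}"] obtain t where
    t: "t \<noteq> 0" "li (y # map2 (\<lambda>u w. u + t *s w) (map (mul a) cs) (map (mul z) cs))" by auto
  have "map2 (\<lambda>u w. u + t *s w) (map (mul a) cs) (map (mul z) cs) = map (mul (a + t *s z)) cs"
    by (induction cs) (simp_all add: mul_simps)
  with t assms(2)[OF t(1)] obtain v where "li (map (mul (a + t *s z)) (v # cs))" by auto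
  with assms(1) show False unfolding max_rank_def by (metis length_Cons)
qed

lemma chain1:
  assumes "max_rank a cs" "a \<diamondop> k = 0" shows "z \<diamondop> k \<in> range (mul a)"
proof (rule max_rank_closed[OF assms(1), of z])
  fix t :: 'a assume t: "t \<noteq> 0"
  have tp: "(inverse t)\<^sup>2 * t = inverse t" "(inverse t) ^ 3 * t = (inverse t)\<^sup>2" "(inverse t) ^ 4 * t = (inverse t) ^ 3"
    using t by (simp_all add: power2_eq_square power3_eq_cube power4_eq_xxxx)
  have "(a + t *s z) \<diamondop> (inverse t *s k) = z \<diamondop> k" using t assms(2) by (simp add: mul_simps)
  then show "\<exists>v. (a + t *s z) \<diamondop> v = z \<diamondop> k" by blast
qed

text \<open>Under a + t z the vector k - t c goes to - t^2 (z c), so z c lies in the range for every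
  nonzero t. The longer chains continue the alternating sum and telescope in the same way.\<close>

lemma chain2:
  assumes "max_rank a cs" "a \<diamondop> k = 0" "z \<diamondop> k = a \<diamondop> c" shows "z \<diamondop> c \<in> range (mul a)"
proof (rule max_rank_closed[OF assms(1), of z])
  fix t :: 'a assume t: "t \<noteq> 0"
  have tp: "(inverse t)\<^sup>2 * t = inverse t" "(inverse t) ^ 3 * t = (inverse t)\<^sup>2" "(inverse t) ^ 4 * t = (inverse t) ^ 3"
    using t by (simp_all add: power2_eq_square power3_eq_cube power4_eq_xxxx)
  have "(a + t *s z) \<diamondop> (inverse t *s c - (inverse t)\<^sup>2 *s k) = z \<diamondop> c"
    using t tp assms(2,3) by (simp add: mul_simps scale_right_distrib)
  then show "\<exists>v. (a + t *s z) \<diamondop> v = z \<diamondop> c" by blast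
qed

lemma chain3:
  assumes "max_rank a cs" "a \<diamondop> k = 0" "z \<diamondop> k = a \<diamondop> c" "z \<diamondop> c = a \<diamondop> d" shows "z \<diamondop> d \<in> range (mul a)"
proof (rule max_rank_closed[OF assms(1), of z])
  fix t :: 'a assume t: "t \<noteq> 0"
  have tp: "(inverse t)\<^sup>2 * t = inverse t" "(inverse t) ^ 3 * t = (inverse t)\<^sup>2" "(inverse t) ^ 4 * t = (inverse t) ^ 3"
    using t by (simp_all add: power2_eq_square power3_eq_cube power4_eq_xxxx)
  have "(a + t *s z) \<diamondop> (inverse t *s d - (inverse t)\<^sup>2 *s c + (inverse t)^3 *s k) = z \<diamondop> d"
    using t tp assms(2-) by (simp add: mul_simps scale_right_distrib)
  then show "\<exists>v. (a + t *s z) \<diamondop> v = z \<diamondop> d" by blast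
qed

lemma chain4:
  assumes "max_rank a cs" "a \<diamondop> k = 0" "z \<diamondop> k = a \<diamondop> c" "z \<diamondop> c = a \<diamondop> d" "z \<diamondop> d = a \<diamondop> e"
  shows "z \<diamondop> e \<in> range (mul a)"
proof (rule max_rank_closed[OF assms(1), of z])
  fix t :: 'a assume t: "t \<noteq> 0"
  have tp: "(inverse t)\<^sup>2 * t = inverse t" "(inverse t) ^ 3 * t = (inverse t)\<^sup>2" "(inverse t) ^ 4 * t = (inverse t) ^ 3"
    using t by (simp_all add: power2_eq_square power3_eq_cube power4_eq_xxxx)
  have "(a + t *s z) \<diamondop> (inverse t *s e - (inverse t)\<^sup>2 *s d + (inverse t)^3 *s c - (inverse t)^4 *s k) = z \<diamondop> e"
    using t tp assms(2-) by (simp add: mul_simps scale_right_distrib)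
  then show "\<exists>v. (a + t *s z) \<diamondop> v = z \<diamondop> e" by blast
qed

text \<open>The vector in \<open>chain2\<close> is quadratic in the pair (z, c); this is its
  polarization, obtained from the cases z + z', z and z'.\<close>

lemma chain2_polar:
  assumes a: "max_rank a cs" "a \<diamondop> k = 0" and z: "z \<diamondop> k = a \<diamondop> c" "z' \<diamondop> k = a \<diamondop> c'"
  shows "z \<diamondop> c' + z' \<diamondop> c \<in> range (mul a)"
proof -
  have "(z + z') \<diamondop> k = a \<diamondop> (c + c')" using z by (simp add: mul_simps)
  from chain2[OF a this] chain2[OF a z(1)] chain2[OF a z(2)]
  have "(z + z') \<diamondop> (c + c') - z \<diamondop> c - z' \<diamondop> c' \<in> range (mul a)"
    by (intro subspace_diff[OF subspace_range_mul])
  then show ?thesis by (simp add: mul_simps algebra_simps)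
qed

end

section \<open>Complements modulo a subspace; subspaces of dimension at most 3\<close>

context vec_sp
begin

lemma span_Un_decomp:
  assumes "subspace U" "x \<in> span (U \<union> S)" obtains u y where "u \<in> U" "y \<in> span S" "x = u + y"
proof -
  from assms(2) obtain u y where "u \<in> span U" "y \<in> span S" "x = u + y" unfolding span_Un by blast
  then show ?thesis using assms(1) that span_eq_iff by metis
qed

lemma decomp2:
  assumes "subspace U" "UNIV \<subseteq> span (U \<union> {c1, c2})"
  obtains u \<alpha> \<beta> where "u \<in> U" "x = u + \<alpha> *s c1 + \<beta> *s c2"
proof -
  have "x \<in> span (U \<union> {c1, c2})" using assms(2) by blast
  from span_Un_decomp[OF assms(1) this] obtain u y where "u \<in> U" "y \<in> span {c1, c2}" "x = u + y" .
  with that show ?thesis unfolding span2 by (metis add.assoc)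
qed

lemma decomp3:
  assumes "subspace U" "UNIV \<subseteq> span (U \<union> {c1, c2, c3})"
  obtains u \<alpha> \<beta> \<gamma> where "u \<in> U" "x = u + \<alpha> *s c1 + \<beta> *s c2 + \<gamma> *s c3"
proof -
  have "x \<in> span (U \<union> {c1, c2, c3})" using assms(2) by blast
  from span_Un_decomp[OF assms(1) this] obtain u y where "u \<in> U" "y \<in> span {c1, c2, c3}" "x = u + y" .
  with that show ?thesis unfolding span3 by (metis add.assoc)
qed

lemma exchange2:
  assumes U: "subspace U" "UNIV \<subseteq> span (U \<union> {v1, v2})" and e: "e \<notin> U"
  obtains c where "UNIV \<subseteq> span (U \<union> {e, c})"
proof -
  have sub: "UNIV \<subseteq> span T" if "U \<union> {v1, v2} \<subseteq> span T" for T
    using span_minimal[OF that subspace_span] U(2) by blast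
  show ?thesis
  proof (cases "e \<in> span (U \<union> {v2})")
    case False
    moreover have "e \<in> span (insert v1 (U \<union> {v2}))" using U(2) by (simp add: insert_commute) blast
    ultimately have "v1 \<in> span (insert e (U \<union> {v2}))" by (rule in_span_insert[rotated])
    then have "UNIV \<subseteq> span (U \<union> {e, v2})" by (intro sub) (auto simp: insert_commute intro: span_base)
    then show ?thesis by (rule that)
  next
    case True
    then have "e \<in> span (insert v2 U)" by simp
    moreover have "e \<notin> span U" using e U(1) span_eq_iff by metis
    ultimately have "v2 \<in> span (insert e U)" by (rule in_span_insert)
    then have "v2 \<in> span (U \<union> {e, v1})" by (rule span_mono[THEN subsetD, rotated]) auto
    then have "UNIV \<subseteq> span (U \<union> {e, v1})" by (intro sub) (auto intro: span_base)
    then show ?thesis by (rule that)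
  qed
qed

lemma exchange3:
  assumes U: "subspace U" "UNIV \<subseteq> span (U \<union> {v1, v2, v3})" and e: "e \<notin> U"
  obtains c d where "UNIV \<subseteq> span (U \<union> {e, c, d})"
proof (cases "e \<in> span (U \<union> {v3})")
  case False
  have eq: "U \<union> {v1, v2, v3} = (U \<union> {v3}) \<union> {v1, v2}" by auto
  have "UNIV \<subseteq> span (span (U \<union> {v3}) \<union> {v1, v2})"
    using U(2) span_mono[of "U \<union> {v1, v2, v3}" "span (U \<union> {v3}) \<union> {v1, v2}"]
    by (auto simp: eq intro: span_base)
  from exchange2[OF subspace_span this False] obtain c where c: "UNIV \<subseteq> span (span (U \<union> {v3}) \<union> {e, c})" .
  have "span (U \<union> {v3}) \<union> {e, c} \<subseteq> span (U \<union> {e, c, v3})"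
    using span_mono[of "U \<union> {v3}" "U \<union> {e, c, v3}"] by (auto intro: span_base)
  with c have "UNIV \<subseteq> span (U \<union> {e, c, v3})" using span_minimal[OF _ subspace_span] by blast
  then show ?thesis by (rule that)
next
  case True
  then have "e \<in> span (insert v3 U)" by simp
  moreover have "e \<notin> span U" using e U(1) span_eq_iff by metis
  ultimately have "v3 \<in> span (insert e U)" by (rule in_span_insert)
  then have "v3 \<in> span (U \<union> {e, v1, v2})" by (rule span_mono[THEN subsetD, rotated]) auto
  then have "U \<union> {v1, v2, v3} \<subseteq> span (U \<union> {e, v1, v2})" by (auto intro: span_base)
  from span_minimal[OF this subspace_span] U(2) have "UNIV \<subseteq> span (U \<union> {e, v1, v2})" by blast
  then show ?thesis by (rule that)
qed

definition small :: "'b set \<Rightarrow> bool" where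
  "small W \<longleftrightarrow> (\<exists>v1 v2 v3. W \<subseteq> span {v1, v2, v3})"

lemma smallI: "W \<subseteq> span {v1, v2, v3} \<Longrightarrow> small W"
  by (auto simp: small_def)

lemma small_of_dependent4:
  assumes "\<not> li [v1, v2, v3, v4]" "W \<subseteq> span {v1, v2, v3, v4}" shows "small W"
proof -
  have "length vs \<le> 3" if vs: "li vs" "set vs \<subseteq> W" for vs
  proof (rule ccontr)
    assume n: "\<not> length vs \<le> 3"
    have sub: "set vs \<subseteq> span (set [v1, v2, v3, v4])" using vs(2) assms(2) by auto
    from li_length_le[OF vs(1) sub] n have len: "length vs = 4" by simp
    have sp: "span (set [v1, v2, v3, v4]) \<subseteq> span (set vs)" using li_span_full[OF vs(1) sub] len by simp
    have "\<exists>us. length us = 3 \<and> span (set [v1, v2, v3, v4]) \<subseteq> span (set us)"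
    proof -
      from assms(1) have "v1 \<in> span {v2, v3, v4} \<or> v2 \<in> span {v3, v4} \<or> v3 \<in> span {v4} \<or> v4 = 0"
        by (simp add: li_Cons)
      then have "v1 \<in> span {v2, v3, v4} \<or> v2 \<in> span {v1, v3, v4} \<or> v3 \<in> span {v1, v2, v4} \<or> v4 \<in> span {v1, v2, v3}"
        using span_mono[of "{v3, v4}" "{v1, v3, v4}"] span_mono[of "{v4}" "{v1, v2, v4}"] span_zero by blast
      then show ?thesis
      proof (elim disjE)
        assume "v1 \<in> span {v2, v3, v4}"
        then show ?thesis by (intro exI[of _ "[v2, v3, v4]"] conjI span_minimal subspace_span) (auto intro: span_base)
      next
        assume "v2 \<in> span {v1, v3, v4}"
        then show ?thesis by (intro exI[of _ "[v1, v3, v4]"] conjI span_minimal subspace_span) (auto intro: span_base)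
      next
        assume "v3 \<in> span {v1, v2, v4}"
        then show ?thesis by (intro exI[of _ "[v1, v2, v4]"] conjI span_minimal subspace_span) (auto intro: span_base)
      next
        assume "v4 \<in> span {v1, v2, v3}"
        then show ?thesis by (intro exI[of _ "[v1, v2, v3]"] conjI span_minimal subspace_span) (auto intro: span_base)
      qed
    qed
    then obtain us where us: "length us = 3" "span (set [v1, v2, v3, v4]) \<subseteq> span (set us)" by blast
    from li_length_le[OF vs(1), of us] sub us len show False by auto
  qed
  then obtain ys where ys: "length ys = 3" "W \<subseteq> span (set ys)" by (rule ex_spanning_list)
  then obtain y1 y2 y3 where "ys = [y1, y2, y3]" by (auto simp: length_Suc_conv eval_nat_numeral)
  with ys(2) show ?thesis by (intro smallI[of _ y1 y2 y3]) simp
qed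

end

context nilp_alg
begin

text \<open>With \<beta> nonzero the relation expresses y through x y and its image. Applying the
  third, second and first power of x successively kills the images of y from the top down, and
  finally y.\<close>

lemma nilp_quadratic:
  assumes "x \<diamondop> (x \<diamondop> y) = \<alpha> *s (x \<diamondop> y) + \<beta> *s y" "y \<noteq> 0" shows "\<beta> = 0"
proof (rule ccontr)
  assume b: "\<beta> \<noteq> 0"
  have 3: "x \<diamondop> (x \<diamondop> (x \<diamondop> y)) = 0"
    using arg_cong[OF assms(1), of "\<lambda>v. x \<diamondop> (x \<diamondop> (x \<diamondop> v))"] b by (simp add: mul_simps nilp4)
  have 2: "x \<diamondop> (x \<diamondop> y) = 0"
    using arg_cong[OF assms(1), of "\<lambda>v. x \<diamondop> (x \<diamondop> v)"] b by (simp add: mul_simps nilp4 3)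
  have 1: "x \<diamondop> y = 0"
    using arg_cong[OF assms(1), of "\<lambda>v. x \<diamondop> v"] b by (simp add: mul_simps 3 2)
  from assms(1) 1 b assms(2) show False by simp
qed

end

section \<open>Subspaces multiplied into a line\<close>

context inf_nilp_alg
begin

text \<open>Here U is invariant and of codimension at most 3, so it contains W; being perfect, W
  then lies on the line itself.\<close>

lemma small_if_line_in:
  assumes U: "subspace U" "UNIV \<subseteq> span (U \<union> {v1, v2, v3})" and line: "\<And>x u. u \<in> U \<Longrightarrow> x \<diamondop> u \<in> span {e}"
    and e: "e \<in> U" and W: "perfect W"
  shows "small W"
proof -
  have "span {e} \<subseteq> U" using e U(1) by (simp add: span_minimal)
  then have "submod U" using U(1) line by (auto simp: submod_def)
  from perfect_codim3[OF this W U(2)] have "W \<subseteq> U" .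
  then have "W \<subseteq> span {e}" using perfect_subset[OF W, of "span {e}"] line by auto
  then show ?thesis by (intro smallI[of _ e e e]) simp
qed

text \<open>Each u in U has rank at most one, so \<open>rank_one_orbit\<close> makes U kill the
  vectors generated from e. With V = U + <e, c>, either h = e e stays in U + <e>, which is then an
  invariant hyperplane or everything, with products spanned by e, h, g; or e and h span V modulo U,
  U kills all products, and the products with W lie in the span of h, g, d.\<close>

lemma small_of_line2:
  assumes U: "subspace U" "UNIV \<subseteq> span (U \<union> {v1, v2})" and line: "\<And>x u. u \<in> U \<Longrightarrow> x \<diamondop> u \<in> span {e}"
    and W: "perfect W"
  shows "small W"
proof (cases "e \<in> U")
  case True
  then show ?thesis using small_if_line_in[of U v1 v2 v2 e W] U line W by simp
next
  case False
  from exchange2[OF U False] obtain c where c: "UNIV \<subseteq> span (U \<union> {e, c})" .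
  have line': "u \<diamondop> v \<in> span {e}" if "u \<in> U" for u v using line[OF that, of v] by (simp add: mul_commute)
  note orb = rank_one_orbit[OF line']
  define h where "h = e \<diamondop> e"
  have ue: "u \<diamondop> e = 0" "e \<diamondop> u = 0" if "u \<in> U" for u using orb(1)[OF that] that by (simp_all add: mul_commute[of e])
  have e0: "e \<noteq> 0" using False U(1) subspace_0 by blast
  show ?thesis
  proof (cases "h \<in> span (U \<union> {e})")
    case True
    define g where "g = e \<diamondop> c"
    \<comment> \<open>The multiple of e in h is an eigenvalue of e on h, hence zero unless h
      is.\<close>
    have hU: "h \<in> U"
    proof -
      from span_Un_decomp[OF U(1) True] obtain u y where u: "u \<in> U" "y \<in> span {e}" "h = u + y" .
      then obtain l where y: "y = l *s e" by (auto simp: span_singleton)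
      have "e \<diamondop> h = l *s h" using ue[OF u(1)] by (simp add: u(3) y mul_simps flip: h_def)
      then have "l = 0 \<or> h = 0" by (rule mul_eigen)
      then show ?thesis using u y U(1) by (auto simp: subspace_0)
    qed
    \<comment> \<open>The vector \<gamma> g + \<epsilon> h, which is e g, is an eigenvector of e
      with eigenvalue \<gamma>, because e h = 0.\<close>
    have gU: "g \<in> span (U \<union> {e})"
    proof -
      obtain u \<epsilon> \<gamma> where u: "u \<in> U" "g = u + \<epsilon> *s e + \<gamma> *s c" by (rule decomp2[OF U(1) c])
      have eg: "e \<diamondop> g = \<epsilon> *s h + \<gamma> *s g"
        unfolding h_def[symmetric] g_def[symmetric] using ue[OF u(1)] by (subst u(2)) (simp add: mul_simps h_def g_def)
      have "e \<diamondop> (\<gamma> *s g + \<epsilon> *s h) = \<gamma> *s (\<gamma> *s g + \<epsilon> *s h)"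
        using ue[OF hU] by (simp add: mul_simps eg algebra_simps)
      then have "\<gamma> = 0 \<or> \<gamma> *s g + \<epsilon> *s h = 0" by (rule mul_eigen)
      then show ?thesis
      proof
        assume "\<gamma> = 0"
        then show ?thesis using u by (auto intro!: span_add intro: span_base span_scale)
      next
        assume z: "\<gamma> *s g + \<epsilon> *s h = 0"
        show ?thesis
        proof (cases "\<gamma> = 0")
          case True
          then show ?thesis using u by (auto intro!: span_add intro: span_base span_scale)
        next
          case False
          have "g = inverse \<gamma> *s (\<gamma> *s g + \<epsilon> *s h) - (inverse \<gamma> * \<epsilon>) *s h"
            using False by (simp add: scale_right_distrib)
          then have "g = - (inverse \<gamma> * \<epsilon>) *s h" using z by simp
          then show ?thesis using hU by (metis UnCI span_base span_scale)
        qed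
      qed
    qed
    let ?U1 = "span (U \<union> {e})"
    have xe: "x \<diamondop> e \<in> span {h, g}" for x
    proof -
      obtain u \<alpha> \<gamma> where u: "u \<in> U" "x = u + \<alpha> *s e + \<gamma> *s c" by (rule decomp2[OF U(1) c])
      then have "x \<diamondop> e = \<alpha> *s h + \<gamma> *s g" using ue by (simp add: mul_simps h_def g_def mul_commute[of c])
      then show ?thesis unfolding span2 by blast
    qed
    have img: "x \<diamondop> y \<in> span {e, h, g}" if "y \<in> ?U1" for x y
      using that
    proof (rule mul_mem_span)
      fix s assume "s \<in> U \<union> {e}"
      then show "x \<diamondop> s \<in> span {e, h, g}"
        using line[of s x] xe[of x] span_mono[of "{e}" "{e, h, g}"] span_mono[of "{h, g}" "{e, h, g}"] by auto
    qed simp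
    have "{e, h, g} \<subseteq> ?U1" using hU gU by (auto intro: span_base)
    then have "span {e, h, g} \<subseteq> ?U1" by (intro span_minimal) auto
    then have sm: "submod ?U1" using img by (auto simp: submod_def)
    have "UNIV \<subseteq> span (?U1 \<union> {c, c, c})"
      using c span_mono[of "U \<union> {e, c}" "?U1 \<union> {c}"] by (auto intro: span_base)
    from perfect_codim3[OF sm W this] have "W \<subseteq> ?U1" .
    then have "W \<subseteq> span {e, h, g}" using perfect_subset[OF W, of "span {e, h, g}"] img by auto
    then show ?thesis by (rule smallI)
  next
    case False
    have "h \<in> span (insert c (U \<union> {e}))" using c by (simp add: insert_commute) blast
    then have "c \<in> span (insert h (U \<union> {e}))" using False by (rule in_span_insert)
    then have "U \<union> {e, c} \<subseteq> span (U \<union> {e, h})" by (auto simp: insert_commute intro: span_base)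
    from span_minimal[OF this subspace_span] c have V: "UNIV \<subseteq> span (U \<union> {e, h})" by blast
    define g d where "g = e \<diamondop> h" and "d = h \<diamondop> h"
    have he: "h \<diamondop> e = g" by (simp add: g_def mul_commute)
    have uh: "u \<diamondop> h = 0" "u \<diamondop> g = 0" "h \<diamondop> u = 0" and ud: "u \<diamondop> d = 0" if "u \<in> U" for u
    proof -
      show "u \<diamondop> h = 0" using orb(2)[OF that, of e] by (simp add: h_def)
      then show "h \<diamondop> u = 0" by (simp add: mul_commute)
      show "u \<diamondop> g = 0" using orb(3)[OF that, of e] by (simp add: h_def g_def)
      have 1: "u \<diamondop> (h \<diamondop> g) = 0" using orb(3)[OF that, of h] by (simp add: he)
      have 2: "u \<diamondop> (e \<diamondop> g) = 0" using orb(4)[OF that, of e] by (simp add: h_def g_def)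
      \<comment> \<open>The orbit vector of e under e + h is the one that contains d = h h; the
        remaining summands are already killed by u.\<close>
      have "(e + h) \<diamondop> ((e + h) \<diamondop> e) = g + e \<diamondop> g + d + h \<diamondop> g"
        by (simp add: mul_simps he flip: h_def) (simp add: g_def d_def algebra_simps)
      then show "u \<diamondop> d = 0"
        using orb(3)[OF that, of "e + h"] 1 2 \<open>u \<diamondop> g = 0\<close> by (simp add: mul_simps)
    qed
    let ?P = "span {e, h, g, d}"
    have "x \<diamondop> y \<in> ?P" for x y
    proof -
      obtain u \<alpha> \<beta> where u: "u \<in> U" "x = u + \<alpha> *s e + \<beta> *s h" by (rule decomp2[OF U(1) V])
      obtain u' \<alpha>' \<beta>' where u': "u' \<in> U" "y = u' + \<alpha>' *s e + \<beta>' *s h" by (rule decomp2[OF U(1) V])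
      from line[OF u'(1), of u] obtain l where l: "u \<diamondop> u' = l *s e" by (auto simp: span_singleton)
      have "x \<diamondop> y = l *s e + (\<alpha> * \<alpha>') *s h + (\<alpha> * \<beta>' + \<beta> * \<alpha>') *s g + (\<beta> * \<beta>') *s d"
        using ue[OF u(1)] ue[OF u'(1)] uh[OF u(1)] uh[OF u'(1)]
        by (simp add: u(2) u'(2) mul_simps l he algebra_simps flip: h_def g_def d_def)
      then show ?thesis unfolding span4 by blast
    qed
    then have WP: "W \<subseteq> ?P" using perfect_subset[OF W, of ?P] by auto
    have kill: "u \<diamondop> p = 0" if "u \<in> U" "p \<in> ?P" for u p
    proof -
      have "u \<diamondop> p \<in> {0}" using that(2) by (rule mul_mem_span) (use ue uh ud that in auto)
      then show ?thesis by simp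
    qed
    have "x \<diamondop> w \<in> span {h, g, d}" if w: "w \<in> W" for x w
    proof -
      obtain u \<alpha> \<beta> where u: "u \<in> U" "x = u + \<alpha> *s e + \<beta> *s h" by (rule decomp2[OF U(1) V])
      obtain u' \<alpha>' \<beta>' where u': "u' \<in> U" "w = u' + \<alpha>' *s e + \<beta>' *s h" by (rule decomp2[OF U(1) V])
      have "u \<diamondop> w = 0" using kill[OF u(1)] w WP by blast
      then have "x \<diamondop> w = \<alpha> *s (e \<diamondop> w) + \<beta> *s (h \<diamondop> w)" by (simp add: u(2) mul_simps)
      also have "e \<diamondop> w = \<alpha>' *s h + \<beta>' *s g" using ue[OF u'(1)] by (simp add: u'(2) mul_simps flip: h_def g_def)
      also have "h \<diamondop> w = \<alpha>' *s g + \<beta>' *s d" using uh[OF u'(1)] by (simp add: u'(2) mul_simps he flip: d_def)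
      finally show ?thesis by (auto intro!: span_add span_scale intro: span_base)
    qed
    then have "W \<subseteq> span {h, g, d}" using perfect_subset[OF W, of "span {h, g, d}"] by auto
    then show ?thesis by (rule smallI)
  qed
qed

lemma small_of_annihilator3:
  assumes "UNIV \<subseteq> span ({u. \<forall>x. x \<diamondop> u = 0} \<union> {v1, v2, v3})" "perfect W" shows "small W"
proof -
  have "W \<subseteq> {u. \<forall>x. x \<diamondop> u = 0}" by (rule perfect_codim3[OF submod_annihilator assms(2,1)])
  from perfect_annihilated[OF assms(2) this] show ?thesis by (intro smallI[of _ 0 0 0]) auto
qed

lemma max_rank_decomp:
  assumes "max_rank a cs" shows "UNIV \<subseteq> span ({k. a \<diamondop> k = 0} \<union> set cs)"
proof
  fix v
  interpret f: Vector_Spaces.linear scale scale "mul a"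
    by (rule Vector_Spaces.linear_iff[THEN iffD2]) (simp add: mul_simps vector_space_axioms)
  have "a \<diamondop> v \<in> span (mul a ` set cs)" using max_rank_range[OF assms] by auto
  then have "a \<diamondop> v \<in> mul a ` span (set cs)" by (simp add: f.span_image)
  then obtain w where w: "w \<in> span (set cs)" "a \<diamondop> v = a \<diamondop> w" by blast
  then have "v - w \<in> {k. a \<diamondop> k = 0}" by (simp add: mul_simps)
  then have "(v - w) + w \<in> span ({k. a \<diamondop> k = 0} \<union> set cs)"
    using w(1) by (intro span_add) (auto intro: span_base span_mono[THEN subsetD, rotated])
  then show "v \<in> span ({k. a \<diamondop> k = 0} \<union> set cs)" by simp
qed

text \<open>By \<open>chain1\<close> every product with ker a lies in the range of a, so only
  products within the complement spanned by \<open>cs\<close> are left to check.\<close>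

lemma products_mem:
  assumes "max_rank a cs" "range (mul a) \<subseteq> S" "subspace S" "\<And>c d. c \<in> set cs \<Longrightarrow> d \<in> set cs \<Longrightarrow> c \<diamondop> d \<in> S"
  shows "x \<diamondop> y \<in> S"
proof -
  let ?T = "{k. a \<diamondop> k = 0} \<union> set cs"
  have xy: "x \<in> span ?T" for x using max_rank_decomp[OF assms(1)] by auto
  have 1: "x \<diamondop> c \<in> S" if "c \<in> set cs" for x c
  proof -
    have "c \<diamondop> x \<in> S" using xy
    proof (rule mul_mem_span)
      fix s assume "s \<in> ?T"
      then show "c \<diamondop> s \<in> S" using assms(2,4) chain1[OF assms(1), of s c] that by auto
    qed (rule assms(3))
    then show ?thesis by (simp add: mul_commute)
  qed
  show ?thesis using xy
  proof (rule mul_mem_span)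
    fix s assume "s \<in> ?T"
    then show "x \<diamondop> s \<in> S" using assms(2) chain1[OF assms(1), of s x] 1 by auto
  qed (rule assms(3))
qed

lemma small_of_products:
  assumes "\<And>x y. x \<diamondop> y \<in> span {v1, v2, v3}" "perfect W" shows "small W"
  using perfect_subset[OF assms(2), of "span {v1, v2, v3}"] assms(1) by (auto intro: smallI)

end

section \<open>Characteristic 2\<close>

text \<open>In characteristic 2 the product of a quadratic map is alternating.\<close>

locale alt_nilp_alg = inf_nilp_alg scale mul
  for scale :: "'a::field \<Rightarrow> 'b::ab_group_add \<Rightarrow> 'b" (infixr "*s" 75)
    and mul :: "'b \<Rightarrow> 'b \<Rightarrow> 'b" (infixl "\<diamondop>" 80) +
  assumes char2: "(1::'a) + 1 = 0" and alt: "x \<diamondop> x = 0"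
begin

lemma neg_scalar: "- (c::'a) = c"
proof -
  have "c + c = c * (1 + 1)" by (simp add: algebra_simps)
  then show ?thesis using char2 by (simp add: add_eq_0_iff)
qed

text \<open>Compared with \<open>small_of_line2\<close> there is one more dimension, compensated by
  e e = 0. Either U + <e> is invariant, of codimension at most 2, or c1 = e c2 is a new direction, V
  = U + <e, c1, c2>, and U kills a space P that contains all products. The final distinction is
  whether d = c1 c2 lies in U + <e, c1>.\<close>

lemma small_of_line3:
  assumes U: "subspace U" "UNIV \<subseteq> span (U \<union> {v1, v2, v3})" and line: "\<And>x u. u \<in> U \<Longrightarrow> x \<diamondop> u \<in> span {e}"
    and W: "perfect W"
  shows "small W"
proof (cases "e \<in> U")
  case True
  then show ?thesis using small_if_line_in[of U v1 v2 v3 e W] U line W by simp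
next
  case False
  have line': "u \<diamondop> v \<in> span {e}" if "u \<in> U" for u v using line[OF that, of v] by (simp add: mul_commute)
  note orb = rank_one_orbit[OF line']
  have ue: "u \<diamondop> e = 0" "e \<diamondop> u = 0" if "u \<in> U" for u using orb(1)[OF that] that by (simp_all add: mul_commute[of e])
  let ?U1 = "span (U \<union> {e})"
  have eU1: "e \<diamondop> v = 0" if "v \<in> ?U1" for v
  proof -
    have "e \<diamondop> v \<in> {0}" using that by (rule mul_mem_span) (use ue alt in auto)
    then show ?thesis by simp
  qed
  obtain c d where cd: "UNIV \<subseteq> span (U \<union> {e, c, d})" by (rule exchange3[OF U False])
  show ?thesis
  proof (cases "e \<diamondop> c \<in> ?U1 \<and> e \<diamondop> d \<in> ?U1")
    case True
    let ?T = "span {e, e \<diamondop> c, e \<diamondop> d}"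
    have xe: "x \<diamondop> e \<in> ?T" for x
    proof -
      obtain u \<alpha> \<beta> \<gamma> where u: "u \<in> U" "x = u + \<alpha> *s e + \<beta> *s c + \<gamma> *s d" by (rule decomp3[OF U(1) cd])
      then have "x \<diamondop> e = \<beta> *s (e \<diamondop> c) + \<gamma> *s (e \<diamondop> d)" using ue alt by (simp add: mul_simps mul_commute[of c] mul_commute[of d])
      then show ?thesis by (auto intro!: span_add span_scale intro: span_base)
    qed
    have img: "x \<diamondop> y \<in> ?T" if "y \<in> ?U1" for x y
      using that
    proof (rule mul_mem_span)
      fix s assume "s \<in> U \<union> {e}"
      then show "x \<diamondop> s \<in> ?T"
        using line[of s x] xe[of x] span_mono[of "{e}" "{e, e \<diamondop> c, e \<diamondop> d}"] by auto
    qed simp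
    have "{e, e \<diamondop> c, e \<diamondop> d} \<subseteq> ?U1" using True by (auto intro: span_base)
    then have "?T \<subseteq> ?U1" by (intro span_minimal) auto
    then have sm: "submod ?U1" using img by (auto simp: submod_def)
    have "UNIV \<subseteq> span (?U1 \<union> {c, d, d})"
      using cd span_mono[of "U \<union> {e, c, d}" "?U1 \<union> {c, d}"] by (auto intro: span_base)
    from perfect_codim3[OF sm W this] have "W \<subseteq> ?U1" .
    then have "W \<subseteq> ?T" using perfect_subset[OF W, of ?T] img by auto
    then show ?thesis by (rule smallI)
  next
    case F: False
    obtain c0 c2 where V0: "UNIV \<subseteq> span (U \<union> {e, c0, c2})" and ec2: "e \<diamondop> c2 \<notin> ?U1"
    proof (cases "e \<diamondop> d \<in> ?U1")
      case True
      then have "e \<diamondop> c \<notin> ?U1" using F by simp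
      moreover have "UNIV \<subseteq> span (U \<union> {e, d, c})" using cd by (simp add: insert_commute)
      ultimately show ?thesis using that by blast
    qed (use cd that in blast)
    define c1 where "c1 = e \<diamondop> c2"
    have c1n: "c1 \<notin> ?U1" using ec2 by (simp add: c1_def)
    have V: "UNIV \<subseteq> span (U \<union> {e, c1, c2})"
    proof -
      \<comment> \<open>Multiplication by e kills U + <e> and sends c2 to c1, so c1 congruent to k
        c2 would be an eigenvector of e with eigenvalue k.\<close>
      have "c1 \<notin> span (insert c2 (U \<union> {e}))"
      proof
        assume "c1 \<in> span (insert c2 (U \<union> {e}))"
        then obtain k where k: "c1 - k *s c2 \<in> ?U1" by (auto simp: span_breakdown_eq)
        then have "e \<diamondop> c1 = k *s c1" using eU1[OF k] by (simp add: mul_simps flip: c1_def)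
        then have "k = 0 \<or> c1 = 0" by (rule mul_eigen)
        then show False using k c1n span_zero by auto
      qed
      moreover have "c1 \<in> span (insert c0 (insert c2 (U \<union> {e})))" using V0 by (simp add: insert_commute) blast
      ultimately have "c0 \<in> span (insert c1 (insert c2 (U \<union> {e})))" by (rule in_span_insert[rotated])
      then have "U \<union> {e, c0, c2} \<subseteq> span (U \<union> {e, c1, c2})" by (auto simp: insert_commute intro: span_base)
      from span_minimal[OF this subspace_span] V0 show ?thesis by blast
    qed
    define g d where "g = e \<diamondop> c1" and "d = c1 \<diamondop> c2"
    have com: "c2 \<diamondop> e = c1" "c1 \<diamondop> e = g" "c2 \<diamondop> c1 = d" by (simp_all add: g_def d_def c1_def mul_commute)
    have gU: "g \<in> ?U1"
    proof -
      obtain u \<kappa> \<alpha> \<beta> where u: "u \<in> U" "g = u + \<kappa> *s e + \<alpha> *s c1 + \<beta> *s c2" by (rule decomp3[OF U(1) V])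
      have eg: "e \<diamondop> (e \<diamondop> c1) = \<alpha> *s (e \<diamondop> c1) + \<beta> *s c1"
        unfolding g_def[symmetric] using ue[OF u(1)] alt by (subst u(2)) (simp add: mul_simps g_def c1_def)
      have "c1 \<noteq> 0" using c1n span_zero by auto
      from nilp_quadratic[OF eg this] have b: "\<beta> = 0" .
      then have "e \<diamondop> g = \<alpha> *s g" using eg by (simp add: g_def)
      then have "\<alpha> = 0 \<or> g = 0" by (rule mul_eigen)
      then show ?thesis
      proof
        assume "\<alpha> = 0"
        then show ?thesis using u b by (auto intro!: span_add intro: span_base span_scale)
      qed (simp add: span_zero)
    qed
    have uc1: "u \<diamondop> c1 = 0" "u \<diamondop> g = 0" "u \<diamondop> d = 0" "c1 \<diamondop> u = 0" if "u \<in> U" for u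
    proof -
      show "u \<diamondop> c1 = 0" using orb(2)[OF that, of c2] by (simp add: com)
      then show "c1 \<diamondop> u = 0" by (simp add: mul_commute)
      show "u \<diamondop> g = 0" using orb(2)[OF that, of c1] by (simp add: com)
      show "u \<diamondop> d = 0" using orb(3)[OF that, of c2] by (simp add: com)
    qed
    let ?P = "span {e, g, c1, d}"
    have kill: "u \<diamondop> p = 0" if "u \<in> U" "p \<in> ?P" for u p
    proof -
      have "u \<diamondop> p \<in> {0}" using that(2) by (rule mul_mem_span) (use ue uc1 that in auto)
      then show ?thesis by simp
    qed
    have "x \<diamondop> y \<in> ?P" for x y
    proof -
      obtain u \<alpha> \<beta> \<gamma> where u: "u \<in> U" "x = u + \<alpha> *s e + \<beta> *s c1 + \<gamma> *s c2" by (rule decomp3[OF U(1) V])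
      obtain u' \<alpha>' \<beta>' \<gamma>' where u': "u' \<in> U" "y = u' + \<alpha>' *s e + \<beta>' *s c1 + \<gamma>' *s c2" by (rule decomp3[OF U(1) V])
      have "x \<diamondop> u' \<in> ?P" using line[OF u'(1), of x] span_mono[of "{e}" "{e, g, c1, d}"] by auto
      moreover have "y \<diamondop> u \<in> ?P" using line[OF u(1), of y] span_mono[of "{e}" "{e, g, c1, d}"] by auto
      moreover have "u \<diamondop> u' \<in> ?P" using line[OF u'(1), of u] span_mono[of "{e}" "{e, g, c1, d}"] by auto
      moreover have "(x - u) \<diamondop> (y - u') \<in> ?P"
        by (simp add: u(2) u'(2) mul_simps alt com flip: c1_def g_def d_def)
          (auto intro!: span_add span_scale intro: span_base)
      ultimately have "(x - u) \<diamondop> (y - u') + x \<diamondop> u' + y \<diamondop> u - u \<diamondop> u' \<in> ?P" by (intro span_add span_diff)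
      then show ?thesis by (simp add: mul_simps mul_commute[of u] algebra_simps)
    qed
    then have WP: "W \<subseteq> ?P" using perfect_subset[OF W, of ?P] by auto
    show ?thesis
    proof (cases "d \<in> span (U \<union> {e, c1})")
      case False
      have "d \<in> span (insert c2 (U \<union> {e, c1}))" using V by (simp add: insert_commute) blast
      then have "c2 \<in> span (insert d (U \<union> {e, c1}))" using False by (rule in_span_insert)
      then have "U \<union> {e, c1, c2} \<subseteq> span (U \<union> {e, c1, d})" by (auto simp: insert_commute intro: span_base)
      from span_minimal[OF this subspace_span] V have Vd: "UNIV \<subseteq> span (U \<union> {e, c1, d})" by blast
      let ?S = "span {e \<diamondop> c1, e \<diamondop> d, c1 \<diamondop> d}"
      have "x \<diamondop> w \<in> ?S" if w: "w \<in> W" for x w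
      proof -
        obtain u \<alpha> \<beta> \<gamma> where u: "u \<in> U" "x = u + \<alpha> *s e + \<beta> *s c1 + \<gamma> *s d" by (rule decomp3[OF U(1) Vd])
        obtain u' \<alpha>' \<beta>' \<gamma>' where u': "u' \<in> U" "w = u' + \<alpha>' *s e + \<beta>' *s c1 + \<gamma>' *s d" by (rule decomp3[OF U(1) Vd])
        have "u \<diamondop> w = 0" using kill[OF u(1)] w WP by blast
        then have "x \<diamondop> w = \<alpha> *s (e \<diamondop> w) + \<beta> *s (c1 \<diamondop> w) + \<gamma> *s (d \<diamondop> w)" by (simp add: u(2) mul_simps)
        also have "\<dots> \<in> ?S"
          using ue[OF u'(1)] uc1[OF u'(1)]
          by (simp add: u'(2) mul_simps alt mul_commute[of c1 e] mul_commute[of d])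
            (auto intro!: span_add span_scale intro: span_base)
        finally show ?thesis .
      qed
      then have "W \<subseteq> ?S" using perfect_subset[OF W, of ?S] by auto
      then show ?thesis by (rule smallI)
    next
      case True
      from span_Un_decomp[OF U(1) True] obtain u2 y2 where u2: "u2 \<in> U" "y2 \<in> span {e, c1}" "d = u2 + y2" .
      then obtain \<delta> \<delta>1 where d: "d = u2 + \<delta> *s e + \<delta>1 *s c1" unfolding span2 by (auto simp: add.assoc)
      from span_Un_decomp[OF U(1) gU] obtain u1 y1 where u1: "u1 \<in> U" "y1 \<in> span {e}" "g = u1 + y1" .
      then obtain \<epsilon> where g: "g = u1 + \<epsilon> *s e" unfolding span1 by auto
      from line[OF u1(1), of c2] obtain \<phi>1 where p1: "c2 \<diamondop> u1 = \<phi>1 *s e" unfolding span1 by auto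
      from line[OF u2(1), of c2] obtain \<phi>2 where p2: "c2 \<diamondop> u2 = \<phi>2 *s e" unfolding span1 by auto
      have cg: "c2 \<diamondop> g = \<phi>1 *s e + \<epsilon> *s c1" by (subst g) (simp add: mul_simps p1 com)
      have cd': "c2 \<diamondop> d = \<phi>2 *s e + \<delta> *s c1 + \<delta>1 *s d" by (subst d) (simp add: mul_simps p2 com)
      have c1g: "c1 \<diamondop> g = \<epsilon> *s g" by (subst g) (simp add: mul_simps uc1 u1 com)
      have u12: "u \<diamondop> u1 = 0" "u \<diamondop> u2 = 0" if "u \<in> U" for u
      proof -
        have "u \<diamondop> (g - \<epsilon> *s e) = 0" using ue uc1 that by (simp add: mul_simps)
        then show "u \<diamondop> u1 = 0" by (simp add: g)
        have "u \<diamondop> (d - \<delta> *s e - \<delta>1 *s c1) = 0" using ue uc1 that by (simp add: mul_simps)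
        then show "u \<diamondop> u2 = 0" by (simp add: d)
      qed
      show ?thesis
      proof (cases "li [e, g, c1, d]")
        case False
        then show ?thesis using WP by (rule small_of_dependent4)
      next
        case li: True
        have e0: "e \<noteq> 0" and gn: "g \<notin> span {c1, d}" using li by (auto simp: li_Cons span_zero)
        have inv: "c2 \<diamondop> y \<in> span {e, c1, d}" if "y \<in> span {e, c1, d}" for y
          using that by (rule mul_mem_span) (auto simp: com cd' intro!: span_add span_scale intro: span_base)
        \<comment> \<open>The span of e, c1, d is invariant under c2, and this cube equals c2 d; so
          all coefficients of c2 d vanish.\<close>
        have "c2 \<diamondop> (c2 \<diamondop> (c2 \<diamondop> e)) = 0"
          by (rule cube_zero_of_dim3[OF inv]) (auto intro: span_base)
        then have "\<phi>2 *s e + 0 *s g + \<delta> *s c1 + \<delta>1 *s d = 0" by (simp add: com cd')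
        then have z: "\<phi>2 = 0" "\<delta> = 0" "\<delta>1 = 0" using li unfolding li4 by blast+
        then have d2: "d = u2" and c2d: "c2 \<diamondop> d = 0" and c2u2: "c2 \<diamondop> u2 = 0" using d cd' p2 by auto
        have c1d: "c1 \<diamondop> d = 0" using uc1(4)[OF u2(1)] d2 by simp
        \<comment> \<open>For this element the orbit of g + c1 satisfies a quadratic relation with
          constant coefficient \<open>\<phi>1\<close>, which \<open>nilp_quadratic\<close> then
          removes.\<close>
        let ?x = "c1 + c2"
        have xe: "?x \<diamondop> e = g + c1" by (simp add: mul_simps com)
        have xxe: "?x \<diamondop> (g + c1) = \<epsilon> *s (g + c1) + \<phi>1 *s e + d"
          by (simp add: mul_simps c1g cg alt com algebra_simps flip: d_def)
        have "?x \<diamondop> (?x \<diamondop> (g + c1)) = \<epsilon> *s (?x \<diamondop> (g + c1)) + \<phi>1 *s (g + c1)"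
          by (subst xxe) (simp only: mul_add_right mul_scale_right xe, simp add: mul_simps c1d c2d)
        moreover have "g + c1 \<noteq> 0"
          using li unfolding li4 by (metis add_0 add.right_neutral scale_one scale_zero_left zero_neq_one)
        ultimately have "\<phi>1 = 0" by (rule nilp_quadratic)
        with p1 have c2u1: "c2 \<diamondop> u1 = 0" by simp
        let ?S = "span {g, c1, d}"
        have xe: "x \<diamondop> e \<in> ?S" "x \<diamondop> c1 \<in> ?S" "x \<diamondop> u1 = 0" "x \<diamondop> u2 = 0" for x
        proof -
          obtain u \<alpha> \<beta> \<gamma> where u: "u \<in> U" "x = u + \<alpha> *s e + \<beta> *s c1 + \<gamma> *s c2" by (rule decomp3[OF U(1) V])
          show "x \<diamondop> e \<in> ?S" using ue[OF u(1)]
            by (simp add: u(2) mul_simps alt com) (auto intro!: span_add span_scale intro: span_base)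
          show "x \<diamondop> c1 \<in> ?S" using uc1[OF u(1)]
            by (simp add: u(2) mul_simps alt com flip: g_def) (auto intro!: span_add span_scale intro: span_base)
          show "x \<diamondop> u1 = 0" "x \<diamondop> u2 = 0"
            using u12[OF u(1)] ue[OF u1(1)] ue[OF u2(1)] uc1(4)[OF u1(1)] uc1(4)[OF u2(1)] c2u1 c2u2
            by (simp_all add: u(2) mul_simps)
        qed
        have "x \<diamondop> w \<in> ?S" if "w \<in> ?P" for x w
          using that
        proof (rule mul_mem_span)
          fix s assume "s \<in> {e, g, c1, d}"
          moreover have "x \<diamondop> g \<in> ?S" by (subst g) (simp add: mul_simps xe span_scale)
          moreover have "x \<diamondop> d \<in> ?S" by (simp add: d2 xe span_zero)
          ultimately show "x \<diamondop> s \<in> ?S" using xe by auto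
        qed simp
        then have "W \<subseteq> ?S" using perfect_subset[OF W, of ?S] WP by auto
        then show ?thesis by (rule smallI)
      qed
    qed
  qed
qed

text \<open>Since squares vanish, a complement of ker a with at most two basis vectors contributes
  only the product c1 c2 besides the range of a.\<close>

lemma low_rank_products:
  assumes "max_rank a cs" "length cs \<le> 2"
  shows "\<exists>y1 y2 y3. \<forall>x y. x \<diamondop> y \<in> span {y1, y2, y3}"
proof -
  consider "cs = []" | c1 where "cs = [c1]" | c1 c2 where "cs = [c1, c2]"
    using assms(2) by (cases cs; cases "tl cs"; cases "tl (tl cs)") auto
  then show ?thesis
  proof cases
    case 1
    have "x \<diamondop> y \<in> span {0, 0, 0}" for x y
      by (rule products_mem[OF assms(1)]) (use max_rank_range[OF assms(1)] 1 in auto)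
    then show ?thesis by blast
  next
    case 2
    have "x \<diamondop> y \<in> span {0, 0, a \<diamondop> c1}" for x y
      by (rule products_mem[OF assms(1)]) (use max_rank_range[OF assms(1)] 2 alt span_zero in auto)
    then show ?thesis by blast
  next
    case 3
    have "x \<diamondop> y \<in> span {c1 \<diamondop> c2, a \<diamondop> c1, a \<diamondop> c2}" for x y
    proof (rule products_mem[OF assms(1)])
      show "range (mul a) \<subseteq> span {c1 \<diamondop> c2, a \<diamondop> c1, a \<diamondop> c2}"
        using max_rank_range[OF assms(1)] 3 span_mono[of "{a \<diamondop> c1, a \<diamondop> c2}" "{c1 \<diamondop> c2, a \<diamondop> c1, a \<diamondop> c2}"] by auto
      show "c \<diamondop> d \<in> span {c1 \<diamondop> c2, a \<diamondop> c1, a \<diamondop> c2}" if "c \<in> set cs" "d \<in> set cs" for c d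
        using that 3 by (auto simp: alt span_zero mul_commute[of c2 c1] intro: span_base)
    qed simp
    then show ?thesis by blast
  qed
qed

end

context vec_sp
begin

lemma li_iff_independent: "li vs \<longleftrightarrow> independent (set vs) \<and> distinct vs"
proof
  show "independent (set vs) \<and> distinct vs \<Longrightarrow> li vs"
    by (induction vs) (auto simp: li_Cons independent_insert)
qed (rule li_independent)

end

context inf_nilp_alg
begin

lemma max_rank3_range:
  assumes "max_rank a [c1, c2, c3]" "y \<in> range (mul a)"
  obtains \<alpha> \<beta> \<gamma> where "y = a \<diamondop> (\<alpha> *s c1 + \<beta> *s c2 + \<gamma> *s c3)"
proof -
  have "y \<in> span {a \<diamondop> c1, a \<diamondop> c2, a \<diamondop> c3}" using assms max_rank_range[OF assms(1)] by simp
  then obtain \<alpha> \<beta> \<gamma> where "y = \<alpha> *s (a \<diamondop> c1) + \<beta> *s (a \<diamondop> c2) + \<gamma> *s (a \<diamondop> c3)" unfolding span3 by blast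
  then show ?thesis by (intro that[of \<alpha> \<beta> \<gamma>]) (simp add: mul_simps)
qed

lemma small_zero: "W \<subseteq> {0} \<Longrightarrow> small W"
  by (intro smallI[of _ 0 0 0]) auto

end

context alt_nilp_alg
begin

text \<open>In the quotient by the annihilator a multiplication T by a of rank 3 is impossible. If a
  = T v, then v fixes a, an eigenvalue 1. If a is outside the range, a and the range fill the
  quotient, and T a = 0 makes T map its range onto itself, against nilpotency. So the rank there is
  at most 2 and the products span at most three dimensions.\<close>

lemma small_of_annihilator4:
  assumes V: "UNIV \<subseteq> span ({u. \<forall>x. x \<diamondop> u = 0} \<union> {v1, v2, v3, v4})" and W: "perfect W"
  shows "small W"
proof -
  let ?A = "{u. \<forall>x. x \<diamondop> u = 0}"
  interpret vp: vector_space_pair scale scale by unfold_locales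
  obtain \<pi> where \<pi>: "Vector_Spaces.linear scale scale \<pi>" "\<And>x. \<pi> x = 0 \<longleftrightarrow> x \<in> ?A" "\<And>x. x - \<pi> x \<in> ?A"
    and q: "inf_nilp_alg scale (\<lambda>x y. \<pi> (x \<diamondop> y))"
    and r: "\<And>x y. \<pi> (x \<diamondop> \<pi> y) = \<pi> (x \<diamondop> y)" and l: "\<And>x y. \<pi> (\<pi> x \<diamondop> y) = \<pi> (x \<diamondop> y)"
    by (rule quotient[OF submod_annihilator]) blast
  note lin = vp.linear_add[OF \<pi>(1)] vp.linear_scale[OF \<pi>(1)] vp.linear_diff[OF \<pi>(1)] vp.linear_0[OF \<pi>(1)]
  interpret q: alt_nilp_alg scale "\<lambda>x y. \<pi> (x \<diamondop> y)"
    by (intro alt_nilp_alg.intro q alt_nilp_alg_axioms.intro char2) (simp add: alt lin)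
  have dim4: "\<pi> x \<in> span (set [\<pi> v1, \<pi> v2, \<pi> v3, \<pi> v4])" for x
  proof -
    have "\<pi> x \<in> \<pi> ` span (?A \<union> {v1, v2, v3, v4})" using V by blast
    also have "\<dots> = span (\<pi> ` (?A \<union> {v1, v2, v3, v4}))" by (rule vp.linear_span_image[OF \<pi>(1), symmetric])
    also have "\<dots> \<subseteq> span (set [\<pi> v1, \<pi> v2, \<pi> v3, \<pi> v4])"
      by (rule span_minimal) (auto simp: \<pi>(2)[THEN iffD2] span_base span_zero)
    finally show ?thesis .
  qed
  have "\<exists>y1 y2 y3. \<forall>x y. \<pi> (x \<diamondop> y) \<in> span {y1, y2, y3}"
  proof -
    obtain a cs where a: "q.max_rank a cs" using q.ex_max_rank by blast
    from q.max_rank_length[OF a] consider "length cs \<le> 2" | "length cs = 3" by linarith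
    then show ?thesis
    proof cases
      case 1
      show ?thesis by (rule q.low_rank_products[OF a 1])
    next
      case 2
      then obtain c1 c2 c3 where cs: "cs = [c1, c2, c3]" by (auto simp: length_Suc_conv eval_nat_numeral)
      let ?T = "\<lambda>x. \<pi> (a \<diamondop> x)"
      have liT: "li [?T c1, ?T c2, ?T c3]" and RT: "range ?T = span {?T c1, ?T c2, ?T c3}"
        using a q.max_rank_range[OF a] by (simp_all add: q.max_rank_def cs)
      then have T1: "?T c1 \<noteq> 0" by (auto simp: li_Cons span_zero)
      have False
      proof (cases "\<pi> a \<in> range ?T")
        case True
        then obtain v where v: "\<pi> a = ?T v" by blast
        have "\<pi> (v \<diamondop> \<pi> a) = \<pi> (a \<diamondop> v)" by (simp only: r mul_commute)
        also have "\<dots> = 1 *s \<pi> a" using v by simp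
        finally have "\<pi> (v \<diamondop> \<pi> a) = 1 *s \<pi> a" .
        from q.mul_eigen[OF this] have "\<pi> a = 0" by simp
        then show False using T1 l[of a c1] by (simp add: lin)
      next
        case False
        then have "li [\<pi> a, ?T c1, ?T c2, ?T c3]" using liT RT by (simp add: li_Cons)
        from li_span_full[OF this, of "[\<pi> v1, \<pi> v2, \<pi> v3, \<pi> v4]"] dim4
        have full: "\<pi> x \<in> span {\<pi> a, ?T c1, ?T c2, ?T c3}" for x by auto
        have onto: "\<exists>z. ?T y = ?T (?T z)" for y
        proof -
          from full[of y] obtain k where "\<pi> y - k *s \<pi> a \<in> span {?T c1, ?T c2, ?T c3}"
            by (auto simp: span_breakdown_eq)
          then obtain z where z: "\<pi> y - k *s \<pi> a = ?T z" using RT by auto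
          have "?T (\<pi> y - k *s \<pi> a) = ?T y" by (simp add: mul_simps lin r alt)
          then have "?T y = ?T (?T z)" unfolding z by (rule sym)
          then show ?thesis by blast
        qed
        obtain z1 z2 z3 where "?T c1 = ?T (?T z1)" "?T z1 = ?T (?T z2)" "?T z2 = ?T (?T z3)"
          using onto by metis
        then have "?T c1 = ?T (?T (?T (?T z3)))" by simp
        then show False using T1 q.nilp4[of a z3] by simp
      qed
      then show ?thesis ..
    qed
  qed
  then obtain y1 y2 y3 where y: "\<And>x y. \<pi> (x \<diamondop> y) \<in> span {y1, y2, y3}" by blast
  have "x \<diamondop> w \<in> span (?A \<union> {y1, y2, y3})" for x w
  proof -
    have "(x \<diamondop> w - \<pi> (x \<diamondop> w)) + \<pi> (x \<diamondop> w) \<in> span (?A \<union> {y1, y2, y3})"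
      using \<pi>(3)[of "x \<diamondop> w"] y[of x w]
      by (intro span_add) (auto intro: span_base span_mono[THEN subsetD, rotated])
    then show ?thesis by simp
  qed
  then have "W \<subseteq> span (?A \<union> {y1, y2, y3})" by (intro perfect_subset[OF W]) auto
  from perfect_subset_submod[OF submod_annihilator W this V] have "W \<subseteq> ?A" .
  then show ?thesis by (intro small_zero perfect_annihilated[OF W])
qed

text \<open>For k in ker a, \<open>chain2\<close> and its polarization show that k acts on c1, c2,
  c3 as one common multiple p1 of a, and that k kills ker a. Hence k - p1 a annihilates V, and the
  annihilator has codimension at most 4.\<close>

lemma small_of_two_products:
  assumes a: "max_rank a [c1, c2, c3]"
    and ind: "\<And>\<alpha> \<beta>. \<alpha> *s (c1 \<diamondop> c2) + \<beta> *s (c1 \<diamondop> c3) \<in> range (mul a) \<Longrightarrow> \<alpha> = 0 \<and> \<beta> = 0"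
    and W: "perfect W"
  shows "small W"
proof -
  let ?R = "range (mul a)" and ?A = "{u. \<forall>x. x \<diamondop> u = 0}"
  note R = subspace_add[OF subspace_range_mul[of a]] subspace_diff[OF subspace_range_mul[of a]]
    subspace_scale[OF subspace_range_mul[of a]] subspace_0[OF subspace_range_mul[of a]]
  have n1: "\<alpha> = 0" if "\<alpha> *s (c1 \<diamondop> c2) \<in> ?R" for \<alpha> using ind[of \<alpha> 0] that by simp
  have n2: "\<alpha> = 0" if "\<alpha> *s (c1 \<diamondop> c3) \<in> ?R" for \<alpha> using ind[of 0 \<alpha>] that by simp
  have key: "\<exists>l. k - l *s a \<in> ?A" if k: "a \<diamondop> k = 0" for k
  proof -
    note ch1 = chain1[OF a k] and ch2 = chain2[OF a k] and chp = chain2_polar[OF a k]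
    obtain p1 p2 p3 where p: "c1 \<diamondop> k = a \<diamondop> (p1 *s c1 + p2 *s c2 + p3 *s c3)" by (rule max_rank3_range[OF a ch1])
    obtain q1 q2 q3 where q: "c2 \<diamondop> k = a \<diamondop> (q1 *s c1 + q2 *s c2 + q3 *s c3)" by (rule max_rank3_range[OF a ch1])
    obtain r1 r2 r3 where r: "c3 \<diamondop> k = a \<diamondop> (r1 *s c1 + r2 *s c2 + r3 *s c3)" by (rule max_rank3_range[OF a ch1])
    have "p2 = 0 \<and> p3 = 0" using ch2[OF p] by (intro ind) (simp add: mul_simps alt)
    then have p: "c1 \<diamondop> k = a \<diamondop> (p1 *s c1)" using p by simp
    have "q2 + p1 = 0 \<and> q3 = 0"
      using chp[OF p q] by (intro ind) (simp add: mul_simps alt mul_commute[of c2 c1] algebra_simps)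
    then have q: "c2 \<diamondop> k = a \<diamondop> (q1 *s c1 + p1 *s c2)" using q by (metis add.right_neutral eq_neg_iff_add_eq_0 neg_scalar scale_zero_left)
    have "r2 = 0 \<and> r3 + p1 = 0"
      using chp[OF p r] by (intro ind) (simp add: mul_simps alt mul_commute[of c3 c1] algebra_simps)
    then have r: "c3 \<diamondop> k = a \<diamondop> (r1 *s c1 + p1 *s c3)" using r by (metis add.right_neutral eq_neg_iff_add_eq_0 neg_scalar scale_zero_left)
    have "q1 = 0" using ch2[OF q] by (intro n1) (simp add: mul_simps alt mul_commute[of c2 c1])
    then have q: "c2 \<diamondop> k = a \<diamondop> (p1 *s c2)" using q by simp
    have "r1 = 0" using ch2[OF r] by (intro n2) (simp add: mul_simps alt mul_commute[of c3 c1])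
    then have r: "c3 \<diamondop> k = a \<diamondop> (p1 *s c3)" using r by simp
    have kk: "k' \<diamondop> k = 0" if k': "a \<diamondop> k' = 0" for k'
    proof -
      obtain s1 s2 s3 where s: "k' \<diamondop> k = a \<diamondop> (s1 *s c1 + s2 *s c2 + s3 *s c3)" by (rule max_rank3_range[OF a ch1])
      have m: "k' \<diamondop> c \<in> ?R" for c using chain1[OF a k', of c] by (simp add: mul_commute)
      have m': "c \<diamondop> (s1 *s c1 + s2 *s c2 + s3 *s c3) \<in> ?R" if "c \<diamondop> k = a \<diamondop> (p1 *s c)" for c
      proof -
        have "c \<diamondop> (s1 *s c1 + s2 *s c2 + s3 *s c3) + k' \<diamondop> (p1 *s c) - k' \<diamondop> (p1 *s c) \<in> ?R"
          by (rule R(2)[OF chp[OF that s] m])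
        then show ?thesis by simp
      qed
      have "s2 = 0 \<and> s3 = 0" using m'[OF p] by (intro ind) (simp add: mul_simps alt)
      then show ?thesis using m'[OF q] s n1[of s1] by (simp add: mul_simps alt mul_commute[of c2 c1])
    qed
    have "x \<diamondop> (k - p1 *s a) = 0" for x
    proof -
      have "(k - p1 *s a) \<diamondop> x \<in> {0}"
      proof (rule mul_mem_span)
        show "x \<in> span ({k. a \<diamondop> k = 0} \<union> set [c1, c2, c3])" using max_rank_decomp[OF a] by auto
        fix s assume "s \<in> {k. a \<diamondop> k = 0} \<union> set [c1, c2, c3]"
        then have "s \<diamondop> k = p1 *s (a \<diamondop> s)" using p q r kk by (auto simp: mul_simps)
        then show "(k - p1 *s a) \<diamondop> s \<in> {0}" by (simp add: mul_simps mul_commute[of k])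
      qed simp
      then show ?thesis by (simp add: mul_commute[of x])
    qed
    then show ?thesis by blast
  qed
  have "{k. a \<diamondop> k = 0} \<union> set [c1, c2, c3] \<subseteq> span (?A \<union> {a, c1, c2, c3})"
  proof
    fix x assume "x \<in> {k. a \<diamondop> k = 0} \<union> set [c1, c2, c3]"
    then consider "a \<diamondop> x = 0" | "x \<in> {c1, c2, c3}" by auto
    then show "x \<in> span (?A \<union> {a, c1, c2, c3})"
    proof cases
      case 1
      from key[OF this] obtain l where "x - l *s a \<in> ?A" by blast
      then have "(x - l *s a) + l *s a \<in> span (?A \<union> {a, c1, c2, c3})"
        by (intro span_add span_scale) (auto intro: span_base)
      then show ?thesis by simp
    qed (auto intro: span_base)
  qed
  from span_minimal[OF this subspace_span] max_rank_decomp[OF a]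
  have "UNIV \<subseteq> span (?A \<union> {a, c1, c2, c3})" by blast
  from small_of_annihilator4[OF this W] show ?thesis .
qed

text \<open>Now c3 is in the radical of the form modulo the range, so k - p1 a is only known to
  multiply V into the line of e = a c3. If some such vector does not annihilate V,
  \<open>rank_violation\<close> leaves every multiplication rank at most 2 modulo e; this makes a
  modification of c3 multiply into the same line, and codimension 3 remains for
  \<open>small_of_line3\<close>.\<close>

lemma small_of_one_product:
  assumes a: "max_rank a [c1, c2, c3]" and w: "c1 \<diamondop> c2 \<notin> range (mul a)"
    and c13: "c1 \<diamondop> c3 \<in> range (mul a)" and c23: "c2 \<diamondop> c3 \<in> range (mul a)"
    and W: "perfect W"
  shows "small W"
proof -
  let ?R = "range (mul a)" and ?A = "{u. \<forall>x. x \<diamondop> u = 0}"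
  define e where "e = a \<diamondop> c3"
  note R = subspace_add[OF subspace_range_mul[of a]] subspace_diff[OF subspace_range_mul[of a]]
    subspace_scale[OF subspace_range_mul[of a]] subspace_0[OF subspace_range_mul[of a]]
  have n1: "\<alpha> = 0" if "\<alpha> *s (c1 \<diamondop> c2) \<in> ?R" for \<alpha>
  proof (rule ccontr)
    assume "\<alpha> \<noteq> 0"
    then have "c1 \<diamondop> c2 = inverse \<alpha> *s (\<alpha> *s (c1 \<diamondop> c2))" by simp
    then show False using R(3)[OF that, of "inverse \<alpha>"] w by simp
  qed
  have n: "\<alpha> = 0" if "\<alpha> *s (c1 \<diamondop> c2) + y \<in> ?R" "y \<in> ?R" for \<alpha> y
    using n1 R(2)[OF that] by simp
  define U where "U = {u. a \<diamondop> u = 0 \<and> (\<forall>x. x \<diamondop> u \<in> span {e})}"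
  have sU: "subspace U"
    unfolding U_def subspace_def by (auto simp: mul_simps span_zero span_add span_scale)
  have line: "x \<diamondop> u \<in> span {e}" if "u \<in> U" for x u using that by (simp add: U_def)
  have key: "\<exists>l. k - l *s a \<in> U" if k: "a \<diamondop> k = 0" for k
  proof -
    note ch1 = chain1[OF a k] and ch2 = chain2[OF a k] and chp = chain2_polar[OF a k]
    obtain p1 p2 p3 where p: "c1 \<diamondop> k = a \<diamondop> (p1 *s c1 + p2 *s c2 + p3 *s c3)" by (rule max_rank3_range[OF a ch1])
    obtain q1 q2 q3 where q: "c2 \<diamondop> k = a \<diamondop> (q1 *s c1 + q2 *s c2 + q3 *s c3)" by (rule max_rank3_range[OF a ch1])
    obtain r1 r2 r3 where r: "c3 \<diamondop> k = a \<diamondop> (r1 *s c1 + r2 *s c2 + r3 *s c3)" by (rule max_rank3_range[OF a ch1])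
    have "p2 = 0" by (rule n[of _ "p3 *s (c1 \<diamondop> c3)"]) (use ch2[OF p] c13 R(3) in \<open>simp_all add: mul_simps alt\<close>)
    then have p: "c1 \<diamondop> k = a \<diamondop> (p1 *s c1 + p3 *s c3)" using p by simp
    have "q1 = 0" by (rule n[of _ "q3 *s (c2 \<diamondop> c3)"])
        (use ch2[OF q] c23 R(3) in \<open>simp_all add: mul_simps alt mul_commute[of c2 c1]\<close>)
    then have q: "c2 \<diamondop> k = a \<diamondop> (q2 *s c2 + q3 *s c3)" using q by simp
    have "q2 + p1 = 0" by (rule n[of _ "q3 *s (c1 \<diamondop> c3) + p3 *s (c2 \<diamondop> c3)"])
        (use chp[OF p q] c13 c23 R in \<open>simp_all add: mul_simps alt mul_commute[of c2 c1] algebra_simps\<close>)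
    then have "q2 = p1" by (metis eq_neg_iff_add_eq_0 neg_scalar)
    then have q: "c2 \<diamondop> k = a \<diamondop> (p1 *s c2 + q3 *s c3)" using q by simp
    have "r2 = 0" by (rule n[of _ "r3 *s (c1 \<diamondop> c3) + p1 *s (c1 \<diamondop> c3)"])
        (use chp[OF p r] c13 c23 R in \<open>simp_all add: mul_simps alt mul_commute[of c3 c1] algebra_simps\<close>)
    moreover have "r1 = 0" by (rule n[of _ "r3 *s (c2 \<diamondop> c3) + p1 *s (c2 \<diamondop> c3)"])
        (use chp[OF q r] c13 c23 R in \<open>simp_all add: mul_simps alt mul_commute[of c3 c2] mul_commute[of c2 c1] algebra_simps\<close>)
    ultimately have r: "c3 \<diamondop> k = a \<diamondop> (r3 *s c3)" using r by simp
    have kk: "k' \<diamondop> k \<in> span {e}" if k': "a \<diamondop> k' = 0" for k'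
    proof -
      obtain s1 s2 s3 where s: "k' \<diamondop> k = a \<diamondop> (s1 *s c1 + s2 *s c2 + s3 *s c3)" by (rule max_rank3_range[OF a ch1])
      have m: "k' \<diamondop> c \<in> ?R" for c using chain1[OF a k', of c] by (simp add: mul_commute)
      have m': "c \<diamondop> (s1 *s c1 + s2 *s c2 + s3 *s c3) \<in> ?R" if "c \<diamondop> k = a \<diamondop> v" for c v
      proof -
        have "c \<diamondop> (s1 *s c1 + s2 *s c2 + s3 *s c3) + k' \<diamondop> v - k' \<diamondop> v \<in> ?R"
          by (rule R(2)[OF chp[OF that s] m])
        then show ?thesis by simp
      qed
      have "s2 = 0" by (rule n[of _ "s3 *s (c1 \<diamondop> c3)"]) (use m'[OF p] c13 R(3) in \<open>simp_all add: mul_simps alt\<close>)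
      moreover have "s1 = 0" by (rule n[of _ "s3 *s (c2 \<diamondop> c3)"])
          (use m'[OF q] c23 R(3) in \<open>simp_all add: mul_simps alt mul_commute[of c2 c1]\<close>)
      ultimately show ?thesis using s by (simp add: mul_simps span_base span_scale flip: e_def)
    qed
    have "x \<diamondop> (k - p1 *s a) \<in> span {e}" for x
    proof -
      have "(k - p1 *s a) \<diamondop> x \<in> span {e}"
      proof (rule mul_mem_span)
        show "x \<in> span ({k. a \<diamondop> k = 0} \<union> set [c1, c2, c3])" using max_rank_decomp[OF a] by auto
        fix s assume "s \<in> {k. a \<diamondop> k = 0} \<union> set [c1, c2, c3]"
        then consider "a \<diamondop> s = 0" | "s = c1" | "s = c2" | "s = c3" by auto
        then show "(k - p1 *s a) \<diamondop> s \<in> span {e}"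
          by cases (use p q r kk in \<open>auto simp: mul_simps mul_commute[of k] span_base span_scale span_diff simp flip: e_def\<close>)
      qed simp
      then show ?thesis by (simp add: mul_commute[of x])
    qed
    moreover have "a \<diamondop> (k - p1 *s a) = 0" using k alt by (simp add: mul_simps)
    ultimately show ?thesis unfolding U_def by blast
  qed
  have "{k. a \<diamondop> k = 0} \<union> set [c1, c2, c3] \<subseteq> span (U \<union> {a, c1, c2, c3})"
  proof
    fix x assume "x \<in> {k. a \<diamondop> k = 0} \<union> set [c1, c2, c3]"
    then consider "a \<diamondop> x = 0" | "x \<in> {c1, c2, c3}" by auto
    then show "x \<in> span (U \<union> {a, c1, c2, c3})"
    proof cases
      case 1
      from key[OF this] obtain l where "x - l *s a \<in> U" by blast
      then have "(x - l *s a) + l *s a \<in> span (U \<union> {a, c1, c2, c3})"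
        by (intro span_add span_scale) (auto intro: span_base)
      then show ?thesis by simp
    qed (auto intro: span_base)
  qed
  from span_minimal[OF this subspace_span] max_rank_decomp[OF a]
  have V: "UNIV \<subseteq> span (U \<union> {a, c1, c2, c3})" by blast
  show ?thesis
  proof (cases "U \<subseteq> ?A")
    case True
    then have "span (U \<union> {a, c1, c2, c3}) \<subseteq> span (?A \<union> {a, c1, c2, c3})" by (intro span_mono) auto
    with V have "UNIV \<subseteq> span (?A \<union> {a, c1, c2, c3})" by blast
    from small_of_annihilator4[OF this W] show ?thesis .
  next
    case False
    then obtain u0 x0 where u0: "u0 \<in> U" "x0 \<diamondop> u0 \<noteq> 0" by blast
    from line[OF u0(1), of x0] u0(2) obtain m where m: "x0 \<diamondop> u0 = m *s e" "m \<noteq> 0" by (auto simp: span_singleton)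
    have nli: "\<not> li [e, z \<diamondop> y1, z \<diamondop> y2, z \<diamondop> y3]" for z y1 y2 y3
    proof
      assume L: "li [e, z \<diamondop> y1, z \<diamondop> y2, z \<diamondop> y3]"
      from line[OF u0(1), of z] obtain l where "z \<diamondop> u0 = l *s e" by (auto simp: span_singleton)
      from rank_violation[OF L this m] show False .
    qed
    define i1 i2 w where "i1 = a \<diamondop> c1" and "i2 = a \<diamondop> c2" and "w = c1 \<diamondop> c2"
    have Re: "?R = span {i1, i2, e}" using max_rank_range[OF a] by (simp add: i1_def i2_def e_def)
    have "li [w, i1, i2, e]"
      using a w unfolding max_rank_def by (simp add: li_Cons Re[unfolded i1_def i2_def e_def] i1_def i2_def e_def w_def)
    then have L: "\<And>p q r s. p *s w + q *s i1 + r *s i2 + s *s e = 0 \<Longrightarrow> p = 0 \<and> q = 0 \<and> r = 0 \<and> s = 0"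
      unfolding li4 by blast
    from c13 obtain s1 s2 s3 where s: "c1 \<diamondop> c3 = s1 *s i1 + s2 *s i2 + s3 *s e" unfolding Re span3 by blast
    from c23 obtain t1 t2 t3 where t: "c2 \<diamondop> c3 = t1 *s i1 + t2 *s i2 + t3 *s e" unfolding Re span3 by blast
    have com: "c1 \<diamondop> a = i1" "c2 \<diamondop> a = i2" "c2 \<diamondop> c1 = w" by (simp_all add: i1_def i2_def w_def mul_commute)
    have "s2 = 0"
    proof (rule ccontr)
      assume s2: "s2 \<noteq> 0"
      have "li [e, c1 \<diamondop> a, c1 \<diamondop> c2, c1 \<diamondop> c3]"
        unfolding li4
      proof (intro allI impI)
        fix \<alpha> \<beta> \<gamma> \<delta> assume "\<alpha> *s e + \<beta> *s c1 \<diamondop> a + \<gamma> *s c1 \<diamondop> c2 + \<delta> *s c1 \<diamondop> c3 = 0"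
        then have "\<gamma> *s w + (\<beta> + \<delta> * s1) *s i1 + (\<delta> * s2) *s i2 + (\<alpha> + \<delta> * s3) *s e = 0"
          by (simp add: com s algebra_simps flip: w_def)
        from L[OF this] s2 show "\<alpha> = 0 \<and> \<beta> = 0 \<and> \<gamma> = 0 \<and> \<delta> = 0" by auto
      qed
      with nli show False by blast
    qed
    have "t1 = 0"
    proof (rule ccontr)
      assume t1: "t1 \<noteq> 0"
      have "li [e, c2 \<diamondop> a, c2 \<diamondop> c1, c2 \<diamondop> c3]"
        unfolding li4
      proof (intro allI impI)
        fix \<alpha> \<beta> \<gamma> \<delta> assume "\<alpha> *s e + \<beta> *s c2 \<diamondop> a + \<gamma> *s c2 \<diamondop> c1 + \<delta> *s c2 \<diamondop> c3 = 0"
        then have "\<gamma> *s w + (\<delta> * t1) *s i1 + (\<beta> + \<delta> * t2) *s i2 + (\<alpha> + \<delta> * t3) *s e = 0"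
          by (simp add: com t algebra_simps)
        from L[OF this] t1 show "\<alpha> = 0 \<and> \<beta> = 0 \<and> \<gamma> = 0 \<and> \<delta> = 0" by auto
      qed
      with nli show False by blast
    qed
    have "s1 = t2"
    proof (rule ccontr)
      assume st: "s1 \<noteq> t2"
      let ?z = "c1 + c2"
      have "li [e, ?z \<diamondop> a, ?z \<diamondop> c1, ?z \<diamondop> c3]"
        unfolding li4
      proof (intro allI impI)
        fix \<alpha> \<beta> \<gamma> \<delta> assume "\<alpha> *s e + \<beta> *s ?z \<diamondop> a + \<gamma> *s ?z \<diamondop> c1 + \<delta> *s ?z \<diamondop> c3 = 0"
        then have "\<gamma> *s w + (\<beta> + \<delta> * s1) *s i1 + (\<beta> + \<delta> * t2) *s i2 + (\<alpha> + \<delta> * s3 + \<delta> * t3) *s e = 0"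
          using \<open>s2 = 0\<close> \<open>t1 = 0\<close> by (simp add: com s t mul_simps alt algebra_simps)
        from L[OF this] have z: "\<gamma> = 0" "\<beta> + \<delta> * s1 = 0" "\<beta> + \<delta> * t2 = 0" "\<alpha> + \<delta> * s3 + \<delta> * t3 = 0" by auto
        from z(2) z(3) have "(\<beta> + \<delta> * s1) - (\<beta> + \<delta> * t2) = 0" by simp
        then have "\<delta> * (s1 - t2) = 0" by (simp add: right_diff_distrib)
        then have "\<delta> = 0" using st by simp
        with z show "\<alpha> = 0 \<and> \<beta> = 0 \<and> \<gamma> = 0 \<and> \<delta> = 0" by simp
      qed
      with nli show False by blast
    qed
    \<comment> \<open>The three relations just proved say that modulo e the actions of c3 and s1 a
      agree on c1 and c2.\<close>
    define c where "c = c3 - s1 *s a"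
    have cc: "a \<diamondop> c = e" "c1 \<diamondop> c = s3 *s e" "c2 \<diamondop> c = t3 *s e" "c3 \<diamondop> c = - (s1 *s e)"
      using \<open>s2 = 0\<close> \<open>t1 = 0\<close> \<open>s1 = t2\<close>
      by (simp_all add: c_def mul_simps alt e_def com s[unfolded e_def] t[unfolded e_def] mul_commute[of c3 a])
    have xc: "x \<diamondop> c \<in> span {e}" for x
    proof -
      have "c \<diamondop> x \<in> span {e}"
      proof (rule mul_mem_span)
        show "x \<in> span (U \<union> {a, c1, c2, c3})" using V by blast
        fix s assume "s \<in> U \<union> {a, c1, c2, c3}"
        then show "c \<diamondop> s \<in> span {e}"
          using line[of s c] cc by (auto simp: mul_commute[of c] span_base span_scale span_neg)
      qed simp
      then show ?thesis by (simp add: mul_commute)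
    qed
    let ?U = "span (U \<union> {c})"
    have line': "x \<diamondop> u \<in> span {e}" if "u \<in> ?U" for x u
      using that by (rule mul_mem_span) (use line xc in auto)
    have "c3 \<in> span (?U \<union> {a, c1, c2})"
    proof -
      have "c + s1 *s a \<in> span (?U \<union> {a, c1, c2})"
        by (intro span_add span_scale) (auto intro: span_base)
      then show ?thesis by (simp add: c_def)
    qed
    then have "U \<union> {a, c1, c2, c3} \<subseteq> span (?U \<union> {a, c1, c2})" by (auto intro: span_base)
    from span_minimal[OF this subspace_span] V have "UNIV \<subseteq> span (?U \<union> {a, c1, c2})" by blast
    from small_of_line3[OF subspace_span this line' W] show ?thesis .
  qed
qed

text \<open>If c1 c3 and c2 c3 are multiples \<alpha> and \<beta> of c1 c2 modulo the range,
  replacing c3 by c3 - \<alpha> c2 - \<beta> c1 puts both into the range. Otherwise two of the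
  products are independent there.\<close>

lemma small_of_rank3:
  assumes a: "max_rank a [c1, c2, c3]" and w: "c1 \<diamondop> c2 \<notin> range (mul a)" and W: "perfect W"
  shows "small W"
proof -
  let ?R = "range (mul a)"
  note sp = span_scale_iff
  have liR: "li [a \<diamondop> c1, a \<diamondop> c2, a \<diamondop> c3]" using a by (simp add: max_rank_def)
  have w1: "\<alpha> = 0" if "\<alpha> *s (c1 \<diamondop> c2) \<in> ?R" for \<alpha>
    using w that max_rank_range[OF a] span_scale_iff[of \<alpha> "c1 \<diamondop> c2"] by metis
  have two: "\<alpha> = 0 \<and> \<beta> = 0" if "v \<notin> span (insert (c1 \<diamondop> c2) ?R)" "\<alpha> *s (c1 \<diamondop> c2) + \<beta> *s v \<in> ?R" for \<alpha> \<beta> v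
  proof -
    have "\<beta> = 0"
    proof (rule ccontr)
      assume b: "\<beta> \<noteq> 0"
      have "(\<alpha> *s (c1 \<diamondop> c2) + \<beta> *s v) - \<alpha> *s (c1 \<diamondop> c2) \<in> span (insert (c1 \<diamondop> c2) ?R)"
        using that(2) by (intro span_diff span_scale) (auto intro: span_base)
      then have "\<beta> *s v \<in> span (insert (c1 \<diamondop> c2) ?R)" by simp
      then show False using that(1) b by (simp add: span_scale_iff)
    qed
    with that(2) w1 show ?thesis by auto
  qed
  consider "c1 \<diamondop> c3 \<notin> span (insert (c1 \<diamondop> c2) ?R)" | "c2 \<diamondop> c3 \<notin> span (insert (c1 \<diamondop> c2) ?R)"
    | "c1 \<diamondop> c3 \<in> span (insert (c1 \<diamondop> c2) ?R)" "c2 \<diamondop> c3 \<in> span (insert (c1 \<diamondop> c2) ?R)" by blast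
  then show ?thesis
  proof cases
    case 1
    show ?thesis by (rule small_of_two_products[OF a two[OF 1] W])
  next
    case 2
    have "max_rank a [c2, c1, c3]"
      by (rule max_rank_transfer[OF a]) (use liR in \<open>auto simp: li_iff_independent insert_commute\<close>)
    then show ?thesis
      by (rule small_of_two_products[OF _ two[OF 2] W]) (simp add: mul_commute[of c2 c1])
  next
    case 3
    from 3 obtain \<alpha> \<beta> where ab: "c1 \<diamondop> c3 - \<alpha> *s (c1 \<diamondop> c2) \<in> ?R" "c2 \<diamondop> c3 - \<beta> *s (c1 \<diamondop> c2) \<in> ?R"
      using subspace_range_mul[of a] by (auto simp: span_breakdown_eq simp flip: span_eq_iff)
    let ?c = "c3 - \<alpha> *s c2 - \<beta> *s c1"
    have "max_rank a [c1, c2, ?c]"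
    proof (rule max_rank_transfer[OF a])
      show "li (map (mul a) [c1, c2, ?c])"
        unfolding list.map li3
      proof (intro allI impI)
        fix p q r assume "p *s a \<diamondop> c1 + q *s a \<diamondop> c2 + r *s a \<diamondop> ?c = 0"
        then have "(p - r * \<beta>) *s a \<diamondop> c1 + (q - r * \<alpha>) *s a \<diamondop> c2 + r *s a \<diamondop> c3 = 0"
          by (simp add: mul_simps algebra_simps)
        then have "p - r * \<beta> = 0 \<and> q - r * \<alpha> = 0 \<and> r = 0" using liR unfolding li3 by blast
        then show "p = 0 \<and> q = 0 \<and> r = 0" by auto
      qed
    qed simp
    then show ?thesis
      by (rule small_of_one_product[OF _ w _ _ W]) (use ab in \<open>simp_all add: mul_simps alt mul_commute[of c2 c1]\<close>)
  qed
qed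

theorem perfect_small:
  assumes W: "perfect W" shows "small W"
proof -
  obtain a cs where a: "max_rank a cs" using ex_max_rank by blast
  from max_rank_length[OF a] consider "length cs \<le> 2" | "length cs = 3" by linarith
  then show ?thesis
  proof cases
    case 1
    from low_rank_products[OF a 1] obtain y1 y2 y3 where "\<forall>x y. x \<diamondop> y \<in> span {y1, y2, y3}"
      by (elim exE)
    then show ?thesis using small_of_products[OF _ W, of y1 y2 y3] by blast
  next
    case 2
    then obtain c1 c2 c3 where cs: "cs = [c1, c2, c3]" by (auto simp: length_Suc_conv eval_nat_numeral)
    note a = a[unfolded cs]
    have liR: "li [a \<diamondop> c1, a \<diamondop> c2, a \<diamondop> c3]" using a by (simp add: max_rank_def)
    have perm: "max_rank a [c1, c3, c2]" "max_rank a [c2, c3, c1]"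
      by (rule max_rank_transfer[OF a]; use liR in \<open>auto simp: li_iff_independent insert_commute\<close>)+
    show ?thesis
    proof (cases "c1 \<diamondop> c2 \<in> range (mul a) \<and> c1 \<diamondop> c3 \<in> range (mul a) \<and> c2 \<diamondop> c3 \<in> range (mul a)")
      case True
      have "x \<diamondop> y \<in> range (mul a)" for x y
        by (rule products_mem[OF a _ subspace_range_mul])
          (use True in \<open>auto simp: alt mul_commute[of c2 c1] mul_commute[of c3] intro: range_eqI[of _ _ 0]\<close>)
      then have "x \<diamondop> y \<in> span {a \<diamondop> c1, a \<diamondop> c2, a \<diamondop> c3}" for x y using max_rank_range[OF a] by simp
      then show ?thesis by (rule small_of_products[OF _ W])
    next
      case False
      then show ?thesis using small_of_rank3[OF a _ W] small_of_rank3[OF perm(1) _ W] small_of_rank3[OF perm(2) _ W] by blast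
    qed
  qed
qed

end

section \<open>Characteristic different from 2\<close>

locale sym_nilp_alg = inf_nilp_alg scale mul
  for scale :: "'a::field \<Rightarrow> 'b::ab_group_add \<Rightarrow> 'b" (infixr "*s" 75)
    and mul :: "'b \<Rightarrow> 'b \<Rightarrow> 'b" (infixl "\<diamondop>" 80) +
  assumes char_not_2: "(2::'a) \<noteq> 0"
begin

lemma double_eq_0: "v + v = 0 \<longleftrightarrow> (v::'b) = 0"
proof -
  have "v + v = (2::'a) *s v" using scale_left_distrib[of 1 1 v] by simp
  then show ?thesis using char_not_2 by simp
qed

text \<open>Maximal rank persists at all but finitely many points of the line a + t z. If all
  squares of elements of maximal rank vanished, the square of a + t z, quadratic in t, would vanish
  at 0 and two further parameters, so z z = 0 for every z; since 2 is invertible the product would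
  be zero.\<close>

lemma ex_max_rank_square:
  assumes "\<exists>x y. x \<diamondop> y \<noteq> 0" shows "\<exists>a cs. max_rank a cs \<and> a \<diamondop> a \<noteq> 0"
proof (rule ccontr)
  assume no: "\<not> ?thesis"
  obtain a cs where a: "max_rank a cs" using ex_max_rank by blast
  then have aa: "a \<diamondop> a = 0" using no by blast
  have sq: "z \<diamondop> z = 0" for z
  proof -
    have ex: "\<exists>t. t \<notin> A \<and> (a + t *s z) \<diamondop> (a + t *s z) = 0" if "finite A" for A
    proof -
      from a have "li (map (mul a) cs)" by (simp add: max_rank_def)
      from li_perturb[OF this, of "map (mul z) cs" A] that obtain t where
        t: "t \<notin> A" "li (map2 (\<lambda>u w. u + t *s w) (map (mul a) cs) (map (mul z) cs))" by auto
      have "map2 (\<lambda>u w. u + t *s w) (map (mul a) cs) (map (mul z) cs) = map (mul (a + t *s z)) cs"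
        by (induction cs) (simp_all add: mul_simps)
      with t(2) have "max_rank (a + t *s z) cs" by (intro max_rank_transfer[OF a]) simp_all
      with no t(1) show ?thesis by blast
    qed
    from ex[of "{0}"] obtain t1 where t1: "t1 \<noteq> 0" "(a + t1 *s z) \<diamondop> (a + t1 *s z) = 0" by auto
    from ex[of "{0, t1}"] obtain t2 where t2: "t2 \<noteq> 0" "t2 \<noteq> t1" "(a + t2 *s z) \<diamondop> (a + t2 *s z) = 0" by auto
    have *: "(a \<diamondop> z + a \<diamondop> z) + t *s (z \<diamondop> z) = 0" if "t \<noteq> 0" "(a + t *s z) \<diamondop> (a + t *s z) = 0" for t
    proof -
      have "t *s ((a \<diamondop> z + a \<diamondop> z) + t *s (z \<diamondop> z)) = 0"
        using that(2) aa by (simp add: mul_simps mul_commute[of z a] scale_right_distrib add_ac)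
      then show ?thesis using that(1) by simp
    qed
    have "(t1 - t2) *s (z \<diamondop> z) = ((a \<diamondop> z + a \<diamondop> z) + t1 *s (z \<diamondop> z)) - ((a \<diamondop> z + a \<diamondop> z) + t2 *s (z \<diamondop> z))"
      by (simp add: algebra_simps)
    also have "\<dots> = 0" by (simp add: *[OF t1] *[OF t2(1,3)])
    finally have "(t1 - t2) *s (z \<diamondop> z) = 0" .
    then show ?thesis using t2(2) by simp
  qed
  have "x \<diamondop> y = 0" for x y
    using sq[of "x + y"] sq[of x] sq[of y] double_eq_0[of "x \<diamondop> y"] by (simp add: mul_simps mul_commute[of y x])
  then show False using assms by blast
qed

lemma max_rank_extend:
  assumes "max_rank a cs" "li (map (mul a) ds)" "length ds < length cs"
  shows "\<exists>c. li (map (mul a) (c # ds))"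
proof (rule ccontr)
  assume no: "\<not> ?thesis"
  then have "set (map (mul a) cs) \<subseteq> span (set (map (mul a) ds))" using assms(2) by (auto simp: li_Cons)
  moreover have "li (map (mul a) cs)" using assms(1) by (simp add: max_rank_def)
  ultimately have "length cs \<le> length ds" using li_length_le[of "map (mul a) cs" "map (mul a) ds"] by simp
  with assms(3) show False by simp
qed

text \<open>The case of a nondegenerate form on the complement of \<open>K + \<langle>a\<rangle>\<close>: here \<open>V\<close> modulo its
  annihilator would be a perfect algebra of dimension 4.\<close>

lemma no_perfect_dim4:
  assumes a: "max_rank a cs" and e0: "a \<diamondop> a \<noteq> 0"
    and R: "range (mul a) = span {a \<diamondop> a, i1, i2}" and li4: "li [w, a \<diamondop> a, i1, i2]"
    and nd: "\<And>x. (\<And>y. x \<diamondop> y \<in> range (mul a)) \<Longrightarrow> a \<diamondop> x \<in> span {a \<diamondop> a}"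
    and W: "perfect W" "W \<subseteq> span {w, a \<diamondop> a, i1, i2}" and full: "span (W \<union> {u. \<forall>x. x \<diamondop> u = 0}) = UNIV"
  shows False
proof -
  let ?R = "range (mul a)" and ?A = "{u. \<forall>x. x \<diamondop> u = 0}"
  have sR: "subspace ?R" by (rule subspace_range_mul)
  have sW: "subspace W" using W(1) by (rule perfect_subspace)
  have dec: "\<exists>v\<in>W. \<forall>y. x \<diamondop> y = v \<diamondop> y" for x
  proof -
    have "x \<in> span (W \<union> ?A)" using full by simp
    from span_Un_decomp[OF sW this] obtain v u where vu: "v \<in> W" "u \<in> span ?A" "x = v + u" .
    have "u \<in> ?A" using vu(2) subspace_annihilator span_eq_iff by metis
    then have "x \<diamondop> y = v \<diamondop> y" for y by (simp add: vu mul_simps mul_commute[of u])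
    with vu show ?thesis by blast
  qed
  \<comment> \<open>The element of W that acts like a. The vectors b4, b3, b2, b1 will turn out to
    be a single Jordan block of a.\<close>
  obtain b4 where b4: "b4 \<in> W" "\<And>y. a \<diamondop> y = b4 \<diamondop> y" using dec[of a] by blast
  define b3 where "b3 = a \<diamondop> a"
  define b2 where "b2 = a \<diamondop> b3"
  define b1 where "b1 = a \<diamondop> b2"
  have b4y: "b4 \<diamondop> y = a \<diamondop> y" "y \<diamondop> b4 = a \<diamondop> y" for y
    using b4(2)[of y] mul_commute[of y b4] by simp_all
  have aa: "a \<diamondop> a = b3" by (simp add: b3_def)
  have ab4: "a \<diamondop> b4 = b3" unfolding b3_def using b4y(2)[of a] by simp
  have ab: "a \<diamondop> b3 = b2" "a \<diamondop> b2 = b1" "a \<diamondop> b1 = 0"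
    using nilp4[of a b4] ab4 by (simp_all add: b2_def b1_def)
  have b3: "b3 \<noteq> 0" using e0 by (simp add: b3_def)
  have RW: "?R \<subseteq> W"
  proof clarify
    fix v obtain v' where "v' \<in> W" "\<And>y. v \<diamondop> y = v' \<diamondop> y" using dec[of v] by blast
    then show "a \<diamondop> v \<in> W" using perfect_mul[OF W(1), of v' a] by (simp add: mul_commute[of a])
  qed
  have b4R: "b4 \<notin> ?R"
  proof
    assume "b4 \<in> ?R"
    then obtain v where v: "b4 = a \<diamondop> v" by blast
    then have "v \<diamondop> b4 = 1 *s b4" using b4y(2)[of v] by simp
    from mul_eigen[OF this] ab4 b3 show False by simp
  qed
  have li4': "li [b4, b3, i1, i2]"
    using b4R li4 R by (simp add: li_Cons b3_def)
  have "set [b4, b3, i1, i2] \<subseteq> W" using b4(1) RW R by (auto simp: b3_def intro: span_base)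
  then have WP: "W \<subseteq> span {b4, b3, i1, i2}" using li_span_full[OF li4', of "[w, b3, i1, i2]"] W(2) by (auto simp: b3_def)
  \<comment> \<open>Every element acts like a multiple of b4 plus a vector of the range; thus the
    range is spanned by b3 and its own image under a, and three iterations exhaust it.\<close>
  have step: "\<exists>k r. r \<in> ?R \<and> a \<diamondop> v = k *s b3 + a \<diamondop> r" for v
  proof -
    obtain v' where v': "v' \<in> W" "\<And>y. v \<diamondop> y = v' \<diamondop> y" using dec[of v] by blast
    with WP have "v' \<in> span (insert b4 {b3, i1, i2})" by blast
    then obtain k where k: "v' - k *s b4 \<in> span {b3, i1, i2}" unfolding span_breakdown_eq by blast
    have "a \<diamondop> v = a \<diamondop> v'" using v'(2)[of a] by (simp add: mul_commute)
    also have "\<dots> = k *s b3 + a \<diamondop> (v' - k *s b4)" by (simp add: mul_simps ab4)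
    finally show ?thesis using k R by (auto simp: b3_def)
  qed
  have Rsp: "?R \<subseteq> span {b1, b2, b3}"
  proof clarify
    fix v
    from step[of v] obtain k1 r1 where 1: "a \<diamondop> v = k1 *s b3 + a \<diamondop> (a \<diamondop> r1)" by blast
    from step[of r1] obtain k2 r2 where 2: "a \<diamondop> r1 = k2 *s b3 + a \<diamondop> (a \<diamondop> r2)" by blast
    from step[of r2] obtain k3 r3 where 3: "a \<diamondop> r2 = k3 *s b3 + a \<diamondop> (a \<diamondop> r3)" by blast
    have "a \<diamondop> v = k3 *s b1 + k2 *s b2 + k1 *s b3"
      by (simp add: 1 2 3 mul_simps ab nilp4)
    then show "a \<diamondop> v \<in> span {b1, b2, b3}" unfolding span3 by blast
  qed
  have li3': "li [b3, i1, i2]" using li4 by (simp add: li_Cons b3_def)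
  have b1: "b1 \<noteq> 0"
  proof
    assume "b1 = 0"
    then have "set [b3, i1, i2] \<subseteq> span (set [b2, b3])" using Rsp R by (auto simp: b3_def intro: span_base)
    from li_length_le[OF li3' this] show False by simp
  qed
  have L: "li [b1, b2, b3]"
    using li3_powers[of a b3] b1 by (auto simp: ab li_iff_independent insert_commute)
  have Reqs: "?R = span {b1, b2, b3}"
    using Rsp sR span_minimal[of "{b1, b2, b3}" ?R] by (auto simp: b1_def b2_def b3_def)
  have L4: "li [b4, b1, b2, b3]" using L b4R Reqs by (simp add: li_Cons)
  have WP': "W \<subseteq> span {b4, b1, b2, b3}"
    using WP span_minimal[of "{b4, b3, i1, i2}" "span {b4, b1, b2, b3}"] R Reqs span_mono[of "{b1,b2,b3}" "{b4, b1, b2, b3}"]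
    by (auto simp: b3_def intro: span_base)
  have rep: "\<exists>m1 m2 m3 m4. x \<diamondop> y = m1 *s b1 + m2 *s b2 + m3 *s b3 + m4 *s b4" for x y
  proof -
    obtain y' where "y' \<in> W" "\<And>x. y \<diamondop> x = y' \<diamondop> x" using dec[of y] by blast
    then have "x \<diamondop> y \<in> W" using perfect_mul[OF W(1), of y' x] by (simp add: mul_commute[of x])
    then have "x \<diamondop> y \<in> span {b4, b1, b2, b3}" using WP' by blast
    then obtain p q r s where "x \<diamondop> y = p *s b4 + q *s b1 + r *s b2 + s *s b3" unfolding span4 by blast
    then have "x \<diamondop> y = q *s b1 + r *s b2 + s *s b3 + p *s b4" by (simp add: add_ac)
    then show ?thesis by blast
  qed
  have repR: "\<exists>m1 m2 m3. x = m1 *s b1 + m2 *s b2 + m3 *s b3" if "x \<in> ?R" for x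
    using that Reqs unfolding span3[symmetric] by simp
  have inR: "b1 \<in> ?R" "b2 \<in> ?R" "b3 \<in> ?R" unfolding Reqs by (auto intro: span_base)
  note Rcl = subspace_add[OF sR] subspace_diff[OF sR] subspace_scale[OF sR]
  have b1R: "b1 \<diamondop> y \<in> ?R" "y \<diamondop> b1 \<in> ?R" for y using chain1[OF a ab(3), of y] by (simp_all add: mul_commute)
  have kz: "k = 0" if "k *s b4 + r \<in> ?R" "r \<in> ?R" for k r
  proof (rule ccontr)
    assume "k \<noteq> 0"
    then have "b4 = inverse k *s (k *s b4 + r - r)" by simp
    then show False using b4R Rcl(2)[OF that] Rcl(3) by metis
  qed
  have L3: "p = 0 \<and> q = 0 \<and> r = 0" if "p *s b1 + q *s b2 + r *s b3 = 0" for p q r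
    using L that unfolding li3 by blast
  obtain g1 g2 g3 where g: "b1 \<diamondop> b1 = g1 *s b1 + g2 *s b2 + g3 *s b3" using repR[OF b1R(1)] by blast
  obtain c1 c2 c3 where c: "b2 \<diamondop> b1 = c1 *s b1 + c2 *s b2 + c3 *s b3" using repR[OF b1R(2)] by blast
  obtain d1 d2 d3 where d: "b3 \<diamondop> b1 = d1 *s b1 + d2 *s b2 + d3 *s b3" using repR[OF b1R(2)] by blast
  obtain m1 m2 m3 q22 where m: "b2 \<diamondop> b2 = m1 *s b1 + m2 *s b2 + m3 *s b3 + q22 *s b4" using rep by blast
  obtain n1 n2 n3 q23 where n: "b2 \<diamondop> b3 = n1 *s b1 + n2 *s b2 + n3 *s b3 + q23 *s b4" using rep by blast
  obtain l1 l2 l3 q33 where l: "b3 \<diamondop> b3 = l1 *s b1 + l2 *s b2 + l3 *s b3 + q33 *s b4" using rep by blast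
  have com: "b1 \<diamondop> b2 = b2 \<diamondop> b1" "b1 \<diamondop> b3 = b3 \<diamondop> b1" "b3 \<diamondop> b2 = b2 \<diamondop> b3" by (simp_all add: mul_commute)
  \<comment> \<open>The linearized fourth power of a, in the directions b1, b2, b3, applied to b4:
    this links the structure constants of different products.\<close>
  have P1: "(d3 + c2 + g1) *s b1 + (c3 + g2) *s b2 + g3 *s b3 = 0"
    using polarized_nilp4[of a b1 b4]
    by (simp add: ab4 aa ab b4y com g c d mul_simps algebra_simps)
  have P2: "(n3 + m2 + c1) *s b1 + (q23 + m3 + c2) *s b2 + (q22 + c3) *s b3 = 0"
    using polarized_nilp4[of a b2 b4]
    by (simp add: ab4 aa ab b4y com m n c mul_simps algebra_simps)
  have P3: "(l3 + n2 + d1) *s b1 + (q33 + n3 + d2) *s b2 + (q23 + d3) *s b3 = 0"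
    using polarized_nilp4[of a b3 b4]
    by (simp add: ab4 aa ab b4y com l n d mul_simps algebra_simps)
  have g3: "g3 = 0" and c3: "c3 + g2 = 0" and q22: "q22 + c3 = 0" and q23: "q23 + d3 = 0"
    using L3[OF P1] L3[OF P2] L3[OF P3] by auto
  have G: "b1 \<diamondop> b1 = a \<diamondop> (g1 *s b2 + g2 *s b3)" by (simp add: g g3 mul_simps ab)
  \<comment> \<open>This vector lies in the radical of the product modulo the range, so
    nondegeneracy puts its image g1 b1 + g2 b2 under a on the line of b3, where it must be
    zero.\<close>
  have "z \<diamondop> (g1 *s b2 + g2 *s b3) \<in> ?R" for z
  proof -
    have "z \<diamondop> b1 \<in> ?R" by (rule b1R)
    then obtain v where v: "z \<diamondop> b1 = a \<diamondop> v" by blast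
    have "z \<diamondop> (g1 *s b2 + g2 *s b3) + b1 \<diamondop> v - b1 \<diamondop> v \<in> ?R"
      by (rule Rcl(2)[OF chain2_polar[OF a ab(3) v G] b1R(1)])
    then show ?thesis by simp
  qed
  then have "a \<diamondop> (g1 *s b2 + g2 *s b3) \<in> span {b3}" unfolding b3_def using nd mul_commute by metis
  then obtain k where "g1 *s b1 + g2 *s b2 = k *s b3" unfolding span1 by (auto simp: mul_simps ab)
  then have "g1 *s b1 + g2 *s b2 + (- k) *s b3 = 0" by simp
  from L3[OF this] have g0: "g1 = 0" "g2 = 0" by auto
  then have c3: "c3 = 0" and q22: "q22 = 0" using c3 q22 by auto
  \<comment> \<open>Otherwise b2 would lie in the radical and b1 = a b2 on the line of b3.\<close>
  have q23': "q23 \<noteq> 0"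
  proof
    assume q0: "q23 = 0"
    have "b2 \<diamondop> y \<in> ?R" for y
    proof -
      obtain y' where y': "y' \<in> W" "\<And>x. y \<diamondop> x = y' \<diamondop> x" using dec[of y] by blast
      have "b2 \<diamondop> y' \<in> ?R"
      proof (rule mul_mem_span)
        show "y' \<in> span {b4, b1, b2, b3}" using y' WP' by blast
        fix s assume "s \<in> {b4, b1, b2, b3}"
        then show "b2 \<diamondop> s \<in> ?R" using inR
          by (auto simp: b4y aa ab c m n q0 q22 intro!: Rcl del: imageE rangeE)
      qed (rule sR)
      then show ?thesis using y'(2)[of b2] by (simp add: mul_commute)
    qed
    then have "a \<diamondop> b2 \<in> span {b3}" unfolding b3_def by (rule nd)
    then obtain k where "b1 = k *s b3" unfolding span1 by (auto simp: ab)
    then have "1 *s b1 + 0 *s b2 + (- k) *s b3 = 0" by simp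
    from L3[OF this] show False by simp
  qed
  have C: "b2 \<diamondop> b1 = a \<diamondop> (c1 *s b2 + c2 *s b3)" by (simp add: c c3 mul_simps ab)
  have D: "b3 \<diamondop> b1 = a \<diamondop> (d1 *s b2 + d2 *s b3 + d3 *s b4)" by (simp add: d mul_simps ab ab4)
  \<comment> \<open>The coefficient of b4 in a vector known to lie in the range. The constants c2,
    d2, d1 fall one after the other, until b3 is an eigenvector of b1 with eigenvalue d3 = - q23,
    which is nonzero.\<close>
  have "c2 * q23 = 0"
    by (rule kz[of _ "c1 *s (b2 \<diamondop> b2) + c2 *s (n1 *s b1 + n2 *s b2 + n3 *s b3)"])
      (use chain2[OF a ab(3) C] inR in \<open>auto simp: mul_simps m n q22 algebra_simps intro!: Rcl del: imageE rangeE\<close>)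
  then have c2: "c2 = 0" using q23' by simp
  then have "b2 \<diamondop> b1 = c1 *s b1" using c c3 by simp
  from mul_eigen[OF this] b1 have "c1 = 0" by simp
  then have C: "b2 \<diamondop> b1 = a \<diamondop> 0" using c c2 c3 by simp
  have "d2 * q23 = 0"
    by (rule kz[of _ "d1 *s (b2 \<diamondop> b2) + d2 *s (n1 *s b1 + n2 *s b2 + n3 *s b3) + d3 *s b1"])
      (use chain2_polar[OF a ab(3) C D] inR in \<open>auto simp: mul_simps m n q22 b4y aa ab algebra_simps intro!: Rcl del: imageE rangeE\<close>)
  then have d2: "d2 = 0" using q23' by simp
  then have D: "b3 \<diamondop> b1 = a \<diamondop> (d1 *s b2 + d3 *s b4)" using D by simp
  have "d1 * q23 = 0"
    by (rule kz[of _ "d1 *s (n1 *s b1 + n2 *s b2 + n3 *s b3) + d3 *s b2"])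
      (use chain2[OF a ab(3) D] inR in \<open>auto simp: mul_simps com n b4y aa ab algebra_simps intro!: Rcl del: imageE rangeE\<close>)
  then have "d1 = 0" using q23' by simp
  then have "b1 \<diamondop> b3 = d3 *s b3" using d d2 by (simp add: com)
  from mul_eigen[OF this] b3 q23 q23' show False by simp
qed

text \<open>In \<open>rank3_frame\<close> the range \<open>R\<close> of multiplication by \<open>a\<close> is spanned by
  \<open>e = a \<diamondop> a\<close>, \<open>a \<diamondop> c1\<close> and \<open>a \<diamondop> c2\<close>, and the product modulo \<open>R\<close> is a quadratic form in the
  coordinates along \<open>c1\<close> and \<open>c2\<close>.\<close>

definition rank3_frame :: "'b \<Rightarrow> 'b \<Rightarrow> 'b \<Rightarrow> bool" where
  "rank3_frame a c1 c2 \<longleftrightarrow> max_rank a [a, c1, c2]"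

lemma rank3_frameD:
  assumes "rank3_frame a c1 c2"
  shows "max_rank a [a, c1, c2]" "li [a \<diamondop> a, a \<diamondop> c1, a \<diamondop> c2]"
    "range (mul a) = span {a \<diamondop> a, a \<diamondop> c1, a \<diamondop> c2}"
    "UNIV \<subseteq> span ({k. a \<diamondop> k = 0} \<union> {a, c1, c2})"
  using assms max_rank_range[of a "[a, c1, c2]"] max_rank_decomp[of a "[a, c1, c2]"]
  by (auto simp: rank3_frame_def max_rank_def)

lemma rank3_frame_change:
  assumes "rank3_frame a c1 c2" "li [a \<diamondop> a, a \<diamondop> d1, a \<diamondop> d2]" shows "rank3_frame a d1 d2"
  unfolding rank3_frame_def by (rule max_rank_transfer[OF rank3_frameD(1)[OF assms(1)]]) (use assms(2) in simp_all)

lemma rank3_frame_add: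
  assumes "rank3_frame a c1 c2" 
  shows "rank3_frame a c1 (c2 + x *s a + y *s c1)" "rank3_frame a c2 c1" "rank3_frame a (c1 + c2) c2"
proof -
  note l = rank3_frameD(2)[OF assms, unfolded li3, rule_format]
  show "rank3_frame a c1 (c2 + x *s a + y *s c1)"
  proof (rule rank3_frame_change[OF assms], unfold li3, intro allI impI)
    fix p q r assume "p *s a \<diamondop> a + q *s a \<diamondop> c1 + r *s a \<diamondop> (c2 + x *s a + y *s c1) = 0"
    then have "(p + r * x) *s a \<diamondop> a + (q + r * y) *s a \<diamondop> c1 + r *s a \<diamondop> c2 = 0"
      by (simp add: mul_simps algebra_simps)
    from l[OF this] show "p = 0 \<and> q = 0 \<and> r = 0" by auto
  qed
  show "rank3_frame a c2 c1"
  proof (rule rank3_frame_change[OF assms], unfold li3, intro allI impI)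
    fix p q r assume "p *s a \<diamondop> a + q *s a \<diamondop> c2 + r *s a \<diamondop> c1 = 0"
    then have "p *s a \<diamondop> a + r *s a \<diamondop> c1 + q *s a \<diamondop> c2 = 0" by (simp add: algebra_simps)
    from l[OF this] show "p = 0 \<and> q = 0 \<and> r = 0" by auto
  qed
  show "rank3_frame a (c1 + c2) c2"
  proof (rule rank3_frame_change[OF assms], unfold li3, intro allI impI)
    fix p q r assume "p *s a \<diamondop> a + q *s a \<diamondop> (c1 + c2) + r *s a \<diamondop> c2 = 0"
    then have "p *s a \<diamondop> a + q *s a \<diamondop> c1 + (q + r) *s a \<diamondop> c2 = 0" by (simp add: mul_simps algebra_simps)
    from l[OF this] show "p = 0 \<and> q = 0 \<and> r = 0" by auto
  qed
qed

lemma frame_decomp: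
  assumes "rank3_frame a c1 c2"
  obtains k \<alpha> \<zeta>1 \<zeta>2 where "a \<diamondop> k = 0" "x = k + \<alpha> *s a + \<zeta>1 *s c1 + \<zeta>2 *s c2"
proof -
  obtain k \<alpha> \<zeta>1 \<zeta>2 where "k \<in> {k. a \<diamondop> k = 0}" "x = k + \<alpha> *s a + \<zeta>1 *s c1 + \<zeta>2 *s c2"
    by (rule decomp3[OF subspace_kernel_mul rank3_frameD(4)[OF assms]])
  with that show ?thesis by blast
qed

lemma frame_kernel_image:
  assumes "rank3_frame a c1 c2" "a \<diamondop> k = 0"
  obtains \<mu> p1 p2 where "x \<diamondop> k = a \<diamondop> (\<mu> *s a + p1 *s c1 + p2 *s c2)"
  by (rule max_rank3_range[OF rank3_frameD(1)[OF assms(1)] chain1[OF rank3_frameD(1)[OF assms(1)] assms(2)]])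

lemma kernel_mul_mem: "rank3_frame a c1 c2 \<Longrightarrow> a \<diamondop> k = 0 \<Longrightarrow> k \<diamondop> x \<in> range (mul a)"
  using chain1[OF rank3_frameD(1), of a c1 c2 k x] by (simp add: mul_commute[of k])

lemma mul_a_mem: "x \<diamondop> a \<in> range (mul a)" "a \<diamondop> x \<in> range (mul a)"
  by (simp_all add: mul_commute[of x])

lemma coeff_zero_mod:
  assumes "w \<notin> range (mul a)" "k *s w + r \<in> range (mul a)" "r \<in> range (mul a)" shows "k = 0"
proof (rule ccontr)
  assume "k \<noteq> 0"
  then have "w = inverse k *s (k *s w + r - r)" by simp
  then show False
    using assms subspace_diff[OF subspace_range_mul assms(2,3)] subspace_scale[OF subspace_range_mul] by metis
qed

text \<open>If the form has rank 2 in the sense of the Jacobian, then the kernel of \<open>a\<close> annihilates \<open>V\<close>.\<close>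

lemma small_of_form_rank2:
  assumes f: "rank3_frame a c1 c2"
    and ind: "\<And>\<alpha> \<beta>. \<alpha> *s (c1 \<diamondop> c1) + \<beta> *s (c1 \<diamondop> c2) \<in> range (mul a) \<Longrightarrow> \<alpha> = 0 \<and> \<beta> = 0"
    and W: "perfect W"
  shows "small W"
proof -
  let ?R = "range (mul a)"
  note sR = subspace_range_mul[of a]
  note a = rank3_frameD(1)[OF f]
  have ma: "x \<diamondop> a \<in> ?R" for x by (simp add: mul_commute[of x])
  have line: "\<exists>m. x \<diamondop> k = m *s (a \<diamondop> a)" if k: "a \<diamondop> k = 0" for x k
  proof -
    obtain \<mu> p1 p2 where p: "c1 \<diamondop> k = a \<diamondop> (\<mu> *s a + p1 *s c1 + p2 *s c2)" by (rule frame_kernel_image[OF f k])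
    obtain \<nu> q1 q2 where q: "x \<diamondop> k = a \<diamondop> (\<nu> *s a + q1 *s c1 + q2 *s c2)" by (rule frame_kernel_image[OF f k])
    have "c1 \<diamondop> (\<mu> *s a + p1 *s c1 + p2 *s c2) - \<mu> *s (c1 \<diamondop> a) \<in> ?R"
      by (rule subspace_diff[OF sR chain2[OF a k p] subspace_scale[OF sR ma]])
    then have "p1 = 0 \<and> p2 = 0" by (intro ind) (simp add: mul_simps)
    then have p: "c1 \<diamondop> k = a \<diamondop> (\<mu> *s a)" using p by simp
    have "c1 \<diamondop> (\<nu> *s a + q1 *s c1 + q2 *s c2) + x \<diamondop> (\<mu> *s a) - (\<nu> *s (c1 \<diamondop> a) + \<mu> *s (x \<diamondop> a)) \<in> ?R"
      by (rule subspace_diff[OF sR chain2_polar[OF a k p q]]) (intro subspace_add[OF sR] subspace_scale[OF sR] ma)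
    then have "q1 = 0 \<and> q2 = 0" by (intro ind) (simp add: mul_simps)
    then show ?thesis using q by (auto simp: mul_simps)
  qed
  have "{k. a \<diamondop> k = 0} \<subseteq> {u. \<forall>x. x \<diamondop> u = 0}"
  proof (clarify, rule ccontr)
    fix k x assume k: "a \<diamondop> k = 0" and xk: "x \<diamondop> k \<noteq> 0"
    from line[OF k, of x] xk obtain m where m: "x \<diamondop> k = m *s (a \<diamondop> a)" "m \<noteq> 0" by auto
    from line[OF k, of c1] obtain l where l: "c1 \<diamondop> k = l *s (a \<diamondop> a)" by blast
    have "li [a \<diamondop> a, c1 \<diamondop> a, c1 \<diamondop> c1, c1 \<diamondop> c2]"
      unfolding li4
    proof (intro allI impI)
      fix p q r s assume e: "p *s a \<diamondop> a + q *s c1 \<diamondop> a + r *s c1 \<diamondop> c1 + s *s c1 \<diamondop> c2 = 0"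
      then have "r *s c1 \<diamondop> c1 + s *s c1 \<diamondop> c2 = - (p *s a \<diamondop> a + q *s c1 \<diamondop> a)"
        by (metis add.assoc eq_neg_iff_add_eq_0 add.commute)
      also have "\<dots> \<in> ?R" by (intro subspace_neg[OF sR] subspace_add[OF sR] subspace_scale[OF sR] ma)
      finally have "r = 0 \<and> s = 0" by (rule ind)
      moreover from this e have "p *s a \<diamondop> a + q *s a \<diamondop> c1 + 0 *s a \<diamondop> c2 = 0" by (simp add: mul_commute[of c1 a])
      then have "p = 0 \<and> q = 0" using rank3_frameD(2)[OF f] unfolding li3 by blast
      ultimately show "p = 0 \<and> q = 0 \<and> r = 0 \<and> s = 0" by simp
    qed
    from rank_violation[OF this l m] show False .
  qed
  then have "span ({k. a \<diamondop> k = 0} \<union> {a, c1, c2}) \<subseteq> span ({u. \<forall>x. x \<diamondop> u = 0} \<union> {a, c1, c2})"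
    by (intro span_mono) auto
  with rank3_frameD(4)[OF f] show ?thesis by (intro small_of_annihilator3[OF _ W]) blast
qed

lemma frame_li4:
  assumes f: "rank3_frame a c1 c2" and w: "w \<notin> range (mul a)"
  shows "\<And>p q r s. p *s w + q *s (a \<diamondop> a) + r *s (a \<diamondop> c1) + s *s (a \<diamondop> c2) = 0 \<Longrightarrow> p = 0 \<and> q = 0 \<and> r = 0 \<and> s = 0"
proof -
  have "li [w, a \<diamondop> a, a \<diamondop> c1, a \<diamondop> c2]" using w rank3_frameD(2,3)[OF f] by (simp add: li_Cons)
  then show "\<And>p q r s. p *s w + q *s (a \<diamondop> a) + r *s (a \<diamondop> c1) + s *s (a \<diamondop> c2) = 0 \<Longrightarrow> p = 0 \<and> q = 0 \<and> r = 0 \<and> s = 0"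
    unfolding li4 by blast
qed

text \<open>The chain conditions leave one free parameter for k in ker a, the c2-coefficient of c1
  k, and k annihilates V when it vanishes. So the annihilator has codimension at most 4, and
  \<open>perfect_codim4\<close> settles everything except W plus the annihilator being V, the
  situation of \<open>no_perfect_dim4\<close>.\<close>

lemma small_of_nondegenerate_form:
  assumes f: "rank3_frame a c1 c2" and w: "c1 \<diamondop> c1 \<notin> range (mul a)" and c12: "c1 \<diamondop> c2 \<in> range (mul a)"
    and D: "c2 \<diamondop> c2 - D *s (c1 \<diamondop> c1) \<in> range (mul a)" "D \<noteq> 0"
    and W: "perfect W"
  shows "small W"
proof -
  let ?R = "range (mul a)" and ?A = "{u. \<forall>x. x \<diamondop> u = 0}"
  note sR = subspace_range_mul[of a]
  note R = subspace_add[OF sR] subspace_diff[OF sR] subspace_scale[OF sR]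
  note a = rank3_frameD(1)[OF f]
  have w2: "c2 \<diamondop> c2 \<notin> ?R"
  proof
    assume "c2 \<diamondop> c2 \<in> ?R"
    then have "c2 \<diamondop> c2 - (c2 \<diamondop> c2 - D *s (c1 \<diamondop> c1)) \<in> ?R" using D(1) by (rule R(2))
    then have "D *s (c1 \<diamondop> c1) + 0 \<in> ?R" by simp
    from coeff_zero_mod[OF w this subspace_0[OF sR]] D(2) show False by simp
  qed
  have c21: "c2 \<diamondop> c1 \<in> ?R" using c12 by (simp add: mul_commute[of c2])
  note L = frame_li4[OF f w]
  have form: "\<zeta>1 *s (c1 \<diamondop> c1) + r \<in> ?R \<Longrightarrow> r \<in> ?R \<Longrightarrow> \<zeta>1 = 0" for \<zeta>1 r by (rule coeff_zero_mod[OF w])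
  have form2: "\<zeta>1 *s (c2 \<diamondop> c2) + r \<in> ?R \<Longrightarrow> r \<in> ?R \<Longrightarrow> \<zeta>1 = 0" for \<zeta>1 r by (rule coeff_zero_mod[OF w2])
  have p1: "p1 = 0" if k: "a \<diamondop> k = 0" and p: "c1 \<diamondop> k = a \<diamondop> (\<mu> *s a + p1 *s c1 + p2 *s c2)" for k \<mu> p1 p2
    by (rule form[of _ "\<mu> *s (c1 \<diamondop> a) + p2 *s (c1 \<diamondop> c2)"])
      (use chain2[OF a k p] in \<open>auto simp: mul_simps algebra_simps intro!: R mul_a_mem c12 del: imageE rangeE\<close>)
  have ker: "k \<in> ?A" if k: "a \<diamondop> k = 0" and ck: "c1 \<diamondop> k = a \<diamondop> (\<mu> *s a)" for k \<mu>
  proof -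
    obtain \<nu> q1 q2 where q: "c2 \<diamondop> k = a \<diamondop> (\<nu> *s a + q1 *s c1 + q2 *s c2)" by (rule frame_kernel_image[OF f k])
    have "q2 = 0" by (rule form2[of _ "\<nu> *s (c2 \<diamondop> a) + q1 *s (c2 \<diamondop> c1)"])
      (use chain2[OF a k q] in \<open>auto simp: mul_simps algebra_simps intro!: R mul_a_mem c21 del: imageE rangeE\<close>)
    have "q1 = 0" by (rule form[of _ "\<nu> *s (c1 \<diamondop> a) + q2 *s (c1 \<diamondop> c2) + \<mu> *s (c2 \<diamondop> a)"])
      (use chain2_polar[OF a k ck q] in \<open>auto simp: mul_simps algebra_simps intro!: R mul_a_mem c12 del: imageE rangeE\<close>)
    with q \<open>q2 = 0\<close> have q: "c2 \<diamondop> k = a \<diamondop> (\<nu> *s a)" by simp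
    have line: "\<exists>m. x \<diamondop> k = m *s (a \<diamondop> a)" for x
    proof -
      obtain \<rho> r1 r2 where r: "x \<diamondop> k = a \<diamondop> (\<rho> *s a + r1 *s c1 + r2 *s c2)" by (rule frame_kernel_image[OF f k])
      have "r1 = 0" by (rule form[of _ "\<rho> *s (c1 \<diamondop> a) + r2 *s (c1 \<diamondop> c2) + \<mu> *s (x \<diamondop> a)"])
        (use chain2_polar[OF a k ck r] in \<open>auto simp: mul_simps algebra_simps intro!: R mul_a_mem c12 del: imageE rangeE\<close>)
      moreover have "r2 = 0" by (rule form2[of _ "\<rho> *s (c2 \<diamondop> a) + r1 *s (c2 \<diamondop> c1) + \<nu> *s (x \<diamondop> a)"])
        (use chain2_polar[OF a k q r] in \<open>auto simp: mul_simps algebra_simps intro!: R mul_a_mem c21 del: imageE rangeE\<close>)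
      ultimately show ?thesis using r by (auto simp: mul_simps)
    qed
    have "x \<diamondop> k = 0" for x
    proof (rule ccontr)
      assume xk: "x \<diamondop> k \<noteq> 0"
      from line[of x] xk obtain m where m: "x \<diamondop> k = m *s (a \<diamondop> a)" "m \<noteq> 0" by auto
      obtain \<xi>0 \<xi>1 \<xi>2 where xi: "c1 \<diamondop> c2 = \<xi>0 *s (a \<diamondop> a) + \<xi>1 *s (a \<diamondop> c1) + \<xi>2 *s (a \<diamondop> c2)"
        using c12 unfolding rank3_frameD(3)[OF f] span3 by blast
      \<comment> \<open>The multiple of a makes the coefficient of a c2 in z c2 equal to 1, which
        gives z rank 3 modulo a a.\<close>
      define z where "z = c1 + (1 - \<xi>2) *s a"
      from line[of z] obtain l where l: "z \<diamondop> k = l *s (a \<diamondop> a)" by blast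
      have "li [a \<diamondop> a, z \<diamondop> a, z \<diamondop> c1, z \<diamondop> c2]"
        unfolding li4
      proof (intro allI impI)
        fix p q r s assume "p *s a \<diamondop> a + q *s z \<diamondop> a + r *s z \<diamondop> c1 + s *s z \<diamondop> c2 = 0"
        then have "r *s (c1 \<diamondop> c1) + (p + q * (1 - \<xi>2) + s * \<xi>0) *s (a \<diamondop> a)
            + (q + r * (1 - \<xi>2) + s * \<xi>1) *s (a \<diamondop> c1) + s *s (a \<diamondop> c2) = 0"
          by (simp add: z_def mul_simps xi mul_commute[of c1 a] algebra_simps)
        from L[OF this] show "p = 0 \<and> q = 0 \<and> r = 0 \<and> s = 0" by auto
      qed
      from rank_violation[OF this l m] show False .
    qed
    then show ?thesis by blast
  qed
  show ?thesis
  proof (cases "\<forall>k. a \<diamondop> k = 0 \<longrightarrow> (\<exists>\<mu>. c1 \<diamondop> k = a \<diamondop> (\<mu> *s a))")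
    case True
    then have "{k. a \<diamondop> k = 0} \<subseteq> ?A" using ker by blast
    then have "span ({k. a \<diamondop> k = 0} \<union> {a, c1, c2}) \<subseteq> span (?A \<union> {a, c1, c2})"
      by (intro span_mono) auto
    with rank3_frameD(4)[OF f] show ?thesis by (intro small_of_annihilator3[OF _ W]) blast
  next
    case False
    then obtain k0 where k0: "a \<diamondop> k0 = 0" "\<nexists>\<mu>. c1 \<diamondop> k0 = a \<diamondop> (\<mu> *s a)" by blast
    obtain \<mu> p p2 where p: "c1 \<diamondop> k0 = a \<diamondop> (\<mu> *s a + p *s c1 + p2 *s c2)" by (rule frame_kernel_image[OF f k0(1)])
    from p1[OF k0(1) p] p k0(2) have p0: "c1 \<diamondop> k0 = a \<diamondop> (\<mu> *s a + p2 *s c2)" "p2 \<noteq> 0" by auto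
    have kA: "k \<in> span (?A \<union> {k0})" if k: "a \<diamondop> k = 0" for k
    proof -
      obtain \<nu> q q2 where q: "c1 \<diamondop> k = a \<diamondop> (\<nu> *s a + q *s c1 + q2 *s c2)" by (rule frame_kernel_image[OF f k])
      from p1[OF k q] have "q = 0" .
      have "c1 \<diamondop> (k - (q2 / p2) *s k0) = a \<diamondop> ((\<nu> - q2 / p2 * \<mu>) *s a)"
        using p0(2) by (simp add: mul_simps q \<open>q = 0\<close> p0(1) algebra_simps)
      moreover have "a \<diamondop> (k - (q2 / p2) *s k0) = 0" using k k0(1) by (simp add: mul_simps)
      ultimately have "k - (q2 / p2) *s k0 \<in> ?A" by (intro ker)
      then have "(k - (q2 / p2) *s k0) + (q2 / p2) *s k0 \<in> span (?A \<union> {k0})"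
        by (intro span_add span_scale) (auto intro: span_base)
      then show ?thesis by simp
    qed
    have "{k. a \<diamondop> k = 0} \<union> {a, c1, c2} \<subseteq> span (?A \<union> {k0, a, c1, c2})"
      using kA span_mono[of "?A \<union> {k0}" "?A \<union> {k0, a, c1, c2}"] by (auto intro: span_base)
    from span_minimal[OF this subspace_span] rank3_frameD(4)[OF f]
    have V: "UNIV \<subseteq> span (?A \<union> {k0, a, c1, c2})" by blast
    show ?thesis
    proof (cases "span (W \<union> ?A) = UNIV")
      case False
      from perfect_codim4[OF submod_annihilator W V False] show ?thesis
        by (intro small_zero perfect_annihilated[OF W])
    next
      case True
      have li: "li [c1 \<diamondop> c1, a \<diamondop> a, a \<diamondop> c1, a \<diamondop> c2]" unfolding li4 using L by blast
      let ?P = "span {c1 \<diamondop> c1, a \<diamondop> a, a \<diamondop> c1, a \<diamondop> c2}"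
      have RP: "?R \<subseteq> ?P" unfolding rank3_frameD(3)[OF f] by (rule span_mono) auto
      have c22P: "c2 \<diamondop> c2 \<in> ?P"
      proof -
        have "(c2 \<diamondop> c2 - D *s (c1 \<diamondop> c1)) + D *s (c1 \<diamondop> c1) \<in> ?P"
          using D(1) RP by (intro span_add span_scale) (auto intro: span_base)
        then show ?thesis by simp
      qed
      have aP: "a \<diamondop> v \<in> ?P" "v \<diamondop> a \<in> ?P" for v
        using RP mul_a_mem(2)[of a v] mul_a_mem(1)[of v a] by blast+
      have cP: "c1 \<diamondop> c1 \<in> ?P" "c1 \<diamondop> c2 \<in> ?P" "c2 \<diamondop> c1 \<in> ?P"
        using RP c12 c21 by (auto intro: span_base)
      have "x \<diamondop> y \<in> ?P" for x y
      proof (rule products_mem[OF a RP subspace_span])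
        fix c d assume "c \<in> set [a, c1, c2]" "d \<in> set [a, c1, c2]"
        then show "c \<diamondop> d \<in> ?P" using aP cP c22P unfolding list.set by (elim insertE emptyE) simp_all
      qed
      then have WP: "W \<subseteq> ?P" using perfect_subset[OF W, of ?P] by auto
      have nd: "a \<diamondop> x \<in> span {a \<diamondop> a}" if x: "\<And>y. x \<diamondop> y \<in> ?R" for x
      proof -
        obtain k \<alpha> \<zeta>1 \<zeta>2 where k: "a \<diamondop> k = 0" "x = k + \<alpha> *s a + \<zeta>1 *s c1 + \<zeta>2 *s c2" by (rule frame_decomp[OF f])
        have "\<zeta>1 = 0" by (rule form[of _ "k \<diamondop> c1 + \<alpha> *s (a \<diamondop> c1) + \<zeta>2 *s (c2 \<diamondop> c1)"])
          (use x[of c1] kernel_mul_mem[OF f k(1), of c1] in \<open>auto simp: k(2) mul_simps algebra_simps intro!: R mul_a_mem c21 del: imageE rangeE\<close>)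
        moreover have "\<zeta>2 = 0" by (rule form2[of _ "k \<diamondop> c2 + \<alpha> *s (a \<diamondop> c2) + \<zeta>1 *s (c1 \<diamondop> c2)"])
          (use x[of c2] kernel_mul_mem[OF f k(1), of c2] in \<open>auto simp: k(2) mul_simps algebra_simps intro!: R mul_a_mem c12 del: imageE rangeE\<close>)
        ultimately have "a \<diamondop> x = \<alpha> *s (a \<diamondop> a)" by (simp add: k mul_simps)
        then show ?thesis unfolding span1 by blast
      qed
      have "a \<diamondop> a \<noteq> 0" using rank3_frameD(2)[OF f] by (auto simp: li_iff_independent dependent_zero)
      from no_perfect_dim4[OF a this rank3_frameD(3)[OF f] li nd W WP True] show ?thesis ..
    qed
  qed
qed

text \<open>Modulo the range only c1 c1 survives, so \<open>chain2\<close> for c1 and its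
  polarization with x remove the c1-coefficient.\<close>

lemma degenerate_kernel_image:
  assumes f: "rank3_frame a c1 c2" and w: "c1 \<diamondop> c1 \<notin> range (mul a)" and c2: "\<And>x. x \<diamondop> c2 \<in> range (mul a)"
    and k: "a \<diamondop> k = 0"
  obtains \<mu> p where "x \<diamondop> k = a \<diamondop> (\<mu> *s a + p *s c2)"
proof -
  let ?R = "range (mul a)"
  note sR = subspace_range_mul[of a]
  note R = subspace_add[OF sR] subspace_diff[OF sR] subspace_scale[OF sR]
  note a = rank3_frameD(1)[OF f]
  obtain \<mu> p1 p2 where p: "c1 \<diamondop> k = a \<diamondop> (\<mu> *s a + p1 *s c1 + p2 *s c2)" by (rule frame_kernel_image[OF f k])
  obtain \<nu> q1 q2 where q: "x \<diamondop> k = a \<diamondop> (\<nu> *s a + q1 *s c1 + q2 *s c2)" by (rule frame_kernel_image[OF f k])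
  have "p1 = 0" by (rule coeff_zero_mod[OF w, of _ "\<mu> *s (c1 \<diamondop> a) + p2 *s (c1 \<diamondop> c2)"])
    (use chain2[OF a k p] in \<open>auto simp: mul_simps algebra_simps intro!: R mul_a_mem c2 del: imageE rangeE\<close>)
  then have p: "c1 \<diamondop> k = a \<diamondop> (\<mu> *s a + p2 *s c2)" using p by simp
  have "q1 = 0" by (rule coeff_zero_mod[OF w, of _ "\<nu> *s (c1 \<diamondop> a) + q2 *s (c1 \<diamondop> c2) + \<mu> *s (x \<diamondop> a) + p2 *s (x \<diamondop> c2)"])
    (use chain2_polar[OF a k p q] in \<open>auto simp: mul_simps algebra_simps intro!: R mul_a_mem c2 del: imageE rangeE\<close>)
  with q that show ?thesis by simp
qed

text \<open>Adding t a to z does not change z k, but shifts the matrix of z. For a suitable t the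
  images of a, c1, c2 are independent modulo a a, and a nonzero m would add a fourth
  dimension.\<close>

lemma degenerate_rank4:
  assumes f: "rank3_frame a c1 c2" and w: "c1 \<diamondop> c1 \<notin> range (mul a)" and c2: "\<And>x. x \<diamondop> c2 \<in> range (mul a)"
    and k: "a \<diamondop> k = 0" and k': "a \<diamondop> k' = 0"
    and z: "z = k' + \<beta> *s a + \<zeta>1 *s c1 + \<zeta>2 *s c2" "\<zeta>1 \<noteq> 0" and zk: "z \<diamondop> k = m *s (a \<diamondop> a)"
  shows "m = 0"
proof (rule ccontr)
  assume m: "m \<noteq> 0"
  note L = frame_li4[OF f w]
  obtain \<xi>0 \<xi>1 \<xi>2 where xi: "z \<diamondop> c2 = \<xi>0 *s (a \<diamondop> a) + \<xi>1 *s (a \<diamondop> c1) + \<xi>2 *s (a \<diamondop> c2)"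
    using c2[of z] unfolding rank3_frameD(3)[OF f] span3 by blast
  have "z \<diamondop> c1 - \<zeta>1 *s (c1 \<diamondop> c1) \<in> range (mul a)"
  proof -
    note sR = subspace_range_mul[of a]
    have "k' \<diamondop> c1 + \<beta> *s (a \<diamondop> c1) + \<zeta>2 *s (c1 \<diamondop> c2) \<in> range (mul a)"
      by (intro subspace_add[OF sR] subspace_scale[OF sR] c2 kernel_mul_mem[OF f k'] rangeI)
    then show ?thesis by (simp add: z mul_simps mul_commute[of c2 c1])
  qed
  then obtain \<eta>0 \<eta>1 \<eta>2 where "z \<diamondop> c1 - \<zeta>1 *s (c1 \<diamondop> c1) = \<eta>0 *s (a \<diamondop> a) + \<eta>1 *s (a \<diamondop> c1) + \<eta>2 *s (a \<diamondop> c2)"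
    unfolding rank3_frameD(3)[OF f] span3 by blast
  then have zc1: "z \<diamondop> c1 = \<zeta>1 *s (c1 \<diamondop> c1) + (\<eta>0 *s (a \<diamondop> a) + \<eta>1 *s (a \<diamondop> c1) + \<eta>2 *s (a \<diamondop> c2))"
    by (metis add_diff_cancel_left' diff_add_cancel add.commute)
  have za: "z \<diamondop> a = \<beta> *s (a \<diamondop> a) + \<zeta>1 *s (a \<diamondop> c1) + \<zeta>2 *s (a \<diamondop> c2)"
    using k' by (simp add: z mul_simps mul_commute[of k' a] mul_commute[of c1 a] mul_commute[of c2 a])
  \<comment> \<open>Chosen so that the determinant of the two equations for q and s below, \<zeta>1
    (t + \<xi>2) - \<zeta>2 \<xi>1, is 1.\<close>
  define t where "t = (1 + \<zeta>2 * \<xi>1) / \<zeta>1 - \<xi>2"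
  have t: "\<zeta>1 * (t + \<xi>2) - \<zeta>2 * \<xi>1 = 1" using z(2) by (simp add: t_def field_simps)
  define y where "y = z + t *s a"
  have yk: "y \<diamondop> k = m *s (a \<diamondop> a)" using k by (simp add: y_def mul_simps zk)
  have "li [a \<diamondop> a, y \<diamondop> a, y \<diamondop> c1, y \<diamondop> c2]"
    unfolding li4
  proof (intro allI impI)
    fix p q r s assume "p *s a \<diamondop> a + q *s y \<diamondop> a + r *s y \<diamondop> c1 + s *s y \<diamondop> c2 = 0"
    then have "(r * \<zeta>1) *s (c1 \<diamondop> c1) + (p + q * (\<beta> + t) + r * \<eta>0 + s * \<xi>0) *s (a \<diamondop> a)
        + (q * \<zeta>1 + r * (\<eta>1 + t) + s * \<xi>1) *s (a \<diamondop> c1) + (q * \<zeta>2 + r * \<eta>2 + s * (\<xi>2 + t)) *s (a \<diamondop> c2) = 0"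
      by (simp add: y_def mul_simps xi za zc1 algebra_simps)
    from L[OF this] have e: "r = 0" "p + q * (\<beta> + t) + s * \<xi>0 = 0" "q * \<zeta>1 + s * \<xi>1 = 0" "q * \<zeta>2 + s * (\<xi>2 + t) = 0"
      using z(2) by auto
    have "s = s * (\<zeta>1 * (t + \<xi>2) - \<zeta>2 * \<xi>1)" using t by simp
    also have "\<dots> = \<zeta>1 * (q * \<zeta>2 + s * (\<xi>2 + t)) - \<zeta>2 * (q * \<zeta>1 + s * \<xi>1)" by (simp add: algebra_simps)
    finally have "s = 0" using e by simp
    with e z(2) show "p = 0 \<and> q = 0 \<and> r = 0 \<and> s = 0" by auto
  qed
  then have "li [y \<diamondop> k, y \<diamondop> a, y \<diamondop> c1, y \<diamondop> c2]" unfolding yk using m by (simp add: li_scale_Cons)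
  then show False by (rule no_rank_4)
qed

text \<open>With m nonzero, \<open>degenerate_rank4\<close> shows that x has no c1-component and
  that c1 k has a nonzero a c2-component. After normalization to c1 k1 = a d, the third and fourth
  chain conditions along c1 + t d, read as polynomials in t, give d k1 = 0; a further chain handles
  the kernel part of x, and x k = 0 follows.\<close>

lemma degenerate_no_e:
  assumes f: "rank3_frame a c1 c2" and w: "c1 \<diamondop> c1 \<notin> range (mul a)" and c2: "\<And>x. x \<diamondop> c2 \<in> range (mul a)"
    and k: "a \<diamondop> k = 0" and xk: "x \<diamondop> k = m *s (a \<diamondop> a)"
  shows "m = 0"
proof (rule ccontr)
  assume m: "m \<noteq> 0"
  note a = rank3_frameD(1)[OF f]
  note img = degenerate_kernel_image[OF f w c2 k]
  note r4 = degenerate_rank4[OF f w c2 k]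
  have Lf: "\<And>p q r. p *s (a \<diamondop> a) + q *s (a \<diamondop> c1) + r *s (a \<diamondop> c2) = 0 \<Longrightarrow> p = 0 \<and> q = 0 \<and> r = 0"
    using rank3_frameD(2)[OF f] unfolding li3 by blast
  obtain kx \<alpha>x \<zeta>x \<eta>x where x: "a \<diamondop> kx = 0" "x = kx + \<alpha>x *s a + \<zeta>x *s c1 + \<eta>x *s c2" by (rule frame_decomp[OF f])
  have zx: "\<zeta>x = 0" using r4[OF x _ xk] m by blast
  obtain \<mu>1 p1 where c1k: "c1 \<diamondop> k = a \<diamondop> (\<mu>1 *s a + p1 *s c2)" by (rule img)
  have p1: "p1 \<noteq> 0"
  proof
    assume p10: "p1 = 0"
    have *: "(c1 + t *s x) \<diamondop> k = (\<mu>1 + t * m) *s (a \<diamondop> a)" for t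
      by (simp add: mul_simps c1k p10 xk algebra_simps)
    have dec: "c1 + t *s x = (t *s kx) + (t * \<alpha>x) *s a + 1 *s c1 + (t * \<eta>x) *s c2" for t
      by (simp add: x(2) zx algebra_simps)
    have "a \<diamondop> (t *s kx) = 0" for t using x(1) by (simp add: mul_simps)
    from r4[OF this dec _ *, of 0] r4[OF this dec _ *, of 1] m show False by simp
  qed
  have pz: "q = 0" if y: "a \<diamondop> ky = 0" "y = ky + \<alpha> *s a + \<eta> *s c2" and yk: "y \<diamondop> k = a \<diamondop> (\<mu> *s a + q *s c2)" for y ky \<alpha> \<eta> \<mu> q
  proof (rule ccontr)
    assume q: "q \<noteq> 0"
    \<comment> \<open>This multiple of c1 cancels the a c2-component. The element obtained has
      c1-coefficient - s, so its coefficient at a a must vanish both for t = 0 and for t = 1; the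
      difference is m.\<close>
    define s where "s = q / p1"
    have *: "(y - s *s c1 + t *s x) \<diamondop> k = (\<mu> - s * \<mu>1 + t * m) *s (a \<diamondop> a)" for t
      using p1 by (simp add: mul_simps c1k yk xk s_def algebra_simps)
    have dec: "y - s *s c1 + t *s x = (ky + t *s kx) + (\<alpha> + t * \<alpha>x) *s a + (- s) *s c1 + (\<eta> + t * \<eta>x) *s c2" for t
      by (simp add: y(2) x(2) zx algebra_simps)
    have kk: "a \<diamondop> (ky + t *s kx) = 0" for t using x(1) y(1) by (simp add: mul_simps)
    have "- s \<noteq> 0" using q p1 by (simp add: s_def)
    from r4[OF kk dec this *, of 0] r4[OF kk dec this *, of 1] m show False by simp
  qed
  \<comment> \<open>The vectors k1 and d are chosen to turn c1 k = a (\<mu>1 a + p1 c2) into c1 k1 =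
    a d.\<close>
  define k1 where "k1 = inverse p1 *s k"
  define d where "d = c2 + (\<mu>1 / p1) *s a"
  have k1: "a \<diamondop> k1 = 0" using k by (simp add: k1_def mul_simps)
  have c1k1: "c1 \<diamondop> k1 = a \<diamondop> d" using p1 by (simp add: k1_def d_def mul_simps c1k divide_inverse algebra_simps)
  have fd: "rank3_frame a c1 d" using rank3_frame_add(1)[OF f, of "\<mu>1 / p1" 0] by (simp add: d_def)
  have Ld: "\<And>p q r. p *s (a \<diamondop> a) + q *s (a \<diamondop> c1) + r *s (a \<diamondop> d) = 0 \<Longrightarrow> p = 0 \<and> q = 0 \<and> r = 0"
    using rank3_frameD(2)[OF fd] unfolding li3 by blast
  have e0: "a \<diamondop> a \<noteq> 0" using rank3_frameD(2)[OF fd] by (auto simp: li_iff_independent dependent_zero)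
  note sR = subspace_range_mul[of a]
  have dR: "v \<diamondop> d \<in> range (mul a)" for v
    unfolding d_def mul_add_right mul_scale_right by (intro subspace_add[OF sR] subspace_scale[OF sR] c2 mul_a_mem)
  obtain \<mu>2 q2 where "c2 \<diamondop> k = a \<diamondop> (\<mu>2 *s a + q2 *s c2)" by (rule img)
  moreover from this have "q2 = 0" by (intro pz[of 0 c2 0 1]) auto
  ultimately have c2k: "c2 \<diamondop> k = \<mu>2 *s (a \<diamondop> a)" by (simp add: mul_simps)
  define n where "n = \<mu>2 / p1"
  have dk1: "d \<diamondop> k1 = n *s (a \<diamondop> a)"
    using k by (simp add: d_def k1_def n_def mul_simps c2k divide_inverse mult.commute)
  obtain \<gamma>0 \<gamma>1 \<gamma>2 where g: "c1 \<diamondop> d = \<gamma>0 *s (a \<diamondop> a) + \<gamma>1 *s (a \<diamondop> c1) + \<gamma>2 *s (a \<diamondop> d)"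
    using dR[of c1] unfolding rank3_frameD(3)[OF fd] span3 by blast
  obtain \<delta>0 \<delta>1 \<delta>2 where dd: "d \<diamondop> d = \<delta>0 *s (a \<diamondop> a) + \<delta>1 *s (a \<diamondop> c1) + \<delta>2 *s (a \<diamondop> d)"
    using dR[of d] unfolding rank3_frameD(3)[OF fd] span3 by blast
  have ca: "c1 \<diamondop> a = a \<diamondop> c1" "d \<diamondop> a = a \<diamondop> d" "d \<diamondop> c1 = c1 \<diamondop> d" by (simp_all add: mul_commute)
  have z1: "(c1 + t *s d) \<diamondop> k1 = a \<diamondop> (d + (t * n) *s a)" for t
    by (simp add: mul_simps c1k1 dk1 algebra_simps)
  have z2: "(c1 + t *s d) \<diamondop> (d + (t * n) *s a) =
      a \<diamondop> ((\<gamma>0 + t * \<delta>0) *s a + (\<gamma>1 + t * (\<delta>1 + n)) *s c1 + (\<gamma>2 + t * \<delta>2 + t * t * n) *s d)" for t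
    by (simp add: mul_simps g dd ca algebra_simps)
  have z3: "\<gamma>1 + t * (\<delta>1 + n) = 0" for t
  proof (rule coeff_zero_mod[OF w])
    let ?r = "(\<gamma>0 + t * \<delta>0) *s (c1 \<diamondop> a) + (\<gamma>2 + t * \<delta>2 + t * t * n) *s (c1 \<diamondop> d)
      + t *s (d \<diamondop> ((\<gamma>0 + t * \<delta>0) *s a + (\<gamma>1 + t * (\<delta>1 + n)) *s c1 + (\<gamma>2 + t * \<delta>2 + t * t * n) *s d))"
    show "?r \<in> range (mul a)"
    proof -
      have "v \<diamondop> d \<in> range (mul a) \<and> d \<diamondop> v \<in> range (mul a)" for v using dR[of v] by (simp add: mul_commute[of d])
      then show ?thesis by (intro subspace_add[OF sR] subspace_scale[OF sR] mul_a_mem) auto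
    qed
    have "(\<gamma>1 + t * (\<delta>1 + n)) *s (c1 \<diamondop> c1) + ?r = (c1 + t *s d) \<diamondop>
        ((\<gamma>0 + t * \<delta>0) *s a + (\<gamma>1 + t * (\<delta>1 + n)) *s c1 + (\<gamma>2 + t * \<delta>2 + t * t * n) *s d)"
      by (simp add: mul_simps scale_right_distrib add_ac mult_ac)
    then show "(\<gamma>1 + t * (\<delta>1 + n)) *s (c1 \<diamondop> c1) + ?r \<in> range (mul a)"
      using chain3[OF a k1 z1 z2, of t] by simp
  qed
  have g1: "\<gamma>1 = 0" and d1: "\<delta>1 = - n" using z3[of 0] z3[of 1] by (auto simp: add_eq_0_iff2)
  have z2: "(c1 + t *s d) \<diamondop> (d + (t * n) *s a) =
      a \<diamondop> ((\<gamma>0 + t * \<delta>0) *s a + (\<gamma>2 + t * \<delta>2 + t * t * n) *s d)" for t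
    using z2[of t] by (simp add: g1 d1)
  have n0: "n = 0"
  proof -
    have "\<exists>\<rho> \<sigma>. (c1 + t *s d) \<diamondop> ((\<gamma>0 + t * \<delta>0) *s a + (\<gamma>2 + t * \<delta>2 + t * t * n) *s d) =
        a \<diamondop> (\<rho> *s a + (\<gamma>0 + t * \<delta>0 - (\<gamma>2 + t * \<delta>2 + t * t * n) * (t * n)) *s c1 + \<sigma> *s d)" for t
      by (rule exI[of _ "(\<gamma>2 + t * \<delta>2 + t * t * n) * (\<gamma>0 + t * \<delta>0)"],
          rule exI[of _ "t * (\<gamma>0 + t * \<delta>0) + (\<gamma>2 + t * \<delta>2 + t * t * n) * (\<gamma>2 + t * \<delta>2)"])
        (simp add: mul_simps g dd ca g1 d1 algebra_simps, simp only: mult_2_right distrib_left scale_left_distrib)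
    then obtain \<rho> \<sigma> where z4: "\<And>t. (c1 + t *s d) \<diamondop> ((\<gamma>0 + t * \<delta>0) *s a + (\<gamma>2 + t * \<delta>2 + t * t * n) *s d) =
        a \<diamondop> (\<rho> t *s a + (\<gamma>0 + t * \<delta>0 - (\<gamma>2 + t * \<delta>2 + t * t * n) * (t * n)) *s c1 + \<sigma> t *s d)" by metis
    have coef: "\<gamma>0 + t * \<delta>0 - (\<gamma>2 + t * \<delta>2 + t * t * n) * (t * n) = 0" for t
    proof (rule coeff_zero_mod[OF w])
      let ?c = "\<gamma>0 + t * \<delta>0 - (\<gamma>2 + t * \<delta>2 + t * t * n) * (t * n)"
      let ?r = "\<rho> t *s (c1 \<diamondop> a) + \<sigma> t *s (c1 \<diamondop> d) + t *s (d \<diamondop> (\<rho> t *s a + ?c *s c1 + \<sigma> t *s d))"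
      show "?r \<in> range (mul a)"
      proof -
        have "v \<diamondop> d \<in> range (mul a) \<and> d \<diamondop> v \<in> range (mul a)" for v using dR[of v] by (simp add: mul_commute[of d])
        then show ?thesis by (intro subspace_add[OF sR] subspace_scale[OF sR] mul_a_mem) auto
      qed
      have "?c *s (c1 \<diamondop> c1) + ?r = (c1 + t *s d) \<diamondop> (\<rho> t *s a + ?c *s c1 + \<sigma> t *s d)"
        by (simp add: mul_simps scale_right_distrib add_ac mult_ac)
      then show "?c *s (c1 \<diamondop> c1) + ?r \<in> range (mul a)" using chain4[OF a k1 z1 z2 z4, of t] by simp
    qed
    \<comment> \<open>The fourth chain condition, multiplied by the nonzero vector a a; its cubic
      coefficient is the negative of the square of n.\<close>
    have "\<gamma>0 *s (a \<diamondop> a) + t *s ((\<delta>0 - \<gamma>2 * n) *s (a \<diamondop> a)) + t\<^sup>2 *s ((- (\<delta>2 * n)) *s (a \<diamondop> a))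
        + t ^ 3 *s ((- (n * n)) *s (a \<diamondop> a)) = 0" for t
    proof -
      have "\<gamma>0 *s (a \<diamondop> a) + t *s ((\<delta>0 - \<gamma>2 * n) *s (a \<diamondop> a)) + t\<^sup>2 *s ((- (\<delta>2 * n)) *s (a \<diamondop> a))
          + t ^ 3 *s ((- (n * n)) *s (a \<diamondop> a))
        = (\<gamma>0 + t * \<delta>0 - (\<gamma>2 + t * \<delta>2 + t * t * n) * (t * n)) *s (a \<diamondop> a)"
        by (simp add: algebra_simps power2_eq_square power3_eq_cube)
      also have "\<dots> = 0" using coef[of t] by simp
      finally show ?thesis .
    qed
    from cubic_coeffs_zero[OF this] e0 show ?thesis by simp
  qed
  have c2k0: "c2 \<diamondop> k = 0" using c2k n0 p1 by (simp add: n_def)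
  have kxk: "kx \<diamondop> k1 = 0"
  proof -
    obtain \<nu> q where q: "kx \<diamondop> k = a \<diamondop> (\<nu> *s a + q *s c2)" by (rule img)
    have "q = 0" by (rule pz[OF x(1) _ q, of 0 0]) simp
    then have q: "kx \<diamondop> k1 = (\<nu> / p1) *s (a \<diamondop> a)" using q by (simp add: k1_def mul_simps divide_inverse mult.commute)
    define \<nu>' where "\<nu>' = \<nu> / p1"
    obtain \<rho> \<sigma> where "c2 \<diamondop> kx = a \<diamondop> (\<rho> *s a + \<sigma> *s c2)" by (rule degenerate_kernel_image[OF f w c2 x(1)])
    then have kd: "kx \<diamondop> d = a \<diamondop> ((\<rho> - \<sigma> * (\<mu>1 / p1)) *s a + \<sigma> *s d)"
      using x(1) by (simp add: d_def mul_simps mul_commute[of kx] algebra_simps)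
    \<comment> \<open>A second chain, with the kernel part of x in place of t d; the c1-coefficient
      after two steps is the factor \<open>\<nu>'\<close> that has to vanish.\<close>
    have z1: "(c1 + kx) \<diamondop> k1 = a \<diamondop> (d + \<nu>' *s a)" using q by (simp add: mul_simps c1k1 \<nu>'_def)
    have z2: "(c1 + kx) \<diamondop> (d + \<nu>' *s a) = a \<diamondop> ((\<gamma>0 + \<rho> - \<sigma> * (\<mu>1 / p1)) *s a + \<nu>' *s c1 + (\<gamma>2 + \<sigma>) *s d)"
      using x(1) by (simp add: mul_add_left mul_add_right mul_scale_left mul_scale_right kd g g1 ca mul_commute[of kx a])
        (simp add: mul_simps algebra_simps)
    have "\<nu>' = 0"
    proof (rule coeff_zero_mod[OF w])
      let ?r = "(\<gamma>0 + \<rho> - \<sigma> * (\<mu>1 / p1)) *s (c1 \<diamondop> a) + (\<gamma>2 + \<sigma>) *s (c1 \<diamondop> d)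
        + kx \<diamondop> ((\<gamma>0 + \<rho> - \<sigma> * (\<mu>1 / p1)) *s a + \<nu>' *s c1 + (\<gamma>2 + \<sigma>) *s d)"
      show "?r \<in> range (mul a)"
        by (intro subspace_add[OF sR] subspace_scale[OF sR] mul_a_mem dR kernel_mul_mem[OF f x(1)])
      have "\<nu>' *s (c1 \<diamondop> c1) + ?r = (c1 + kx) \<diamondop> ((\<gamma>0 + \<rho> - \<sigma> * (\<mu>1 / p1)) *s a + \<nu>' *s c1 + (\<gamma>2 + \<sigma>) *s d)"
        by (simp add: mul_add_left mul_add_right[of c1] mul_scale_right[of c1] add_ac)
      then show "\<nu>' *s (c1 \<diamondop> c1) + ?r \<in> range (mul a)" using chain3[OF a k1 z1 z2] by simp
    qed
    then show ?thesis using q by (simp add: \<nu>'_def)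
  qed
  have "x \<diamondop> k1 = 0"
    using k1 c2k0 kxk by (simp add: x(2) zx mul_simps) (simp add: k1_def mul_simps)
  then have "x \<diamondop> k = 0" using p1 by (simp add: k1_def mul_simps)
  with xk m e0 show False by simp
qed

text \<open>If ker a does not annihilate V, one product x0 k0 = p0 (a d) serves to cancel the a
  d-component of any other product with ker a; the rest is a multiple of a a, zero by
  \<open>degenerate_no_e\<close>. So V multiplies ker a into the line of a d. By
  \<open>rank_violation\<close> the same holds for d, and ker a + <d> has codimension at most
  2.\<close>

lemma small_of_degenerate_form:
  assumes f: "rank3_frame a c1 c2" and w: "c1 \<diamondop> c1 \<notin> range (mul a)" and c2: "\<And>x. x \<diamondop> c2 \<in> range (mul a)"
    and W: "perfect W"
  shows "small W"
proof (cases "\<forall>k x. a \<diamondop> k = 0 \<longrightarrow> x \<diamondop> k = 0")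
  case True
  then have "span ({k. a \<diamondop> k = 0} \<union> {a, c1, c2}) \<subseteq> span ({u. \<forall>x. x \<diamondop> u = 0} \<union> {a, c1, c2})"
    by (intro span_mono) auto
  with rank3_frameD(4)[OF f] show ?thesis by (intro small_of_annihilator3[OF _ W]) blast
next
  case False
  then obtain k0 x0 where k0: "a \<diamondop> k0 = 0" "x0 \<diamondop> k0 \<noteq> 0" by blast
  note sR = subspace_range_mul[of a]
  obtain \<mu>0 p0 where xk0: "x0 \<diamondop> k0 = a \<diamondop> (\<mu>0 *s a + p0 *s c2)" by (rule degenerate_kernel_image[OF f w c2 k0(1)])
  have p0: "p0 \<noteq> 0"
  proof
    assume "p0 = 0"
    then have "x0 \<diamondop> k0 = \<mu>0 *s (a \<diamondop> a)" using xk0 by (simp add: mul_simps)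
    from degenerate_no_e[OF f w c2 k0(1) this] this k0(2) show False by simp
  qed
  define d where "d = c2 + (\<mu>0 / p0) *s a"
  have fd: "rank3_frame a c1 d" using rank3_frame_add(1)[OF f, of "\<mu>0 / p0" 0] by (simp add: d_def)
  have dR: "v \<diamondop> d \<in> range (mul a)" for v
    unfolding d_def mul_add_right mul_scale_right by (intro subspace_add[OF sR] subspace_scale[OF sR] c2 mul_a_mem)
  note img = degenerate_kernel_image[OF fd w dR] and no_e = degenerate_no_e[OF fd w dR]
  have xk0: "x0 \<diamondop> k0 = p0 *s (a \<diamondop> d)" using p0 by (simp add: xk0 d_def mul_simps algebra_simps)
  define D where "D x k m \<longleftrightarrow> (\<exists>p. x \<diamondop> k = m *s (a \<diamondop> a) + p *s (a \<diamondop> d))" for x k m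
  have D0: "m = 0" if k: "a \<diamondop> k = 0" and xk: "x0 \<diamondop> k = m *s (a \<diamondop> a) + p *s (a \<diamondop> d)" for k m p
  proof -
    have "x0 \<diamondop> (k - (p / p0) *s k0) = m *s (a \<diamondop> a)" using p0 by (simp add: mul_simps xk xk0)
    moreover have "a \<diamondop> (k - (p / p0) *s k0) = 0" using k k0 by (simp add: mul_simps)
    ultimately show ?thesis using no_e by blast
  qed
  have D1: "m = 0" if xk: "x \<diamondop> k0 = m *s (a \<diamondop> a) + p *s (a \<diamondop> d)" for x m p
  proof -
    have "(x - (p / p0) *s x0) \<diamondop> k0 = m *s (a \<diamondop> a)" using p0 by (simp add: mul_simps xk xk0)
    then show ?thesis using no_e[OF k0(1)] by blast
  qed
  have line: "x \<diamondop> k \<in> span {a \<diamondop> d}" if k: "a \<diamondop> k = 0" for x k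
  proof -
    obtain m p where xk: "x \<diamondop> k = a \<diamondop> (m *s a + p *s d)" by (rule img[OF k])
    obtain m' p' where x0k: "x0 \<diamondop> k = a \<diamondop> (m' *s a + p' *s d)" by (rule img[OF k])
    then have "x0 \<diamondop> k = m' *s (a \<diamondop> a) + p' *s (a \<diamondop> d)" by (simp add: mul_simps)
    from D0[OF k this] this have x0k: "x0 \<diamondop> k = p' *s (a \<diamondop> d)" by simp
    obtain m'' p'' where xk0': "x \<diamondop> k0 = a \<diamondop> (m'' *s a + p'' *s d)" by (rule img[OF k0(1)])
    then have "x \<diamondop> k0 = m'' *s (a \<diamondop> a) + p'' *s (a \<diamondop> d)" by (simp add: mul_simps)
    from D1[OF this] this have xk0': "x \<diamondop> k0 = p'' *s (a \<diamondop> d)" by simp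
    \<comment> \<open>Adding u k0 makes the a d-coefficient of x0 (k + u k0) nonzero, so that s can
      then remove the one of x (k + u k0).\<close>
    define u where "u = (if p' = 0 then 1 else 0 :: 'a)"
    have P: "p' + u * p0 \<noteq> 0" using p0 by (simp add: u_def)
    define s where "s = (p + u * p'') / (p' + u * p0)"
    have e: "(x - s *s x0) \<diamondop> (k + u *s k0) = m *s (a \<diamondop> a) + (p + u * p'' - s * (p' + u * p0)) *s (a \<diamondop> d)"
      by (simp add: mul_simps xk x0k xk0 xk0' algebra_simps)
    have "p + u * p'' - s * (p' + u * p0) = 0" using P by (simp add: s_def)
    with e have "(x - s *s x0) \<diamondop> (k + u *s k0) = m *s (a \<diamondop> a)" by simp
    moreover have "a \<diamondop> (k + u *s k0) = 0" using k k0 by (simp add: mul_simps)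
    ultimately have "m = 0" using no_e by blast
    then have "x \<diamondop> k = p *s (a \<diamondop> d)" using xk by (simp add: mul_simps)
    then show ?thesis unfolding span1 by blast
  qed
  have nli: "\<not> li [a \<diamondop> d, z \<diamondop> y1, z \<diamondop> y2, z \<diamondop> y3]" for z y1 y2 y3
  proof
    assume L: "li [a \<diamondop> d, z \<diamondop> y1, z \<diamondop> y2, z \<diamondop> y3]"
    from line[OF k0(1), of z] obtain l where "z \<diamondop> k0 = l *s (a \<diamondop> d)" by (auto simp: span_singleton)
    from rank_violation[OF L this xk0 p0] show False .
  qed
  note L = frame_li4[OF fd w]
  obtain \<gamma>0 \<gamma>1 \<gamma>2 where g: "c1 \<diamondop> d = \<gamma>0 *s (a \<diamondop> a) + \<gamma>1 *s (a \<diamondop> c1) + \<gamma>2 *s (a \<diamondop> d)"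
    using dR[of c1] unfolding rank3_frameD(3)[OF fd] span3 by blast
  obtain \<delta>0 \<delta>1 \<delta>2 where dd: "d \<diamondop> d = \<delta>0 *s (a \<diamondop> a) + \<delta>1 *s (a \<diamondop> c1) + \<delta>2 *s (a \<diamondop> d)"
    using dR[of d] unfolding rank3_frameD(3)[OF fd] span3 by blast
  have ca: "c1 \<diamondop> a = a \<diamondop> c1" "d \<diamondop> a = a \<diamondop> d" "d \<diamondop> c1 = c1 \<diamondop> d" by (simp_all add: mul_commute)
  \<comment> \<open>For z = c1 + \<zeta> d + \<alpha> a the vectors a d, z a, z c1, z d are
    dependent, which forces this determinant condition. Four choices of (\<alpha>, \<zeta>) make all
    four constants zero.\<close>
  have proportional: "\<alpha> * (\<gamma>1 + \<zeta> * \<delta>1) = \<gamma>0 + \<zeta> * \<delta>0" for \<alpha> \<zeta>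
  proof (rule ccontr)
    assume ne: "\<alpha> * (\<gamma>1 + \<zeta> * \<delta>1) \<noteq> \<gamma>0 + \<zeta> * \<delta>0"
    let ?z = "c1 + \<zeta> *s d + \<alpha> *s a"
    have "li [a \<diamondop> d, ?z \<diamondop> a, ?z \<diamondop> c1, ?z \<diamondop> d]"
      unfolding li4
    proof (intro allI impI)
      fix p q r s assume "p *s a \<diamondop> d + q *s ?z \<diamondop> a + r *s ?z \<diamondop> c1 + s *s ?z \<diamondop> d = 0"
      then have "r *s (c1 \<diamondop> c1) + (q * \<alpha> + r * \<zeta> * \<gamma>0 + s * (\<gamma>0 + \<zeta> * \<delta>0)) *s (a \<diamondop> a)
          + (q + r * (\<alpha> + \<zeta> * \<gamma>1) + s * (\<gamma>1 + \<zeta> * \<delta>1)) *s (a \<diamondop> c1)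
          + (p + q * \<zeta> + r * \<zeta> * \<gamma>2 + s * (\<alpha> + \<gamma>2 + \<zeta> * \<delta>2)) *s (a \<diamondop> d) = 0"
        by (simp add: mul_simps g dd ca algebra_simps)
      from L[OF this] have e: "r = 0" "q * \<alpha> + s * (\<gamma>0 + \<zeta> * \<delta>0) = 0" "q + s * (\<gamma>1 + \<zeta> * \<delta>1) = 0"
        "p + q * \<zeta> + s * (\<alpha> + \<gamma>2 + \<zeta> * \<delta>2) = 0" by auto
      have "s * (\<alpha> * (\<gamma>1 + \<zeta> * \<delta>1) - (\<gamma>0 + \<zeta> * \<delta>0))
          = \<alpha> * (q + s * (\<gamma>1 + \<zeta> * \<delta>1)) - (q * \<alpha> + s * (\<gamma>0 + \<zeta> * \<delta>0))" by (simp add: algebra_simps)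
      also have "\<dots> = 0" using e by simp
      finally have "s = 0" using ne by simp
      with e show "p = 0 \<and> q = 0 \<and> r = 0 \<and> s = 0" by simp
    qed
    with nli show False by blast
  qed
  have "\<gamma>0 = 0" using proportional[of 0 0] by simp
  moreover have "\<gamma>1 = 0" using proportional[of 1 0] \<open>\<gamma>0 = 0\<close> by simp
  moreover have "\<delta>0 = 0" using proportional[of 0 1] \<open>\<gamma>0 = 0\<close> by simp
  moreover have "\<delta>1 = 0" using proportional[of 1 1] \<open>\<gamma>0 = 0\<close> \<open>\<gamma>1 = 0\<close> \<open>\<delta>0 = 0\<close> by simp
  ultimately have gd: "c1 \<diamondop> d = \<gamma>2 *s (a \<diamondop> d)" "d \<diamondop> d = \<delta>2 *s (a \<diamondop> d)" using g dd by simp_all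
  have xd: "x \<diamondop> d \<in> span {a \<diamondop> d}" for x
  proof -
    have "d \<diamondop> x \<in> span {a \<diamondop> d}"
    proof (rule mul_mem_span)
      show "x \<in> span ({k. a \<diamondop> k = 0} \<union> {a, c1, d})" using rank3_frameD(4)[OF fd] by blast
      fix s assume "s \<in> {k. a \<diamondop> k = 0} \<union> {a, c1, d}"
      then show "d \<diamondop> s \<in> span {a \<diamondop> d}" using line[of s d] gd ca by (auto simp: span_base span_scale)
    qed simp
    then show ?thesis by (simp add: mul_commute)
  qed
  let ?U = "span ({k. a \<diamondop> k = 0} \<union> {d})"
  have line': "x \<diamondop> u \<in> span {a \<diamondop> d}" if "u \<in> ?U" for x u
    using that by (rule mul_mem_span) (use line xd in auto)
  have "{k. a \<diamondop> k = 0} \<union> {a, c1, d} \<subseteq> span (?U \<union> {a, c1})" by (auto intro: span_base)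
  from span_minimal[OF this subspace_span] rank3_frameD(4)[OF fd] have "UNIV \<subseteq> span (?U \<union> {a, c1})" by blast
  from small_of_line2[OF subspace_span this line' W] show ?thesis .
qed

text \<open>If no frame has d1 d1 and d1 d2 independent modulo the range, the form takes values in
  one line modulo the range. Unless it vanishes, it can be diagonalized with d1 d in the range and d
  d congruent to D times d1 d1; then D separates the nondegenerate from the degenerate case.\<close>

lemma small_of_rank3:
  assumes f: "rank3_frame a c1 c2" and W: "perfect W"
  shows "small W"
proof -
  let ?R = "range (mul a)"
  note sR = subspace_range_mul[of a]
  note R = subspace_add[OF sR] subspace_diff[OF sR] subspace_scale[OF sR]
  show ?thesis
  proof (cases "\<exists>d1 d2. rank3_frame a d1 d2 \<and> (\<forall>\<alpha> \<beta>. \<alpha> *s (d1 \<diamondop> d1) + \<beta> *s (d1 \<diamondop> d2) \<in> ?R \<longrightarrow> \<alpha> = 0 \<and> \<beta> = 0)")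
    case True
    then show ?thesis using small_of_form_rank2[OF _ _ W] by blast
  next
    case False
    then have dep: "\<exists>\<alpha> \<beta>. \<alpha> *s (d1 \<diamondop> d1) + \<beta> *s (d1 \<diamondop> d2) \<in> ?R \<and> (\<alpha> \<noteq> 0 \<or> \<beta> \<noteq> 0)" if "rank3_frame a d1 d2" for d1 d2
      using that by blast
    show ?thesis
    proof (cases "c1 \<diamondop> c1 \<in> ?R \<and> c2 \<diamondop> c2 \<in> ?R \<and> (c1 + c2) \<diamondop> (c1 + c2) \<in> ?R")
      case True
      then have "(c1 + c2) \<diamondop> (c1 + c2) - c1 \<diamondop> c1 - c2 \<diamondop> c2 \<in> ?R" by (intro R) auto
      then have "inverse 2 *s (c1 \<diamondop> c2 + c1 \<diamondop> c2) \<in> ?R" 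
        by (intro R(3)) (simp add: mul_simps mul_commute[of c2 c1])
      moreover have "inverse 2 *s (c1 \<diamondop> c2 + c1 \<diamondop> c2) = c1 \<diamondop> c2"
      proof -
        have "inverse 2 *s (c1 \<diamondop> c2 + c1 \<diamondop> c2) = (inverse 2 + inverse 2) *s (c1 \<diamondop> c2)"
          by (simp only: scale_right_distrib scale_left_distrib)
        also have "inverse 2 + inverse 2 = (1::'a)" using char_not_2 by (simp add: field_simps)
        finally show ?thesis by simp
      qed
      ultimately have c12: "c1 \<diamondop> c2 \<in> ?R" "c2 \<diamondop> c1 \<in> ?R" by (simp_all add: mul_commute)
      have "x \<diamondop> y \<in> ?R" for x y
      proof (rule products_mem[OF rank3_frameD(1)[OF f] _ sR])
        fix c d assume "c \<in> set [a, c1, c2]" "d \<in> set [a, c1, c2]"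
        then show "c \<diamondop> d \<in> ?R" using True c12 mul_a_mem unfolding list.set by (elim insertE emptyE) simp_all
      qed simp
      then have "x \<diamondop> y \<in> span {a \<diamondop> a, a \<diamondop> c1, a \<diamondop> c2}" for x y unfolding rank3_frameD(3)[OF f, symmetric] .
      then show ?thesis by (rule small_of_products[OF _ W])
    next
      case False
      then obtain d1 d2 where fd: "rank3_frame a d1 d2" and w: "d1 \<diamondop> d1 \<notin> ?R"
        using f rank3_frame_add(2,3)[OF f] by blast
      have w0: "\<alpha> = 0" if "\<alpha> *s (d1 \<diamondop> d1) \<in> ?R" for \<alpha>
        using coeff_zero_mod[OF w, of \<alpha> 0] that subspace_0[OF sR] by simp
      from dep[OF fd] obtain \<alpha> \<beta> where ab: "\<alpha> *s (d1 \<diamondop> d1) + \<beta> *s (d1 \<diamondop> d2) \<in> ?R" "\<alpha> \<noteq> 0 \<or> \<beta> \<noteq> 0" by blast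
      have b: "\<beta> \<noteq> 0" using ab w0[of \<alpha>] by auto
      define d where "d = d2 + (\<alpha> / \<beta>) *s d1"
      have fd: "rank3_frame a d1 d" using rank3_frame_add(1)[OF fd, of 0 "\<alpha> / \<beta>"] by (simp add: d_def)
      have "d1 \<diamondop> d = inverse \<beta> *s (\<alpha> *s (d1 \<diamondop> d1) + \<beta> *s (d1 \<diamondop> d2))"
        using b by (simp add: d_def mul_simps divide_inverse algebra_simps)
      then have d1d: "d1 \<diamondop> d \<in> ?R" using R(3)[OF ab(1)] by simp
      \<comment> \<open>In the sheared frame (d1 + d, d) the mixed products drop out modulo the
        range, so the dependence relates d1 d1 and d d.\<close>
      from dep[OF rank3_frame_add(3)[OF fd]] obtain \<rho> \<sigma> where
        rs: "\<rho> *s ((d1 + d) \<diamondop> (d1 + d)) + \<sigma> *s ((d1 + d) \<diamondop> d) \<in> ?R" "\<rho> \<noteq> 0 \<or> \<sigma> \<noteq> 0" by blast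
      have "\<rho> *s ((d1 + d) \<diamondop> (d1 + d)) + \<sigma> *s ((d1 + d) \<diamondop> d) - (\<rho> + \<rho> + \<sigma>) *s (d1 \<diamondop> d) \<in> ?R"
        by (intro R rs d1d)
      moreover have "\<rho> *s ((d1 + d) \<diamondop> (d1 + d)) + \<sigma> *s ((d1 + d) \<diamondop> d) - (\<rho> + \<rho> + \<sigma>) *s (d1 \<diamondop> d)
          = \<rho> *s (d1 \<diamondop> d1) + (\<rho> + \<sigma>) *s (d \<diamondop> d)" by (simp add: mul_simps mul_commute[of d d1] algebra_simps)
          (simp only: mult_2_right scale_left_distrib)
      ultimately have rs': "\<rho> *s (d1 \<diamondop> d1) + (\<rho> + \<sigma>) *s (d \<diamondop> d) \<in> ?R" by simp
      have nz: "\<rho> + \<sigma> \<noteq> 0"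
      proof
        assume z: "\<rho> + \<sigma> = 0"
        then have "\<rho> = 0" using rs' w0[of \<rho>] by simp
        with z rs(2) show False by simp
      qed
      define D where "D = - \<rho> / (\<rho> + \<sigma>)"
      have "d \<diamondop> d - D *s (d1 \<diamondop> d1) = inverse (\<rho> + \<sigma>) *s (\<rho> *s (d1 \<diamondop> d1) + (\<rho> + \<sigma>) *s (d \<diamondop> d))"
        using nz by (simp add: D_def scale_right_distrib divide_inverse mult.commute)
      then have DD: "d \<diamondop> d - D *s (d1 \<diamondop> d1) \<in> ?R" using R(3)[OF rs'] by simp
      show ?thesis
      proof (cases "D = 0")
        case False
        from small_of_nondegenerate_form[OF fd w d1d DD False W] show ?thesis .
      next
        case True
        have "x \<diamondop> d \<in> ?R" for x
        proof -
          have "d \<diamondop> x \<in> ?R"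
          proof (rule mul_mem_span)
            show "x \<in> span ({k. a \<diamondop> k = 0} \<union> {a, d1, d})" using rank3_frameD(4)[OF fd] by blast
            fix s assume "s \<in> {k. a \<diamondop> k = 0} \<union> {a, d1, d}"
            then consider "a \<diamondop> s = 0" | "s = a" | "s = d1" | "s = d" by blast
            then show "d \<diamondop> s \<in> ?R"
            proof cases
              case 1
              then show ?thesis using kernel_mul_mem[OF fd 1, of d] by (simp add: mul_commute[of d])
            next
              case 2
              then show ?thesis using mul_a_mem(1) by simp
            next
              case 3
              then show ?thesis using d1d by (simp add: mul_commute[of d])
            next
              case 4
              then show ?thesis using DD True by simp
            qed
          qed (rule sR)
          then show ?thesis by (simp add: mul_commute)
        qed
        from small_of_degenerate_form[OF fd w this W] show ?thesis .
      qed
    qed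
  qed
qed

theorem perfect_small:
  assumes W: "perfect W" shows "small W"
proof (cases "\<exists>x y. x \<diamondop> y \<noteq> 0")
  case False
  then have "x \<diamondop> y \<in> span {0, 0, 0}" for x y using span_zero by auto
  then show ?thesis by (rule small_of_products[OF _ W])
next
  case True
  from ex_max_rank_square[OF True] obtain a cs where a: "max_rank a cs" "a \<diamondop> a \<noteq> 0" by blast
  note sR = subspace_range_mul[of a]
  have tr: "max_rank a ds" if "li (map (mul a) ds)" "length ds = length cs" for ds
    by (rule max_rank_transfer[OF a(1) that])
  have l1: "li (map (mul a) [a])" using a(2) by (simp add: li1)
  have len0: "length cs \<noteq> 0"
  proof
    assume "length cs = 0"
    then have "range (mul a) = {0}" using max_rank_range[OF a(1)] by simp
    with a(2) show False by blast
  qed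
  show ?thesis
  proof (cases "length cs = 1")
    case True
    then have m: "max_rank a [a]" by (intro tr l1) simp
    have "x \<diamondop> y \<in> range (mul a)" for x y by (rule products_mem[OF m _ sR]) auto
    then have "x \<diamondop> y \<in> span {a \<diamondop> a, a \<diamondop> a, a \<diamondop> a}" for x y using max_rank_range[OF m] by simp
    then show ?thesis by (rule small_of_products[OF _ W])
  next
    case False
    with len0 have len: "length [a] < length cs" by (cases cs) auto
    from max_rank_extend[OF a(1) l1 len] obtain c where c: "li (map (mul a) [c, a])" by auto
    show ?thesis
    proof (cases "length cs = 2")
      case True
      then have m: "max_rank a [c, a]" by (intro tr c) simp
      let ?S = "span {c \<diamondop> c, a \<diamondop> c, a \<diamondop> a}"
      have RS: "range (mul a) \<subseteq> ?S" unfolding max_rank_range[OF m] by (intro span_mono) auto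
      have aS: "v \<diamondop> a \<in> ?S" "a \<diamondop> v \<in> ?S" for v using RS mul_a_mem by blast+
      have cS: "c \<diamondop> c \<in> ?S" by (simp add: span_base)
      have "x \<diamondop> y \<in> ?S" for x y
      proof (rule products_mem[OF m RS subspace_span])
        fix u v assume "u \<in> set [c, a]" "v \<in> set [c, a]"
        then show "u \<diamondop> v \<in> ?S" using aS cS unfolding list.set by (elim insertE emptyE) simp_all
      qed
      then show ?thesis by (rule small_of_products[OF _ W])
    next
      case F: False
      with False len0 max_rank_length[OF a(1)] have len3: "length cs = 3" by arith
      then have "length [c, a] < length cs" by simp
      from max_rank_extend[OF a(1) c this] obtain d where d: "li (map (mul a) [d, c, a])" by auto
      then have "li (map (mul a) [a, c, d])" by (auto simp: li_iff_independent insert_commute)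
      then have "rank3_frame a c d" unfolding rank3_frame_def using len3 by (intro tr) simp_all
      from small_of_rank3[OF this W] show ?thesis .
    qed
  qed
qed

end

section \<open>Adapted bases\<close>

context vec_sp
begin

lemma li_of_finite_independent:
  assumes "independent B" "finite B" obtains vs where "li vs" "set vs = B" "length vs = card B"
proof -
  obtain vs where "set vs = B" "distinct vs" using finite_distinct_list[OF assms(2)] by blast
  with assms that show ?thesis by (metis li_iff_independent distinct_card)
qed

lemma li_extend:
  assumes vs: "li vs" "set vs \<subseteq> span (set es)" and Z: "Z \<subseteq> span (set es)"
  obtains us where "li (us @ vs)" "set us \<subseteq> Z" "set vs \<union> Z \<subseteq> span (set us \<union> set vs)"
proof -
  have "independent (set vs)" using vs by (simp add: li_iff_independent)
  from maximal_independent_subset_extend[OF _ this, of "set vs \<union> Z"]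
  obtain B where B: "set vs \<subseteq> B" "B \<subseteq> set vs \<union> Z" "independent B" "set vs \<union> Z \<subseteq> span B" by blast
  have "finite B" using independent_span_bound[of "set es" B] B vs Z by blast
  then obtain us where us: "set us = B - set vs" "distinct us" using finite_distinct_list[of "B - set vs"] by auto
  then have "set us \<union> set vs = B" using B by blast
  moreover have "li (us @ vs)" using us vs B \<open>set us \<union> set vs = B\<close> by (auto simp: li_iff_independent)
  ultimately show ?thesis using that[of us] us B by auto
qed

end

context comm_alg
begin

lemma frame3_linear:
  assumes "frame3 W p1 p2 p3 s t"
  shows "s (x + y) = s x + s y" "t (x + y) = t x + t y" "s (c *s x) = c * s x" "t (c *s x) = c * t x"
    "s (x - y) = s x - s y" "t (x - y) = t x - t y"
proof -
  interpret s: Vector_Spaces.linear scale "(*)" s using assms by (simp add: frame3_def)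
  interpret t: Vector_Spaces.linear scale "(*)" t using assms by (simp add: frame3_def)
  show "s (x + y) = s x + s y" "t (x + y) = t x + t y" "s (c *s x) = c * s x" "t (c *s x) = c * t x"
    "s (x - y) = s x - s y" "t (x - y) = t x - t y"
    by (rule s.add t.add s.scale t.scale s.diff t.diff)+
qed

primrec lower_series :: "'b set \<Rightarrow> nat \<Rightarrow> 'b set" where
  "lower_series E 0 = E"
| "lower_series E (Suc k) = products (lower_series E k)"

end

text \<open>The properties \<open>perfect_imp_small\<close> and \<open>perfect_star\<close> are
  assumptions because they are proved over an infinite extension and then carried down to a field
  that may be finite. \<open>representative\<close> reduces the action of an arbitrary vector to one
  in the span of \<open>es\<close>.\<close>

locale quad_alg = nilp_alg scale mul
  for scale :: "'a::field \<Rightarrow> 'b::ab_group_add \<Rightarrow> 'b" (infixr "*s" 75)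
    and mul :: "'b \<Rightarrow> 'b \<Rightarrow> 'b" (infixl "\<diamondop>" 80) +
  fixes es :: "'b list"
  assumes li_es: "li es"
    and mul_mem: "x \<diamondop> y \<in> span (set es)"
    and representative: "\<exists>x'\<in>span (set es). \<forall>y. x \<diamondop> y = x' \<diamondop> y"
    and char2_alt: "(2::'a) = 0 \<Longrightarrow> x \<diamondop> x = 0"
    and perfect_imp_small: "perfect W \<Longrightarrow> small W"
    and perfect_star: "perfect W \<Longrightarrow> w \<in> W \<Longrightarrow>
      x \<diamondop> (x \<diamondop> (y \<diamondop> w)) + x \<diamondop> (y \<diamondop> (x \<diamondop> w)) + y \<diamondop> (x \<diamondop> (x \<diamondop> w)) = 0"
begin

definition E where "E = span (set es)"

definition basis_of_E :: "'b list \<Rightarrow> bool" where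
  "basis_of_E ts \<longleftrightarrow> li ts \<and> set ts \<subseteq> E \<and> length ts = length es"

lemma basis_of_EI:
  assumes "li ts" "set ts \<subseteq> E" "E \<subseteq> span (set ts)" shows "basis_of_E ts"
proof -
  have "set es \<subseteq> span (set ts)" using assms(3) span_superset[of "set es"] unfolding E_def by blast
  from li_length_le[OF li_es this] li_length_le[OF assms(1), of es] assms(2)
  show ?thesis by (simp add: basis_of_E_def E_def assms(1))
qed

lemma subspace_E: "subspace E" and mul_E: "x \<diamondop> y \<in> E"
  using mul_mem by (simp_all add: E_def)

lemma lower_series_subspace: "subspace (lower_series E k)"
  by (cases k) (simp_all add: subspace_E subspace_products)

lemma lower_series_decreasing: "lower_series E (Suc k) \<subseteq> lower_series E k"
proof (induction k)
  case 0
  show ?case using products_least[of E E] mul_E subspace_E by auto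
next
  case (Suc k)
  then show ?case using products_mono by auto
qed

lemma lower_series_subset_E: "lower_series E k \<subseteq> E"
  by (induction k) (use lower_series_decreasing in auto)

lemma lower_series_stable: "\<exists>m. perfect (lower_series E m)"
proof -
  define d where "d k = dim (lower_series E k)" for k
  obtain m where m: "\<And>k. d m \<le> d k" using ex_has_least_nat[of "\<lambda>_. True" 0 d] by auto
  let ?S = "lower_series E m" and ?T = "lower_series E (Suc m)"
  obtain B where B: "B \<subseteq> ?T" "independent B" "?T \<subseteq> span B" "card B = dim ?T" using basis_exists by blast
  obtain B' where B': "B' \<subseteq> ?S" "independent B'" "?S \<subseteq> span B'" "card B' = dim ?S" using basis_exists by blast
  have fin: "finite B" "finite B'"
    using independent_span_bound[OF _ B(2), of "set es"] independent_span_bound[OF _ B'(2), of "set es"]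
      B(1) B'(1) lower_series_subset_E[of m] lower_series_subset_E[of "Suc m"] unfolding E_def by auto
  obtain vs where vs: "li vs" "set vs = B" "length vs = card B" by (rule li_of_finite_independent[OF B(2) fin(1)])
  obtain us where us: "li us" "set us = B'" "length us = card B'" by (rule li_of_finite_independent[OF B'(2) fin(2)])
  have "span (set us) \<subseteq> span (set vs)"
  proof (rule li_span_full[OF vs(1)])
    show "set vs \<subseteq> span (set us)" using vs us B B' lower_series_decreasing[of m] by blast
    show "length us \<le> length vs" using m[of "Suc m"] vs us B(4) B'(4) by (simp add: d_def)
  qed
  then have "?S \<subseteq> ?T" using us vs B' span_minimal[OF B(1) lower_series_subspace] by blast
  then have "products ?S = ?S" using lower_series_decreasing[of m] by auto
  then show ?thesis unfolding perfect_def using lower_series_subspace by blast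
qed

text \<open>The basis grows from the bottom of the series upwards, new vectors being put in front: a
  product with a vector of one term of the series lies in the next term, which the later entries
  span.\<close>

lemma triangular_basis:
  assumes zero: "lower_series E m = {0}"
  shows "\<exists>ts. basis_of_E ts \<and> (\<forall>j<length ts. \<forall>x. x \<diamondop> ts ! j \<in> span (set (drop (Suc j) ts)))"
proof -
  have "k \<le> m \<Longrightarrow> \<exists>ts. li ts \<and> set ts \<subseteq> lower_series E (m - k) \<and> lower_series E (m - k) \<subseteq> span (set ts) \<and>
      (\<forall>j<length ts. \<forall>x. x \<diamondop> ts ! j \<in> span (set (drop (Suc j) ts)))" for k
  proof (induction k)
    case 0
    show ?case using zero by (intro exI[of _ "[]"]) simp
  next
    case (Suc k)
    then obtain ts where ts: "li ts" "set ts \<subseteq> lower_series E (m - k)" "lower_series E (m - k) \<subseteq> span (set ts)"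
      "\<And>j x. j < length ts \<Longrightarrow> x \<diamondop> ts ! j \<in> span (set (drop (Suc j) ts))" by auto
    define l where "l = m - Suc k"
    have l: "m - k = Suc l" using Suc.prems by (simp add: l_def)
    have sub: "set ts \<subseteq> span (set es)" "lower_series E l \<subseteq> span (set es)"
      using ts(2) lower_series_subset_E unfolding E_def by blast+
    obtain us where us: "li (us @ ts)" "set us \<subseteq> lower_series E l" "set ts \<union> lower_series E l \<subseteq> span (set us \<union> set ts)"
      by (rule li_extend[OF ts(1) sub])
    have "x \<diamondop> (us @ ts) ! j \<in> span (set (drop (Suc j) (us @ ts)))" if j: "j < length (us @ ts)" for j x
    proof (cases "j < length us")
      case True
      then have "us ! j \<in> lower_series E l" using us(2) by auto
      then have "x \<diamondop> us ! j \<in> span (set ts)" using mul_in_products[of "us ! j" "lower_series E l" x] ts(3) l by auto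
      also have "span (set ts) \<subseteq> span (set (drop (Suc j) (us @ ts)))" by (rule span_mono) (use True in auto)
      finally show ?thesis using True by (simp add: nth_append)
    next
      case False
      then show ?thesis using ts(4)[of "j - length us" x] j by (simp add: nth_append Suc_diff_le)
    qed
    moreover have "set (us @ ts) \<subseteq> lower_series E l" using us(2) ts(2) lower_series_decreasing[of l] l by auto
    ultimately show ?case using us unfolding l_def[symmetric] by (intro exI[of _ "us @ ts"]) auto
  qed
  from this[of m] obtain ts where ts: "li ts" "set ts \<subseteq> E" "E \<subseteq> span (set ts)"
      "\<forall>j<length ts. \<forall>x. x \<diamondop> ts ! j \<in> span (set (drop (Suc j) ts))" by auto
  with basis_of_EI[OF ts(1-3)] show ?thesis by blast
qed

text \<open>On W alone z has rank 2, with range spanned by p2 and s z p1 + t z p3, and z y' outside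
  W makes 3. So z y must lie in that plane. Since p2 acts trivially on W, z + p2 is subject to the
  same constraint, while p2 y = s y p1 + t y p3; comparing the two gives proportionality of (s y, t
  y) and (s z, t z).\<close>

lemma frame3_rank:
  assumes f: "frame3 W p1 p2 p3 s t" and z: "s z \<noteq> 0 \<or> t z \<noteq> 0"
    and y: "z \<diamondop> y \<in> W" and y': "z \<diamondop> y' \<notin> W"
  shows "z \<diamondop> y \<in> span {p2, s z *s p1 + t z *s p3}" "t z * s y = s z * t y"
proof -
  from f have li: "li [p1, p2, p3]" and W: "W = span {p1, p2, p3}"
    and act: "\<And>y. y \<diamondop> p1 = t y *s p2" "\<And>y. y \<diamondop> p2 = s y *s p1 + t y *s p3" "\<And>y. y \<diamondop> p3 = - (s y *s p2)"
    and van: "\<And>w. w \<in> W \<Longrightarrow> s w = 0 \<and> t w = 0"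
    and lin: "Vector_Spaces.linear scale (*) s" "Vector_Spaces.linear scale (*) t"
    unfolding frame3_def by blast+
  note L = li[unfolded li3, rule_format]
  have p2: "s p2 = 0" "t p2 = 0" using van[of p2] W by (simp_all add: span_base)
  let ?g = "s z *s p1 + t z *s p3"
  obtain q where q: "z \<diamondop> q = p2" "q \<in> W"
  proof (cases "t z = 0")
    case False
    show ?thesis by (rule that[of "inverse (t z) *s p1"]) (use False W in \<open>auto simp: mul_simps act intro: span_base span_scale\<close>)
  next
    case True
    then have "s z \<noteq> 0" using z by simp
    then show ?thesis by (intro that[of "- (inverse (s z) *s p3)"]) (use W in \<open>auto simp: mul_simps act intro: span_base span_scale span_neg\<close>)
  qed
  \<comment> \<open>The cases \<eta> = 0 and \<eta> = 1 are the multiplications by z and z +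
    p2.\<close>
  have key: "z \<diamondop> y + \<eta> *s (s y *s p1 + t y *s p3) \<in> span {p2, ?g}" if "\<eta> \<in> {0, 1}" for \<eta>
  proof (rule ccontr)
    let ?z = "z + \<eta> *s p2"
    assume n: "z \<diamondop> y + \<eta> *s (s y *s p1 + t y *s p3) \<notin> span {p2, ?g}"
    have zq: "?z \<diamondop> q = p2" using van[OF q(2)] q(1) by (simp add: mul_simps mul_commute[of p2 q] act)
    have zp: "?z \<diamondop> p2 = ?g" by (simp add: mul_simps act p2 frame3_linear[OF f])
    have zy: "?z \<diamondop> y = z \<diamondop> y + \<eta> *s (s y *s p1 + t y *s p3)" for y by (simp add: mul_simps mul_commute[of p2 y] act)
    have WW: "s y *s p1 + t y *s p3 \<in> W" for y unfolding W by (intro span_add span_scale) (auto intro: span_base)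
    have "?z \<diamondop> y' \<notin> W"
    proof
      assume "?z \<diamondop> y' \<in> W"
      then have "?z \<diamondop> y' - \<eta> *s (s y' *s p1 + t y' *s p3) \<in> W"
        using WW[of y'] unfolding W by (intro span_diff span_scale)
      then show False using y' by (simp add: zy)
    qed
    moreover have "span {?z \<diamondop> y, p2, ?g} \<subseteq> W"
      using y WW[of y] WW[of z] unfolding zy W by (intro span_minimal) (auto intro: span_base span_add span_scale)
    moreover have "li [p2, ?g]"
      unfolding li2
    proof (intro allI impI)
      fix a b assume "a *s p2 + b *s ?g = 0"
      then have "(b * s z) *s p1 + a *s p2 + (b * t z) *s p3 = 0" by (simp add: algebra_simps)
      from L[OF this] z show "a = 0 \<and> b = 0" by auto
    qed
    ultimately have "li [?z \<diamondop> y', ?z \<diamondop> y, ?z \<diamondop> q, ?z \<diamondop> p2]"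
      using n unfolding zq zp by (auto simp: li_Cons zy)
    then show False by (rule no_rank_4)
  qed
  from key[of 0] show 1: "z \<diamondop> y \<in> span {p2, ?g}" by simp
  from span_diff[OF key[of 1] 1] have "s y *s p1 + t y *s p3 \<in> span {p2, ?g}" by simp
  then obtain a b where "s y *s p1 + t y *s p3 = a *s p2 + b *s ?g" unfolding span2 by blast
  then have "(s y - b * s z) *s p1 + (- a) *s p2 + (t y - b * t z) *s p3 = 0" by (simp add: algebra_simps)
  from L[OF this] show "t z * s y = s z * t y" by auto
qed

text \<open>Modulo W a multiplication z with (s z, t z) nonzero has rank at most one, its rank on W
  being 2 already, and by \<open>frame3_rank\<close> its kernel modulo W lies in the kernel of the
  alternating form w z. So the product modulo W is a multiple of w. The product is symmetric and w
  alternating, whence the second claim.\<close>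

lemma frame3_product:
  assumes f: "frame3 W p1 p2 p3 s t" and c: "s c4 = 0" "t c4 = 1" "s c5 = 1" "t c5 = 0"
  shows "x \<diamondop> y - (t x * s y - s x * t y) *s (c4 \<diamondop> c5) \<in> W" "c4 \<diamondop> c5 + c4 \<diamondop> c5 \<in> W"
proof -
  from f have W: "W = span {p1, p2, p3}" and act: "\<And>y. y \<diamondop> p2 = s y *s p1 + t y *s p3"
    and li: "li [p1, p2, p3]" and lin: "Vector_Spaces.linear scale (*) s" "Vector_Spaces.linear scale (*) t"
    unfolding frame3_def by blast+
  have sW: "subspace W" by (simp add: W)
  note st = frame3_linear[OF f]
  define w where "w x y = t x * s y - s x * t y" for x y
  have R: "\<exists>v. \<forall>y. z \<diamondop> y - w z y *s v \<in> W" if z: "s z \<noteq> 0 \<or> t z \<noteq> 0" for z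
  proof (cases "\<forall>y. z \<diamondop> y \<in> W")
    case True
    then show ?thesis by (intro exI[of _ 0]) simp
  next
    case False
    then obtain y0 where y0: "z \<diamondop> y0 \<notin> W" by blast
    have ker: "w z y = 0" if "z \<diamondop> y \<in> W" for y using frame3_rank(2)[OF f z that y0] by (simp add: w_def)
    have mod1: "\<exists>k. z \<diamondop> y - k *s (z \<diamondop> y0) \<in> W" for y
    proof (rule ccontr)
      assume n: "\<not> ?thesis"
      let ?g = "s z *s p1 + t z *s p3"
      obtain q where q: "z \<diamondop> q = p2"
      proof (cases "t z = 0")
        case False
        show ?thesis by (rule that[of "inverse (t z) *s p1"]) (use False f in \<open>auto simp: mul_simps frame3_def\<close>)
      next
        case True
        then have "s z \<noteq> 0" using z by simp
        then show ?thesis by (intro that[of "- (inverse (s z) *s p3)"]) (use f in \<open>auto simp: mul_simps frame3_def\<close>)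
      qed
      have "li [p2, ?g]"
        unfolding li2
      proof (intro allI impI)
        fix a b assume "a *s p2 + b *s ?g = 0"
        then have "(b * s z) *s p1 + a *s p2 + (b * t z) *s p3 = 0" by (simp add: algebra_simps)
        with li[unfolded li3] z show "a = 0 \<and> b = 0" by fastforce
      qed
      moreover have gW: "span {p2, ?g} \<subseteq> W" unfolding W by (intro span_minimal) (auto intro: span_base span_add span_scale)
      ultimately have "li [z \<diamondop> y0, p2, ?g]" using y0 by (auto simp: li_Cons)
      moreover have "z \<diamondop> y \<notin> span {z \<diamondop> y0, p2, ?g}"
        using n gW by (auto simp: span_breakdown_eq[of _ "z \<diamondop> y0"])
      ultimately have "li [z \<diamondop> y, z \<diamondop> y0, z \<diamondop> q, z \<diamondop> p2]" unfolding q act[of z] by (simp add: li_Cons)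
      then show False by (rule no_rank_4)
    qed
    have w0: "w z y0 \<noteq> 0"
    proof
      assume w0: "w z y0 = 0"
      have "w z y = 0" for y
      proof -
        from mod1[of y] obtain k where "z \<diamondop> (y - k *s y0) \<in> W" by (auto simp: mul_simps)
        from ker[OF this] w0 show ?thesis by (simp add: w_def st algebra_simps)
      qed
      from this[of c4] this[of c5] z c show False by (simp add: w_def)
    qed
    have "z \<diamondop> y - w z y *s (inverse (w z y0) *s (z \<diamondop> y0)) \<in> W" for y
    proof -
      from mod1[of y] obtain k where k: "z \<diamondop> y - k *s (z \<diamondop> y0) \<in> W" by blast
      then have "z \<diamondop> (y - k *s y0) \<in> W" by (simp add: mul_simps)
      from ker[OF this] have "w z y = k * w z y0" by (simp add: w_def st algebra_simps)
      then have "w z y * inverse (w z y0) = k" using w0 by simp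
      then show ?thesis using k by simp
    qed
    then show ?thesis by blast
  qed
  let ?v = "c4 \<diamondop> c5"
  note sb = subspace_diff[OF sW] subspace_add[OF sW] subspace_scale[OF sW] subspace_neg[OF sW]
  have sym: "z \<diamondop> y - w z y *s v \<in> W \<Longrightarrow> y \<diamondop> z - w z y *s v \<in> W" for z y v by (simp add: mul_commute[of y])
  obtain v4 where v4: "\<And>y. c4 \<diamondop> y - w c4 y *s v4 \<in> W" using R[of c4] c by auto
  obtain v5 where v5: "\<And>y. c5 \<diamondop> y - w c5 y *s v5 \<in> W" using R[of c5] c by auto
  obtain v6 where v6: "\<And>y. (c4 + c5) \<diamondop> y - w (c4 + c5) y *s v6 \<in> W" using R[of "c4 + c5"] c by (auto simp: st)
  have w45: "w c4 y = s y" "w c5 y = - t y" "w (c4 + c5) y = s y - t y" for y by (simp_all add: w_def c st)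
  have e4: "?v - v4 \<in> W" using v4[of c5] c by (simp add: w45)
  have e5: "?v + v5 \<in> W" using v5[of c4] c by (simp add: w45 mul_commute[of c5])
  have c44: "c4 \<diamondop> c4 \<in> W" and c55: "c5 \<diamondop> c5 \<in> W" using v4[of c4] v5[of c5] c by (simp_all add: w45)
  have "(c4 + c5) \<diamondop> c4 + v6 \<in> W" using v6[of c4] c by (simp add: w45)
  from sb(1)[OF this c44] have e6: "?v + v6 \<in> W" by (simp add: mul_simps mul_commute[of c5])
  have "(c4 + c5) \<diamondop> c5 - v6 \<in> W" using v6[of c5] c by (simp add: w45)
  from sb(1)[OF this c55] have e6': "?v - v6 \<in> W" by (simp add: mul_simps)
  \<comment> \<open>Evaluated at c4 and at c5, the vector v6 belonging to c4 + c5 is congruent to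
    both - \<open>?v\<close> and \<open>?v\<close>.\<close>
  have "(?v + v6) + (?v - v6) \<in> W" using e6 e6' by (rule sb)
  then show two: "?v + ?v \<in> W" by simp
  have N: "z \<diamondop> y - w z y *s ?v \<in> W" if z: "s z \<noteq> 0 \<or> t z \<noteq> 0" for z y
  proof -
    obtain vz where vz: "\<And>y. z \<diamondop> y - w z y *s vz \<in> W" using R[OF z] by blast
    have wz: "w z c4 = - s z" "w z c5 = t z" by (simp_all add: w_def c)
    have 4: "c4 \<diamondop> z - s z *s ?v \<in> W"
    proof -
      have "(c4 \<diamondop> z - w c4 z *s v4) - s z *s (?v - v4) \<in> W" by (intro sb v4 e4)
      then show ?thesis by (simp add: w45 scale_right_diff_distrib)
    qed
    have 5: "c5 \<diamondop> z - t z *s ?v \<in> W"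
    proof -
      have "(c5 \<diamondop> z - w c5 z *s v5) - t z *s (?v + v5) \<in> W" by (intro sb v5 e5)
      then show ?thesis by (simp add: w45 scale_right_distrib algebra_simps)
    qed
    have "t z *s (vz - ?v) \<in> W"
    proof -
      have "(c5 \<diamondop> z - t z *s ?v) - (z \<diamondop> c5 - w z c5 *s vz) \<in> W" by (intro sb 5 vz)
      then show ?thesis by (simp add: wz mul_commute[of z] algebra_simps)
    qed
    moreover have "s z *s (vz - ?v) \<in> W"
    proof -
      have "(z \<diamondop> c4 - w z c4 *s vz) - (c4 \<diamondop> z - s z *s ?v) - s z *s (?v + ?v) \<in> W" by (intro sb 4 vz two)
      then show ?thesis by (simp add: wz mul_commute[of z] algebra_simps)
    qed
    moreover have "x \<in> W" if "k *s x \<in> W" "k \<noteq> 0" for k x using that sb(3)[of "k *s x" "inverse k"] by simp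
    ultimately have "vz - ?v \<in> W" using z by blast
    from sb(2)[OF vz[of y] sb(3)[OF this, of "w z y"]] show ?thesis by (simp add: algebra_simps)
  qed
  have N': "z \<diamondop> y - w z y *s ?v \<in> W" if y: "s y \<noteq> 0 \<or> t y \<noteq> 0" for z y
  proof -
    have "(y \<diamondop> z - w y z *s ?v) - w z y *s (?v + ?v) + w z y *s (?v + ?v) \<in> W" by (intro sb N[OF y] two)
    then have "y \<diamondop> z + w z y *s ?v \<in> W" by (simp add: w_def algebra_simps)
    from sb(1)[OF this sb(3)[OF two, of "w z y"]] show ?thesis by (simp add: mul_commute[of z] algebra_simps)
  qed
  show "x \<diamondop> y - (t x * s y - s x * t y) *s ?v \<in> W"
  proof (cases "(s x \<noteq> 0 \<or> t x \<noteq> 0) \<or> (s y \<noteq> 0 \<or> t y \<noteq> 0)")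
    case True
    then show ?thesis using N[of x y] N'[of y x] by (auto simp: w_def)
  next
    case False
    \<comment> \<open>When s and t vanish at both x and y, y is the difference of y + c4 and c4, to
      which the previous case applies.\<close>
    have "(x \<diamondop> (y + c4) - w x (y + c4) *s ?v) - (x \<diamondop> c4 - w x c4 *s ?v) \<in> W"
      using False c by (intro sb N') (auto simp: st)
    then show ?thesis using False by (simp add: w_def st mul_simps algebra_simps)
  qed
qed

end

section \<open>Shapes of an adapted basis\<close>

context comm_alg
begin

text \<open>The order is the reverse of that in \<open>triangular_basis\<close>: coordinate l of a
  product then involves only basis vectors of index above l, as \<open>triangular\<close> requires
  of component l.\<close>

definition basis_triangular :: "'b list \<Rightarrow> bool" where
  "basis_triangular ts \<longleftrightarrow> (\<forall>j<length ts. \<forall>x. x \<diamondop> ts ! j \<in> span (set (take j ts)))"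

definition basis_form_2 :: "'b list \<Rightarrow> bool" where
  "basis_form_2 ts \<longleftrightarrow> (\<exists>p1 p2 p3 c4 c5 us. ts = p1 # p2 # p3 # c4 # c5 # us \<and>
     (\<forall>p\<in>{p1, p2, p3}. \<forall>u\<in>{p1, p2, p3} \<union> set us. p \<diamondop> u = 0) \<and>
     c4 \<diamondop> p1 = p2 \<and> c4 \<diamondop> p2 = p3 \<and> c4 \<diamondop> p3 = 0 \<and> c5 \<diamondop> p1 = 0 \<and> c5 \<diamondop> p2 = p1 \<and> c5 \<diamondop> p3 = - p2 \<and>
     (\<forall>x y. x \<diamondop> y \<in> span {p1, p2, p3}))"

definition basis_form_3 :: "'b list \<Rightarrow> bool" where
  "basis_form_3 ts \<longleftrightarrow> (\<exists>p1 p2 p3 v c5 c6 us. ts = p1 # p2 # p3 # v # c5 # c6 # us \<and>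
     (\<forall>p\<in>{p1, p2, p3}. \<forall>u\<in>{p1, p2, p3, v} \<union> set us. p \<diamondop> u = 0) \<and>
     c5 \<diamondop> p1 = p2 \<and> c5 \<diamondop> p2 = p3 \<and> c5 \<diamondop> p3 = 0 \<and> c6 \<diamondop> p1 = 0 \<and> c6 \<diamondop> p2 = p1 \<and> c6 \<diamondop> p3 = - p2 \<and>
     c5 \<diamondop> c6 = v \<and> c5 \<diamondop> v \<in> span {p2} \<and> c6 \<diamondop> v \<in> span {p2} \<and>
     (\<forall>u\<in>set us. c5 \<diamondop> u = 0 \<and> c6 \<diamondop> u = 0) \<and> (\<forall>u\<in>insert v (set us). \<forall>u'\<in>insert v (set us). u \<diamondop> u' \<in> span {p2}))"

end

context quad_alg
begin

lemma frame3_basis: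
  assumes f: "frame3 W p1 p2 p3 s t" and c: "s c4 = 0" "t c4 = 1" "s c5 = 1" "t c5 = 0" "c4 \<in> E" "c5 \<in> E"
    and us: "li us" "set us \<subseteq> {y\<in>E. s y = 0 \<and> t y = 0}" "{y\<in>E. s y = 0 \<and> t y = 0} \<subseteq> span (set us)"
    and ts: "set ts = {c4, c5} \<union> set us" "length ts = length us + 2"
  shows "basis_of_E ts"
proof (rule basis_of_EI)
  note st = frame3_linear[OF f]
  have z: "s y = 0 \<and> t y = 0" if "y \<in> span (set us)" for y
    using that
  proof (induction rule: span_induct_alt)
    case base
    then show ?case using st(3)[of 0 0] st(4)[of 0 0] by simp
  next
    case (step k v z)
    then show ?case using us(2) by (auto simp: st)
  qed
  have "c5 \<notin> span (set us)" using z[of c5] c by auto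
  moreover have "c4 \<notin> span (set (c5 # us))"
  proof
    assume "c4 \<in> span (set (c5 # us))"
    then obtain k where "c4 - k *s c5 \<in> span (set us)" by (auto simp: span_breakdown_eq)
    from z[OF this] c show False by (simp add: st)
  qed
  ultimately have "li (c4 # c5 # us)" using us(1) by (simp add: li_Cons)
  then have ind: "independent (set ts)" and dist: "distinct (c4 # c5 # us)" using ts(1) by (auto simp: li_iff_independent)
  have "card (set ts) = card (set (c4 # c5 # us))" using ts(1) by simp
  also have "\<dots> = length ts" using distinct_card[OF dist] ts(2) by simp
  finally show "li ts" using ind by (simp add: li_iff_independent card_distinct)
  show "set ts \<subseteq> E" using ts(1) us(2) c by auto
  show "E \<subseteq> span (set ts)"
  proof
    fix y assume y: "y \<in> E"
    have "y - s y *s c5 - t y *s c4 \<in> {y\<in>E. s y = 0 \<and> t y = 0}"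
      using y c subspace_E by (auto simp: st intro!: subspace_diff subspace_scale)
    then have "y - s y *s c5 - t y *s c4 \<in> span (set us)" using us(3) by blast
    then have "y - s y *s c5 - t y *s c4 \<in> span (set ts)" by (rule span_mono[THEN subsetD, rotated]) (use ts(1) in auto)
    then have "(y - s y *s c5 - t y *s c4) + t y *s c4 + s y *s c5 \<in> span (set ts)"
      using ts(1) by (intro span_add span_scale) (auto intro: span_base)
    then show "y \<in> span (set ts)" by simp
  qed
qed

lemma form_2_basis:
  assumes f: "frame3 W p1 p2 p3 s t" and c: "s c4 = 0" "t c4 = 1" "s c5 = 1" "t c5 = 0" "c4 \<in> E" "c5 \<in> E"
    and WE: "W \<subseteq> E" and all: "\<And>x y. x \<diamondop> y \<in> W"
  shows "\<exists>ts. basis_of_E ts \<and> basis_form_2 ts"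
proof -
  from f have W: "W = span {p1, p2, p3}" and li: "li [p1, p2, p3]"
    and act: "\<And>y. y \<diamondop> p1 = t y *s p2" "\<And>y. y \<diamondop> p2 = s y *s p1 + t y *s p3" "\<And>y. y \<diamondop> p3 = - (s y *s p2)"
    and van: "\<And>w. w \<in> W \<Longrightarrow> s w = 0 \<and> t w = 0"
    unfolding frame3_def by blast+
  have pW: "p1 \<in> W" "p2 \<in> W" "p3 \<in> W" unfolding W by (auto intro: span_base)
  let ?Z = "{y\<in>E. s y = 0 \<and> t y = 0}"
  have sub: "set [p1, p2, p3] \<subseteq> span (set es)" "?Z \<subseteq> span (set es)" using pW WE unfolding E_def by auto
  obtain us where us: "li (us @ [p1, p2, p3])" "set us \<subseteq> ?Z" "set [p1, p2, p3] \<union> ?Z \<subseteq> span (set us \<union> set [p1, p2, p3])"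
    by (rule li_extend[OF li sub])
  let ?ts = "p1 # p2 # p3 # c4 # c5 # us"
  have "basis_of_E ?ts"
    by (rule frame3_basis[OF f c, of "us @ [p1, p2, p3]"]) (use us pW WE van in auto)
  moreover have "p \<diamondop> u = 0" if "p \<in> {p1, p2, p3}" "u \<in> {p1, p2, p3} \<union> set us" for p u
  proof -
    have "s u = 0 \<and> t u = 0" using that(2) us(2) van pW by auto
    then have "u \<diamondop> p = 0" using that(1) by (auto simp: act)
    then show ?thesis by (simp add: mul_commute)
  qed
  then have "basis_form_2 ?ts"
    unfolding basis_form_2_def using all c
    by (intro exI[of _ p1] exI[of _ p2] exI[of _ p3] exI[of _ c4] exI[of _ c5] exI[of _ us]) (simp add: act W)
  ultimately show ?thesis by blast
qed

text \<open>Because c4 c5 is outside W, each z with (s z, t z) nonzero has rank exactly 3, so by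
  \<open>frame3_rank\<close> it multiplies Vo, the common kernel of s and t, into the plane of p2
  and s z p1 + t z p3. The planes for c4, c5 and c4 + c5 tie the coefficients together, and
  corrections by p1, p2, p3 remove what is left.\<close>

lemma form_3_basis:
  assumes f: "frame3 W p1 p2 p3 s t" and c: "s c4 = 0" "t c4 = 1" "s c5 = 1" "t c5 = 0" "c4 \<in> E" "c5 \<in> E"
    and WE: "W \<subseteq> E" and alt: "\<And>x. x \<diamondop> x = 0" and v: "c4 \<diamondop> c5 \<notin> W"
  shows "\<exists>ts. basis_of_E ts \<and> basis_form_3 ts"
proof -
  note st = frame3_linear[OF f]
  from f have W: "W = span {p1, p2, p3}" and li: "li [p1, p2, p3]"
    and act: "\<And>y. y \<diamondop> p1 = t y *s p2" "\<And>y. y \<diamondop> p2 = s y *s p1 + t y *s p3" "\<And>y. y \<diamondop> p3 = - (s y *s p2)"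
    and van: "\<And>w. w \<in> W \<Longrightarrow> s w = 0 \<and> t w = 0"
    unfolding frame3_def by blast+
  have sW: "subspace W" by (simp add: W)
  note sb = subspace_diff[OF sW] subspace_add[OF sW] subspace_scale[OF sW] subspace_neg[OF sW]
  note L = li[unfolded li3, rule_format]
  have pW: "p1 \<in> W" "p2 \<in> W" "p3 \<in> W" unfolding W by (auto intro: span_base)
  have mW: "y \<diamondop> w \<in> W" if "w \<in> W" for y w
    using that unfolding W
  proof (rule mul_mem_span)
    fix p assume "p \<in> {p1, p2, p3}"
    then show "y \<diamondop> p \<in> span {p1, p2, p3}"
      by (auto simp: act intro!: span_add span_scale span_neg intro: span_base)
  qed simp
  note prod = frame3_product(1)[OF f c(1-4)]
  have nmul: "k = 0" if "k *s (c4 \<diamondop> c5) \<in> W" for k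
    using v that sb(3)[of "k *s (c4 \<diamondop> c5)" "inverse k"] by (cases "k = 0") auto
  define Vo where "Vo = {y. s y = 0 \<and> t y = 0}"
  have Vo_mul: "z \<diamondop> y \<in> W" if "y \<in> Vo" for z y using prod[of z y] that by (simp add: Vo_def)
  \<comment> \<open>Modulo W, c4 c5 is an eigenvector of c4 with eigenvalue s (c4 c5) and of c5 with
    eigenvalue - t (c4 c5); nilpotency makes both zero.\<close>
  have v_Vo: "c4 \<diamondop> c5 \<in> Vo"
  proof -
    have kv: "k = 0" if k: "x \<diamondop> (c4 \<diamondop> c5) - k *s (c4 \<diamondop> c5) \<in> W" for x k
    proof -
      have "(mul x ^^ N) (c4 \<diamondop> c5) - k ^ N *s (c4 \<diamondop> c5) \<in> W" for N
      proof (induction N)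
        case (Suc N)
        have "x \<diamondop> ((mul x ^^ N) (c4 \<diamondop> c5) - k ^ N *s (c4 \<diamondop> c5)) + k ^ N *s (x \<diamondop> (c4 \<diamondop> c5) - k *s (c4 \<diamondop> c5)) \<in> W"
          by (intro sb mW Suc k)
        then show ?case by (simp add: mul_simps algebra_simps)
      qed (simp add: sW subspace_0)
      moreover obtain N where "(mul x ^^ N) (c4 \<diamondop> c5) = 0" using nilp by blast
      ultimately have "- (k ^ N *s (c4 \<diamondop> c5)) \<in> W" by (metis diff_0)
      from sb(4)[OF this] have "k ^ N *s (c4 \<diamondop> c5) \<in> W" by simp
      from nmul[OF this] show ?thesis by simp
    qed
    have "s (c4 \<diamondop> c5) = 0" by (rule kv[of c4]) (use prod[of c4 "c4 \<diamondop> c5"] c in simp)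
    moreover have "- t (c4 \<diamondop> c5) = 0" by (rule kv[of c5]) (use prod[of c5 "c4 \<diamondop> c5"] c in simp)
    ultimately show ?thesis by (simp add: Vo_def)
  qed
  have plane: "z \<diamondop> y \<in> span {p2, s z *s p1 + t z *s p3}" if z: "s z \<noteq> 0 \<or> t z \<noteq> 0" and y: "y \<in> Vo" for z y
  proof -
    have "\<exists>y'. z \<diamondop> y' \<notin> W"
    proof (rule ccontr)
      assume "\<not> ?thesis"
      then have a: "z \<diamondop> y' \<in> W" for y' by blast
      have "(t z * s y' - s z * t y') *s (c4 \<diamondop> c5) \<in> W" for y'
        using sb(1)[OF a[of y'] prod[of z y']] by simp
      then have "t z * s y' - s z * t y' = 0" for y' by (rule nmul)
      from this[of c4] this[of c5] c z show False by simp
    qed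
    then obtain y' where "z \<diamondop> y' \<notin> W" by blast
    from frame3_rank(1)[OF f z Vo_mul[OF y] this] show ?thesis .
  qed
  have c4y: "\<exists>\<alpha> \<beta>. c4 \<diamondop> y = \<alpha> *s p2 + \<beta> *s p3" if "y \<in> Vo" for y
    using plane[OF _ that, of c4] c by (simp add: span2)
  have c5y: "\<exists>\<alpha> \<beta>. c5 \<diamondop> y = \<alpha> *s p2 + \<beta> *s p1" if "y \<in> Vo" for y
    using plane[OF _ that, of c5] c by (simp add: span2)
  have c45y: "\<exists>\<alpha> \<alpha>' \<beta>. c4 \<diamondop> y = \<alpha> *s p2 + \<beta> *s p3 \<and> c5 \<diamondop> y = \<alpha>' *s p2 + \<beta> *s p1" if y: "y \<in> Vo" for y
  proof -
    from c4y[OF y] obtain \<alpha> \<beta> where 4: "c4 \<diamondop> y = \<alpha> *s p2 + \<beta> *s p3" by blast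
    from c5y[OF y] obtain \<alpha>' \<beta>' where 5: "c5 \<diamondop> y = \<alpha>' *s p2 + \<beta>' *s p1" by blast
    have "(c4 + c5) \<diamondop> y \<in> span {p2, p1 + p3}" using plane[OF _ y, of "c4 + c5"] c by (simp add: st)
    then obtain k l where "(c4 + c5) \<diamondop> y = k *s p2 + l *s (p1 + p3)" unfolding span2 by blast
    then have "(\<beta>' - l) *s p1 + (\<alpha> + \<alpha>' - k) *s p2 + (\<beta> - l) *s p3 = 0" by (simp add: mul_simps 4 5 algebra_simps)
    from L[OF this] have "\<beta> = \<beta>'" by auto
    with 4 5 show ?thesis by blast
  qed
  have VoVo: "z \<diamondop> y \<in> span {p2}" if z: "z \<in> Vo" and y: "y \<in> Vo" for z y
  proof -
    have "(z + c4) \<diamondop> y \<in> span {p2, p3}" using plane[OF _ y, of "z + c4"] c z by (simp add: st Vo_def)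
    then obtain k l where 1: "(z + c4) \<diamondop> y = k *s p2 + l *s p3" unfolding span2 by blast
    have "(z + c5) \<diamondop> y \<in> span {p2, p1}" using plane[OF _ y, of "z + c5"] c z by (simp add: st Vo_def)
    then obtain k' l' where 2: "(z + c5) \<diamondop> y = k' *s p2 + l' *s p1" unfolding span2 by blast
    from c45y[OF y] obtain \<alpha> \<alpha>' \<beta> where 3: "c4 \<diamondop> y = \<alpha> *s p2 + \<beta> *s p3" "c5 \<diamondop> y = \<alpha>' *s p2 + \<beta> *s p1" by blast
    have e1: "z \<diamondop> y = (k - \<alpha>) *s p2 + (l - \<beta>) *s p3" using 1 3 by (simp add: mul_simps algebra_simps)
    have e2: "z \<diamondop> y = (k' - \<alpha>') *s p2 + (l' - \<beta>) *s p1" using 2 3 by (simp add: mul_simps algebra_simps)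
    from e1 e2 have "(- (l' - \<beta>)) *s p1 + ((k - \<alpha>) - (k' - \<alpha>')) *s p2 + (l - \<beta>) *s p3 = 0" by (simp add: algebra_simps)
    from L[OF this] have "l - \<beta> = 0" by blast
    with e1 show ?thesis by (simp add: span_base span_scale)
  qed
  from c45y[OF v_Vo] obtain \<alpha>4 \<alpha>5 \<kappa> where lam: "c4 \<diamondop> (c4 \<diamondop> c5) = \<alpha>4 *s p2 + \<kappa> *s p3"
    "c5 \<diamondop> (c4 \<diamondop> c5) = \<alpha>5 *s p2 + \<kappa> *s p1" by blast
  \<comment> \<open>The shift turns c4 c5 into u = c4 c5 - \<kappa> p2, whose products with d and c5
    lose their p3- and p1-parts and lie on the line of p2.\<close>
  define d where "d = c4 + \<kappa> *s p3"
  define u where "u = d \<diamondop> c5"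
  have u: "u = c4 \<diamondop> c5 - \<kappa> *s p2"
    using act(3)[of c5] c by (simp add: u_def d_def mul_simps mul_commute[of p3])
  have d: "s d = 0" "t d = 1" "d \<in> E"
    using van[OF pW(3)] c pW WE subspace_E by (auto simp: d_def st intro!: subspace_add subspace_scale)
  have dy: "d \<diamondop> y = c4 \<diamondop> y" if "y \<in> Vo" for y
    using that act(3)[of y] by (simp add: d_def mul_simps mul_commute[of p3] Vo_def)
  have p2Vo: "p1 \<in> Vo" "p2 \<in> Vo" "p3 \<in> Vo" using van pW by (auto simp: Vo_def)
  have sVo: "subspace Vo" unfolding Vo_def subspace_def using st(1-4) st(3)[of 0 0] st(4)[of 0 0] by auto
  have u_Vo: "u \<in> Vo" using v_Vo p2Vo sVo unfolding u by (intro subspace_diff subspace_scale)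
  have du: "d \<diamondop> u = \<alpha>4 *s p2" "c5 \<diamondop> u = \<alpha>5 *s p2"
  proof -
    have "d \<diamondop> u = c4 \<diamondop> u" by (rule dy[OF u_Vo])
    then show "d \<diamondop> u = \<alpha>4 *s p2" "c5 \<diamondop> u = \<alpha>5 *s p2"
      using act(2)[of c4] act(2)[of c5] c by (simp_all add: u mul_simps lam)
  qed
  have dp: "d \<diamondop> p1 = p2" "d \<diamondop> p2 = p3" "d \<diamondop> p3 = 0" "c5 \<diamondop> p1 = 0" "c5 \<diamondop> p2 = p1" "c5 \<diamondop> p3 = - p2"
    using d c by (simp_all add: act)
  let ?Z = "{y\<in>E. y \<in> Vo \<and> d \<diamondop> y = 0 \<and> c5 \<diamondop> y = 0}"
  have uW: "u \<notin> W"
  proof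
    assume "u \<in> W"
    then have "u + \<kappa> *s p2 \<in> W" using pW by (intro sb)
    then show False using v by (simp add: u)
  qed
  have li4: "li [u, p1, p2, p3]" using li uW by (simp add: li_Cons W)
  have uE: "u \<in> E" by (simp add: u_def mul_E)
  have sub: "set [u, p1, p2, p3] \<subseteq> span (set es)" "?Z \<subseteq> span (set es)" using pW WE uE unfolding E_def by auto
  obtain us where us: "li (us @ [u, p1, p2, p3])" "set us \<subseteq> ?Z"
    "set [u, p1, p2, p3] \<union> ?Z \<subseteq> span (set us \<union> set [u, p1, p2, p3])"
    by (rule li_extend[OF li4 sub])
  let ?us = "us @ [u, p1, p2, p3]"
  have spVo: "{y\<in>E. s y = 0 \<and> t y = 0} \<subseteq> span (set ?us)"
  proof clarify
    fix y assume y: "y \<in> E" "s y = 0" "t y = 0"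
    then have yVo: "y \<in> Vo" by (simp add: Vo_def)
    from c45y[OF yVo] obtain \<alpha> \<alpha>' \<beta> where 3: "c4 \<diamondop> y = \<alpha> *s p2 + \<beta> *s p3" "c5 \<diamondop> y = \<alpha>' *s p2 + \<beta> *s p1" by blast
    \<comment> \<open>The correction by p2, p1, p3 cancels \<beta>, \<alpha>,
      \<open>\<alpha>'\<close> in turn, so that both d and c5 kill the result.\<close>
    let ?y = "y - \<beta> *s p2 - \<alpha> *s p1 + \<alpha>' *s p3"
    have "?y \<in> Vo" using yVo p2Vo sVo by (intro subspace_add subspace_diff subspace_scale)
    moreover have "?y \<in> E" using y(1) pW WE subspace_E by (intro subspace_add subspace_diff subspace_scale) auto
    moreover have "d \<diamondop> ?y = 0" using dy[OF yVo] by (simp add: mul_simps 3 dp)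
    moreover have "c5 \<diamondop> ?y = 0" by (simp add: mul_simps 3 dp)
    ultimately have "?y \<in> span (set ?us)" using us(3) by auto
    moreover have "\<beta> *s p2 + \<alpha> *s p1 - \<alpha>' *s p3 \<in> span (set ?us)"
      by (intro span_add span_diff span_scale) (auto intro: span_base)
    ultimately have "?y + (\<beta> *s p2 + \<alpha> *s p1 - \<alpha>' *s p3) \<in> span (set ?us)" by (rule span_add)
    then show "y \<in> span (set ?us)" by simp
  qed
  let ?ts = "p1 # p2 # p3 # u # d # c5 # us"
  have usVo: "set us \<subseteq> Vo" using us(2) by blast
  have be: "basis_of_E ?ts"
    by (rule frame3_basis[OF f d(1,2) c(3,4) d(3) c(6) us(1) _ spVo])
      (use us(2) p2Vo u_Vo uE pW WE in \<open>auto simp: Vo_def\<close>)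
  have pp: "p \<diamondop> x = 0" if "p \<in> {p1, p2, p3}" "x \<in> {p1, p2, p3, u} \<union> set us" for p x
  proof -
    have "x \<in> Vo" using that(2) usVo p2Vo u_Vo by auto
    then have "x \<diamondop> p = 0" using that(1) by (auto simp: act Vo_def)
    then show ?thesis by (simp add: mul_commute)
  qed
  have uu: "x \<diamondop> y \<in> span {p2}" if "x \<in> insert u (set us)" "y \<in> insert u (set us)" for x y
    using VoVo that usVo u_Vo by blast
  have u0: "d \<diamondop> x = 0" "c5 \<diamondop> x = 0" if "x \<in> set us" for x using that us(2) by auto
  have du': "d \<diamondop> u \<in> span {p2}" "c5 \<diamondop> u \<in> span {p2}" by (simp_all add: du span_base span_scale)
  have "basis_form_3 ?ts"
    unfolding basis_form_3_def
    apply (rule exI[of _ p1], rule exI[of _ p2], rule exI[of _ p3], rule exI[of _ u], rule exI[of _ d],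
        rule exI[of _ c5], rule exI[of _ us])
    apply (intro conjI ballI)
    apply (rule refl dp du' u_def[symmetric] | (rule pp uu u0, assumption+))+
    done
  with be show ?thesis by blast
qed

theorem basis_classification:
  "(\<exists>ts. basis_of_E ts \<and> basis_triangular ts) \<or> (\<exists>ts. basis_of_E ts \<and> basis_form_2 ts) \<or>
   ((2::'a) = 0 \<and> (\<exists>ts. basis_of_E ts \<and> basis_form_3 ts))"
proof -
  obtain m where m: "perfect (lower_series E m)" using lower_series_stable by blast
  let ?W = "lower_series E m"
  show ?thesis
  proof (cases "?W = {0}")
    case True
    from triangular_basis[OF True] obtain ts where ts: "basis_of_E ts"
      "\<And>j x. j < length ts \<Longrightarrow> x \<diamondop> ts ! j \<in> span (set (drop (Suc j) ts))" by blast
    have "basis_of_E (rev ts)" using ts(1) by (auto simp: basis_of_E_def li_iff_independent)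
    moreover have "basis_triangular (rev ts)"
      unfolding basis_triangular_def
    proof (intro allI impI)
      fix j x assume j: "j < length (rev ts)"
      have "x \<diamondop> ts ! (length ts - Suc j) \<in> span (set (drop (Suc (length ts - Suc j)) ts))"
        using j by (intro ts(2)) auto
      moreover have "Suc (length ts - Suc j) = length ts - j" using j by simp
      ultimately show "x \<diamondop> rev ts ! j \<in> span (set (take j (rev ts)))" using j by (simp add: rev_nth take_rev)
    qed
    ultimately show ?thesis by blast
  next
    case False
    from perfect_imp_small[OF m] obtain v1 v2 v3 where sm: "?W \<subseteq> span {v1, v2, v3}" unfolding small_def by blast
    have cube: "x \<diamondop> (x \<diamondop> (x \<diamondop> w)) = 0" if "w \<in> ?W" for x w
      by (rule cube_zero_of_dim3[OF perfect_mul[OF m] sm that])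
    from frame3_of_perfect[OF m sm False cube perfect_star[OF m]]
    obtain p1 p2 p3 s t c4 c5 where f: "frame3 ?W p1 p2 p3 s t"
      and c: "s c4 = 0" "t c4 = 1" "s c5 = 1" "t c5 = 0" by blast
    have li: "li [p1, p2, p3]" and act: "\<And>y. y \<diamondop> p2 = s y *s p1 + t y *s p3" using f unfolding frame3_def by blast+
    \<comment> \<open>The elements c4 and c5 of the frame may lie outside E. Both s and t can be
      read off the action on p2, so a representative in E has the same values.\<close>
    have rp: "\<exists>x'\<in>E. s x' = s x \<and> t x' = t x" for x
    proof -
      obtain x' where x': "x' \<in> E" "\<And>y. x \<diamondop> y = x' \<diamondop> y" using representative[of x] unfolding E_def by blast
      have "(s x' - s x) *s p1 + 0 *s p2 + (t x' - t x) *s p3 = 0"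
        using x'(2)[of p2] by (simp add: act algebra_simps)
      with li[unfolded li3] x'(1) show ?thesis by fastforce
    qed
    from rp[of c4] c obtain d4 where d4: "d4 \<in> E" "s d4 = 0" "t d4 = 1" by auto
    from rp[of c5] c obtain d5 where d5: "d5 \<in> E" "s d5 = 1" "t d5 = 0" by auto
    note fc = d4(2,3) d5(2,3)
    have sW: "subspace ?W" by (rule lower_series_subspace)
    show ?thesis
    proof (cases "d4 \<diamondop> d5 \<in> ?W")
      case True
      have "x \<diamondop> y \<in> ?W" for x y
      proof -
        have "(x \<diamondop> y - (t x * s y - s x * t y) *s (d4 \<diamondop> d5)) + (t x * s y - s x * t y) *s (d4 \<diamondop> d5) \<in> ?W"
          by (intro subspace_add[OF sW] subspace_scale[OF sW] True frame3_product(1)[OF f fc])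
        then show ?thesis by simp
      qed
      from form_2_basis[OF f fc d4(1) d5(1) lower_series_subset_E this] show ?thesis by blast
    next
      case False
      have two: "(2::'a) = 0"
      proof (rule ccontr)
        assume "(2::'a) \<noteq> 0"
        have "d4 \<diamondop> d5 + d4 \<diamondop> d5 = (2::'a) *s (d4 \<diamondop> d5)"
          using scale_left_distrib[of 1 1 "d4 \<diamondop> d5"] by simp
        then have "(2::'a) *s (d4 \<diamondop> d5) \<in> ?W" using frame3_product(2)[OF f fc] by simp
        from subspace_scale[OF sW this, of "inverse 2"] \<open>(2::'a) \<noteq> 0\<close> False show False by simp
      qed
      from form_3_basis[OF f fc d4(1) d5(1) lower_series_subset_E char2_alt[OF two] False] two
      show ?thesis by blast
    qed
  qed
qed

end

section \<open>Polynomials and substitution\<close>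

lemma poly_mapping_additive_induct [case_names zero single add]:
  fixes p :: "'b \<Rightarrow>\<^sub>0 'c::ab_group_add"
  assumes "P 0" "\<And>m c. P (Poly_Mapping.single m c)" "\<And>p q. P p \<Longrightarrow> P q \<Longrightarrow> P (p + q)"
  shows "P p"
proof (induction p rule: update_induct)
  case const
  then show ?case using assms(1) by simp
next
  case (update p a b)
  then have "Poly_Mapping.update a b p = Poly_Mapping.single a b + p"
    by (intro poly_mapping_eqI) (auto simp: lookup_update lookup_add lookup_single in_keys_iff when_def)
  with update assms show ?case by simp
qed

definition monom_eval :: "(nat \<Rightarrow> 'c::comm_ring_1) \<Rightarrow> (nat \<Rightarrow>\<^sub>0 nat) \<Rightarrow> 'c" where
  "monom_eval f m = (\<Prod>i\<in>Poly_Mapping.keys m. f i ^ Poly_Mapping.lookup m i)"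

text \<open>Evaluation along a coefficient map \<phi> into any commutative ring. This covers
  \<open>subst\<close> (with \<open>Const\<close>), evaluation at a point over a field extension,
  and the substitution of multiples of a new parameter for the variables.\<close>

definition insertion :: "('a \<Rightarrow> 'c::comm_ring_1) \<Rightarrow> (nat \<Rightarrow> 'c) \<Rightarrow> 'a::field mpoly \<Rightarrow> 'c" where
  "insertion \<phi> f p = (\<Sum>m\<in>Poly_Mapping.keys p. \<phi> (Poly_Mapping.lookup p m) * monom_eval f m)"

lemma subst_eq_insertion: "subst f = insertion Const f"
  by (simp add: fun_eq_iff subst_def insertion_def monom_eval_def)

lemma monom_eval_superset:
  assumes "finite A" "Poly_Mapping.keys m \<subseteq> A"
  shows "monom_eval f m = (\<Prod>i\<in>A. f i ^ Poly_Mapping.lookup m i)"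
  unfolding monom_eval_def using assms by (intro prod.mono_neutral_left) (auto simp: in_keys_iff)

lemma monom_eval_add: "monom_eval f (m + m') = monom_eval f m * monom_eval f m'"
proof -
  let ?A = "Poly_Mapping.keys m \<union> Poly_Mapping.keys m'"
  have "Poly_Mapping.keys (m + m') \<subseteq> ?A" by (rule keys_add)
  then show ?thesis
    by (simp add: monom_eval_superset[of ?A] lookup_add power_add prod.distrib)
qed

lemma monom_eval_0 [simp]: "monom_eval f 0 = 1"
  and monom_eval_single [simp]: "monom_eval f (Poly_Mapping.single i k) = f i ^ k"
  by (simp_all add: monom_eval_def)

locale coeff_hom = comm_ring_hom \<phi> for \<phi> :: "'a::field \<Rightarrow> 'c::comm_ring_1"
begin

lemma insertion_superset:
  assumes "finite A" "Poly_Mapping.keys p \<subseteq> A"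
  shows "insertion \<phi> f p = (\<Sum>m\<in>A. \<phi> (Poly_Mapping.lookup p m) * monom_eval f m)"
  unfolding insertion_def using assms by (intro sum.mono_neutral_left) (auto simp: in_keys_iff)

lemma insertion_add: "insertion \<phi> f (p + q) = insertion \<phi> f p + insertion \<phi> f q"
proof -
  let ?A = "Poly_Mapping.keys p \<union> Poly_Mapping.keys q"
  have "Poly_Mapping.keys (p + q) \<subseteq> ?A" by (rule keys_add)
  then show ?thesis
    by (simp add: insertion_superset[of ?A] lookup_add hom_add distrib_right sum.distrib)
qed

lemma insertion_single [simp]: "insertion \<phi> f (Poly_Mapping.single m c) = \<phi> c * monom_eval f m"
  by (simp add: insertion_def)

lemma insertion_zero [simp]: "insertion \<phi> f 0 = 0"
  by (simp add: insertion_def)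

lemma insertion_mult: "insertion \<phi> f (p * q) = insertion \<phi> f p * insertion \<phi> f q"
proof (induction p rule: poly_mapping_additive_induct)
  case (single m c)
  show ?case
    by (induction q rule: poly_mapping_additive_induct)
      (simp_all add: mult_single hom_mult monom_eval_add insertion_add distrib_left mult.assoc mult.left_commute)
qed (simp_all add: insertion_add distrib_right)

lemma insertion_one [simp]: "insertion \<phi> f 1 = 1"
  using insertion_single[of f 0 1] by simp

sublocale insertion: comm_ring_hom "insertion \<phi> f"
  by unfold_locales (simp_all add: insertion_add insertion_mult)

lemma insertion_Const [simp]: "insertion \<phi> f (Const c) = \<phi> c"
  by (simp add: Const_def)

lemma insertion_Var [simp]: "insertion \<phi> f (Var i) = f i"
  by (simp add: Var_def)

end

interpretation Const: coeff_hom "Const :: 'a::field \<Rightarrow> 'a mpoly"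
  by unfold_locales (simp_all add: Const_def single_add mult_single)

lemma Const_eq_0_iff [simp]: "Const c = 0 \<longleftrightarrow> c = 0"
  by (auto simp: Const_def dest: arg_cong[where f = "\<lambda>p. Poly_Mapping.lookup p 0"])

lemma monom_eval_Var: "monom_eval Var m = Poly_Mapping.single m (1::'a::field)"
proof (induction m rule: update_induct)
  case const
  then show ?case by simp
next
  case (update m i k)
  have "Poly_Mapping.update i k m = Poly_Mapping.single i k + m"
    using update by (intro poly_mapping_eqI) (auto simp: lookup_update lookup_add lookup_single in_keys_iff when_def)
  moreover have "(Var i :: 'a mpoly) ^ k = Poly_Mapping.single (Poly_Mapping.single i k) 1"
    by (induction k) (simp_all add: Var_def mult_single flip: single_add)
  ultimately show ?case using update by (simp add: monom_eval_add mult_single)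
qed

lemma mpoly_induct [case_names Const Var add mult]:
  fixes p :: "'a::field mpoly"
  assumes Const: "\<And>c. P (Const c)" and Var: "\<And>i. P (Var i)"
    and add: "\<And>p q. P p \<Longrightarrow> P q \<Longrightarrow> P (p + q)" and mult: "\<And>p q. P p \<Longrightarrow> P q \<Longrightarrow> P (p * q)"
  shows "P p"
proof (induction p rule: poly_mapping_additive_induct)
  case zero
  then show ?case using Const[of 0] by simp
next
  case (single m c)
  have 1: "P 1" using Const[of 1] by simp
  have pow: "P (Var i ^ k)" for i k by (induction k) (simp_all add: 1 Var mult)
  have "P (\<Prod>i\<in>A. Var i ^ Poly_Mapping.lookup m i)" if "finite A" for A
    using that by induction (simp_all add: 1 pow mult)
  then have "P (monom_eval Var m)" by (simp add: monom_eval_def)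
  then have "P (Const c * Poly_Mapping.single m 1)" using Const mult by (simp add: monom_eval_Var)
  then show ?case by (simp add: Const_def mult_single)
qed (rule add)

lemma subst_simps [simp]:
  "subst f (p + q) = subst f p + subst f q" "subst f (p * q) = subst f p * subst f q"
  "subst f (p - q) = subst f p - subst f q" "subst f (- p) = - subst f p"
  "subst f 0 = 0" "subst f (Const c) = Const c" "subst f (Var i) = f i"
  "subst f (sum g A) = (\<Sum>a\<in>A. subst f (g a))"
  by (simp_all add: subst_eq_insertion Const.insertion_add Const.insertion_mult Const.insertion.hom_minus
      Const.insertion.hom_uminus Const.insertion.hom_sum)

lemma subst_Var: "subst Var p = p"
  by (induction p rule: mpoly_induct) simp_all

lemma subst_subst: "subst g (subst f p) = subst (\<lambda>i. subst g (f i)) p"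
  by (induction p rule: mpoly_induct) simp_all

lemma subst_cong: "(\<And>i. i \<in> vars p \<Longrightarrow> f i = g i) \<Longrightarrow> subst f p = subst g p"
  unfolding subst_def vars_def by (intro sum.cong prod.cong refl arg_cong2[where f = "(*)"]) (auto intro!: arg_cong2[where f = "(^)"])

lemma vars_Const [simp]: "vars (Const c) = {}"
  and vars_0 [simp]: "vars 0 = {}"
  and vars_Var [simp]: "vars (Var i) = {i}"
  by (auto simp: vars_def Const_def Var_def)

lemma vars_add: "vars (p + q) \<subseteq> vars p \<union> vars q"
  unfolding vars_def using keys_add[of p q] by blast

lemma vars_uminus [simp]: "vars (- p) = vars p"
  by (simp add: vars_def)

lemma vars_diff: "vars (p - q) \<subseteq> vars p \<union> vars q"
  using vars_add[of p "- q"] by simp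

lemma vars_mult: "vars (p * q) \<subseteq> vars p \<union> vars q"
proof
  fix i assume "i \<in> vars (p * q)"
  then obtain m where "m \<in> Poly_Mapping.keys (p * q)" and i: "i \<in> Poly_Mapping.keys m"
    by (auto simp: vars_def)
  then obtain a b where "m = a + b" "a \<in> Poly_Mapping.keys p" "b \<in> Poly_Mapping.keys q"
    using keys_mult[of p q] by auto
  with i show "i \<in> vars p \<union> vars q"
    using subsetD[OF keys_add[of a b], of i] by (auto simp: vars_def)
qed

lemma vars_sum: "(\<And>a. a \<in> A \<Longrightarrow> vars (g a) \<subseteq> S) \<Longrightarrow> vars (sum g A) \<subseteq> S"
  by (induction A rule: infinite_finite_induct) (simp_all add: order_trans[OF vars_add])

lemma vars_1 [simp]: "vars 1 = {}"
  using vars_Const[of 1] by simp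

lemma vars_prod: "(\<And>a. a \<in> A \<Longrightarrow> vars (g a) \<subseteq> S) \<Longrightarrow> vars (prod g A) \<subseteq> S"
  by (induction A rule: infinite_finite_induct) (simp_all add: order_trans[OF vars_mult])

lemma vars_power: "vars (p ^ k) \<subseteq> vars p"
  by (induction k) (simp_all add: order_trans[OF vars_mult])

lemma vars_subst: "vars (subst f p) \<subseteq> (\<Union>i\<in>vars p. vars (f i))"
  unfolding subst_def
proof (rule vars_sum)
  fix m assume m: "m \<in> Poly_Mapping.keys p"
  have "vars (\<Prod>i\<in>Poly_Mapping.keys m. f i ^ Poly_Mapping.lookup m i) \<subseteq> (\<Union>i\<in>vars p. vars (f i))"
  proof (rule vars_prod)
    fix i assume "i \<in> Poly_Mapping.keys m"
    then have "i \<in> vars p" using m by (auto simp: vars_def)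
    then show "vars (f i ^ Poly_Mapping.lookup m i) \<subseteq> (\<Union>i\<in>vars p. vars (f i))"
      using vars_power[of "f i"] by blast
  qed
  then show "vars (Const (Poly_Mapping.lookup p m) * (\<Prod>i\<in>Poly_Mapping.keys m. f i ^ Poly_Mapping.lookup m i))
      \<subseteq> (\<Union>i\<in>vars p. vars (f i))"
    by (simp add: order_trans[OF vars_mult])
qed

lemma partial_deriv_superset:
  assumes "finite A" "Poly_Mapping.keys p \<subseteq> A"
  shows "partial_deriv l p = (\<Sum>m\<in>A. Poly_Mapping.single (m - Poly_Mapping.single l 1)
    (of_nat (Poly_Mapping.lookup m l) * Poly_Mapping.lookup p m))"
  unfolding partial_deriv_def using assms by (intro sum.mono_neutral_left) (auto simp: in_keys_iff)

lemma partial_deriv_add: "partial_deriv l (p + q) = partial_deriv l p + partial_deriv l q"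
proof -
  let ?A = "Poly_Mapping.keys p \<union> Poly_Mapping.keys q"
  have "Poly_Mapping.keys (p + q) \<subseteq> ?A" by (rule keys_add)
  then show ?thesis
    by (simp add: partial_deriv_superset[of ?A] lookup_add distrib_left single_add sum.distrib)
qed

lemma partial_deriv_single: "partial_deriv l (Poly_Mapping.single m c) =
    Poly_Mapping.single (m - Poly_Mapping.single l 1) (of_nat (Poly_Mapping.lookup m l) * c)"
  by (simp add: partial_deriv_def)

lemma partial_deriv_0 [simp]: "partial_deriv l 0 = 0"
  by (simp add: partial_deriv_def)

lemma partial_deriv_sum: "partial_deriv l (sum g A) = (\<Sum>a\<in>A. partial_deriv l (g a))"
  by (induction A rule: infinite_finite_induct) (simp_all add: partial_deriv_add)

lemma partial_deriv_Var: "partial_deriv l (Var i) = (if i = l then 1 else 0)"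
  by (simp add: Var_def partial_deriv_single lookup_single)

lemma partial_deriv_monom2: "partial_deriv l (Const c * Var i * Var j) =
    Const (if i = l then c else 0) * Var j + Const (if j = l then c else 0) * Var i"
proof -
  let ?s = "\<lambda>i. Poly_Mapping.single i (1::nat)"
  have *: "Const c * Var i * Var j = Poly_Mapping.single (?s i + ?s j) c"
    by (simp add: Const_def Var_def mult_single)
  have V: "Const d * Var i = Poly_Mapping.single (?s i) d" for d :: 'a and i
    by (simp add: Const_def Var_def mult_single)
  have c: "?s i + ?s j - ?s j = ?s i" "?s i + ?s j - ?s i = ?s j"
    by (rule add_diff_cancel_right' add_diff_cancel_left')+
  have n: "of_nat ((if i = l then 1 else 0) + (if j = l then 1 else 0)) * c =
      (if i = l then c else 0) + (if j = l then c else 0)" by simp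
  have "partial_deriv l (Const c * Var i * Var j) = Poly_Mapping.single (?s i + ?s j - ?s l) (if i = l then c else 0)
      + Poly_Mapping.single (?s i + ?s j - ?s l) (if j = l then c else 0)"
    unfolding * partial_deriv_single lookup_add lookup_single when_def n single_add ..
  moreover have "Poly_Mapping.single (?s i + ?s j - ?s l) (if i = l then c else 0) = Const (if i = l then c else 0) * Var j"
  proof (cases "i = l")
    case True
    show ?thesis unfolding V True[symmetric] c by (simp only: refl if_True)
  next
    case False
    then show ?thesis by (simp only: if_False single_zero Const.hom_zero mult_zero_left)
  qed
  moreover have "Poly_Mapping.single (?s i + ?s j - ?s l) (if j = l then c else 0) = Const (if j = l then c else 0) * Var i"
  proof (cases "j = l")
    case True
    show ?thesis unfolding V True[symmetric] c by (simp only: refl if_True)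
  next
    case False
    then show ?thesis by (simp only: if_False single_zero Const.hom_zero mult_zero_left)
  qed
  ultimately show ?thesis by (simp only:)
qed

section \<open>Quadratic forms and minors\<close>

text \<open>The coefficients are redundant: \<open>C i j\<close> and \<open>C j i\<close> belong to
  the same monomial. Only their sum, the polarization, is compared later, which in characteristic 2
  loses exactly the squares.\<close>

definition quad_form :: "nat \<Rightarrow> (nat \<Rightarrow> nat \<Rightarrow> 'a) \<Rightarrow> 'a::field mpoly" where
  "quad_form n C = (\<Sum>i<n. \<Sum>j<n. Const (C i j) * Var i * Var j)"

lemma monom_degree_superset:
  assumes "finite A" "Poly_Mapping.keys m \<subseteq> A"
  shows "monom_degree m = (\<Sum>i\<in>A. Poly_Mapping.lookup m i)"
  unfolding monom_degree_def using assms by (intro sum.mono_neutral_left) (auto simp: in_keys_iff)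

lemma monom_degree_add: "monom_degree (m + m') = monom_degree m + monom_degree m'"
proof -
  let ?A = "Poly_Mapping.keys m \<union> Poly_Mapping.keys m'"
  have "Poly_Mapping.keys (m + m') \<subseteq> ?A" by (rule keys_add)
  then show ?thesis
    by (simp add: monom_degree_superset[of ?A] lookup_add sum.distrib)
qed

lemma monom_degree_single [simp]: "monom_degree (Poly_Mapping.single i k) = k"
  by (simp add: monom_degree_def)

lemma monom_degree_SucE:
  assumes "monom_degree m = Suc d"
  obtains i m' where "m = Poly_Mapping.single i 1 + m'" "monom_degree m' = d"
proof -
  obtain i where i: "i \<in> Poly_Mapping.keys m" using assms by (force simp: monom_degree_def)
  define m' where "m' = m - Poly_Mapping.single i 1"
  have m: "m = Poly_Mapping.single i 1 + m'"
    using i unfolding m'_def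
    by (intro poly_mapping_eqI) (auto simp: lookup_add lookup_minus lookup_single in_keys_iff when_def)
  moreover have "monom_degree m' = d" using assms unfolding m monom_degree_add by simp
  ultimately show ?thesis by (rule that)
qed

abbreviation mon2 :: "nat \<Rightarrow> nat \<Rightarrow> (nat \<Rightarrow>\<^sub>0 nat)" where
  "mon2 i j \<equiv> Poly_Mapping.single i 1 + Poly_Mapping.single j 1"

lemma monom_degree_2E:
  assumes "monom_degree m = 2"
  obtains i j where "i \<le> j" "m = mon2 i j"
proof -
  obtain i m' where i: "m = Poly_Mapping.single i 1 + m'" "monom_degree m' = 1"
    using monom_degree_SucE[of m 1] assms by (auto simp: numeral_2_eq_2)
  then obtain j m'' where j: "m' = Poly_Mapping.single j 1 + m''" "monom_degree m'' = 0"
    using monom_degree_SucE[of m' 0] by auto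
  have "m'' = 0" using j(2) by (intro poly_mapping_eqI) (auto simp: monom_degree_def in_keys_iff)
  then have "m = mon2 i j" "m = mon2 j i" using i j by (simp_all add: add.commute)
  then show ?thesis using that[of i j] that[of j i] linear[of i j] by blast
qed

lemma mon2_eq_iff:
  assumes "i \<le> j" "k \<le> l" shows "mon2 i j = mon2 k l \<longleftrightarrow> i = k \<and> j = l"
proof
  assume "mon2 i j = mon2 k l"
  then have "Poly_Mapping.lookup (mon2 i j) a = Poly_Mapping.lookup (mon2 k l) a" for a by simp
  from this[of i] this[of j] this[of k] this[of l] assms show "i = k \<and> j = l"
    by (auto simp: lookup_add lookup_single when_def split: if_splits)
qed auto

lemma keys_mon2: "Poly_Mapping.keys (mon2 i j) = {i, j}"
  by (auto simp: in_keys_iff lookup_add lookup_single when_def split: if_splits)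

lemma quad_term: "Const c * Var i * Var j = Poly_Mapping.single (mon2 i j) c"
  by (simp add: Const_def Var_def mult_single)

lemma quad_form_of_homogeneous:
  assumes "vars p \<subseteq> {..<n}" "\<forall>m\<in>Poly_Mapping.keys p. monom_degree m = 2"
  shows "p = quad_form n (\<lambda>i j. if i \<le> j then Poly_Mapping.lookup p (mon2 i j) else 0)"
proof (rule poly_mapping_eqI)
  fix m
  let ?C = "\<lambda>i j. if i \<le> j then Poly_Mapping.lookup p (mon2 i j) else 0"
  have q: "Poly_Mapping.lookup (quad_form n ?C) m = (\<Sum>i<n. \<Sum>j<n. if mon2 i j = m then ?C i j else 0)"
    by (simp add: quad_form_def quad_term lookup_sum lookup_single when_def)
  show "Poly_Mapping.lookup p m = Poly_Mapping.lookup (quad_form n ?C) m"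
  proof (cases "m \<in> Poly_Mapping.keys p")
    case True
    with assms(2) obtain k l where kl: "k \<le> l" "m = mon2 k l" by (metis monom_degree_2E)
    then have b: "k < n" "l < n" using True assms(1) keys_mon2[of k l] by (auto simp: vars_def)
    have "(if mon2 i j = m then ?C i j else 0) = (if j = l then if i = k then Poly_Mapping.lookup p m else 0 else 0)" for i j
      using kl mon2_eq_iff[of i j k l] by auto
    then show ?thesis unfolding q using b by simp
  next
    case False
    then have "Poly_Mapping.lookup p m = 0" by (simp add: in_keys_iff)
    then show ?thesis unfolding q by (auto intro!: sum.neutral[symmetric])
  qed
qed

lemma partial_deriv_quad_form:
  assumes "l < n" shows "partial_deriv l (quad_form n C) = (\<Sum>i<n. Const (C i l + C l i) * Var i)"
proof -
  have if1: "Const (if b then c else 0) * v = (if b then Const c * v else 0)" for b c and v :: "'a mpoly" by simp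
  have "(\<Sum>i<n. \<Sum>j<n. if i = l then Const (C i j) * Var j else 0) = (\<Sum>j<n. Const (C l j) * Var j)"
    by (subst sum.swap) (simp add: assms)
  then show ?thesis
    by (simp add: quad_form_def partial_deriv_sum partial_deriv_monom2 sum.distrib if1 assms
      Const.hom_add distrib_right)
qed

section \<open>Coordinate vectors and minors\<close>

definition fscale :: "'l::field \<Rightarrow> (nat \<Rightarrow> 'l) \<Rightarrow> nat \<Rightarrow> 'l" where
  "fscale c f = (\<lambda>i. c * f i)"

interpretation fs: vec_sp "fscale :: 'l::field \<Rightarrow> (nat \<Rightarrow> 'l) \<Rightarrow> nat \<Rightarrow> 'l"
  by unfold_locales (auto simp: fscale_def fun_eq_iff algebra_simps)

lemma sum_fun_apply: "(\<Sum>a\<in>A. f a) i = (\<Sum>a\<in>A. f a i :: 'l::comm_monoid_add)"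
  by (induction A rule: infinite_finite_induct) simp_all

definition fminor :: "(nat \<Rightarrow> 'l::comm_ring_1) list \<Rightarrow> nat list \<Rightarrow> 'l mat" where
  "fminor us rs = mat (length us) (length us) (\<lambda>(l, j). (us ! j) (rs ! l))"

text \<open>Minors are used because they commute with ring homomorphisms. In the induction a row k
  is added in front; the cofactors of that row do not depend on k, so if all these determinants
  vanished, the cofactors would be a linear relation, whose first coefficient is the nonzero minor
  already found.\<close>

lemma ex_nonzero_minor:
  fixes us :: "(nat \<Rightarrow> 'l::field) list"
  assumes "fs.li us" "\<And>u k. u \<in> set us \<Longrightarrow> k \<ge> n \<Longrightarrow> u k = 0"
  obtains rs where "length rs = length us" "set rs \<subseteq> {..<n}" "det (fminor us rs) \<noteq> 0"
  using assms
proof (induction us arbitrary: thesis)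
  case Nil
  show ?case by (rule Nil.prems(1)[of "[]"]) (simp_all add: fminor_def)
next
  case (Cons v us)
  have li: "fs.li (v # us)" and li': "fs.li us" using Cons.prems(2) by (simp_all add: fs.li_Cons)
  obtain rs where rs: "length rs = length us" "set rs \<subseteq> {..<n}" "det (fminor us rs) \<noteq> 0"
    by (rule Cons.IH[OF _ li']) (use Cons.prems(3) in auto)
  let ?m = "Suc (length us)"
  define A where "A k = fminor (v # us) (k # rs)" for k
  have A: "A k \<in> carrier_mat ?m ?m" for k by (simp add: A_def fminor_def)
  have del: "mat_delete (A k) 0 j = mat_delete (A 0) 0 j" for k j
    by (rule eq_matI) (auto simp: mat_delete_def A_def fminor_def)
  have del0: "mat_delete (A k) 0 0 = fminor us rs" for k
    by (rule eq_matI) (auto simp: mat_delete_def A_def fminor_def)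
  define cs where "cs = map (\<lambda>j. cofactor (A 0) 0 j) [0..<?m]"
  have cs: "length cs = length (v # us)" "cs ! 0 \<noteq> 0"
    using rs(3) by (simp_all add: cs_def cofactor_def del0 nth_Cons' del: upt_Suc)
  have det: "det (A k) = fs.lincomb_list cs (v # us) k" for k
  proof -
    have "det (A k) = (\<Sum>j<?m. A k $$ (0, j) * cofactor (A k) 0 j)"
      by (rule laplace_expansion_row[OF A]) simp
    also have "\<dots> = (\<Sum>j<?m. cs ! j * ((v # us) ! j) k)"
    proof (rule sum.cong[OF refl])
      fix j assume j: "j \<in> {..<?m}"
      then have "A k $$ (0, j) = ((v # us) ! j) k" by (simp add: A_def fminor_def)
      moreover have "cofactor (A k) 0 j = cs ! j"
        using j by (simp add: cs_def cofactor_def del[of k] del: upt_Suc)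
      ultimately show "A k $$ (0, j) * cofactor (A k) 0 j = cs ! j * ((v # us) ! j) k" by simp
    qed
    also have "\<dots> = fs.lincomb_list cs (v # us) k"
      by (subst fs.lincomb_list_sum[OF cs(1)]) (simp add: sum_fun_apply fscale_def)
    finally show ?thesis .
  qed
  have "\<exists>k<n. det (A k) \<noteq> 0"
  proof (rule ccontr)
    assume no: "\<not> ?thesis"
    have "fs.lincomb_list cs (v # us) = 0"
    proof
      fix k show "fs.lincomb_list cs (v # us) k = 0 k"
      proof (cases "k < n")
        case True
        with no show ?thesis by (simp flip: det)
      next
        case False
        then have "((v # us) ! j) k = 0" if "j < length (v # us)" for j
          using Cons.prems(3)[of "(v # us) ! j" k] nth_mem[OF that] by simp
        then show ?thesis
          by (subst fs.lincomb_list_sum[OF cs(1)]) (simp add: sum_fun_apply fscale_def del: sum.lessThan_Suc)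
      qed
    qed
    with li cs(1) have "set cs \<subseteq> {0}" by (auto simp: fs.li_def)
    moreover have "cs ! 0 \<in> set cs" using cs(1) by (intro nth_mem) simp
    ultimately show False using cs(2) by blast
  qed
  then obtain k where "k < n" "det (A k) \<noteq> 0" by blast
  with rs show ?case by (intro Cons.prems(1)[of "k # rs"]) (auto simp: A_def)
qed

lemma li_of_nonzero_minor:
  fixes us :: "(nat \<Rightarrow> 'l::field) list"
  assumes "det (fminor us rs) \<noteq> 0"
  shows "fs.li us"
  unfolding fs.li_def
proof (intro allI impI)
  fix cs assume cs: "length cs = length us" "fs.lincomb_list cs us = 0"
  let ?m = "length us"
  have A: "fminor us rs \<in> carrier_mat ?m ?m" by (simp add: fminor_def)
  have "fminor us rs *\<^sub>v vec ?m ((!) cs) = 0\<^sub>v ?m"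
  proof (rule eq_vecI)
    fix l assume l: "l < dim_vec (0\<^sub>v ?m :: 'l vec)"
    have "(fminor us rs *\<^sub>v vec ?m ((!) cs)) $ l = (\<Sum>j<?m. (us ! j) (rs ! l) * cs ! j)"
      using l by (simp add: fminor_def scalar_prod_def atLeast0LessThan)
    also have "\<dots> = fs.lincomb_list cs us (rs ! l)"
      by (subst fs.lincomb_list_sum[OF cs(1)]) (simp add: sum_fun_apply fscale_def mult.commute)
    finally show "(fminor us rs *\<^sub>v vec ?m ((!) cs)) $ l = 0\<^sub>v ?m $ l" using cs(2) l by simp
  qed (simp add: fminor_def)
  then have "vec ?m ((!) cs) = 0\<^sub>v ?m"
    using assms det_0_iff_vec_prod_zero_field[OF A] by (metis vec_carrier)
  then have "cs ! j = 0" if "j < ?m" for j using that by (metis index_vec index_zero_vec(1))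
  then show "set cs \<subseteq> {0}" using cs(1) by (auto simp: in_set_conv_nth)
qed

section \<open>The algebra of a quadratic Keller map\<close>

definition bil :: "nat \<Rightarrow> (nat \<Rightarrow> nat \<Rightarrow> nat \<Rightarrow> 'l) \<Rightarrow> (nat \<Rightarrow> 'l) \<Rightarrow> (nat \<Rightarrow> 'l) \<Rightarrow> nat \<Rightarrow> 'l::field" where
  "bil n B x y = (\<lambda>k. if k < n then \<Sum>i<n. \<Sum>j<n. B k i j * x i * y j else 0)"

definition polar :: "(nat \<Rightarrow> nat \<Rightarrow> nat \<Rightarrow> 'a::field) \<Rightarrow> nat \<Rightarrow> nat \<Rightarrow> nat \<Rightarrow> 'a" where
  "polar C k i j = C k i j + C k j i"

definition fbasis :: "nat \<Rightarrow> nat \<Rightarrow> 'l::field" where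
  "fbasis l = (\<lambda>i. if i = l then 1 else 0)"

lemma bil_matrix: "k < n \<Longrightarrow> bil n B x y k = (\<Sum>l<n. (\<Sum>i<n. B k i l * x i) * y l)"
  unfolding bil_def by (simp add: sum_distrib_right) (rule sum.swap)

lemma bil_ge: "n \<le> k \<Longrightarrow> bil n B x y k = 0"
  by (simp add: bil_def)

lemma bil_cong: "(\<And>i. i < n \<Longrightarrow> y i = y' i) \<Longrightarrow> bil n B x y = bil n B x y'"
  by (auto simp: bil_def fun_eq_iff)

lemma comm_alg_bil:
  assumes "\<And>k i j. B k i j = B k j i" shows "comm_alg fscale (bil n B)"
proof unfold_locales
  fix x y z :: "nat \<Rightarrow> 'a" and c
  show "bil n B x y = bil n B y x"
  proof
    fix k
    have "(\<Sum>i<n. \<Sum>j<n. B k i j * x i * y j) = (\<Sum>i<n. \<Sum>j<n. B k j i * x j * y i)"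
      by (rule sum.swap)
    also have "\<dots> = (\<Sum>i<n. \<Sum>j<n. B k i j * y i * x j)"
      by (intro sum.cong refl) (simp add: assms[of k] mult_ac)
    finally show "bil n B x y k = bil n B y x k" by (simp add: bil_def)
  qed
  show "bil n B (x + y) z = bil n B x z + bil n B y z"
    by (auto simp: bil_def fun_eq_iff algebra_simps sum.distrib)
  show "bil n B (fscale c x) y = fscale c (bil n B x y)"
    by (auto simp: bil_def fun_eq_iff fscale_def sum_distrib_left mult_ac)
qed

lemma bil_fbasis: "k < n \<Longrightarrow> l < n \<Longrightarrow> bil n B x (fbasis l) k = (\<Sum>i<n. B k i l * x i)"
  by (simp add: bil_matrix fbasis_def if_distrib[of "\<lambda>a. _ * a"] cong: if_cong)

lemma bil_expand: "bil n B x y = (\<Sum>l<n. fscale (y l) (bil n B x (fbasis l)))"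
proof
  fix k show "bil n B x y k = (\<Sum>l<n. fscale (y l) (bil n B x (fbasis l))) k"
  proof (cases "k < n")
    case True
    then have "(\<Sum>l<n. fscale (y l) (bil n B x (fbasis l))) k = (\<Sum>l<n. (\<Sum>i<n. B k i l * x i) * y l)"
      by (simp add: sum_fun_apply fscale_def bil_fbasis mult.commute)
    then show ?thesis using True by (simp add: bil_matrix)
  qed (simp add: sum_fun_apply fscale_def bil_ge)
qed

text \<open>Via \<phi> the same coefficients give an algebra over K itself or over an extension
  field of K.\<close>

locale quad_map = \<phi>: coeff_hom \<phi> for \<phi> :: "'a::field \<Rightarrow> 'l::field" +
  fixes n :: nat and C :: "nat \<Rightarrow> nat \<Rightarrow> nat \<Rightarrow> 'a" and H :: "'a mpoly vec"
  assumes dim_H: "H \<in> carrier_vec n" and H_eq: "k < n \<Longrightarrow> H $ k = quad_form n (C k)"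
begin

definition B :: "nat \<Rightarrow> nat \<Rightarrow> nat \<Rightarrow> 'l" where "B k i j = \<phi> (polar C k i j)"

lemma B_sym: "B k i j = B k j i"
  by (simp add: B_def polar_def add.commute)

sublocale comm_alg fscale "bil n B"
  by (rule comm_alg_bil[OF B_sym])

lemma insertion_deriv:
  assumes "k < n" "l < n" shows "insertion \<phi> x (partial_deriv l (H $ k)) = bil n B x (fbasis l) k"
  by (simp add: assms H_eq partial_deriv_quad_form \<phi>.insertion.hom_sum \<phi>.insertion_mult bil_fbasis B_def polar_def)

text \<open>Replacing the variables by s x_i makes the Jacobian matrix 1 + s J with J the
  multiplication by x, still of constant determinant. Its adjugate, polynomial in s, is a multiple
  of the geometric series of - s J; since it has only finitely many coefficients, some power of J
  kills y.\<close>

lemma nilpotent: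
  assumes det: "det (jacobian n (id_map n + H)) = Const c" "c \<noteq> 0"
  shows "\<exists>N. ((bil n B x) ^^ N) y = 0"
proof -
  interpret p: coeff_hom "\<lambda>c. [:\<phi> c:]"
    by unfold_locales (simp_all add: \<phi>.hom_add \<phi>.hom_mult one_pCons)
  define ev where "ev = insertion (\<lambda>c. [:\<phi> c:]) (\<lambda>i. [:0, x i:])"
  interpret ev: comm_ring_hom ev unfolding ev_def by (rule p.insertion.comm_ring_hom_axioms)
  let ?J = "jacobian n (id_map n + H)"
  define A where "A = map_mat ev ?J"
  have A: "A \<in> carrier_mat n n" by (simp add: A_def jacobian_def)
  have A_index: "A $$ (k, l) = (if k = l then 1 else 0) + [:0, bil n B x (fbasis l) k:]"
    if "k < n" "l < n" for k l
  proof -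
    have "(id_map n + H) $ k = Var k + H $ k" using that dim_H by (simp add: id_map_def)
    moreover have "ev (partial_deriv l (H $ k)) = [:0, bil n B x (fbasis l) k:]"
    proof -
      have "ev (partial_deriv l (H $ k)) = (\<Sum>i<n. ev (Const (C k i l + C k l i)) * ev (Var i))"
        using that by (simp add: H_eq partial_deriv_quad_form ev.hom_sum ev.hom_mult)
      also have "\<dots> = (\<Sum>i<n. [:0, B k i l * x i:])"
        by (intro sum.cong refl) (simp add: ev_def B_def polar_def mult.commute)
      also have "\<dots> = [:0, \<Sum>i<n. B k i l * x i:]"
        by (induction n) simp_all
      finally show ?thesis using that by (simp add: bil_fbasis)
    qed
    ultimately show ?thesis using that
      by (simp add: A_def jacobian_def partial_deriv_add partial_deriv_Var ev.hom_add)
  qed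
  have "det A = ev (det ?J)" unfolding A_def by (rule ev.hom_det)
  then have "A * adj_mat A = [:\<phi> c:] \<cdot>\<^sub>m 1\<^sub>m n" using adj_mat(2)[OF A] det(1) by (simp add: ev_def)
  then have "A *\<^sub>v (adj_mat A *\<^sub>v vec n (\<lambda>i. [:y i:])) = ([:\<phi> c:] \<cdot>\<^sub>m 1\<^sub>m n) *\<^sub>v vec n (\<lambda>i. [:y i:])"
    using A adj_mat(1)[OF A] by (metis assoc_mult_mat_vec vec_carrier)
  moreover define w where "w = adj_mat A *\<^sub>v vec n (\<lambda>i. [:y i:])"
  ultimately have w: "A *\<^sub>v w = ([:\<phi> c:] \<cdot>\<^sub>m 1\<^sub>m n) *\<^sub>v vec n (\<lambda>i. [:y i:])" by simp
  have dim_w: "dim_vec w = n" using adj_mat(1)[OF A] by (simp add: w_def)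
  have eq: "w $ k + (\<Sum>l<n. [:0, bil n B x (fbasis l) k:] * w $ l) = [:\<phi> c * y k:]" if "k < n" for k
  proof -
    have "(A *\<^sub>v w) $ k = (\<Sum>l<n. A $$ (k, l) * w $ l)"
      using that A dim_w by (simp add: scalar_prod_def atLeast0LessThan)
    also have "\<dots> = (\<Sum>l<n. (if k = l then w $ l else 0) + [:0, bil n B x (fbasis l) k:] * w $ l)"
      using that by (intro sum.cong refl) (simp add: A_index distrib_right)
    also have "\<dots> = w $ k + (\<Sum>l<n. [:0, bil n B x (fbasis l) k:] * w $ l)"
      using that by (simp add: sum.distrib)
    finally have "(A *\<^sub>v w) $ k = \<dots>" .
    moreover have "(([:\<phi> c:] \<cdot>\<^sub>m 1\<^sub>m n) *\<^sub>v vec n (\<lambda>i. [:y i:])) $ k = [:\<phi> c * y k:]"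
      using that by (simp add: scalar_prod_def if_distrib[of "\<lambda>a. a * _"]
        if_distrib[of "\<lambda>a. _ * a"] if_distrib[of "Polynomial.smult _"] mult.commute cong: if_cong)
    ultimately show ?thesis using w by simp
  qed
  \<comment> \<open>The coefficient vectors of the adjugate applied to y: multiplication by x sends
    each to the negative of the next, and the one of order 0 is y times the nonzero
    constant.\<close>
  define W where "W s k = (if k < n then coeff (w $ k) s else 0)" for s k
  have W_Suc: "bil n B x (W s) = fscale (-1) (W (Suc s))" for s
  proof
    fix k show "bil n B x (W s) k = fscale (-1) (W (Suc s)) k"
    proof (cases "k < n")
      case True
      have "coeff (w $ k) (Suc s) + (\<Sum>l<n. bil n B x (fbasis l) k * coeff (w $ l) s) = 0"
        using arg_cong[OF eq[OF True], of "\<lambda>p. coeff p (Suc s)"] by (simp add: coeff_sum)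
      moreover have "bil n B x (W s) k = (\<Sum>l<n. bil n B x (fbasis l) k * coeff (w $ l) s)"
        using True by (simp add: bil_fbasis) (simp add: bil_matrix W_def)
      ultimately show ?thesis
        using True by (simp add: W_def fscale_def eq_neg_iff_add_eq_0 add.commute)
    qed (simp add: bil_ge W_def fscale_def)
  qed
  have "W 0 k = \<phi> c * y k" if "k < n" for k
    using arg_cong[OF eq[OF that], of "\<lambda>p. coeff p 0"] that by (simp add: coeff_sum W_def)
  then have W_0: "bil n B x (fscale (\<phi> c) y) = bil n B x (W 0)"
    by (intro bil_cong) (simp add: fscale_def)
  have pow: "((bil n B x) ^^ s) (W 0) = fscale ((-1) ^ s) (W s)" for s
  proof (induction s)
    case (Suc s)
    then show ?case by (simp add: mul_simps W_Suc)
  qed (simp add: fscale_def)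
  have lin: "((bil n B x) ^^ s) (fscale d z) = fscale d (((bil n B x) ^^ s) z)" for s d z
    by (induction s) (simp_all add: mul_simps)
  define s where "s = Suc (Max ((\<lambda>k. degree (w $ k)) ` {..<n}))"
  have "W (Suc s) = 0"
  proof
    fix k show "W (Suc s) k = 0 k"
    proof (cases "k < n")
      case True
      then have "degree (w $ k) < s" unfolding s_def by (intro le_imp_less_Suc Max_ge) auto
      then show ?thesis by (simp add: W_def coeff_eq_0)
    qed (simp add: W_def)
  qed
  have "fscale (\<phi> c) (((bil n B x) ^^ Suc s) y) = ((bil n B x) ^^ Suc s) (fscale (\<phi> c) y)"
    by (rule lin[symmetric])
  also have "\<dots> = ((bil n B x) ^^ Suc s) (W 0)" by (simp only: funpow_Suc_right comp_apply W_0)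
  also have "\<dots> = 0" unfolding pow \<open>W (Suc s) = 0\<close> by simp
  finally have "fscale (\<phi> c) (((bil n B x) ^^ Suc s) y) = 0" .
  moreover have "\<phi> c \<noteq> 0" using \<phi>.hom_mult[of c "inverse c"] det(2) by auto
  ultimately have "((bil n B x) ^^ Suc s) y = 0" by (simp add: fscale_def fun_eq_iff)
  then show ?thesis by blast
qed

text \<open>Four independent images under the multiplication by x would give a nonzero 4 by 4 minor
  of the Jacobian matrix evaluated at x, hence a minor that is nonzero as a polynomial, hence four
  independent columns over the fraction field.\<close>

lemma rank_bound:
  assumes rank: "jacobian_rank n H \<le> 3" and ys: "length ys = 4"
  shows "\<not> fs.li (map (bil n B x) ys)"
proof
  assume li: "fs.li (map (bil n B x) ys)"
  define U where "U = (\<lambda>l. bil n B x (fbasis l)) ` {..<n}"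
  have in_U: "bil n B x y \<in> fs.span U" for y
    unfolding bil_expand[of n B x y] U_def by (intro fs.span_sum fs.span_scale fs.span_base) auto
  have "\<exists>vs. fs.li vs \<and> set vs \<subseteq> U \<and> 4 \<le> length vs"
  proof (rule ccontr)
    assume "\<not> ?thesis"
    then have "length vs \<le> 3" if "fs.li vs" "set vs \<subseteq> U" for vs using that by force
    then obtain zs where zs: "length zs = 3" "U \<subseteq> fs.span (set zs)" by (rule fs.ex_spanning_list)
    then have "fs.span U \<subseteq> fs.span (set zs)" by (simp add: fs.span_minimal)
    then have "set (map (bil n B x) ys) \<subseteq> fs.span (set zs)" using in_U by auto
    from fs.li_length_le[OF li this] zs(1) ys show False by simp
  qed
  then obtain vs where vs: "fs.li vs" "set vs \<subseteq> U" "4 \<le> length vs" by blast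
  have vs4: "fs.li (take 4 vs)" "set (take 4 vs) \<subseteq> U" "length (take 4 vs) = 4"
    using vs set_take_subset[of 4 vs] fs.independent_mono[of "set vs" "set (take 4 vs)"]
    by (auto simp: fs.li_iff_independent)
  have "take 4 vs \<in> map (\<lambda>l. bil n B x (fbasis l)) ` lists {..<n}"
    unfolding lists_image[symmetric] U_def[symmetric] using vs4(2) by (simp only: in_lists_conv_set subset_iff) blast
  then obtain js where "js \<in> lists {..<n}" and js2: "take 4 vs = map (\<lambda>l. bil n B x (fbasis l)) js"
    by (rule imageE)
  then have js: "set js \<subseteq> {..<n}" "take 4 vs = map (\<lambda>l. bil n B x (fbasis l)) js" by auto
  have len: "length js = 4" using vs4(3) js(2) by (metis length_map)
  obtain rs where rs: "length rs = 4" "set rs \<subseteq> {..<n}" "det (fminor (take 4 vs) rs) \<noteq> 0"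
    by (rule ex_nonzero_minor[OF vs4(1), of n]) (use vs4 js in \<open>auto simp: bil_ge\<close>)
  have nth: "rs ! i < n" "js ! i < n" if "i < 4" for i
    using that len rs(1,2) js(1) by (metis lessThan_iff nth_mem subsetD)+
  define P where "P = fminor (map (\<lambda>l k. partial_deriv l (H $ k)) js) rs"
  have "map_mat (insertion \<phi> x) P = fminor (take 4 vs) rs"
    unfolding js(2) using len rs(1) nth
    by (intro eq_matI) (auto simp: P_def fminor_def insertion_deriv)
  then have "insertion \<phi> x (det P) \<noteq> 0" using rs(3) by (metis \<phi>.insertion.hom_det)
  then have "det P \<noteq> 0" by auto
  interpret Fr: inj_comm_ring_hom "\<lambda>p::'a mpoly. Fract p 1"
    by unfold_locales (simp_all add: Zero_fract_def One_fract_def eq_fract)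
  have "det (map_mat (\<lambda>p. Fract p 1) P) \<noteq> 0" using \<open>det P \<noteq> 0\<close> by (metis Fr.hom_det Fr.hom_0_iff)
  define J where "J = map_mat (\<lambda>p. Fract p 1) (jacobian n H)"
  have J: "J \<in> carrier_mat n n" by (simp add: J_def jacobian_def)
  define f where "f l = (\<lambda>k. if k < n then J $$ (k, l) else 0)" for l
  have "map_mat (\<lambda>p. Fract p 1) P = fminor (map f js) rs"
    using len rs(1) nth
    by (intro eq_matI) (auto simp: P_def fminor_def f_def J_def jacobian_def)
  then have li_f: "fs.li (map f js)"
    using \<open>det (map_mat _ P) \<noteq> 0\<close> by (intro li_of_nonzero_minor) simp
  interpret V: vec_space "TYPE('a mpoly fract)" n .
  define cs where "cs = map (col J) js"
  have col: "col J l = vec n (f l)" if "l < n" for l using that J by (intro eq_vecI) (auto simp: f_def)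
  have "distinct (map f js)" using li_f by (simp add: fs.li_iff_independent)
  moreover have "f l = f l'" if "col J l = col J l'" "l < n" "l' < n" for l l'
  proof
    fix k show "f l k = f l' k"
    proof (cases "k < n")
      case True
      then have "J $$ (k, l) = col J l $ k" "J $$ (k, l') = col J l' $ k" using that(2,3) J by simp_all
      with that(1) show ?thesis by (simp add: f_def)
    qed (simp add: f_def)
  qed
  ultimately have dist: "distinct cs"
    using js(1) unfolding cs_def distinct_map inj_on_def by (metis in_mono lessThan_iff)
  have cs: "cs ! j = vec n (map f js ! j)" if "j < 4" for j
    using that len col[OF nth(2)] by (simp add: cs_def)
  have "set cs \<subseteq> set (cols J)" using js(1) J by (auto simp: cs_def cols_def)
  moreover have "V.lin_indpt (set cs)"
  proof
    let ?A = "mat_of_cols n cs"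
    have "set cs \<subseteq> carrier_vec n" using J by (auto simp: cs_def)
    then have A: "?A \<in> carrier_mat n 4" "cols ?A = cs"
      using len cols_mat_of_cols[of cs n] mat_of_cols_carrier(1)[of n cs] by (simp_all add: cs_def)
    assume "V.lin_dep (set cs)"
    then obtain v where v: "v \<in> carrier_vec 4" "v \<noteq> 0\<^sub>v 4" "?A *\<^sub>v v = 0\<^sub>v n"
      using V.lin_depE[of ?A 4] A dist by metis
    define c where "c = map (\<lambda>j. v $ j) [0..<4]"
    have c: "length c = length (map f js)" by (simp add: c_def len)
    have "fs.lincomb_list c (map f js) = 0"
    proof
      fix k
      have "fs.lincomb_list c (map f js) k = (\<Sum>j<4. v $ j * f (js ! j) k)"
        by (subst fs.lincomb_list_sum[OF c]) (simp add: sum_fun_apply fscale_def len c_def)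
      also have "\<dots> = 0"
      proof (cases "k < n")
        case True
        then have "(?A *\<^sub>v v) $ k = (\<Sum>j<4. f (js ! j) k * v $ j)"
          using A(1) v(1) len cs by (simp add: scalar_prod_def atLeast0LessThan mat_of_cols_index cs_def)
        with v(3) True show ?thesis by (simp add: mult.commute)
      qed (simp add: f_def)
      finally show "fs.lincomb_list c (map f js) k = 0 k" by simp
    qed
    then have "set c \<subseteq> {0}" using li_f c by (simp add: fs.li_def)
    then have "v $ j = 0" if "j < 4" for j using that by (simp add: c_def image_subset_iff)
    then have "v = 0\<^sub>v 4" using v(1) by (intro eq_vecI) auto
    with v(2) show False by simp
  qed
  ultimately have "card (set cs) \<le> V.rank J" by (rule V.rank_ge_card_indpt[OF J])
  moreover have "card (set cs) = 4" using distinct_card[OF dist] len by (simp add: cs_def)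
  ultimately show False using rank unfolding jacobian_rank_def J_def[symmetric] by simp
qed

end

lemma alternating_double_sum:
  fixes f :: "nat \<Rightarrow> nat \<Rightarrow> 'l::comm_ring_1"
  assumes "(2::'l) = 0" "\<And>i j. f i j = f j i" "\<And>i. f i i = 0"
  shows "(\<Sum>i<n. \<Sum>j<n. f i j) = 0"
proof (induction n)
  case (Suc n)
  have "(\<Sum>i<n. f i n) = (\<Sum>i<n. f n i)" using assms(2) by simp
  moreover have "a + a = 0" for a :: 'l using assms(1) by (metis mult_2 mult_zero_left)
  ultimately show ?case using Suc assms(3) by (simp add: sum.distrib)
qed simp

locale keller_quad = quad_map \<phi> n C H
  for \<phi> :: "'a::field \<Rightarrow> 'l::field" and n C and H :: "'a mpoly vec" +
  assumes keller: "\<exists>c. c \<noteq> 0 \<and> det (jacobian n (id_map n + H)) = Const c"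
    and rank: "jacobian_rank n H \<le> 3"
begin

sublocale nilp_alg fscale "bil n B"
proof unfold_locales
  show "\<not> fs.li (map (bil n B x) ys)" if "length ys = 4" for x ys
    by (rule rank_bound[OF rank that])
  show "\<exists>N. (bil n B x ^^ N) y = 0" for x y
    using keller nilpotent by blast
qed

lemma alternating:
  assumes "(2::'l) = 0" shows "bil n B x x = 0"
proof
  fix k
  have "B k i i = 0" for i
    using assms by (metis B_def polar_def \<phi>.hom_add mult_2 mult_zero_left)
  then show "bil n B x x k = 0 k"
    using alternating_double_sum[OF assms, of "\<lambda>i j. B k i j * x i * x j"] B_sym
    by (simp add: bil_def mult_ac)
qed

lemma perfect_small:
  assumes "infinite (UNIV :: 'l set)" "perfect W" shows "fs.small W"
proof (cases "(2::'l) = 0")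
  case True
  interpret alt_nilp_alg fscale "bil n B"
    by unfold_locales (use assms True alternating in simp_all)
  show ?thesis by (rule perfect_small[OF assms(2)])
next
  case False
  interpret sym_nilp_alg fscale "bil n B"
    by unfold_locales (use assms False in simp_all)
  show ?thesis by (rule perfect_small[OF assms(2)])
qed

lemma perfect_cube:
  assumes "infinite (UNIV :: 'l set)" "perfect W" "w \<in> W"
  shows "bil n B x (bil n B x (bil n B y w)) + bil n B x (bil n B y (bil n B x w))
    + bil n B y (bil n B x (bil n B x w)) = 0"
proof -
  interpret inf_nilp_alg fscale "bil n B" by unfold_locales (rule assms)
  obtain v1 v2 v3 where v: "W \<subseteq> fs.span {v1, v2, v3}"
    using perfect_small[OF assms(1,2)] by (auto simp: fs.small_def)
  show ?thesis
    by (rule polarized_cube, rule cube_zero_of_dim3[OF _ v assms(3)]) (rule perfect_mul[OF assms(2)])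
qed

end

section \<open>Extension of scalars to an infinite field\<close>

locale keller_quad_ext = \<iota>: coeff_hom \<iota> + K: keller_quad \<kappa> n C H
  for \<iota> :: "'k::field \<Rightarrow> 'l::field" and \<kappa> :: "'a::field \<Rightarrow> 'k" and n C and H :: "'a mpoly vec" +
  assumes infinite_ext: "infinite (UNIV :: 'l set)"
begin

sublocale L: keller_quad "\<lambda>c. \<iota> (\<kappa> c)" n C H
proof -
  have "coeff_hom (\<lambda>c. \<iota> (\<kappa> c))"
    by unfold_locales (simp_all add: \<iota>.hom_add \<iota>.hom_mult K.\<phi>.hom_add K.\<phi>.hom_mult)
  then show "keller_quad (\<lambda>c. \<iota> (\<kappa> c)) n C H"
    by (intro keller_quad.intro quad_map.intro quad_map_axioms.intro keller_quad_axioms.intro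
      K.dim_H K.H_eq K.keller K.rank)
qed

abbreviation "mulK \<equiv> bil n K.B"
abbreviation "mulL \<equiv> bil n L.B"

definition lift :: "(nat \<Rightarrow> 'k) \<Rightarrow> nat \<Rightarrow> 'l" where "lift x = (\<lambda>k. \<iota> (x k))"

lemma \<iota>_eq_0 [simp]: "\<iota> c = 0 \<longleftrightarrow> c = 0"
  using \<iota>.hom_mult[of c "inverse c"] by (cases "c = 0") auto

lemma lift_mul: "lift (mulK x y) = mulL (lift x) (lift y)"
  by (simp add: lift_def bil_def fun_eq_iff \<iota>.hom_sum \<iota>.hom_mult K.B_def L.B_def)

lemma lift_simps: "lift (x + y) = lift x + lift y" "lift (fscale c x) = fscale (\<iota> c) (lift x)" "lift 0 = 0"
  by (simp_all add: lift_def fscale_def fun_eq_iff \<iota>.hom_add \<iota>.hom_mult)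

lemma lift_eq_0: "lift x = 0 \<longleftrightarrow> x = 0"
  by (simp add: lift_def fun_eq_iff)

lemma lift_fbasis: "lift (fbasis l) = fbasis l"
  by (auto simp: lift_def fbasis_def)

text \<open>The unit vectors are lifts of unit vectors, so products with them stay in the span of
  the lifted products; an arbitrary factor over the larger field is a combination of unit
  vectors.\<close>

lemma perfect_lift:
  assumes W: "K.perfect W" shows "L.perfect (fs.span (lift ` W))"
proof -
  let ?WL = "fs.span (lift ` W)"
  have "L.products ?WL \<subseteq> ?WL"
  proof (rule L.products_least)
    fix x w assume "w \<in> ?WL"
    then show "mulL x w \<in> ?WL"
    proof (induction rule: fs.span_induct_alt)
      case base
      show ?case by (simp only: L.mul_zero_right fs.span_zero)
    next
      case (step c z y)
      then obtain w where w: "w \<in> W" "z = lift w" by blast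
      have "mulL (fbasis l) z \<in> ?WL" for l
        using K.perfect_mul[OF W w(1), of "fbasis l"] w(2)
        by (metis fs.span_base image_eqI lift_fbasis lift_mul)
      then have "mulL x z \<in> ?WL"
        unfolding L.mul_commute[of x z] bil_expand[of n L.B z x]
        by (intro fs.span_sum fs.span_scale) (simp add: L.mul_commute[of z])
      with step show ?case by (simp only: L.mul_simps fs.span_add fs.span_scale)
    qed
  qed simp
  moreover have "?WL \<subseteq> L.products ?WL"
  proof (rule fs.span_minimal[OF _ L.subspace_products], safe)
    fix w assume "w \<in> W"
    then have "w \<in> fs.span {mulK x w | x w. w \<in> W}" using W by (simp add: K.perfect_def K.products_def)
    then show "lift w \<in> L.products ?WL"
    proof (induction rule: fs.span_induct_alt)
      case base
      then show ?case using fs.subspace_0[OF L.subspace_products] by (simp only: lift_simps)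
    next
      case (step c z y)
      then obtain x w where "w \<in> W" "z = mulK x w" by blast
      then have "lift z \<in> L.products ?WL" by (simp add: lift_mul L.mul_in_products fs.span_base)
      with step show ?case
        unfolding lift_simps
        by (intro fs.subspace_add[OF L.subspace_products] fs.subspace_scale[OF L.subspace_products])
    qed
  qed
  ultimately show ?thesis by (simp add: L.perfect_def)
qed

text \<open>A nonzero minor remains nonzero under the field homomorphism \<iota>. This is what lets
  the bound on dim W descend.\<close>

lemma lift_li:
  assumes "fs.li us" "\<And>u k. u \<in> set us \<Longrightarrow> k \<ge> n \<Longrightarrow> u k = 0" shows "fs.li (map lift us)"
proof -
  obtain rs where rs: "length rs = length us" "det (fminor us rs) \<noteq> 0"
    by (rule ex_nonzero_minor[of us n]) (use assms in blast)+
  have "fminor (map lift us) rs = map_mat \<iota> (fminor us rs)"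
    by (rule eq_matI) (auto simp: fminor_def lift_def)
  then have "det (fminor (map lift us) rs) = \<iota> (det (fminor us rs))" by (simp add: \<iota>.hom_det)
  then show ?thesis using rs by (intro li_of_nonzero_minor[of _ rs]) simp
qed

lemma perfect_supported:
  assumes "K.perfect W" "w \<in> W" "n \<le> k" shows "w k = 0"
proof -
  have "w \<in> fs.span {mulK x w | x w. w \<in> W}" using assms by (simp add: K.perfect_def K.products_def)
  then show ?thesis
    by (induction rule: fs.span_induct_alt) (use bil_ge[OF assms(3)] in \<open>auto simp: fscale_def\<close>)
qed

lemma perfect_small_K:
  assumes W: "K.perfect W" shows "fs.small W"
proof -
  obtain v1 v2 v3 where v: "fs.span (lift ` W) \<subseteq> fs.span {v1, v2, v3}"
    using L.perfect_small[OF infinite_ext perfect_lift[OF W]] by (auto simp: fs.small_def)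
  have "length vs \<le> 3" if vs: "fs.li vs" "set vs \<subseteq> W" for vs
  proof -
    have "fs.li (map lift vs)"
      by (rule lift_li[OF vs(1)]) (use perfect_supported[OF W] vs(2) in blast)
    moreover have "set (map lift vs) \<subseteq> fs.span (set [v1, v2, v3])"
      using vs(2) v fs.span_superset[of "lift ` W"] by auto
    ultimately show ?thesis using fs.li_length_le[of "map lift vs" "[v1, v2, v3]"] by simp
  qed
  then obtain ys where ys: "length ys = 3" "W \<subseteq> fs.span (set ys)" by (rule fs.ex_spanning_list)
  then obtain y1 y2 y3 where "ys = [y1, y2, y3]" by (auto simp: length_Suc_conv eval_nat_numeral)
  with ys(2) show ?thesis by (intro fs.smallI[of _ y1 y2 y3]) simp
qed

lemma perfect_cube_K:
  assumes W: "K.perfect W" "w \<in> W"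
  shows "mulK x (mulK x (mulK y w)) + mulK x (mulK y (mulK x w)) + mulK y (mulK x (mulK x w)) = 0"
proof -
  have "lift w \<in> fs.span (lift ` W)" using W(2) by (simp add: fs.span_base)
  from L.perfect_cube[OF infinite_ext perfect_lift[OF W(1)] this, of "lift x" "lift y"]
  have "lift (mulK x (mulK x (mulK y w)) + mulK x (mulK y (mulK x w)) + mulK y (mulK x (mulK x w))) = 0"
    by (simp add: lift_mul lift_simps)
  then show ?thesis by (simp only: lift_eq_0)
qed

end

definition fbases :: "nat \<Rightarrow> (nat \<Rightarrow> 'l::field) list" where
  "fbases n = map fbasis [0..<n]"

lemma supported_in_span:
  assumes "\<And>k. n \<le> k \<Longrightarrow> x k = 0" shows "x \<in> fs.span (set (fbases n))"
proof -
  have "x = (\<Sum>l<n. fscale (x l) (fbasis l))"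
    by (rule ext) (auto simp: sum_fun_apply fscale_def fbasis_def assms if_distrib[of "\<lambda>a. _ * a"] cong: if_cong)
  then show ?thesis
    by (metis (no_types, lifting) fs.span_sum fs.span_scale fs.span_base fbases_def image_eqI set_map set_upt atLeast0LessThan)
qed

lemma span_fbases_supported:
  assumes "x \<in> fs.span (set (fbases n))" "n \<le> k" shows "x k = 0"
  using assms(1)
  by (induction rule: fs.span_induct_alt) (use assms(2) in \<open>auto simp: fscale_def fbases_def fbasis_def\<close>)

lemma length_fbases [simp]: "length (fbases n) = n"
  by (simp add: fbases_def)

lemma li_fbases: "fs.li (fbases n :: (nat \<Rightarrow> 'l::field) list)"
proof -
  have "fminor (fbases n :: (nat \<Rightarrow> 'l) list) [0..<n] = 1\<^sub>m n"
    by (rule eq_matI) (auto simp: fminor_def fbases_def fbasis_def)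
  then have "det (fminor (fbases n :: (nat \<Rightarrow> 'l) list) [0..<n]) \<noteq> 0" by (simp only: det_one) simp
  then show ?thesis by (rule li_of_nonzero_minor)
qed

lemma infinite_fract_poly: "infinite (UNIV :: 'a::field poly fract set)"
proof -
  have "inj (\<lambda>k::nat. to_fract (monom (1::'a) k))"
    by (rule injI) (auto simp: monom_eq_iff')
  then show ?thesis using finite_subset[OF subset_UNIV] infinite_iff_countable_subset by blast
qed

lemma (in keller_quad_ext) quad_alg_K: "quad_alg fscale mulK (fbases n)"
proof unfold_locales
  show "fs.li (fbases n)" by (rule li_fbases)
  show "mulK x y \<in> fs.span (set (fbases n))" for x y by (intro supported_in_span bil_ge)
  show "\<exists>x'\<in>fs.span (set (fbases n)). \<forall>y. mulK x y = mulK x' y" for x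
  proof
    show "(\<lambda>i. if i < n then x i else 0) \<in> fs.span (set (fbases n))" by (intro supported_in_span) simp
    show "\<forall>y. mulK x y = mulK (\<lambda>i. if i < n then x i else 0) y" by (auto simp: bil_def fun_eq_iff)
  qed
  show "mulK x x = 0" if "(2::'k) = 0" for x by (rule K.alternating[OF that])
  show "fs.small W" if "K.perfect W" for W by (rule perfect_small_K[OF that])
  show "mulK x (mulK x (mulK y w)) + mulK x (mulK y (mulK x w)) + mulK y (mulK x (mulK x w)) = 0"
    if "K.perfect W" "w \<in> W" for W w x y by (rule perfect_cube_K[OF that])
qed

text \<open>The extension is K(s), the fraction field of K[s], which is infinite for every K; so
  finite and infinite fields are treated alike.\<close>

theorem quad_alg_of_keller_quad:
  assumes "keller_quad (\<lambda>c::'a::field. c) n C H"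
  shows "quad_alg fscale (bil n (polar C)) (fbases n)"
proof -
  have "coeff_hom (\<lambda>c::'a. to_fract [:c:])"
    by unfold_locales (simp_all flip: one_pCons to_fract_add to_fract_mult add: pCons_one)
  then have ext: "keller_quad_ext (\<lambda>c::'a. to_fract [:c:]) (\<lambda>c. c) n C H"
    by (intro keller_quad_ext.intro assms keller_quad_ext_axioms.intro infinite_fract_poly)
  have "quad_map.B (\<lambda>c::'a. c) C = polar C"
    using quad_map.B_def[OF keller_quad.axioms(1)[OF assms]] by (simp only: fun_eq_iff) simp
  then show ?thesis using keller_quad_ext.quad_alg_K[OF ext] by simp
qed

section \<open>Tame automorphisms\<close>

lemma polynomial_mapD: "polynomial_map n F \<Longrightarrow> dim_vec F = n" "polynomial_map n F \<Longrightarrow> i < n \<Longrightarrow> vars (F $ i) \<subseteq> {..<n}"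
  by (auto simp: polynomial_map_def)

lemma dim_compose [simp]: "dim_vec (compose F G) = dim_vec F"
  by (simp add: compose_def)

lemma compose_index: "i < dim_vec F \<Longrightarrow> compose F G $ i = subst (($) G) (F $ i)"
  by (simp add: compose_def)

lemma dim_id_map [simp]: "dim_vec (id_map n) = n"
  and id_map_index [simp]: "i < n \<Longrightarrow> id_map n $ i = Var i"
  by (simp_all add: id_map_def)

lemma polynomial_map_compose:
  assumes "polynomial_map n F" "polynomial_map n G" shows "polynomial_map n (compose F G)"
proof -
  have "vars (subst (($) G) (F $ i)) \<subseteq> {..<n}" if "i < n" for i
  proof (rule order_trans[OF vars_subst], rule UN_least)
    fix j assume "j \<in> vars (F $ i)"
    then have "j < n" using polynomial_mapD(2)[OF assms(1) that] by blast
    then show "vars (G $ j) \<subseteq> {..<n}" by (rule polynomial_mapD(2)[OF assms(2)])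
  qed
  moreover have "compose F G \<in> carrier_vec n" by (rule carrier_vecI) (simp add: polynomial_mapD(1)[OF assms(1)])
  ultimately show ?thesis using polynomial_mapD(1)[OF assms(1)]
    by (simp add: polynomial_map_def compose_index)
qed

lemma polynomial_map_id [simp]: "polynomial_map n (id_map n)"
  by (simp add: polynomial_map_def carrier_vecI)

lemma compose_assoc:
  assumes "polynomial_map n F" "polynomial_map n G"
  shows "compose (compose F G) K = compose F (compose G K)"
proof (rule eq_vecI)
  fix i assume "i < dim_vec (compose F (compose G K))"
  then have i: "i < n" using polynomial_mapD[OF assms(1)] by simp
  have "subst (\<lambda>j. subst (($) K) (G $ j)) (F $ i) = subst (($) (compose G K)) (F $ i)"
  proof (rule subst_cong)
    fix j assume "j \<in> vars (F $ i)"
    then have "j < n" using polynomial_mapD(2)[OF assms(1) i] by blast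
    then show "subst (($) K) (G $ j) = compose G K $ j"
      using polynomial_mapD(1)[OF assms(2)] by (simp add: compose_index)
  qed
  then show "compose (compose F G) K $ i = compose F (compose G K) $ i"
    using i polynomial_mapD(1)[OF assms(1)] by (simp add: compose_index subst_subst)
qed simp

lemma compose_id_left: "dim_vec F = n \<Longrightarrow> compose (id_map n) F = F"
  by (intro eq_vecI) (auto simp: compose_index)

lemma compose_id_right:
  assumes "polynomial_map n F" shows "compose F (id_map n) = F"
proof (rule eq_vecI)
  fix i assume "i < dim_vec F"
  then have i: "i < n" using polynomial_mapD[OF assms] by simp
  have "subst (($) (id_map n)) (F $ i) = subst Var (F $ i)"
    using polynomial_mapD(2)[OF assms i] by (intro subst_cong) auto
  then show "compose F (id_map n) $ i = F $ i"
    using i polynomial_mapD(1)[OF assms] by (simp add: compose_index subst_Var)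
qed simp

lemma polynomial_automorphism_id: "polynomial_automorphism n (id_map n)"
  unfolding polynomial_automorphism_def by (metis polynomial_map_id compose_id_right)

lemma polynomial_automorphism_compose:
  assumes "polynomial_automorphism n F" "polynomial_automorphism n G"
  shows "polynomial_automorphism n (compose F G)"
proof -
  obtain F' where F: "polynomial_map n F" "polynomial_map n F'" "compose F F' = id_map n" "compose F' F = id_map n"
    using assms(1) by (auto simp: polynomial_automorphism_def)
  obtain G' where G: "polynomial_map n G" "polynomial_map n G'" "compose G G' = id_map n" "compose G' G = id_map n"
    using assms(2) by (auto simp: polynomial_automorphism_def)
  have "compose (compose F G) (compose G' F') = compose F (compose (compose G G') F')"
    by (simp only: compose_assoc[OF F(1) G(1)] compose_assoc[OF G(1,2)])
  also have "\<dots> = id_map n" by (simp only: G(3) compose_id_left[OF polynomial_mapD(1)[OF F(2)]] F(3))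
  finally have 1: "compose (compose F G) (compose G' F') = id_map n" .
  have "compose (compose G' F') (compose F G) = compose G' (compose (compose F' F) G)"
    by (simp only: compose_assoc[OF G(2) F(2)] compose_assoc[OF F(2,1)])
  also have "\<dots> = id_map n" by (simp only: F(4) compose_id_left[OF polynomial_mapD(1)[OF G(1)]] G(4))
  finally show ?thesis using 1 F G polynomial_map_compose unfolding polynomial_automorphism_def by blast
qed

definition elem_map :: "nat \<Rightarrow> nat \<Rightarrow> 'a::field mpoly \<Rightarrow> 'a mpoly vec" where
  "elem_map n i a = vec n (\<lambda>j. if j = i then Var i + a else Var j)"

lemma elem_map_inverse:
  assumes "i < n" "vars a \<subseteq> {..<n} - {i}"
  shows "compose (elem_map n i a) (elem_map n i (- a)) = id_map n"
proof (rule eq_vecI)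
  fix j assume j: "j < dim_vec (id_map n)"
  have "subst (($) (elem_map n i (- a))) a = subst Var a"
  proof (rule subst_cong)
    fix l assume "l \<in> vars a"
    then have "l < n" "l \<noteq> i" using assms(2) by auto
    then show "elem_map n i (- a) $ l = Var l" by (simp add: elem_map_def)
  qed
  then show "compose (elem_map n i a) (elem_map n i (- a)) $ j = id_map n $ j"
    using j assms(1) by (auto simp: compose_index elem_map_def subst_Var)
qed (simp add: elem_map_def)

lemma polynomial_map_elem: "vars a \<subseteq> {..<n} \<Longrightarrow> polynomial_map n (elem_map n i a)"
  using order_trans[OF vars_add, of "Var i" a "{..<n}"] by (auto simp: polynomial_map_def elem_map_def)

lemma polynomial_automorphism_elementary:
  assumes "elementary_automorphism n E" shows "polynomial_automorphism n E"
proof -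
  obtain i a where a: "i < n" "vars a \<subseteq> {..<n} - {i}" "E = elem_map n i a"
    using assms by (auto simp: elementary_automorphism_def elem_map_def)
  then have "vars a \<subseteq> {..<n}" "vars (- a) \<subseteq> {..<n}" by auto
  then have "polynomial_map n E" "polynomial_map n (elem_map n i (- a))"
    using a(3) by (simp_all add: polynomial_map_elem)
  moreover have "compose E (elem_map n i (- a)) = id_map n"
    unfolding a(3) by (rule elem_map_inverse[OF a(1,2)])
  moreover have "compose (elem_map n i (- a)) E = id_map n"
    using elem_map_inverse[of i n "- a"] a by simp
  ultimately show ?thesis unfolding polynomial_automorphism_def by blast
qed

definition elementary_product :: "nat \<Rightarrow> 'a::field mpoly vec \<Rightarrow> bool" where
  "elementary_product n F \<longleftrightarrow>
    (\<exists>Es. (\<forall>E\<in>set Es. elementary_automorphism n E) \<and> F = foldr compose Es (id_map n))"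

lemma polynomial_automorphism_foldr:
  assumes "\<forall>E\<in>set Es. polynomial_automorphism n E" "polynomial_automorphism n F"
  shows "polynomial_automorphism n (foldr compose Es F)"
  using assms(1) by (induction Es) (use assms(2) polynomial_automorphism_compose in auto)

lemma elementary_product_automorphism: "elementary_product n F \<Longrightarrow> polynomial_automorphism n F"
  unfolding elementary_product_def
  using polynomial_automorphism_foldr polynomial_automorphism_elementary polynomial_automorphism_id by blast

lemma elementary_product_id: "elementary_product n (id_map n)"
  unfolding elementary_product_def by (intro exI[of _ "[]"]) simp

lemma elementary_product_step:
  assumes "elementary_product n F" "i < n" "vars a \<subseteq> {..<n} - {i}"
    and "dim_vec G = n" "G $ i = F $ i + subst (($) F) a" "\<And>j. j < n \<Longrightarrow> j \<noteq> i \<Longrightarrow> G $ j = F $ j"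
  shows "elementary_product n G"
proof -
  obtain Es where Es: "\<forall>E\<in>set Es. elementary_automorphism n E" "F = foldr compose Es (id_map n)"
    using assms(1) by (auto simp: elementary_product_def)
  have "elementary_automorphism n (elem_map n i a)"
    using assms(2,3) by (auto simp: elementary_automorphism_def elem_map_def)
  moreover have "G = compose (elem_map n i a) F"
    using assms(2,4-6) by (intro eq_vecI) (auto simp: compose_index elem_map_def)
  ultimately show ?thesis
    using Es unfolding elementary_product_def by (intro exI[of _ "elem_map n i a # Es"]) simp
qed

text \<open>Components are built in the order 0, 1, 2, ...: when component k is changed, its
  polynomial involves only later variables, whose components are still untouched.\<close>

lemma elementary_product_triangular:
  assumes "triangular n F" shows "elementary_product n F"
proof -
  obtain H where H: "H \<in> carrier_vec n" "F = id_map n + H" "\<And>i. i < n \<Longrightarrow> vars (H $ i) \<subseteq> {i<..<n}"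
    using assms by (auto simp: triangular_def)
  define P where "P k = vec n (\<lambda>j. if j < k then Var j + H $ j else Var j)" for k
  have "elementary_product n (P k)" if "k \<le> n" for k
    using that
  proof (induction k)
    case 0
    have "P 0 = id_map n" by (simp add: P_def id_map_def)
    then show ?case by (simp add: elementary_product_id)
  next
    case (Suc k)
    have "subst (($) (P k)) (H $ k) = subst Var (H $ k)"
      using H(3)[of k] Suc.prems by (intro subst_cong) (auto simp: P_def)
    then have s: "P (Suc k) $ k = P k $ k + subst (($) (P k)) (H $ k)"
      using Suc.prems by (simp add: P_def subst_Var)
    show ?case
    proof (rule elementary_product_step[OF Suc.IH _ _ _ s])
      show "vars (H $ k) \<subseteq> {..<n} - {k}" using H(3)[of k] Suc.prems by auto
      show "P (Suc k) $ j = P k $ j" if "j < n" "j \<noteq> k" for j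
        using that by (simp add: P_def less_Suc_eq)
    qed (use Suc.prems in \<open>simp_all add: P_def\<close>)
  qed
  moreover have "P n = F" using H(1,2) by (intro eq_vecI) (auto simp: P_def)
  ultimately show ?thesis by auto
qed

lemma subst_fixed:
  assumes "\<And>i. i \<in> vars p \<Longrightarrow> f i = Var i" shows "subst f p = p"
  using subst_cong[of p f Var] assms by (simp add: subst_Var)

lemma poly_in_4: "u \<in> poly_in {4..n} \<Longrightarrow> i \<in> vars u \<Longrightarrow> 3 \<le> i \<and> i < n"
  by (auto simp: poly_in_def dest!: subsetD)

lemma poly_in_4_7: "4 \<le> n \<Longrightarrow> u \<in> poly_in ({4} \<union> {7..n}) \<Longrightarrow> i \<in> vars u \<Longrightarrow> (i = 3 \<or> 6 \<le> i) \<and> i < n"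
  by (auto simp: poly_in_def dest!: subsetD)

lemma vec_of_list_map_X:
  assumes "length xs = m" "m \<le> n" "k = Suc m"
  shows "vec_of_list (xs @ map X [k..<Suc n]) = vec n (\<lambda>j. if j < m then xs ! j else Var j)"
  using assms by (intro eq_vecI) (auto simp: nth_append X_def vec_of_list_index simp del: upt_Suc)

lemma normal_form_2_vec:
  assumes "n \<ge> 5"
  shows "vec_of_list ([X 1 + X 2 * X 5 + u1, X 2 + X 1 * X 4 - X 3 * X 5 + u2, X 3 + X 2 * X 4 + u3]
      @ map X [4..<Suc n]) =
    vec n (\<lambda>j. if j < 3 then [Var 0 + Var 1 * Var 4 + u1, Var 1 + Var 0 * Var 3 - Var 2 * Var 4 + u2,
      Var 2 + Var 1 * Var 3 + u3] ! j else Var j)"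
  using assms by (subst vec_of_list_map_X[of _ 3]) (simp_all add: X_def cong: if_cong)

lemma elementary_product_normal_form_2:
  assumes "normal_form_2 n G" shows "elementary_product n G"
proof -
  obtain u1 u2 u3 where n: "n \<ge> 5" and u: "u1 \<in> poly_in {4..n}" "u2 \<in> poly_in {4..n}" "u3 \<in> poly_in {4..n}"
    and G': "G = vec_of_list ([X 1 + X 2 * X 5 + u1, X 2 + X 1 * X 4 - X 3 * X 5 + u2, X 3 + X 2 * X 4 + u3]
      @ map X [4..<Suc n])"
    using assms unfolding normal_form_2_def by blast
  note G = G'[unfolded normal_form_2_vec[OF n]]
  define F1 where "F1 = vec n (\<lambda>j. if j = 0 then Var 0 + (Var 1 * Var 4 + u1) else Var j)"
  define F2 where "F2 = vec n (\<lambda>j. if j = 2 then Var 2 + (Var 1 * Var 3 + u3) else F1 $ j)"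
  \<comment> \<open>After substitution of the new components 0 and 2, their terms in
    \<open>Var 1 * Var 3 * Var 4\<close> cancel; the last two summands cancel the contributions of
    u1 and u3.\<close>
  define a where "a = Var 0 * Var 3 - Var 2 * Var 4 + u2 - u1 * Var 3 + u3 * Var 4"
  note uv = poly_in_4[OF u(1)] poly_in_4[OF u(2)] poly_in_4[OF u(3)]
  note vss = subsetD[OF vars_add] subsetD[OF vars_diff] subsetD[OF vars_mult]
  have 1: "elementary_product n F1"
    by (rule elementary_product_step[OF elementary_product_id, of 0 _ "Var 1 * Var 4 + u1"])
      (use n uv in \<open>auto simp: F1_def subst_fixed dest!: vss dest: uv\<close>)
  have sub1: "subst (($) F1) u3 = u3" using n by (intro subst_fixed) (auto simp: F1_def dest: uv)
  have 2: "elementary_product n F2"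
    by (rule elementary_product_step[OF 1, of 2 "Var 1 * Var 3 + u3"])
      (use n in \<open>auto simp: F2_def sub1 dest!: vss dest: uv\<close>, simp_all add: F1_def)
  have sub: "subst (($) F2) u = u" if "u \<in> {u1, u2, u3}" for u
    using that n by (intro subst_fixed) (auto simp: F2_def F1_def dest: uv)
  show ?thesis
  proof (rule elementary_product_step[OF 2, of 1 a])
    show "vars a \<subseteq> {..<n} - {1}" using n by (auto simp: a_def dest!: vss dest: uv)
    have "subst (($) F2) a = Var 0 * Var 3 - Var 2 * Var 4 + u2"
      using n by (simp add: a_def sub) (simp add: F2_def F1_def algebra_simps)
    then show "G $ 1 = F2 $ 1 + subst (($) F2) a" using n by (simp add: G F2_def F1_def)
    show "G $ j = F2 $ j" if "j < n" "j \<noteq> 1" for j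
      using that by (cases "j = 0"; cases "j = 2") (auto simp: G F2_def F1_def add.assoc)
  qed (use n G in auto)
qed

lemma normal_form_3_vec:
  assumes "n \<ge> 6"
  shows "vec_of_list ([X 1 + X 2 * X 6,
      X 2 + X 1 * X 5 - X 3 * X 6 + Const a * X 4 * X 5 - Const b * X 4 * X 6 + u,
      X 3 + X 2 * X 5, X 4 + X 5 * X 6] @ map X [5..<Suc n]) =
    vec n (\<lambda>j. if j < 4 then [Var 0 + Var 1 * Var 5,
      Var 1 + Var 0 * Var 4 - Var 2 * Var 5 + Const a * Var 3 * Var 4 - Const b * Var 3 * Var 5 + u,
      Var 2 + Var 1 * Var 4, Var 3 + Var 4 * Var 5] ! j else Var j)"
  using assms by (subst vec_of_list_map_X[of _ 4]) (simp_all add: X_def cong: if_cong)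

lemma elementary_product_normal_form_3:
  fixes G :: "'a::field mpoly vec"
  assumes "normal_form_3 n G" shows "elementary_product n G"
proof -
  obtain a b u where n: "n \<ge> 6" and u: "u \<in> poly_in ({4} \<union> {7..n})"
    and G': "G = vec_of_list ([X 1 + X 2 * X 6,
      X 2 + X 1 * X 5 - X 3 * X 6 + Const a * X 4 * X 5 - Const b * X 4 * X 6 + u,
      X 3 + X 2 * X 5, X 4 + X 5 * X 6] @ map X [5..<Suc n])"
    using assms unfolding normal_form_3_def by blast
  note G = G'[unfolded normal_form_3_vec[OF n]]
  define F1 :: "'a mpoly vec" where "F1 = vec n (\<lambda>j. if j = 0 then Var 0 + Var 1 * Var 5 else Var j)"
  define F2 where "F2 = vec n (\<lambda>j. if j = 2 then Var 2 + Var 1 * Var 4 else F1 $ j)"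
  \<comment> \<open>The substitution of F2 fixes c: the terms in
    \<open>Var 1 * Var 4 * Var 5\<close> from components 0 and 2 cancel, and component 3 is still
    \<open>Var 3\<close>.\<close>
  define c where "c = Var 0 * Var 4 - Var 2 * Var 5 + Const a * Var 3 * Var 4 - Const b * Var 3 * Var 5 + u"
  define F3 where "F3 = vec n (\<lambda>j. if j = 1 then Var 1 + c else F2 $ j)"
  have "i = 3 \<or> 6 \<le> i" "i < n" if "i \<in> vars u" for i using poly_in_4_7[OF _ u that] n by simp_all
  note uv = this
  note vss = subsetD[OF vars_add] subsetD[OF vars_diff] subsetD[OF vars_mult]
  have 1: "elementary_product n F1"
    by (rule elementary_product_step[OF elementary_product_id, of 0 _ "Var 1 * Var 5"])
      (use n in \<open>auto simp: F1_def dest!: vss\<close>)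
  have 2: "elementary_product n F2"
    by (rule elementary_product_step[OF 1, of 2 "Var 1 * Var 4"])
      (use n in \<open>auto simp: F2_def F1_def dest!: vss\<close>)
  have 3: "elementary_product n F3"
  proof (rule elementary_product_step[OF 2, of 1 c])
    show "vars c \<subseteq> {..<n} - {1}" using n by (auto simp: c_def dest!: vss dest: uv)
    have "F2 $ i = Var i" if "i \<in> vars u" for i
      using uv[OF that] n by (auto simp: F2_def F1_def)
    then have "subst (($) F2) u = u" by (rule subst_fixed)
    then have "subst (($) F2) c = c"
      using n by (simp add: c_def) (simp add: F2_def F1_def algebra_simps)
    then show "F3 $ 1 = F2 $ 1 + subst (($) F2) c" using n by (simp add: F3_def F2_def F1_def)
  qed (use n in \<open>auto simp: F3_def\<close>)
  show ?thesis
  \<comment> \<open>Component 3 comes last because component 1 has to be formed with the unchanged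
    \<open>Var 3\<close>.\<close>
  proof (rule elementary_product_step[OF 3, of 3 "Var 4 * Var 5"])
    show "G $ j = F3 $ j" if "j < n" "j \<noteq> 3" for j
      using that n
      by (cases "j = 0"; cases "j = 1"; cases "j = 2") (auto simp: G F3_def F2_def F1_def c_def add.assoc)
  qed (use n in \<open>auto simp: G F3_def F2_def F1_def dest!: vss\<close>)
qed

section \<open>Linear conjugation\<close>

definition lin_map :: "nat \<Rightarrow> 'a::field mat \<Rightarrow> 'a mpoly vec" where
  "lin_map n A = map_mat Const A *\<^sub>v id_map n"

lemma mult_map_Const_index:
  assumes "A \<in> carrier_mat n n" "dim_vec F = n" "i < n"
  shows "(map_mat Const A *\<^sub>v F) $ i = (\<Sum>j<n. Const (A $$ (i, j)) * F $ j)"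
  using assms by (simp add: scalar_prod_def atLeast0LessThan)

lemma lin_map_index:
  assumes "A \<in> carrier_mat n n" "i < n"
  shows "lin_map n A $ i = (\<Sum>j<n. Const (A $$ (i, j)) * Var j)"
  unfolding lin_map_def mult_map_Const_index[OF assms(1) dim_id_map assms(2)] by simp

lemma dim_lin_map [simp]: "A \<in> carrier_mat n n \<Longrightarrow> dim_vec (lin_map n A) = n"
  by (simp add: lin_map_def)

lemma polynomial_map_lin:
  assumes "A \<in> carrier_mat n n" shows "polynomial_map n (lin_map n A)"
proof -
  have "vars (lin_map n A $ i) \<subseteq> {..<n}" if "i < n" for i
    unfolding lin_map_index[OF assms that] by (intro vars_sum order_trans[OF vars_mult]) simp
  then show ?thesis using assms by (simp add: polynomial_map_def carrier_vecI)
qed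

lemma mult_map_Const_eq_compose:
  assumes "A \<in> carrier_mat n n" "dim_vec F = n"
  shows "map_mat Const A *\<^sub>v F = compose (lin_map n A) F"
proof (rule eq_vecI)
  fix i assume "i < dim_vec (compose (lin_map n A) F)"
  then have "i < n" using assms by simp
  then show "(map_mat Const A *\<^sub>v F) $ i = compose (lin_map n A) F $ i"
    using assms by (subst mult_map_Const_index[OF assms]) (simp_all add: compose_index lin_map_index)
qed (use assms in simp)

lemma lin_map_inverse:
  assumes "A \<in> carrier_mat n n" "B \<in> carrier_mat n n" "A * B = 1\<^sub>m n"
  shows "compose (lin_map n A) (lin_map n B) = id_map n"
proof -
  have "compose (lin_map n A) (lin_map n B) = map_mat Const A *\<^sub>v (map_mat Const B *\<^sub>v id_map n)"
    using assms by (subst mult_map_Const_eq_compose[symmetric]) (simp_all add: lin_map_def)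
  also have "\<dots> = (map_mat Const A * map_mat Const B) *\<^sub>v id_map n"
    using assms by (intro assoc_mult_mat_vec[symmetric]) (auto simp: id_map_def)
  also have "map_mat Const A * map_mat Const B = map_mat Const (1\<^sub>m n)"
    using assms Const.mat_hom_mult by metis
  also have "\<dots> *\<^sub>v id_map n = id_map n"
    by (simp add: Const.mat_hom_one id_map_def)
  finally show ?thesis .
qed

lemma affine_automorphism_lin:
  assumes "A \<in> carrier_mat n n" "B \<in> carrier_mat n n" "A * B = 1\<^sub>m n" "B * A = 1\<^sub>m n"
  shows "affine_automorphism n (lin_map n A)"
proof -
  have "monom_degree m \<le> 1" if "m \<in> Poly_Mapping.keys (lin_map n A $ i)" "i < n" for i m
  proof -
    have "lin_map n A $ i = (\<Sum>j<n. Poly_Mapping.single (Poly_Mapping.single j 1) (A $$ (i, j)))"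
      using that(2) by (simp add: lin_map_index[OF assms(1)] Const_def Var_def mult_single)
    then have "(\<Sum>j<n. Poly_Mapping.lookup (Poly_Mapping.single (Poly_Mapping.single j 1) (A $$ (i, j))) m) \<noteq> 0"
      using that(1) by (simp add: in_keys_iff lookup_sum)
    then obtain j where "Poly_Mapping.lookup (Poly_Mapping.single (Poly_Mapping.single j 1) (A $$ (i, j))) m \<noteq> 0"
      by (meson sum.neutral)
    then have "m = Poly_Mapping.single j 1" by (metis lookup_single_not_eq)
    then show ?thesis by simp
  qed
  then show ?thesis
    using lin_map_inverse polynomial_map_lin assms
    unfolding affine_automorphism_def polynomial_automorphism_def by blast
qed

lemma foldr_compose:
  assumes "\<forall>E\<in>set Es. polynomial_automorphism n E" "dim_vec Y = n"
  shows "foldr compose Es Y = compose (foldr compose Es (id_map n)) Y"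
  using assms(1)
proof (induction Es)
  case Nil
  then show ?case using assms(2) by (simp add: compose_id_left)
next
  case (Cons E Es)
  have "polynomial_automorphism n (foldr compose Es (id_map n))"
    by (rule polynomial_automorphism_foldr[OF _ polynomial_automorphism_id]) (use Cons.prems in simp)
  then have "polynomial_map n (foldr compose Es (id_map n))" by (simp add: polynomial_automorphism_def)
  moreover have "polynomial_map n E" using Cons.prems by (simp add: polynomial_automorphism_def)
  ultimately show ?case using Cons by (simp add: compose_assoc)
qed

lemma tame_conjugate:
  assumes G: "elementary_product n G"
    and T: "T \<in> carrier_mat n n" "T' \<in> carrier_mat n n" "T * T' = 1\<^sub>m n" "T' * T = 1\<^sub>m n"
    and F: "F = compose (lin_map n T) (compose G (lin_map n T'))"
  shows "linearly_conjugate n F G" "tame_automorphism n F"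
proof -
  obtain Es where Es: "\<forall>E\<in>set Es. elementary_automorphism n E" "G = foldr compose Es (id_map n)"
    using G by (auto simp: elementary_product_def)
  have aG: "polynomial_automorphism n G" by (rule elementary_product_automorphism[OF G])
  then have mG: "polynomial_map n G" by (simp add: polynomial_automorphism_def)
  note m = mG polynomial_map_lin[OF T(1)] polynomial_map_lin[OF T(2)]
  note aff = affine_automorphism_lin[OF T] affine_automorphism_lin[OF T(2,1,4,3)]
  then have aT: "polynomial_automorphism n (lin_map n T)" "polynomial_automorphism n (lin_map n T')"
    by (simp_all add: affine_automorphism_def)
  have "compose (lin_map n T') (compose F (lin_map n T)) =
      compose (compose (lin_map n T') (lin_map n T)) (compose G (compose (lin_map n T') (lin_map n T)))"
    unfolding F using m by (simp add: compose_assoc polynomial_map_compose)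
  also have "\<dots> = G"
    using polynomial_mapD(1)[OF mG] by (simp add: lin_map_inverse T compose_id_left compose_id_right mG)
  finally have "G = map_mat Const T' *\<^sub>v compose F (map_mat Const T *\<^sub>v id_map n)"
    using T by (simp add: F mult_map_Const_eq_compose flip: lin_map_def)
  then show "linearly_conjugate n F G" using T unfolding linearly_conjugate_def by blast
  have "F = foldr compose ([lin_map n T] @ Es @ [lin_map n T']) (id_map n)"
  proof -
    have "\<forall>E\<in>set Es. polynomial_automorphism n E" using Es(1) polynomial_automorphism_elementary by blast
    from foldr_compose[OF this dim_lin_map[OF T(2)]] show ?thesis
      by (simp add: F compose_id_right[OF m(3)] flip: Es(2))
  qed
  moreover have "polynomial_automorphism n F"
    unfolding F by (intro polynomial_automorphism_compose aT aG)
  ultimately show "tame_automorphism n F"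
    using Es(1) aff unfolding tame_automorphism_def
    by (intro conjI exI[of _ "[lin_map n T] @ Es @ [lin_map n T']"]) auto
qed

lemma sum4_swap:
  "(\<Sum>i\<in>A. \<Sum>j\<in>A. \<Sum>a\<in>A. \<Sum>b\<in>A. h i j a b) = (\<Sum>a\<in>A. \<Sum>b\<in>A. \<Sum>i\<in>A. \<Sum>j\<in>A. h i j a b)"
proof -
  have "(\<Sum>i\<in>A. \<Sum>j\<in>A. \<Sum>a\<in>A. \<Sum>b\<in>A. h i j a b) = (\<Sum>i\<in>A. \<Sum>a\<in>A. \<Sum>j\<in>A. \<Sum>b\<in>A. h i j a b)"
    by (intro sum.cong refl sum.swap)
  also have "\<dots> = (\<Sum>i\<in>A. \<Sum>a\<in>A. \<Sum>b\<in>A. \<Sum>j\<in>A. h i j a b)"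
    by (intro sum.cong refl sum.swap)
  also have "\<dots> = (\<Sum>a\<in>A. \<Sum>i\<in>A. \<Sum>b\<in>A. \<Sum>j\<in>A. h i j a b)"
    by (rule sum.swap)
  also have "\<dots> = (\<Sum>a\<in>A. \<Sum>b\<in>A. \<Sum>i\<in>A. \<Sum>j\<in>A. h i j a b)"
    by (intro sum.cong refl sum.swap)
  finally show ?thesis .
qed

lemma subst_lin_quad_form:
  assumes "A \<in> carrier_mat n n"
  shows "subst (($) (lin_map n A)) (quad_form n g) =
    quad_form n (\<lambda>a b. \<Sum>i<n. \<Sum>j<n. g i j * A $$ (i, a) * A $$ (j, b))"
proof -
  have "subst (($) (lin_map n A)) (quad_form n g) = (\<Sum>i<n. \<Sum>j<n. Const (g i j)
      * (\<Sum>a<n. Const (A $$ (i, a)) * Var a) * (\<Sum>b<n. Const (A $$ (j, b)) * Var b))"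
    by (simp add: quad_form_def lin_map_index[OF assms])
  also have "\<dots> = (\<Sum>i<n. \<Sum>j<n. \<Sum>a<n. \<Sum>b<n. Const (g i j * A $$ (i, a) * A $$ (j, b)) * Var a * Var b)"
    by (simp add: sum_distrib_left sum_distrib_right Const.hom_mult mult_ac)
  also have "\<dots> = quad_form n (\<lambda>a b. \<Sum>i<n. \<Sum>j<n. g i j * A $$ (i, a) * A $$ (j, b))"
    by (subst sum4_swap) (simp add: quad_form_def Const.hom_sum sum_distrib_right)
  finally show ?thesis .
qed

lemma quad_form_sum: "(\<Sum>l\<in>A. Const (t l) * quad_form n (g l)) = quad_form n (\<lambda>i j. \<Sum>l\<in>A. t l * g l i j)"
proof -
  have "(\<Sum>l\<in>A. Const (t l) * quad_form n (g l)) = (\<Sum>l\<in>A. \<Sum>i<n. \<Sum>j<n. Const (t l * g l i j) * Var i * Var j)"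
    by (simp add: quad_form_def sum_distrib_left Const.hom_mult mult.assoc)
  also have "\<dots> = (\<Sum>i<n. \<Sum>l\<in>A. \<Sum>j<n. Const (t l * g l i j) * Var i * Var j)"
    by (rule sum.swap)
  also have "\<dots> = (\<Sum>i<n. \<Sum>j<n. \<Sum>l\<in>A. Const (t l * g l i j) * Var i * Var j)"
    by (intro sum.cong refl sum.swap)
  also have "\<dots> = quad_form n (\<lambda>i j. \<Sum>l\<in>A. t l * g l i j)"
    by (simp add: quad_form_def Const.hom_sum sum_distrib_right)
  finally show ?thesis .
qed

lemma conjugate_index:
  assumes T: "T \<in> carrier_mat n n" "T' \<in> carrier_mat n n" "T * T' = 1\<^sub>m n"
    and k: "k < n"
  shows "compose (lin_map n T) (compose (vec n (\<lambda>l. Var l + quad_form n (g l))) (lin_map n T')) $ k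
    = Var k + quad_form n (\<lambda>a b. \<Sum>l<n. T $$ (k, l) * (\<Sum>i<n. \<Sum>j<n. g l i j * T' $$ (i, a) * T' $$ (j, b)))"
proof -
  let ?G = "vec n (\<lambda>l. Var l + quad_form n (g l))"
  have "compose (lin_map n T) (compose ?G (lin_map n T')) $ k
      = (\<Sum>l<n. Const (T $$ (k, l)) * lin_map n T' $ l) +
        (\<Sum>l<n. Const (T $$ (k, l)) * subst (($) (lin_map n T')) (quad_form n (g l)))"
    using k T by (simp add: compose_index lin_map_index[OF T(1)] distrib_left sum.distrib)
  also have "(\<Sum>l<n. Const (T $$ (k, l)) * lin_map n T' $ l) = compose (lin_map n T) (lin_map n T') $ k"
    using k T by (simp add: compose_index lin_map_index[OF T(1)])
  also have "\<dots> = Var k" using lin_map_inverse[OF T] k by simp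
  finally show ?thesis by (simp only: subst_lin_quad_form[OF T(2)] quad_form_sum)
qed

lemma quad_form_add: "quad_form n C + quad_form n D = quad_form n (\<lambda>i j. C i j + D i j)"
  by (simp add: quad_form_def Const.hom_add distrib_right sum.distrib)

lemma quad_form_transpose: "quad_form n (\<lambda>i j. C j i) = quad_form n C"
  unfolding quad_form_def by (subst sum.swap) (simp add: mult.assoc mult.commute[of "Var _" "Var _"])

lemma quad_form_cong: "(\<And>i j. i < n \<Longrightarrow> j < n \<Longrightarrow> C i j = D i j) \<Longrightarrow> quad_form n C = quad_form n D"
  unfolding quad_form_def by (intro sum.cong refl) simp

lemma Const_2: "Const 2 = 2"
proof -
  have "Const (1 + 1) = Const 1 + Const 1" by (rule Const.hom_add)
  then show ?thesis by (simp only: one_add_one Const.hom_one)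
qed

lemma quad_form_eq_of_polar:
  assumes "(2::'a::field) \<noteq> 0" "\<And>i j. i < n \<Longrightarrow> j < n \<Longrightarrow> C i j + C j i = D i j + (D j i :: 'a)"
  shows "quad_form n C = quad_form n D"
proof -
  have "Const 2 * quad_form n C = quad_form n C + quad_form n C" for C :: "nat \<Rightarrow> nat \<Rightarrow> 'a"
    by (simp add: Const_2)
  also have "quad_form n C + quad_form n C = quad_form n (\<lambda>i j. C i j + C j i)" for C :: "nat \<Rightarrow> nat \<Rightarrow> 'a"
    by (simp add: quad_form_transpose[of n C] flip: quad_form_add)
  finally have "Const 2 * quad_form n C = Const 2 * quad_form n D"
    using quad_form_cong[OF assms(2)] by simp
  then show ?thesis using assms(1) by simp
qed

text \<open>The difference of C and D is skew off the diagonal, hence symmetric in characteristic 2,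
  so its mixed terms cancel in pairs and only the diagonal remains.\<close>

lemma quad_form_eq_up_to_squares:
  assumes "(2::'a::field) = 0" "\<And>i j. i < n \<Longrightarrow> j < n \<Longrightarrow> C i j + C j i = D i j + (D j i :: 'a)"
  shows "quad_form n C = quad_form n D + (\<Sum>i<n. Poly_Mapping.single (Poly_Mapping.single i 2) (C i i - D i i))"
proof -
  define e where "e i j = (if i < n \<and> j < n \<and> i \<noteq> j then C i j - D i j else 0)" for i j
  define d where "d i j = (if i = j then C i i - D i i else 0)" for i j
  have neg: "- a = a" for a :: 'a using assms(1) by (metis mult_2 mult_zero_left eq_neg_iff_add_eq_0)
  have "C i j - D i j = - (C j i - D j i)" if "i < n" "j < n" for i j
    using assms(2)[OF that] by (simp add: algebra_simps)
  then have sym: "e i j = e j i" for i j unfolding e_def by (simp add: neg)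
  have two: "(2::'a mpoly) = 0" using Const_2[where 'a = 'a] assms(1) by simp
  have "quad_form n e = 0"
  proof -
    have sq: "quad_form n e = (\<Sum>i<n. \<Sum>j<n. Const (e i j) * Var i * Var j)" by (simp add: quad_form_def)
    show ?thesis unfolding sq
    proof (rule alternating_double_sum[OF two])
      show "Const (e i j) * Var i * Var j = Const (e j i) * Var j * Var i" for i j
        by (simp add: sym[of i j] mult_ac)
      show "Const (e i i) * Var i * Var i = 0" for i by (simp add: e_def)
    qed
  qed
  moreover have "quad_form n d = (\<Sum>i<n. Poly_Mapping.single (Poly_Mapping.single i 2) (C i i - D i i))"
  proof -
    have "Const (d i j) * Var i * Var j = (if j = i then Const (C i i - D i i) * Var i * Var i else 0)" for i j
      by (auto simp: d_def)
    moreover have "Const c * Var i * Var i = Poly_Mapping.single (Poly_Mapping.single i 2) c" for c :: 'a and i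
      by (simp add: quad_term numeral_2_eq_2 flip: single_add)
    ultimately show ?thesis by (simp add: quad_form_def)
  qed
  moreover have "quad_form n C = quad_form n D + quad_form n d + quad_form n e"
    unfolding quad_form_add by (rule quad_form_cong) (auto simp: d_def e_def)
  ultimately show ?thesis by simp
qed

lemma square_free_part_add_squares:
  assumes "dim_vec F = n" "dim_vec F' = n"
    and "\<And>k. k < n \<Longrightarrow> F $ k = F' $ k + (\<Sum>i<n. Poly_Mapping.single (Poly_Mapping.single i 2) (c k i))"
  shows "square_free_part n F = square_free_part n F'"
proof (rule eq_vecI)
  fix k assume "k < dim_vec (square_free_part n F')"
  then have k: "k < n" using assms by (simp add: square_free_part_def)
  have inj: "Poly_Mapping.single i (2::nat) = Poly_Mapping.single j 2 \<longleftrightarrow> i = j" for i j :: nat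
    by (auto simp: poly_mapping_eq_iff fun_eq_iff lookup_single when_def split: if_splits)
  have "Poly_Mapping.lookup (F $ k) (Poly_Mapping.single i 2) =
      Poly_Mapping.lookup (F' $ k) (Poly_Mapping.single i 2) + c k i" if "i < n" for i
    using that by (simp add: assms(3)[OF k] lookup_add lookup_sum lookup_single when_def inj)
  then show "square_free_part n F $ k = square_free_part n F' $ k"
    using k assms by (simp add: square_free_part_def single_add sum.distrib)
qed (use assms in \<open>simp add: square_free_part_def\<close>)

lemma CHAR_eq_2_iff: "CHAR('a::field) = 2 \<longleftrightarrow> (2::'a) = 0"
proof
  assume "(2::'a) = 0"
  then have "of_nat 2 = (0::'a)" by simp
  then have "CHAR('a) dvd 2" unfolding of_nat_eq_0_iff_char_dvd .
  moreover have "CHAR('a) \<noteq> 1" using of_nat_CHAR[where 'a = 'a] by (metis of_nat_1 zero_neq_one)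
  ultimately show "CHAR('a) = 2" using two_is_prime_nat prime_nat_iff by blast
qed (metis of_nat_CHAR of_nat_numeral)

lemma eq_up_to_square_part_of_polar:
  fixes F F' :: "'a::field mpoly vec"
  assumes "dim_vec F = n" "dim_vec F' = n"
    and F: "\<And>k. k < n \<Longrightarrow> F $ k = Var k + quad_form n (C k)" "\<And>k. k < n \<Longrightarrow> F' $ k = Var k + quad_form n (D k)"
    and polar: "\<And>k i j. k < n \<Longrightarrow> i < n \<Longrightarrow> j < n \<Longrightarrow> polar C k i j = polar D k i j"
  shows "eq_up_to_square_part n F F'"
proof (cases "(2::'a) = 0")
  case True
  have "square_free_part n F = square_free_part n F'"
    by (rule square_free_part_add_squares[OF assms(1,2), of "\<lambda>k i. C k i i - D k i i"])
      (use quad_form_eq_up_to_squares[OF True polar[unfolded polar_def]] in \<open>simp add: F add.assoc\<close>)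
  then show ?thesis using True by (simp add: eq_up_to_square_part_def CHAR_eq_2_iff)
next
  case False
  have "F = F'"
    by (intro eq_vecI) (use assms(1,2) F quad_form_eq_of_polar[OF False polar[unfolded polar_def]] in auto)
  then show ?thesis using False by (simp add: eq_up_to_square_part_def CHAR_eq_2_iff)
qed

section \<open>Normal forms\<close>

lemma vars_quad_form_subset:
  assumes "\<And>i j. i < n \<Longrightarrow> j < n \<Longrightarrow> C i j \<noteq> 0 \<Longrightarrow> i \<in> V \<and> j \<in> V" shows "vars (quad_form n C) \<subseteq> V"
  unfolding quad_form_def
proof (intro vars_sum)
  fix i j assume "i \<in> {..<n}" "j \<in> {..<n}"
  then show "vars (Const (C i j) * Var i * Var j) \<subseteq> V"
    using assms[of i j] by (cases "C i j = 0") (auto dest!: subsetD[OF vars_mult])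
qed

lemma quad_form_eq_0: "(\<And>i j. i < n \<Longrightarrow> j < n \<Longrightarrow> C i j = 0) \<Longrightarrow> quad_form n C = 0"
  by (simp add: quad_form_def)

lemma quad_form_split:
  assumes "S \<subseteq> {..<n} \<times> {..<n}"
  shows "quad_form n C = (\<Sum>(i, j)\<in>S. Const (C i j) * Var i * Var j)
    + quad_form n (\<lambda>i j. if (i, j) \<in> S then 0 else C i j)"
proof -
  have Q: "quad_form n D = (\<Sum>p\<in>{..<n} \<times> {..<n}. Const (D (fst p) (snd p)) * Var (fst p) * Var (snd p))"
    for D :: "nat \<Rightarrow> nat \<Rightarrow> 'a"
    unfolding quad_form_def by (simp add: sum.cartesian_product split_def)
  have "(\<Sum>p\<in>{..<n} \<times> {..<n}. Const (if p \<in> S then 0 else C (fst p) (snd p)) * Var (fst p) * Var (snd p))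
      = (\<Sum>p\<in>{..<n} \<times> {..<n} - S. Const (C (fst p) (snd p)) * Var (fst p) * Var (snd p))"
    by (rule sum.mono_neutral_cong_right) auto
  then show ?thesis
    unfolding Q using sum.subset_diff[OF assms, of "\<lambda>p. Const (C (fst p) (snd p)) * Var (fst p) * Var (snd p)"]
    by (simp add: split_def add.commute)
qed

lemma poly_in_4I: "vars u \<subseteq> {3..<n} \<Longrightarrow> u \<in> poly_in {4..n}"
  unfolding poly_in_def by (force intro!: image_eqI[of _ _ "Suc _"])

lemma poly_in_4_7I: "vars u \<subseteq> {3} \<union> {6..<n} \<Longrightarrow> u \<in> poly_in ({4} \<union> {7..n})"
  unfolding poly_in_def by (force intro!: image_eqI[of _ _ "Suc _"])

locale basis_change = comm_alg fscale mul
  for mul :: "(nat \<Rightarrow> 'a::field) \<Rightarrow> (nat \<Rightarrow> 'a) \<Rightarrow> nat \<Rightarrow> 'a" (infixl "\<diamondop>" 80) +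
  fixes n :: nat and ts :: "(nat \<Rightarrow> 'a) list"
  assumes li_ts: "fs.li ts" and length_ts: "length ts = n"
    and supported_ts: "i < n \<Longrightarrow> n \<le> k \<Longrightarrow> (ts ! i) k = 0"
    and supported_mul: "n \<le> k \<Longrightarrow> (x \<diamondop> y) k = 0"
    and alternating: "(2::'a) = 0 \<Longrightarrow> x \<diamondop> x = 0"
begin

definition T :: "'a mat" where "T = mat n n (\<lambda>(k, j). (ts ! j) k)"

lemma T_carrier [simp]: "T \<in> carrier_mat n n"
  by (simp add: T_def)

lemma det_T: "det T \<noteq> 0"
proof
  assume "det T = 0"
  then obtain v where v: "v \<in> carrier_vec n" "v \<noteq> 0\<^sub>v n" "T *\<^sub>v v = 0\<^sub>v n"
    using det_0_iff_vec_prod_zero_field[OF T_carrier] by blast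
  define c where "c = map (\<lambda>j. v $ j) [0..<n]"
  have c: "length c = length ts" by (simp add: c_def length_ts)
  have "fs.lincomb_list c ts = 0"
  proof
    fix k
    have e: "fs.lincomb_list c ts k = (\<Sum>j<n. v $ j * (ts ! j) k)"
      by (subst fs.lincomb_list_sum[OF c]) (simp add: sum_fun_apply fscale_def length_ts c_def)
    show "fs.lincomb_list c ts k = 0 k"
    proof (cases "k < n")
      case True
      then have "(T *\<^sub>v v) $ k = (\<Sum>j<n. (ts ! j) k * v $ j)"
        using v(1) by (simp add: scalar_prod_def atLeast0LessThan T_def)
      with v(3) True show ?thesis unfolding e by (simp add: mult.commute)
    qed (simp add: e supported_ts)
  qed
  then have "set c \<subseteq> {0}" using li_ts c by (simp add: fs.li_def)
  then have "v $ j = 0" if "j < n" for j using that by (simp add: c_def image_subset_iff)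
  then have "v = 0\<^sub>v n" using v(1) by (intro eq_vecI) auto
  with v(2) show False by simp
qed

definition T' :: "'a mat" where "T' = inverse (det T) \<cdot>\<^sub>m adj_mat T"

lemma T'_carrier [simp]: "T' \<in> carrier_mat n n"
  using adj_mat(1)[OF T_carrier] by (simp add: T'_def)

lemma T_inverse: "T * T' = 1\<^sub>m n" "T' * T = 1\<^sub>m n"
proof -
  have "inverse (det T) \<cdot>\<^sub>m (det T \<cdot>\<^sub>m 1\<^sub>m n) = 1\<^sub>m n" using det_T by (intro eq_matI) auto
  then show "T * T' = 1\<^sub>m n" "T' * T = 1\<^sub>m n"
    using adj_mat[OF T_carrier] T_carrier
    by (simp_all add: T'_def mult_smult_distrib[of T n n "adj_mat T" n] mult_smult_assoc_mat[of "adj_mat T" n n T n])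
qed

lemma T_inverse_index:
  assumes "i < n" "j < n"
  shows "(\<Sum>l<n. T $$ (i, l) * T' $$ (l, j)) = (if i = j then 1 else 0)"
    "(\<Sum>l<n. T' $$ (i, l) * T $$ (l, j)) = (if i = j then 1 else 0)"
proof -
  have "(A * A') $$ (i, j) = (\<Sum>l<n. A $$ (i, l) * A' $$ (l, j))"
    if "A \<in> carrier_mat n n" "A' \<in> carrier_mat n n" for A A' :: "'a mat"
    using that assms by (simp add: scalar_prod_def atLeast0LessThan)
  from this[of T T'] this[of T' T] show "(\<Sum>l<n. T $$ (i, l) * T' $$ (l, j)) = (if i = j then 1 else 0)"
    "(\<Sum>l<n. T' $$ (i, l) * T $$ (l, j)) = (if i = j then 1 else 0)"
    using assms by (simp_all add: T_inverse)
qed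

definition coord :: "(nat \<Rightarrow> 'a) \<Rightarrow> nat \<Rightarrow> 'a" where
  "coord x l = (\<Sum>k<n. T' $$ (l, k) * x k)"

lemma coord_add: "coord (x + y) l = coord x l + coord y l"
  and coord_scale: "coord (fscale c x) l = c * coord x l"
  and coord_uminus: "coord (- x) l = - coord x l"
  and coord_0 [simp]: "coord 0 l = 0"
  by (simp_all add: coord_def distrib_left sum.distrib fscale_def sum_distrib_left mult.left_commute sum_negf)

lemma coord_ts: "i < n \<Longrightarrow> l < n \<Longrightarrow> coord (ts ! i) l = (if l = i then 1 else 0)"
  using T_inverse_index(2)[of l i] by (simp add: coord_def T_def)

lemma coord_span: "x \<in> fs.span S \<Longrightarrow> (\<And>z. z \<in> S \<Longrightarrow> coord z l = 0) \<Longrightarrow> coord x l = 0"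
  by (induction rule: fs.span_induct_alt) (simp_all only: coord_add coord_scale coord_0, simp)

lemma coord_expand:
  assumes "k < n" shows "(\<Sum>l<n. T $$ (k, l) * coord x l) = x k"
proof -
  have "(\<Sum>l<n. T $$ (k, l) * coord x l) = (\<Sum>l<n. \<Sum>k'<n. T $$ (k, l) * T' $$ (l, k') * x k')"
    by (simp add: coord_def sum_distrib_left mult.assoc)
  also have "\<dots> = (\<Sum>k'<n. (\<Sum>l<n. T $$ (k, l) * T' $$ (l, k')) * x k')"
    by (subst sum.swap) (simp add: sum_distrib_right)
  also have "\<dots> = (\<Sum>k'<n. if k = k' then x k' else 0)"
    by (intro sum.cong refl) (use assms in \<open>simp add: T_inverse_index\<close>)
  finally show ?thesis using assms by simp
qed

definition sc :: "nat \<Rightarrow> nat \<Rightarrow> nat \<Rightarrow> 'a" where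
  "sc l i j = coord (ts ! i \<diamondop> ts ! j) l"

lemma sc_sym: "sc l i j = sc l j i"
  by (simp add: sc_def mul_commute)

text \<open>In characteristic 2 the division by 2 gives 0, which is correct there because the product is
  alternating.\<close>

definition gc :: "nat \<Rightarrow> nat \<Rightarrow> nat \<Rightarrow> 'a" where
  "gc l i j = (if i < j then sc l i j else if i = j then sc l i i / 2 else 0)"

lemma polar_gc: "polar gc l i j = sc l i j"
proof (cases "i = j")
  case True
  show ?thesis
  proof (cases "(2::'a) = 0")
    case True
    with \<open>i = j\<close> show ?thesis by (simp add: polar_def gc_def sc_def alternating)
  next
    case False
    then have "sc l i i / 2 + sc l i i / 2 = sc l i i" by (metis field_sum_of_halves mult_2 add_divide_distrib nonzero_mult_div_cancel_left)
    with \<open>i = j\<close> show ?thesis by (simp add: polar_def gc_def)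
  qed
next
  case False
  then show ?thesis using sc_sym[of l i j] by (auto simp: polar_def gc_def)
qed

lemma fbasis_expand:
  assumes "a < n" shows "fbasis a = (\<Sum>i<n. fscale (T' $$ (i, a)) (ts ! i))"
proof
  fix k
  have "(\<Sum>i<n. fscale (T' $$ (i, a)) (ts ! i)) k = (\<Sum>i<n. (ts ! i) k * T' $$ (i, a))"
    by (simp add: sum_fun_apply fscale_def mult.commute)
  also have "\<dots> = fbasis a k"
  proof (cases "k < n")
    case True
    then show ?thesis using T_inverse_index(1)[OF True assms] by (simp add: T_def fbasis_def)
  next
    case False
    with assms show ?thesis by (simp add: supported_ts fbasis_def)
  qed
  finally show "fbasis a k = (\<Sum>i<n. fscale (T' $$ (i, a)) (ts ! i)) k" by simp
qed

lemma mul_sum_left: "(\<Sum>i\<in>A. fscale (c i) (f i)) \<diamondop> y = (\<Sum>i\<in>A. fscale (c i) (f i \<diamondop> y))"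
  by (induction A rule: infinite_finite_induct) (simp_all only: sum.infinite sum.empty sum.insert not_False_eq_True mul_zero_left mul_add_left mul_scale_left)

lemma mul_fbasis:
  assumes "a < n" "b < n"
  shows "coord (fbasis a \<diamondop> fbasis b) l = (\<Sum>i<n. \<Sum>j<n. sc l i j * T' $$ (i, a) * T' $$ (j, b))"
proof -
  have cs: "coord (\<Sum>i\<in>A. fscale (c i) (f i)) l = (\<Sum>i\<in>A. c i * coord (f i) l)" for c f and A :: "nat set"
    by (induction A rule: infinite_finite_induct)
      (simp_all only: sum.infinite sum.empty sum.insert not_False_eq_True coord_0 coord_add coord_scale)
  have "coord (fbasis a \<diamondop> fbasis b) l = (\<Sum>i<n. T' $$ (i, a) * coord (ts ! i \<diamondop> fbasis b) l)"
    by (subst (1) fbasis_expand[OF assms(1)]) (simp only: mul_sum_left cs)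
  also have "\<dots> = (\<Sum>i<n. T' $$ (i, a) * (\<Sum>j<n. T' $$ (j, b) * sc l i j))"
  proof (rule sum.cong[OF refl])
    fix i
    have "coord (ts ! i \<diamondop> fbasis b) l = coord (fbasis b \<diamondop> ts ! i) l" by (simp add: mul_commute)
    also have "\<dots> = (\<Sum>j<n. T' $$ (j, b) * coord (ts ! j \<diamondop> ts ! i) l)"
      by (subst fbasis_expand[OF assms(2)]) (simp only: mul_sum_left cs)
    finally show "T' $$ (i, a) * coord (ts ! i \<diamondop> fbasis b) l = T' $$ (i, a) * (\<Sum>j<n. T' $$ (j, b) * sc l i j)"
      by (simp add: sc_def mul_commute[of "ts ! i"])
  qed
  finally show ?thesis by (simp add: sum_distrib_left mult_ac)
qed

definition G :: "'a mpoly vec" where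
  "G = vec n (\<lambda>l. Var l + quad_form n (gc l))"

text \<open>The coefficients of G conjugated back by T, as they arise in
  \<open>conjugate_index\<close>.\<close>

definition D :: "nat \<Rightarrow> nat \<Rightarrow> nat \<Rightarrow> 'a" where
  "D k a b = (\<Sum>l<n. T $$ (k, l) * (\<Sum>i<n. \<Sum>j<n. gc l i j * T' $$ (i, a) * T' $$ (j, b)))"

text \<open>The polarization of G consists of the structure constants in the basis
  \<open>ts\<close>; changing back to unit vectors therefore recovers the original product. In
  characteristic 2 this determines D only up to its diagonal.\<close>

lemma polar_D:
  assumes "k < n" "a < n" "b < n" shows "polar D k a b = (fbasis a \<diamondop> fbasis b) k"
proof -
  have sym: "(\<Sum>i<n. \<Sum>j<n. gc l i j * T' $$ (i, a) * T' $$ (j, b)) + (\<Sum>i<n. \<Sum>j<n. gc l i j * T' $$ (i, b) * T' $$ (j, a))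
      = coord (fbasis a \<diamondop> fbasis b) l" for l
  proof -
    have "(\<Sum>i<n. \<Sum>j<n. gc l i j * T' $$ (i, b) * T' $$ (j, a)) = (\<Sum>i<n. \<Sum>j<n. gc l j i * T' $$ (i, a) * T' $$ (j, b))"
      by (subst sum.swap) (simp add: mult_ac)
    then show ?thesis
      unfolding mul_fbasis[OF assms(2,3)] polar_gc[symmetric] polar_def
      by (simp add: distrib_right sum.distrib)
  qed
  have "polar D k a b = (\<Sum>l<n. T $$ (k, l) * coord (fbasis a \<diamondop> fbasis b) l)"
    unfolding polar_def D_def
    by (subst sum.distrib[symmetric]) (intro sum.cong refl, simp only: distrib_left[symmetric] sym)
  then show ?thesis by (simp add: coord_expand[OF assms(1)])
qed

lemma triangular_G:
  assumes "basis_triangular ts" shows "triangular n G"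
proof -
  have z: "sc l i j = 0" if "j \<le> l" "l < n" "i < n" "j < n" for l i j
  proof -
    have "ts ! i \<diamondop> ts ! j \<in> fs.span (set (take j ts))"
      using assms that length_ts by (simp add: basis_triangular_def)
    then show ?thesis
      unfolding sc_def
    proof (rule coord_span)
      fix z assume "z \<in> set (take j ts)"
      then obtain m where "m < j" "z = ts ! m" using that length_ts by (auto simp: in_set_conv_nth)
      with that show "coord z l = 0" by (simp add: coord_ts)
    qed
  qed
  have "vars (quad_form n (gc l)) \<subseteq> {l<..<n}" if "l < n" for l
  proof (rule vars_quad_form_subset)
    fix i j assume ij: "i < n" "j < n" "gc l i j \<noteq> 0"
    then have "sc l i j \<noteq> 0" "sc l j i \<noteq> 0" using sc_sym by (auto simp: gc_def split: if_splits)
    with ij z[of j l i] z[of i l j] that show "i \<in> {l<..<n} \<and> j \<in> {l<..<n}" by fastforce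
  qed
  then show ?thesis
    unfolding triangular_def by (intro bexI[of _ "vec n (\<lambda>l. quad_form n (gc l))"]) (auto simp: G_def id_map_def)
qed

text \<open>The table \<open>tab\<close> fixes all monomials that involve the first three variables.
  The remaining products are arbitrary in the span of p1, p2, p3, and their coefficients are the
  polynomials u1, u2, u3.\<close>

lemma normal_form_2_G:
  assumes "basis_form_2 ts" shows "normal_form_2 n G"
proof -
  obtain p1 p2 p3 c4 c5 us where ts: "ts = p1 # p2 # p3 # c4 # c5 # us"
    and pp: "\<And>p u. p \<in> {p1, p2, p3} \<Longrightarrow> u \<in> {p1, p2, p3} \<union> set us \<Longrightarrow> p \<diamondop> u = 0"
    and c: "c4 \<diamondop> p1 = p2" "c4 \<diamondop> p2 = p3" "c4 \<diamondop> p3 = 0" "c5 \<diamondop> p1 = 0" "c5 \<diamondop> p2 = p1" "c5 \<diamondop> p3 = - p2"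
    and all: "\<And>x y. x \<diamondop> y \<in> fs.span {p1, p2, p3}"
    using assms unfolding basis_form_2_def by blast
  note c' = c[unfolded mul_commute[of c4] mul_commute[of c5]]
  have len: "n = 5 + length us" using length_ts by (simp add: ts)
  then have n: "5 \<le> n" by simp
  have idx: "ts ! 0 = p1" "ts ! 1 = p2" "ts ! 2 = p3" "ts ! 3 = c4" "ts ! 4 = c5" by (simp_all add: ts)
  have us: "ts ! j \<in> set us" if "5 \<le> j" "j < n" for j
    using that nth_mem[of "j - 5" us] by (simp add: ts len numeral_eq_Suc nth_Cons')
  have tab: "ts ! i \<diamondop> ts ! j = (if j = 3 then (if i = 0 then ts ! 1 else if i = 1 then ts ! 2 else 0)
      else if j = 4 then (if i = 1 then ts ! 0 else if i = 2 then - ts ! 1 else 0) else 0)"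
    if "i < 3" "j < n" for i j
  proof -
    have i: "i = 0 \<or> i = 1 \<or> i = 2" using that by auto
    then have pi: "ts ! i \<in> {p1, p2, p3}" using idx by auto
    consider "j < 3" | "j = 3" | "j = 4" | "5 \<le> j" by linarith
    then show ?thesis
    proof cases
      case 1
      then have "j = 0 \<or> j = 1 \<or> j = 2" by auto
      then have "ts ! j \<in> {p1, p2, p3} \<union> set us" using idx by auto
      with pp[OF pi] 1 show ?thesis by simp
    next
      case 2
      then show ?thesis using i by (auto simp: c' idx[simplified])
    next
      case 3
      then show ?thesis using i by (auto simp: c' idx[simplified])
    next
      case 4
      with pp[OF pi, of "ts ! j"] us[of j] that show ?thesis by simp
    qed
  qed
  have gA: "gc l i j = (if j = 3 \<and> i < 2 \<and> l = i + 1 then 1 else if j = 4 \<and> i = 1 \<and> l = 0 then 1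
      else if j = 4 \<and> i = 2 \<and> l = 1 then -1 else 0)" if "i < 3 \<or> j < 3" "i < n" "j < n" "l < n" for l i j
  proof (cases "i \<le> j")
    case True
    then have i: "i < 3" using that by auto
    then have "sc l i j = (if j = 3 \<and> i < 2 \<and> l = i + 1 then 1 else if j = 4 \<and> i = 1 \<and> l = 0 then 1
      else if j = 4 \<and> i = 2 \<and> l = 1 then -1 else 0)"
      unfolding sc_def tab[OF i that(3)] using that n by (auto simp: coord_ts coord_uminus simp del: One_nat_def)
    with True i that show ?thesis by (auto simp: gc_def)
  next
    case False
    with that show ?thesis by (auto simp: gc_def)
  qed
  have high: "gc l i j = 0" if "3 \<le> l" "l < n" for l i j
  proof -
    have "sc l i j = 0" for i j
      unfolding sc_def
    proof (rule coord_span[OF all])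
      fix z assume "z \<in> {p1, p2, p3}"
      then have "z = ts ! 0 \<or> z = ts ! 1 \<or> z = ts ! 2" by (simp only: idx) blast
      with that show "coord z l = 0" by (auto simp: coord_ts simp del: One_nat_def)
    qed
    then show ?thesis by (simp add: gc_def)
  qed
  define u where "u l = quad_form n (\<lambda>i j. if i < 3 \<or> j < 3 then 0 else gc l i j)" for l
  have u: "u l \<in> poly_in {4..n}" for l
    unfolding u_def by (intro poly_in_4I vars_quad_form_subset) (auto split: if_splits)
  have split: "quad_form n (gc l) = (\<Sum>(i, j)\<in>S. Const (gc l i j) * Var i * Var j) + u l"
    if "l < 3" "S \<subseteq> {..<3} \<times> {3, 4}" "\<And>i j. i < 3 \<or> j < 3 \<Longrightarrow> i < n \<Longrightarrow> j < n \<Longrightarrow> (i, j) \<notin> S \<Longrightarrow> gc l i j = 0" for l S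
  proof -
    have "S \<subseteq> {..<n} \<times> {..<n}" using that(2) n by auto
    moreover have "quad_form n (\<lambda>i j. if (i, j) \<in> S then 0 else gc l i j) = u l"
      unfolding u_def using that(2,3) by (intro quad_form_cong) auto
    ultimately show ?thesis by (simp add: quad_form_split[of S n "gc l"])
  qed
  have q0: "quad_form n (gc 0) = Var 1 * Var 4 + u 0"
    by (subst split[of 0 "{(1, 4)}"]) (use n in \<open>auto simp: gA split: if_splits\<close>)
  have q1: "quad_form n (gc 1) = Var 0 * Var 3 - Var 2 * Var 4 + u 1"
    by (subst split[of 1 "{(0, 3), (2, 4)}"])
      (use n in \<open>auto simp: gA Const.hom_uminus simp del: One_nat_def split: if_splits\<close>)
  have q2: "quad_form n (gc 2) = Var 1 * Var 3 + u 2"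
    by (subst split[of 2 "{(1, 3)}"]) (use n in \<open>auto simp: gA split: if_splits\<close>)
  have "G = vec n (\<lambda>j. if j < 3 then [Var 0 + Var 1 * Var 4 + u 0, Var 1 + Var 0 * Var 3 - Var 2 * Var 4 + u 1,
      Var 2 + Var 1 * Var 3 + u 2] ! j else Var j)" (is "_ = ?G")
    unfolding G_def
  proof (rule eq_vecI)
    fix l assume "l < dim_vec ?G"
    then have l: "l < n" by simp
    consider "l = 0" | "l = 1" | "l = 2" | "3 \<le> l" by linarith
    then show "vec n (\<lambda>l. Var l + quad_form n (gc l)) $ l = ?G $ l"
      by cases (use l q0 q1 q2 high in \<open>simp_all add: quad_form_eq_0\<close>)
  qed simp
  also have "\<dots> = vec_of_list ([X 1 + X 2 * X 5 + u 0, X 2 + X 1 * X 4 - X 3 * X 5 + u 1, X 3 + X 2 * X 4 + u 2]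
      @ map X [4..<Suc n])"
    using n by (intro normal_form_2_vec[symmetric]) simp
  finally show ?thesis unfolding normal_form_2_def using u n by (intro conjI bexI[of _ "u 0"] bexI[of _ "u 1"] bexI[of _ "u 2"]) simp_all
qed

lemma normal_form_3_G:
  assumes "basis_form_3 ts" and char2: "(2::'a) = 0" shows "normal_form_3 n G"
proof -
  obtain p1 p2 p3 v c5 c6 us where ts: "ts = p1 # p2 # p3 # v # c5 # c6 # us"
    and pp: "\<And>p u. p \<in> {p1, p2, p3} \<Longrightarrow> u \<in> {p1, p2, p3, v} \<union> set us \<Longrightarrow> p \<diamondop> u = 0"
    and c: "c5 \<diamondop> p1 = p2" "c5 \<diamondop> p2 = p3" "c5 \<diamondop> p3 = 0" "c6 \<diamondop> p1 = 0" "c6 \<diamondop> p2 = p1" "c6 \<diamondop> p3 = - p2"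
    and c56: "c5 \<diamondop> c6 = v" and cv: "c5 \<diamondop> v \<in> fs.span {p2}" "c6 \<diamondop> v \<in> fs.span {p2}"
    and cu: "\<And>u. u \<in> set us \<Longrightarrow> c5 \<diamondop> u = 0" "\<And>u. u \<in> set us \<Longrightarrow> c6 \<diamondop> u = 0"
    and uu: "\<And>u u'. u \<in> insert v (set us) \<Longrightarrow> u' \<in> insert v (set us) \<Longrightarrow> u \<diamondop> u' \<in> fs.span {p2}"
    using assms(1) unfolding basis_form_3_def
    by (elim exE conjE) (rule that, assumption, (assumption | (drule (1) bspec)+, (assumption | erule conjE, assumption))+)
  note c' = c[unfolded mul_commute[of c5] mul_commute[of c6]]
  have len: "n = 6 + length us" using length_ts by (simp add: ts)
  then have n: "6 \<le> n" by simp
  have idx: "ts ! 0 = p1" "ts ! 1 = p2" "ts ! 2 = p3" "ts ! 3 = v" "ts ! 4 = c5" "ts ! 5 = c6" by (simp_all add: ts)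
  have us: "ts ! j \<in> set us" if "6 \<le> j" "j < n" for j
    using that nth_mem[of "j - 6" us] by (simp add: ts len numeral_eq_Suc nth_Cons')
  have tab: "ts ! i \<diamondop> ts ! j = (if j = 4 then (if i = 0 then ts ! 1 else if i = 1 then ts ! 2 else 0)
      else if j = 5 then (if i = 1 then ts ! 0 else if i = 2 then - ts ! 1 else 0) else 0)"
    if "i < 3" "j < n" for i j
  proof -
    have i: "i = 0 \<or> i = 1 \<or> i = 2" using that by auto
    then have pi: "ts ! i \<in> {p1, p2, p3}" using idx by auto
    consider "j < 4" | "j = 4" | "j = 5" | "6 \<le> j" by linarith
    then show ?thesis
    proof cases
      case 1
      then have "j = 0 \<or> j = 1 \<or> j = 2 \<or> j = 3" by auto
      then have "ts ! j \<in> {p1, p2, p3, v} \<union> set us" using idx by auto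
      with pp[OF pi] 1 show ?thesis by simp
    next
      case 2
      then show ?thesis using i by (auto simp: c' idx[simplified])
    next
      case 3
      then show ?thesis using i by (auto simp: c' idx[simplified])
    next
      case 4
      with pp[OF pi, of "ts ! j"] us[of j] that show ?thesis by simp
    qed
  qed
  have gA: "gc l i j = (if j = 4 \<and> i < 2 \<and> l = i + 1 then 1 else if j = 5 \<and> i = 1 \<and> l = 0 then 1
      else if j = 5 \<and> i = 2 \<and> l = 1 then -1 else 0)" if "i < 3 \<or> j < 3" "i < n" "j < n" "l < n" for l i j
  proof (cases "i \<le> j")
    case True
    then have i: "i < 3" using that by auto
    then have "sc l i j = (if j = 4 \<and> i < 2 \<and> l = i + 1 then 1 else if j = 5 \<and> i = 1 \<and> l = 0 then 1
      else if j = 5 \<and> i = 2 \<and> l = 1 then -1 else 0)"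
      unfolding sc_def tab[OF i that(3)] using that n by (auto simp: coord_ts coord_uminus simp del: One_nat_def)
    with True i that show ?thesis by (auto simp: gc_def)
  next
    case False
    with that show ?thesis by (auto simp: gc_def)
  qed
  have p2: "coord x l = 0" if "x \<in> fs.span {p2}" "l < n" "l \<noteq> 1" for x l
    by (rule coord_span[OF that(1)]) (use that n coord_ts[of 1 l] in \<open>simp add: idx del: One_nat_def\<close>)
  have uv: "ts ! i \<in> insert v (set us)" if "i = 3 \<or> 6 \<le> i" "i < n" for i
    using that us[of i] idx by auto
  have diag: "gc l i i = 0" for l i by (simp add: gc_def sc_def alternating[OF char2])
  have s45: "sc l 4 5 = (if l = 3 then 1 else 0)" if "l < n" for l
    using that n coord_ts[of 3 l] c56 by (simp add: sc_def idx)
  have s3: "sc l 3 4 = 0" "sc l 3 5 = 0" if "l < n" "l \<noteq> 1" for l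
    using that p2[OF cv(1)] p2[OF cv(2)] by (simp_all add: sc_def idx mul_commute[of v])
  have s6: "sc l 4 j = 0" "sc l 5 j = 0" if "6 \<le> j" "j < n" for l j
    using cu us[OF that] by (simp_all add: sc_def idx)
  have su: "sc l i j = 0" if "i = 3 \<or> 6 \<le> i" "i < n" "j = 3 \<or> 6 \<le> j" "j < n" "l < n" "l \<noteq> 1" for l i j
    unfolding sc_def by (rule p2[OF uu]) (use that uv in auto)
  \<comment> \<open>Among v, c5, c6 and \<open>us\<close> only c5 c6 = v has a prescribed
    coordinate. Coordinate 1, that of p2, is left open for pairs of indices from 3 and 6 onwards,
    which go into u2, and for (3, 4) and (3, 5), which give a and b.\<close>
  have gB: "gc l i j = (if l = 3 \<and> i = 4 \<and> j = 5 then 1 else 0)"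
    if "3 \<le> i" "3 \<le> j" "i < n" "j < n" "l < n" "l \<noteq> 1 \<or> i \<in> {4, 5} \<or> (j \<in> {4, 5} \<and> i \<noteq> 3)" for l i j
  proof (cases "i < j")
    case True
    have "i = 3 \<or> i = 4 \<or> i = 5 \<or> 6 \<le> i" using that(1) by arith
    then consider "i = 3" | "i = 4" | "i = 5" | "6 \<le> i" by blast
    then have "sc l i j = (if l = 3 \<and> i = 4 \<and> j = 5 then 1 else 0)"
    proof cases
      case 1
      then have l: "l \<noteq> 1" using that(6) by auto
      consider "j = 4" | "j = 5" | "6 \<le> j" using True 1 by linarith
      then show ?thesis using 1 l that s3[OF that(5) l] su[of i j l] by cases auto
    next
      case 2
      consider "j = 5" | "6 \<le> j" using True 2 by linarith
      then show ?thesis using 2 that s45[OF that(5)] s6[of j l] by cases auto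
    next
      case 3
      then show ?thesis using True that s6[of j l] by auto
    next
      case 4
      then have "l \<noteq> 1" using that(6) True by auto
      then show ?thesis using 4 True that su[of i j l] by auto
    qed
    with True show ?thesis by (simp add: gc_def)
  next
    case False
    then show ?thesis using diag[of l i] by (cases "i = j") (auto simp: gc_def)
  qed
  have split: "quad_form n (gc l) = (\<Sum>(i, j)\<in>S. Const (gc l i j) * Var i * Var j)"
    if "S \<subseteq> {..<6} \<times> {..<6}" "\<And>i j. i < n \<Longrightarrow> j < n \<Longrightarrow> (i, j) \<notin> S \<Longrightarrow> gc l i j = 0" for l S
  proof -
    have "S \<subseteq> {..<n} \<times> {..<n}" using that(1) n by auto
    moreover have "quad_form n (\<lambda>i j. if (i, j) \<in> S then 0 else gc l i j) = 0"
      using that(2) by (intro quad_form_eq_0) auto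
    ultimately show ?thesis by (simp add: quad_form_split[of S n "gc l"])
  qed
  have gc: "gc l i j = 0" if "l < n" "i < n" "j < n" "l \<noteq> 1"
    "(l, i, j) \<notin> {(0, 1, 5), (2, 1, 4), (3, 4, 5)}" for l i j
  proof (cases "i < 3 \<or> j < 3")
    case True
    with that show ?thesis by (auto simp: gA)
  next
    case False
    with that show ?thesis by (auto simp: gB)
  qed
  have q0: "quad_form n (gc 0) = Var 1 * Var 5"
    by (subst split[of "{(1, 5)}"]) (use n gc[of 0] in \<open>auto simp: gA\<close>)
  have q2: "quad_form n (gc 2) = Var 1 * Var 4"
    by (subst split[of "{(1, 4)}"]) (use n gc[of 2] in \<open>auto simp: gA\<close>)
  have q3: "quad_form n (gc 3) = Var 4 * Var 5"
    by (subst split[of "{(4, 5)}"]) (use n gc[of 3] in \<open>auto simp: gB\<close>)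
  have high: "quad_form n (gc l) = 0" if "4 \<le> l" "l < n" for l
    using that gc[of l] by (intro quad_form_eq_0) auto
  define a where "a = gc 1 3 4"
  \<comment> \<open>The sign matches the term with - b in the normal form.\<close>
  define b where "b = - gc 1 3 5"
  let ?S = "{(0, 4), (2, 5), (3, 4), (3, 5)} :: (nat \<times> nat) set"
  define u where "u = quad_form n (\<lambda>i j. if (i, j) \<in> ?S then 0 else gc 1 i j)"
  have u: "u \<in> poly_in ({4} \<union> {7..n})"
    unfolding u_def
  proof (intro poly_in_4_7I vars_quad_form_subset)
    fix i j assume ij: "i < n" "j < n" "(if (i, j) \<in> ?S then 0 else gc 1 i j) \<noteq> 0"
    then have S: "(i, j) \<notin> ?S" and g: "gc 1 i j \<noteq> 0" by (auto split: if_splits)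
    have "\<not> (i < 3 \<or> j < 3)"
    proof
      assume "i < 3 \<or> j < 3"
      from gA[OF this ij(1,2), of 1] g S n show False by (auto split: if_splits)
    qed
    then have 3: "3 \<le> i" "3 \<le> j" by auto
    have "\<not> (i \<in> {4, 5} \<or> (j \<in> {4, 5} \<and> i \<noteq> 3))"
      using gB[OF 3 ij(1,2), of 1] g n by auto
    with S 3 ij show "i \<in> {3} \<union> {6..<n} \<and> j \<in> {3} \<union> {6..<n}" by auto
  qed
  have q1: "quad_form n (gc 1) = Var 0 * Var 4 - Var 2 * Var 5 + Const a * Var 3 * Var 4 - Const b * Var 3 * Var 5 + u"
  proof -
    have "?S \<subseteq> {..<n} \<times> {..<n}" using n by auto
    moreover have "gc 1 0 4 = 1" "gc 1 2 5 = -1" using n by (simp_all add: gA)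
    ultimately show ?thesis
      by (subst quad_form_split[of ?S])
        (simp_all add: a_def b_def u_def Const.hom_uminus algebra_simps del: One_nat_def)
  qed
  have "G = vec n (\<lambda>j. if j < 4 then [Var 0 + Var 1 * Var 5,
      Var 1 + Var 0 * Var 4 - Var 2 * Var 5 + Const a * Var 3 * Var 4 - Const b * Var 3 * Var 5 + u,
      Var 2 + Var 1 * Var 4, Var 3 + Var 4 * Var 5] ! j else Var j)" (is "_ = ?G")
    unfolding G_def
  proof (rule eq_vecI)
    fix l assume "l < dim_vec ?G"
    then have l: "l < n" by simp
    consider "l = 0" | "l = 1" | "l = 2" | "l = 3" | "4 \<le> l" by linarith
    then show "vec n (\<lambda>l. Var l + quad_form n (gc l)) $ l = ?G $ l"
      by cases (use l q0 q1 q2 q3 high in \<open>simp_all add: algebra_simps\<close>)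
  qed simp
  also have "\<dots> = vec_of_list ([X 1 + X 2 * X 6,
      X 2 + X 1 * X 5 - X 3 * X 6 + Const a * X 4 * X 5 - Const b * X 4 * X 6 + u,
      X 3 + X 2 * X 5, X 4 + X 5 * X 6] @ map X [5..<Suc n])"
    using n by (intro normal_form_3_vec[symmetric]) simp
  finally show ?thesis
    unfolding normal_form_3_def CHAR_eq_2_iff using u n char2 by (intro conjI exI bexI[of _ u]) simp_all
qed

end

theorem theorem4p5:
  fixes n :: nat and H :: "'a::field mpoly vec"
  assumes "quadratic_homogeneous n H"
    and "keller_map n (id_map n + H)"
    and "jacobian_rank n H \<le> 3"
  shows "\<exists>F. eq_up_to_square_part n F (id_map n + H) \<and>
    (\<exists>G. linearly_conjugate n F G \<and> polynomial_automorphism n G \<and>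
      (triangular n G \<or> normal_form_2 n G \<or> normal_form_3 n G)) \<and>
    tame_automorphism n F"
proof -
  have H: "H \<in> carrier_vec n" using assms(1) by (simp add: quadratic_homogeneous_def polynomial_map_def)
  \<comment> \<open>Each mixed monomial is stored once, above the diagonal, so the polarization has
    the plain coefficient for i different from j and twice the coefficient on the diagonal.\<close>
  define C where "C k i j = (if i \<le> j then Poly_Mapping.lookup (H $ k) (mon2 i j) else 0)" for k i j
  have HC: "H $ k = quad_form n (C k)" if "k < n" for k
    unfolding C_def using that assms(1)
    by (intro quad_form_of_homogeneous) (simp_all add: quadratic_homogeneous_def polynomial_map_def)
  have "coeff_hom (\<lambda>c::'a. c)" by unfold_locales simp_all
  then have kq: "keller_quad (\<lambda>c. c) n C H"
    using assms(2,3) unfolding keller_map_def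
    by (intro keller_quad.intro quad_map.intro quad_map_axioms.intro keller_quad_axioms.intro H HC) auto
  interpret Q: quad_alg fscale "bil n (polar C)" "fbases n"
    by (rule quad_alg_of_keller_quad[OF kq])
  from Q.basis_classification obtain ts where ts: "Q.basis_of_E ts"
    and form: "Q.basis_triangular ts \<or> Q.basis_form_2 ts \<or> (2::'a) = 0 \<and> Q.basis_form_3 ts" by blast
  interpret b: basis_change "bil n (polar C)" n ts
  proof unfold_locales
    show "fs.li ts" "length ts = n" using ts by (simp_all add: Q.basis_of_E_def)
    then show "(ts ! i) k = 0" if "i < n" "n \<le> k" for i k
      using ts that nth_mem[of i ts] by (intro span_fbases_supported[of _ n]) (auto simp: Q.basis_of_E_def Q.E_def)
    show "bil n (polar C) x y k = 0" if "n \<le> k" for k x y by (rule bil_ge[OF that])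
    show "bil n (polar C) x x = 0" if "(2::'a) = 0" for x by (rule Q.char2_alt[OF that])
  qed
  \<comment> \<open>Conjugating the normal form back gives a map that has the polarization of x + H.
    It equals x + H outside characteristic 2 and agrees with it up to squares in characteristic 2,
    which is why F is the witness and not x + H.\<close>
  define F where "F = compose (lin_map n b.T) (compose b.G (lin_map n b.T'))"
  have nf: "triangular n b.G \<or> normal_form_2 n b.G \<or> normal_form_3 n b.G"
    using form b.triangular_G b.normal_form_2_G b.normal_form_3_G by blast
  then have elem: "elementary_product n b.G"
    using elementary_product_triangular elementary_product_normal_form_2 elementary_product_normal_form_3 by blast
  note conj = tame_conjugate[OF elem b.T_carrier b.T'_carrier b.T_inverse F_def]
  have "eq_up_to_square_part n F (id_map n + H)"
  proof (rule eq_up_to_square_part_of_polar)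
    show "dim_vec F = n" "dim_vec (id_map n + H) = n" using H by (simp_all add: F_def)
    show "F $ k = Var k + quad_form n (b.D k)" if "k < n" for k
      unfolding F_def b.G_def b.D_def by (rule conjugate_index[OF b.T_carrier b.T'_carrier b.T_inverse(1) that])
    show "(id_map n + H) $ k = Var k + quad_form n (C k)" if "k < n" for k
      using that H by (simp add: HC)
    show "polar b.D k i j = polar C k i j" if "k < n" "i < n" "j < n" for k i j
      unfolding b.polar_D[OF that] using that by (simp add: bil_fbasis) (simp add: fbasis_def if_distrib[of "\<lambda>a. _ * a"] cong: if_cong)
  qed
  with conj nf elementary_product_automorphism[OF elem] show ?thesis by blast
qed

end
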